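(* Let $\Omega$ be any open set in $\mathbb R^n$, $n\geq2$. Let $\mu$ be a Borel measure in $\Omega$ such that $\mu(B_r(x)\cap\Omega)\leq C_\mu r^\alpha$ for $x\in\Omega$ and $r>0$, for some exponent $\alpha\in(n-1,n]$ and some constant $C_\mu>0$. Assume that $\mathcal L^n(\Omega)<\infty$, $\mu(\Omega)<\infty$ and $\mathcal H^{n-1}(\partial\Omega)<\infty$. (i) Assume that $1<p<n$ and $\sigma\in\mathbb R$. Then there exists a constant $C=C(n,p,\sigma,\alpha,C_\mu,\mathcal L^n(\Omega),\mu(\Omega),\mathcal H^{n-1}(\partial\Omega))$ such that $$\|\mathbf u\|_{L^{\frac{p\alpha}{n-p}}(\log L)^{\frac{\sigma\alpha}{n-p}}(\Omega,\mu)}\leq C\Big(\|\mathcal E\mathbf u\|_{L^p(\log L)^\sigma(\Omega)}+\|\mathbf u\|_{L^{\frac{p(n-1)}{n-p}}(\log L)^{\frac{\sigma(n-1)}{n-p}}(\partial\Omega)}\Big)$$ for every $\mathbf u\in E^1L^p(\log L)^\sigma(\Omega)\cap C_b(\overline\Omega)$. (ii) Assume that $p=n$ and $\sigma<n-1$. Then there exists a constant $C=C(n,\sigma,\alpha,C_\mu,\mathcal L^n(\Omega),\mu(\Omega),\mathcal H^{n-1}(\partial\Omega))$ such that $$\|\mathbf u\|_{\exp L^{\frac n{n-1-\sigma}}(\Omega,\mu)}\leq C\Big(\|\mathcal E\mathbf u\|_{L^n(\log L)^\sigma(\Omega)}+\|\mathbf u\|_{\exp L^{\frac n{n-1-\sigma}}(\partial\Omega)}\Big)$$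 for every $\mathbf u\in E^1L^n(\log L)^\sigma(\Omega)\cap C_b(\overline\Omega)$. (iii) Assume that $p=n$ and $\sigma=n-1$. Then there exists a constant $C=C(n,\alpha,C_\mu,\mathcal L^n(\Omega),\mu(\Omega),\mathcal H^{n-1}(\partial\Omega))$ such that $$\|\mathbf u\|_{\exp\exp L^{\frac n{n-1}}(\Omega,\mu)}\leq C\Big(\|\mathcal E\mathbf u\|_{L^n(\log L)^{n-1}(\Omega)}+\|\mathbf u\|_{\exp\exp L^{\frac n{n-1}}(\partial\Omega)}\Big)$$ for every $\mathbf u\in E^1L^n(\log L)^{n-1}(\Omega)\cap C_b(\overline\Omega)$. (iv) Assume that either $p=n$ and $\sigma>n-1$, or $p>n$ and $\sigma\in\mathbb R$. Then there exists a constant $C=C(n,p,\sigma,C_\mu,\mathcal L^n(\Omega),\mu(\Omega),\mathcal H^{n-1}(\partial\Omega))$ such that $$\|\mathbf u\|_{L^\infty(\Omega)}\leq C\Big(\|\mathcal E\mathbf u\|_{L^p(\log L)^\sigma(\Omega)}+\|\mathbf u\|_{L^\infty(\partial\Omega)}\Big)$$ for every $\mathbf u\in E^1L^p(\log L)^\sigma(\Omega)\cap C_b(\overline\Omega)$.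
   Context: Functions $\mathbf u$ are $\mathbb R^n$-valued. $\mathcal E\mathbf u=\tfrac12(\nabla\mathbf u+(\nabla\mathbf u)^T)$ is the symmetric part of the distributional gradient. For a function space $X(\Omega)$, $E^1X(\Omega)=\{\mathbf u\in L^1_{\rm loc}(\Omega):|\mathcal E\mathbf u|\in X(\Omega)\}$. $C_b(\overline\Omega)$ is the set of functions that are continuous in $\overline\Omega$ and have bounded support. $B_r(x)$ is the ball centered at $x$ with radius $r$; $\mathcal L^n$ is Lebesgue measure and $\mathcal H^{n-1}$ the $(n-1)$-dimensional Hausdorff measure. Norms over $\Omega$ with no measure indicated are with respect to $\mathcal L^n$; norms over $\partial\Omega$ are with respect to $\mathcal H^{n-1}$ and are applied to the restriction of $\mathbf u$ to $\partial\Omega$. Let $\mathcal R$ be a measure space with a finite non-atomic measure $\nu$. A Young function is a left-continuous convex function $A:[0,\infty)\to[0,\infty]$ that is neither identically $0$ nor identically $\infty$ (with $A(0)=0$); the Orlicz space $L^A(\mathcal R)$ has the Luxemburg norm $\|\phi\|_{L^A(\mathcal R)}=\inf\{\lambda>0:\int_{\mathcal R}A(|\phi|/\lambda)\,d\nu\leq1\}$. Two functions $A,B$ are equivalent near infinity if $A(t/k)\le B(t)\le A(kt)$ for large $t$ and some $k\geq 1$. For $\sigma>0$, $\exp L^\sigma(\mathcal R)$ and $\exp\exp L^\sigma(\mathcal R)$ are the Orlicz spaces built on Young functions equivalent near infinity to $e^{t^\sigma}-1$ and $e^{e^{t^\sigma}}-e$, respectively. For $p>1$ and $\sigma\in\mathbb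 R$, $L^p(\log L)^\sigma(\mathcal R)$ is the Orlicz (Zygmund) space built on a Young function equivalent near infinity to $t^p\log^\sigma(1+t)$. *)

theory Defs
  imports "HOL-Analysis.Analysis" "HOL-Probability.Essential_Supremum"
begin

section \<open>Young functions and Orlicz spaces\<close>

text \<open>
  Only the values on \<open>[0,\<infinity>)\<close> matter. Since \<open>A 0 = 0\<close> is required, ``not identically infinite''
  is read on \<open>(0,\<infinity>)\<close>. The library's \<open>convex_on\<close> is for real-valued functions only, so convexity
  is spelled out.
\<close>

definition young_function :: "(real \<Rightarrow> ennreal) \<Rightarrow> bool" where
  "young_function A \<longleftrightarrow>
     A 0 = 0 \<and>
     (\<forall>s\<ge>0. \<forall>t\<ge>0. \<forall>\<theta>\<in>{0..1}.
        A ((1 - \<theta>) * s + \<theta> * t) \<le> ennreal (1 - \<theta>) * A s + ennreal \<theta> * A t) \<and>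
     (\<forall>t>0. continuous (at_left t) A) \<and>
     (\<exists>t>0. A t \<noteq> 0) \<and> (\<exists>t>0. A t \<noteq> \<infinity>)"

definition equivalent_near_infinity :: "(real \<Rightarrow> ennreal) \<Rightarrow> (real \<Rightarrow> ennreal) \<Rightarrow> bool" where
  "equivalent_near_infinity A B \<longleftrightarrow>
     (\<exists>k\<ge>1. eventually (\<lambda>t. A (t / k) \<le> B t \<and> B t \<le> A (k * t)) at_top)"

definition luxemburg_norm ::
    "'a measure \<Rightarrow> (real \<Rightarrow> ennreal) \<Rightarrow> ('a \<Rightarrow> 'b::real_normed_vector) \<Rightarrow> ennreal" where
  "luxemburg_norm \<nu> A f =
     (INF l \<in> {l::real. 0 < l \<and> (\<integral>\<^sup>+ x. A (norm (f x) / l) \<partial>\<nu>) \<le> 1}. ennreal l)"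

definition orlicz_space ::
    "'a measure \<Rightarrow> (real \<Rightarrow> ennreal) \<Rightarrow> ('a \<Rightarrow> 'b::{second_countable_topology, real_normed_vector}) set"
  where
  "orlicz_space \<nu> A = {f \<in> borel_measurable \<nu>. luxemburg_norm \<nu> A f < \<infinity>}"

definition linfty_norm :: "'a measure \<Rightarrow> ('a \<Rightarrow> 'b::real_normed_vector) \<Rightarrow> ennreal" where
  "linfty_norm \<nu> f = esssup \<nu> (\<lambda>x. ennreal (norm (f x)))"

text \<open>
  The Young functions that may be used to build \<open>L\<^sup>p(log L)\<^sup>\<sigma>\<close>, \<open>exp L\<^sup>\<sigma>\<close> and \<open>exp exp L\<^sup>\<sigma>\<close>.
  Each of these spaces is determined, up to equivalent norms, only by the behaviour of the Young
  function near infinity.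
\<close>

definition zygmund_young :: "real \<Rightarrow> real \<Rightarrow> (real \<Rightarrow> ennreal) \<Rightarrow> bool" where
  "zygmund_young p \<sigma> A \<longleftrightarrow>
     young_function A \<and>
     equivalent_near_infinity A (\<lambda>t. ennreal (t powr p * ln (1 + t) powr \<sigma>))"

definition exp_young :: "real \<Rightarrow> (real \<Rightarrow> ennreal) \<Rightarrow> bool" where
  "exp_young \<sigma> A \<longleftrightarrow>
     young_function A \<and>
     equivalent_near_infinity A (\<lambda>t. ennreal (exp (t powr \<sigma>) - 1))"

definition exp_exp_young :: "real \<Rightarrow> (real \<Rightarrow> ennreal) \<Rightarrow> bool" where
  "exp_exp_young \<sigma> A \<longleftrightarrow>
     young_function A \<and>
     equivalent_near_infinity A (\<lambda>t. ennreal (exp (exp (t powr \<sigma>)) - exp 1))"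

section \<open>Hausdorff measure\<close>

text \<open>
  For \<open>s > 0\<close>, normalised by the volume of the unit ball. Covering sets must be bounded because
  \<open>diameter\<close> is unspecified on unbounded sets; empty sets contribute \<open>0 powr s = 0\<close>, so
  countable covers include finite ones.
\<close>

definition hausdorff_content :: "real \<Rightarrow> real \<Rightarrow> 'a::metric_space set \<Rightarrow> ennreal" where
  "hausdorff_content s \<delta> A =
     (INF U \<in> {U :: nat \<Rightarrow> 'a set. A \<subseteq> (\<Union>i. U i) \<and> (\<forall>i. bounded (U i) \<and> diameter (U i) \<le> \<delta>)}.
        (\<Sum>i. ennreal (unit_ball_vol s * (diameter (U i) / 2) powr s)))"

definition hausdorff_outer :: "real \<Rightarrow> 'a::metric_space set \<Rightarrow> ennreal" where
  "hausdorff_outer s A = (SUP \<delta>\<in>{0<..}. hausdorff_content s \<delta> A)"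

text \<open>
  \<open>hausdorff_outer s\<close> is a metric outer measure, hence countably additive on the Borel sets by
  Caratheodory's criterion, so \<open>measure_of\<close> does not fall back to the zero measure here.
\<close>

definition hausdorff_measure :: "real \<Rightarrow> 'a::metric_space measure" where
  "hausdorff_measure s = measure_of UNIV (sets borel) (hausdorff_outer s)"

section \<open>Distributional symmetric gradient\<close>

definition partial :: "'n::finite \<Rightarrow> (real ^ 'n \<Rightarrow> real) \<Rightarrow> real ^ 'n \<Rightarrow> real" where
  "partial i f x = frechet_derivative f (at x) (axis i 1)"

primrec iterated_partial :: "'n::finite list \<Rightarrow> (real ^ 'n \<Rightarrow> real) \<Rightarrow> real ^ 'n \<Rightarrow> real" where
  "iterated_partial [] f = f"
| "iterated_partial (i # is) f = partial i (iterated_partial is f)"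

text \<open>
  \<open>C\<^sub>c\<^sup>\<infinity>(\<Omega>)\<close>, extended by zero to the whole space. Differentiability of all iterated partial
  derivatives also makes them all continuous.
\<close>

definition test_functions :: "(real ^ 'n::finite) set \<Rightarrow> (real ^ 'n \<Rightarrow> real) set" where
  "test_functions \<Omega> =
     {\<phi>. (\<forall>is. iterated_partial is \<phi> differentiable_on UNIV) \<and>
          compact (closure {x. \<phi> x \<noteq> 0}) \<and> closure {x. \<phi> x \<noteq> 0} \<subseteq> \<Omega>}"

definition locally_integrable :: "(real ^ 'n::finite) set \<Rightarrow> (real ^ 'n \<Rightarrow> 'b::euclidean_space) \<Rightarrow> bool"
  where
  "locally_integrable \<Omega> f \<longleftrightarrow> (\<forall>K. compact K \<and> K \<subseteq> \<Omega> \<longrightarrow> f absolutely_integrable_on K)"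

definition has_sym_grad ::
    "(real ^ 'n::finite) set \<Rightarrow> (real ^ 'n \<Rightarrow> real ^ 'n) \<Rightarrow> (real ^ 'n \<Rightarrow> real ^ 'n ^ 'n) \<Rightarrow> bool" where
  "has_sym_grad \<Omega> u G \<longleftrightarrow>
     locally_integrable \<Omega> G \<and>
     (\<forall>\<phi>\<in>test_functions \<Omega>. \<forall>i j.
        (LINT x|lebesgue_on \<Omega>. G x $ i $ j * \<phi> x) =
        - (LINT x|lebesgue_on \<Omega>. (1/2) * (u x $ i * partial j \<phi> x + u x $ j * partial i \<phi> x)))"

text \<open>A representative; it is unique up to null sets whenever one exists.\<close>

definition sym_grad ::
    "(real ^ 'n::finite) set \<Rightarrow> (real ^ 'n \<Rightarrow> real ^ 'n) \<Rightarrow> real ^ 'n \<Rightarrow> real ^ 'n ^ 'n" where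
  "sym_grad \<Omega> u = (SOME G. has_sym_grad \<Omega> u G)"

text \<open>\<open>E\<^sup>1X(\<Omega>)\<close>; the norm on matrices is the Euclidean (Frobenius) norm.\<close>

definition E1 ::
    "(real ^ 'n::finite) set \<Rightarrow> (real ^ 'n \<Rightarrow> real) set \<Rightarrow> (real ^ 'n \<Rightarrow> real ^ 'n) set" where
  "E1 \<Omega> X =
     {u. locally_integrable \<Omega> u \<and> (\<exists>G. has_sym_grad \<Omega> u G) \<and> (\<lambda>x. norm (sym_grad \<Omega> u x)) \<in> X}"

text \<open>Functions are total; values outside the given closed set are ignored.\<close>

definition Cb :: "'a::metric_space set \<Rightarrow> ('a \<Rightarrow> 'b::real_normed_vector) set" where
  "Cb S = {u. continuous_on S u \<and> bounded {x \<in> S. u x \<noteq> 0}}"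

section \<open>Admissible domains and measures\<close>

abbreviation boundary_measure :: "(real ^ 'n::finite) set \<Rightarrow> (real ^ 'n) measure" where
  "boundary_measure \<Omega> \<equiv>
     restrict_space (hausdorff_measure (real CARD('n) - 1)) (frontier \<Omega>)"

text \<open>
  The three total masses \<open>V\<close>, \<open>m\<close>, \<open>h\<close> are parameters so that a constant can be chosen depending
  on them but not otherwise on \<open>\<Omega>\<close> and \<open>\<mu>\<close>.
\<close>

definition admissible ::
    "real \<Rightarrow> real \<Rightarrow> ennreal \<Rightarrow> ennreal \<Rightarrow> ennreal \<Rightarrow> (real ^ 'n::finite) set \<Rightarrow> (real ^ 'n) measure \<Rightarrow> bool"
  where
  "admissible \<alpha> c V m h \<Omega> \<mu> \<longleftrightarrow>
     open \<Omega> \<and>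
     sets \<mu> = sets (restrict_space borel \<Omega>) \<and>
     (\<forall>x\<in>\<Omega>. \<forall>r>0. emeasure \<mu> (ball x r \<inter> \<Omega>) \<le> ennreal (c * r powr \<alpha>)) \<and>
     emeasure lebesgue \<Omega> = V \<and>
     emeasure \<mu> \<Omega> = m \<and>
     emeasure (hausdorff_measure (real CARD('n) - 1)) (frontier \<Omega>) = h"

end

theory Submission
  imports Defs "HOL-Real_Asymp.Real_Asymp"
begin

text \<open>
  Fix \<open>x \<in> \<Omega>\<close> and a direction \<open>z\<close>. Along the ray from \<open>x\<close> until it first leaves \<open>\<Omega>\<close>, the function
  \<open>u \<bullet> z\<close> has derivative \<open>z\<^sup>T (\<E>u) z\<close>, so \<open>\<bar>u x \<bullet> z\<bar>\<close> is at most the value of \<open>\<bar>u\<bar>\<close> at the exit point plus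
  the integral of \<open>\<bar>\<E>u\<bar>\<close> over the ray. Integrating over \<open>z\<close> in the unit ball (instead of the sphere, which
  avoids polar coordinates) bounds \<open>\<bar>u x\<bar>\<close> by the Riesz potential of order one of \<open>\<bar>\<E>u\<bar>\<close> and an average of
  the exit values. A piece of the boundary of diameter \<open>d\<close> is seen from \<open>x\<close> in a set of directions of measure
  at most \<open>C (d / \<bar>x - y\<bar>)\<^sup>n\<^sup>-\<^sup>1\<close>, so covering the level sets of \<open>\<bar>u\<bar>\<close> on the boundary as in the definition
  of the Hausdorff measure bounds the second term, too, by potentials with kernel \<open>\<bar>x - y\<bar>\<^sup>1\<^sup>-\<^sup>n\<close>.
  Since \<open>\<alpha> > n - 1\<close>, the kernel integrates against \<open>\<mu>\<close> over a set \<open>E\<close> to at most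
  \<open>C \<mu>(E)\<^bsup>1 - (n - 1)/\<alpha>\<^esup>\<close>.

  Truncating \<open>\<bar>\<E>u\<bar>\<close> and the boundary values at levels \<open>T1\<close> and \<open>T2\<close> so large that the truncated parts
  contribute at most \<open>\<lambda>/2\<close> gives
  \<open>\<mu>{\<bar>u\<bar> > \<lambda>} \<le> (C \<phi> / \<lambda>)\<^bsup>\<alpha>/(n - 1)\<^esup>\<close>, where \<open>\<phi>\<close> is the mass of the two excesses. All four parts
  follow by choosing the levels as functions of \<open>\<lambda>\<close> and summing over \<open>\<lambda>\<close>.
\<close>

section \<open>Hausdorff measure is a Borel measure\<close>

text \<open>Only the symmetric part of the gradient is controlled, and the derivative of u \<bullet>
  z sees nothing else exactly when it is taken in the direction z itself. Hence the rays, and on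
  each ray the component of u along it. As u is merely continuous, this derivative exists only after
  mollification; the limit is taken under the integral over z by Fatou's lemma. The exit value need
  not depend measurably on z, so it enters through a measurable majorant. On a boundary of which
  only the measure is known to be finite there is no trace or divergence theorem; a cover of its
  level sets by balls takes their place. Two functions carry each regime. W behaves like A(t)/t and
  bounds the mass of the gradient above a level T by 1/W(T). Y is a positive function with Y' \<ge>
  W^(-1/(n-1)), and the potential of the gradient below T is at most a constant times 1 +
  Y(T)^((n-1)/n). That Y is a power with a logarithmic factor, a power of a logarithm, an iterated
  logarithm, or bounded is what separates the four parts.\<close>

lemma hausdorff_content_antimono:
  assumes "\<delta> \<le> \<delta>'"
  shows "hausdorff_content s \<delta>' A \<le> hausdorff_content s \<delta> A"
  unfolding hausdorff_content_def
  using assms by (intro INF_superset_mono) (auto intro: order_trans)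

lemma hausdorff_content_mono:
  assumes "A \<subseteq> B"
  shows "hausdorff_content s \<delta> A \<le> hausdorff_content s \<delta> B"
  unfolding hausdorff_content_def
  by (intro INF_superset_mono) (use assms in auto)

lemma hausdorff_content_le_outer:
  assumes "\<delta> > 0"
  shows "hausdorff_content s \<delta> A \<le> hausdorff_outer s A"
  unfolding hausdorff_outer_def using assms by (intro SUP_upper) auto

lemma hausdorff_outer_mono:
  assumes "A \<subseteq> B"
  shows "hausdorff_outer s A \<le> hausdorff_outer s B"
  unfolding hausdorff_outer_def
  by (intro SUP_mono) (use assms hausdorff_content_mono in blast)

lemma hausdorff_outer_empty: "hausdorff_outer s {} = 0"
proof -
  have "hausdorff_content s \<delta> {} \<le> 0" if "\<delta> > 0" for \<delta>
    unfolding hausdorff_content_def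
    using that by (intro INF_lower2[of "\<lambda>_. {}"]) (auto simp: diameter_def)
  then show ?thesis
    unfolding hausdorff_outer_def by (metis (no_types, lifting) SUP_least bot.extremum_uniqueI bot_ennreal greaterThan_iff)
qed

text \<open>Near-optimal covers of the \<open>A n\<close>, with errors e/2, e/4, and so on, are
  merged into a single sequence by the pairing function; \<open>suminf_ennreal_2dimen\<close> then
  sums the merged sequence row by row.\<close>

lemma hausdorff_content_UN:
  "hausdorff_content s \<delta> (\<Union>n. A n) \<le> (\<Sum>n. hausdorff_content s \<delta> (A n))"
proof (rule ennreal_le_epsilon)
  fix e :: real
  assume fin: "(\<Sum>n. hausdorff_content s \<delta> (A n)) < top" and e: "0 < e"
  let ?g = "\<lambda>U. ennreal (unit_ball_vol s * (diameter U / 2) powr s)"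
  have "\<exists>U :: nat \<Rightarrow> 'a set. A n \<subseteq> (\<Union>i. U i) \<and> (\<forall>i. bounded (U i) \<and> diameter (U i) \<le> \<delta>) \<and>
      (\<Sum>i. ?g (U i)) \<le> hausdorff_content s \<delta> (A n) + ennreal (e * (1/2) ^ Suc n)" for n
  proof -
    have "hausdorff_content s \<delta> (A n) < top"
      using fin ennreal_suminf_lessD by blast
    then have "hausdorff_content s \<delta> (A n) < hausdorff_content s \<delta> (A n) + ennreal (e * (1/2) ^ Suc n)"
      using e by (simp add: ennreal_less_iff)
    then show ?thesis
      unfolding hausdorff_content_def[of s \<delta> "A n"] INF_less_iff
      by (auto intro: less_imp_le)
  qed
  then obtain U :: "nat \<Rightarrow> nat \<Rightarrow> 'a set" where
    U: "\<And>n. A n \<subseteq> (\<Union>i. U n i)" "\<And>n i. bounded (U n i) \<and> diameter (U n i) \<le> \<delta>"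
       "\<And>n. (\<Sum>i. ?g (U n i)) \<le> hausdorff_content s \<delta> (A n) + ennreal (e * (1/2) ^ Suc n)"
    by metis
  define V where "V i = U (fst (prod_decode i)) (snd (prod_decode i))" for i
  have "hausdorff_content s \<delta> (\<Union>n. A n) \<le> (\<Sum>i. ?g (V i))"
    unfolding hausdorff_content_def
  proof (rule INF_lower, safe)
    fix x n assume "x \<in> A n"
    then obtain i where "x \<in> U n i" using U(1) by blast
    then have "x \<in> V (prod_encode (n, i))" by (simp add: V_def)
    then show "x \<in> (\<Union>i. V i)" by blast
  qed (use U(2) in \<open>auto simp: V_def\<close>)
  also have "\<dots> = (\<Sum>n. \<Sum>i. ?g (U n i))"
    using suminf_ennreal_2dimen[of "\<lambda>n. \<Sum>i. ?g (U n i)" "\<lambda>(n, i). ?g (U n i)"]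
    by (simp add: V_def case_prod_unfold)
  also have "\<dots> \<le> (\<Sum>n. hausdorff_content s \<delta> (A n) + ennreal (e * (1/2) ^ Suc n))"
    using U(3) by (intro suminf_le) auto
  also have "\<dots> = (\<Sum>n. hausdorff_content s \<delta> (A n)) + (\<Sum>n. ennreal (e * (1/2) ^ Suc n))"
    by (intro suminf_add[symmetric]) auto
  also have "(\<Sum>n. ennreal (e * (1/2) ^ Suc n)) = ennreal e"
    using e sums_mult[OF power_half_series, of e]
    by (intro suminf_ennreal_eq) auto
  finally show "hausdorff_content s \<delta> (\<Union>n. A n) \<le> (\<Sum>n. hausdorff_content s \<delta> (A n)) + ennreal e" .
qed

lemma hausdorff_outer_UN:
  "hausdorff_outer s (\<Union>n. A n) \<le> (\<Sum>n. hausdorff_outer s (A n))"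
  unfolding hausdorff_outer_def[of s "\<Union>n. A n"]
proof (rule SUP_least)
  fix \<delta> :: real assume "\<delta> \<in> {0<..}"
  then have "(\<Sum>n. hausdorff_content s \<delta> (A n)) \<le> (\<Sum>n. hausdorff_outer s (A n))"
    by (intro suminf_le hausdorff_content_le_outer) auto
  then show "hausdorff_content s \<delta> (\<Union>n. A n) \<le> (\<Sum>n. hausdorff_outer s (A n))"
    using hausdorff_content_UN order_trans by blast
qed

lemma hausdorff_outer_Un:
  "hausdorff_outer s (A \<union> B) \<le> hausdorff_outer s A + hausdorff_outer s B"
proof -
  have "hausdorff_outer s (A \<union> B) = hausdorff_outer s (\<Union>n. binaryset A B n)"
    by (simp add: UN_binaryset_eq)
  also have "\<dots> \<le> (\<Sum>n. hausdorff_outer s (binaryset A B n))"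
    by (rule hausdorff_outer_UN)
  also have "\<dots> = hausdorff_outer s A + hausdorff_outer s B"
    by (rule suminf_binaryset_eq) (rule hausdorff_outer_empty)
  finally show ?thesis .
qed

text \<open>For \<delta> < d no covering set meets both A and B, so a cover of the union splits into
  a cover of A and one of B. A covering set that misses the part in question is replaced by the
  empty set, which contributes 0 and keeps the index set all of \<open>nat\<close>.\<close>

lemma hausdorff_outer_add_separated:
  assumes "d > 0" and sep: "\<And>x y. x \<in> A \<Longrightarrow> y \<in> B \<Longrightarrow> dist x y \<ge> d"
  shows "hausdorff_outer s A + hausdorff_outer s B \<le> hausdorff_outer s (A \<union> B)"
proof -
  let ?g = "\<lambda>U. ennreal (unit_ball_vol s * (diameter U / 2) powr s)"
  have small: "hausdorff_content s \<delta> A + hausdorff_content s \<delta> B \<le> hausdorff_content s \<delta> (A \<union> B)"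
    if \<delta>: "0 < \<delta>" "\<delta> < d" for \<delta>
    unfolding hausdorff_content_def[of s \<delta> "A \<union> B"]
  proof (rule INF_greatest, safe)
    fix U :: "nat \<Rightarrow> 'a set"
    assume cov: "A \<union> B \<subseteq> (\<Union>i. U i)" and U: "\<forall>i. bounded (U i) \<and> diameter (U i) \<le> \<delta>"
    have part: "hausdorff_content s \<delta> X \<le> (\<Sum>i. ?g (if U i \<inter> X = {} then {} else U i))"
      if "X \<subseteq> A \<union> B" for X
      unfolding hausdorff_content_def
    proof (rule INF_lower, safe)
      fix x assume "x \<in> X"
      then have "x \<in> (\<Union>i. U i)" using that cov by blast
      then obtain i where "x \<in> U i" by blast
      with \<open>x \<in> X\<close> have "x \<in> (if U i \<inter> X = {} then {} else U i)" by auto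
      then show "x \<in> (\<Union>i. if U i \<inter> X = {} then {} else U i)" by blast
    next
      fix i
      show "bounded (if U i \<inter> X = {} then {} else U i)" using U by simp
      show "diameter (if U i \<inter> X = {} then {} else U i) \<le> \<delta>" using U \<delta> by simp
    qed
    have disj: "U i \<inter> A = {} \<or> U i \<inter> B = {}" for i
    proof (rule ccontr)
      assume "\<not> ?thesis"
      then obtain x y where xy: "x \<in> U i" "x \<in> A" "y \<in> U i" "y \<in> B" by blast
      then have "dist x y \<le> diameter (U i)" using U diameter_bounded_bound by blast
      then show False using U sep[of x y] xy \<delta> by (metis linorder_not_less order_trans)
    qed
    have "hausdorff_content s \<delta> A + hausdorff_content s \<delta> B \<le>
       (\<Sum>i. ?g (if U i \<inter> A = {} then {} else U i)) + (\<Sum>i. ?g (if U i \<inter> B = {} then {} else U i))"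
      by (intro add_mono part) auto
    also have "\<dots> = (\<Sum>i. ?g (if U i \<inter> A = {} then {} else U i) + ?g (if U i \<inter> B = {} then {} else U i))"
      by (intro suminf_add) auto
    also have "\<dots> \<le> (\<Sum>i. ?g (U i))"
    proof (intro suminf_le)
      fix i
      show "?g (if U i \<inter> A = {} then {} else U i) + ?g (if U i \<inter> B = {} then {} else U i) \<le> ?g (U i)"
        using disj[of i] by (cases "U i \<inter> A = {}"; cases "U i \<inter> B = {}") (simp_all add: diameter_def)
    qed auto
    finally show "hausdorff_content s \<delta> A + hausdorff_content s \<delta> B \<le> (\<Sum>i. ?g (U i))" .
  qed
  \<comment> \<open>The two suprema to be added run over independent \<delta> and \<delta>'; a
    common smaller \<eta> serves both.\<close>
  have "hausdorff_content s \<delta> A + hausdorff_content s \<delta>' B \<le> hausdorff_outer s (A \<union> B)"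
    if "\<delta> > 0" "\<delta>' > 0" for \<delta> \<delta>'
  proof -
    define \<eta> where "\<eta> = min (min \<delta> \<delta>') (d / 2)"
    have \<eta>: "0 < \<eta>" "\<eta> < d" "\<eta> \<le> \<delta>" "\<eta> \<le> \<delta>'" using that \<open>d > 0\<close> by (auto simp: \<eta>_def)
    have "hausdorff_content s \<delta> A + hausdorff_content s \<delta>' B \<le> hausdorff_content s \<eta> A + hausdorff_content s \<eta> B"
      using \<eta> by (intro add_mono hausdorff_content_antimono) auto
    also have "\<dots> \<le> hausdorff_content s \<eta> (A \<union> B)" using small \<eta> by blast
    also have "\<dots> \<le> hausdorff_outer s (A \<union> B)" using \<eta> hausdorff_content_le_outer by blast
    finally show ?thesis .
  qed
  then show ?thesis
    unfolding hausdorff_outer_def[of s A] hausdorff_outer_def[of s B]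
    by (subst ennreal_SUP_add_left[symmetric], simp, intro SUP_least)
       (subst ennreal_SUP_add_right, simp, intro SUP_least, auto)
qed

text \<open>Caratheodory's criterion for closed F. T - F is exhausted by the parts
  \<open>A k\<close> at distance at least 1/(k + 1) from F, to which additivity on separated sets
  applies; what remains are the shells \<open>R j\<close> with j \<ge> k. Shells whose indices
  differ by at least two are separated, so the even ones and the odd ones each have total mass at
  most that of T, and the series over all shells converges.\<close>

lemma hausdorff_outer_closed_split:
  fixes F :: "'a::metric_space set"
  assumes "closed F"
  shows "hausdorff_outer s (T \<inter> F) + hausdorff_outer s (T - F) \<le> hausdorff_outer s T"
proof (cases "hausdorff_outer s T = \<infinity> \<or> F = {}")
  case True
  then show ?thesis by (auto simp: hausdorff_outer_empty)
next
  case False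
  let ?H = "hausdorff_outer s"
  define A where "A k = {x \<in> T - F. infdist x F \<ge> 1 / (real k + 1)}" for k
  define R where "R k = {x \<in> T - F. 1 / (real k + 2) \<le> infdist x F \<and> infdist x F < 1 / (real k + 1)}" for k
  have pos: "infdist x F > 0" if "x \<notin> F" for x
    using assms False that infdist_pos_not_in_closed by blast
  have A_T: "?H (T \<inter> F) + ?H (A k) \<le> ?H T" for k
  proof -
    have "?H (T \<inter> F) + ?H (A k) \<le> ?H ((T \<inter> F) \<union> A k)"
    proof (rule hausdorff_outer_add_separated[of "1 / (real k + 1)"])
      fix x y assume "x \<in> T \<inter> F" "y \<in> A k"
      then show "1 / (real k + 1) \<le> dist x y"
        using infdist_le[of x F y] by (auto simp: A_def dist_commute)
    qed auto
    also have "\<dots> \<le> ?H T" by (rule hausdorff_outer_mono) (auto simp: A_def)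
    finally show ?thesis .
  qed
  have sepR: "1 / (real i + 2) - 1 / (real i + 3) \<le> dist x y"
    if "x \<in> R i" "y \<in> R j" "i + 2 \<le> j" for x y i j
  proof -
    have "infdist x F \<le> infdist y F + dist x y" by (rule infdist_triangle)
    moreover have "1 / (real j + 1) \<le> 1 / (real i + 3)" using that by (intro divide_left_mono) auto
    ultimately show ?thesis using that by (auto simp: R_def)
  qed
  have fin: "(\<Sum>i<N. ?H (R (2 * i + c))) \<le> ?H (\<Union>i<N. R (2 * i + c))" for N c
  proof (induction N)
    case (Suc N)
    \<comment> \<open>The gap between shell 2i + c and any shell beyond the next one is the width of
      shell 2i + c + 1. These widths decrease with the index, so the width of shell 2N + c bounds
      all of them from below.\<close>
    define e where "e = 1 / (real (2 * N + c) + 1) - 1 / (real (2 * N + c) + 2)"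
    have "(\<Sum>i<Suc N. ?H (R (2 * i + c))) \<le> ?H (\<Union>i<N. R (2 * i + c)) + ?H (R (2 * N + c))"
      using Suc by (simp add: add_right_mono)
    also have "\<dots> \<le> ?H ((\<Union>i<N. R (2 * i + c)) \<union> R (2 * N + c))"
    proof (rule hausdorff_outer_add_separated)
      show "e > 0" unfolding e_def by (simp add: divide_strict_left_mono)
      fix x y assume "x \<in> (\<Union>i<N. R (2 * i + c))" "y \<in> R (2 * N + c)"
      then obtain i where i: "i < N" "x \<in> R (2 * i + c)" by auto
      have "1 / (real (2 * i + c) + 2) - 1 / (real (2 * i + c) + 3) \<le> dist x y"
        using sepR[OF i(2) \<open>y \<in> _\<close>] i by auto
      moreover have "e \<le> 1 / (real (2 * i + c) + 2) - 1 / (real (2 * i + c) + 3)"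
      proof -
        have eq: "1 / (a + 1) - 1 / (a + 2) = 1 / ((a + 1) * (a + 2))" if "a \<ge> 0" for a :: real
          using that by (simp add: field_simps)
        have "e = 1 / ((real (2 * N + c) + 1) * (real (2 * N + c) + 2))"
          unfolding e_def by (rule eq) simp
        also have "\<dots> \<le> 1 / (((real (2 * i + c) + 1) + 1) * ((real (2 * i + c) + 1) + 2))"
          using i by (intro divide_left_mono mult_mono) auto
        also have "\<dots> = 1 / ((real (2 * i + c) + 1) + 1) - 1 / ((real (2 * i + c) + 1) + 2)"
          by (rule eq[symmetric]) simp
        finally show ?thesis by (simp add: add.assoc)
      qed
      ultimately show "e \<le> dist x y" by linarith
    qed
    also have "(\<Union>i<N. R (2 * i + c)) \<union> R (2 * N + c) = (\<Union>i<Suc N. R (2 * i + c))"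
      by (auto simp: lessThan_Suc)
    finally show ?case .
  qed simp
  have bnd: "(\<Sum>i. ?H (R (2 * i + c))) \<le> ?H T" for c
  proof (rule suminf_le_const)
    fix N
    show "(\<Sum>i<N. ?H (R (2 * i + c))) \<le> ?H T"
      using fin[of c N] hausdorff_outer_mono[of "\<Union>i<N. R (2 * i + c)" T s]
      by (force simp: R_def intro: order_trans)
  qed simp
  have split_sum: "(\<Sum>j<2 * N. r j) = (\<Sum>i<N. r (2 * i + 0)) + (\<Sum>i<N. r (2 * i + 1))" for r :: "nat \<Rightarrow> ennreal" and N
    by (induction N) (auto simp: algebra_simps)
  have "(\<Sum>j. ?H (R j)) \<le> ?H T + ?H T"
  proof (rule suminf_le_const)
    fix N
    have "(\<Sum>j<N. ?H (R j)) \<le> (\<Sum>j<2 * N. ?H (R j))" by (rule sum_mono2) auto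
    also have "\<dots> \<le> (\<Sum>i. ?H (R (2 * i + 0))) + (\<Sum>i. ?H (R (2 * i + 1)))"
      unfolding split_sum by (intro add_mono sum_le_suminf) auto
    also have "\<dots> \<le> ?H T + ?H T" by (intro add_mono bnd)
    finally show "(\<Sum>j<N. ?H (R j)) \<le> ?H T + ?H T" .
  qed simp
  then have sum_fin: "(\<Sum>j. ?H (R j)) < \<infinity>"
    using False by (simp add: top.not_eq_extremum le_less_trans)
  have tail: "?H (T - F) \<le> ?H (A k) + (\<Sum>j. ?H (R (j + k)))" for k
  proof -
    have "T - F \<subseteq> A k \<union> (\<Union>j. R (j + k))"
    proof
      fix x assume x: "x \<in> T - F"
      show "x \<in> A k \<union> (\<Union>j. R (j + k))"
      proof (cases "x \<in> A k")
        case nA: False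
        define m where "m = (LEAST m. infdist x F \<ge> 1 / (real m + 1))"
        obtain m0 where "1 / (real m0 + 1) < infdist x F"
          using pos[of x] x reals_Archimedean[of "infdist x F"] by (auto simp: inverse_eq_divide add.commute)
        then have m: "infdist x F \<ge> 1 / (real m + 1)"
          unfolding m_def by (rule LeastI[of "\<lambda>m. 1 / (real m + 1) \<le> infdist x F", OF less_imp_le])
        have "infdist x F < 1 / (real k + 1)" using nA x by (auto simp: A_def)
        then have "1 / (real m + 1) < 1 / (real k + 1)" using m by linarith
        then have "k < m" by (simp add: field_simps)
        moreover have "infdist x F < 1 / (real (m - 1) + 1)"
          using not_less_Least[of "m - 1" "\<lambda>m. infdist x F \<ge> 1 / (real m + 1)"] \<open>k < m\<close> by (auto simp: m_def[symmetric])
        ultimately have "x \<in> R ((m - 1 - k) + k)" using m x by (auto simp: R_def of_nat_diff add.commute)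
        then show ?thesis by blast
      qed auto
    qed
    then have "?H (T - F) \<le> ?H (A k \<union> (\<Union>j. R (j + k)))" by (rule hausdorff_outer_mono)
    also have "\<dots> \<le> ?H (A k) + ?H (\<Union>j. R (j + k))" by (rule hausdorff_outer_Un)
    also have "\<dots> \<le> ?H (A k) + (\<Sum>j. ?H (R (j + k)))" by (intro add_left_mono hausdorff_outer_UN)
    finally show ?thesis .
  qed
  \<comment> \<open>The head of the shell series is added on both sides instead of passing to the
    limit in the tails: the left side increases to one containing the whole series, which is finite
    and cancels.\<close>
  have "?H (T \<inter> F) + ?H (T - F) + (\<Sum>j<k. ?H (R j)) \<le> ?H T + (\<Sum>j. ?H (R j))" for k
  proof -
    have "?H (T \<inter> F) + ?H (T - F) + (\<Sum>j<k. ?H (R j)) \<le>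
        (?H (T \<inter> F) + ?H (A k)) + ((\<Sum>j. ?H (R (j + k))) + (\<Sum>j<k. ?H (R j)))"
      using add_mono[OF tail[of k] order_refl[of "?H (T \<inter> F) + (\<Sum>j<k. ?H (R j))"]]
      by (simp add: ac_simps)
    also have "(\<Sum>j. ?H (R (j + k))) + (\<Sum>j<k. ?H (R j)) = (\<Sum>j. ?H (R j))"
      by (rule suminf_offset[symmetric]) simp
    also have "(?H (T \<inter> F) + ?H (A k)) + (\<Sum>j. ?H (R j)) \<le> ?H T + (\<Sum>j. ?H (R j))"
      by (intro add_right_mono A_T)
    finally show ?thesis .
  qed
  then have "(SUP k. ?H (T \<inter> F) + ?H (T - F) + (\<Sum>j<k. ?H (R j))) \<le> ?H T + (\<Sum>j. ?H (R j))"
    by (intro SUP_least)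
  also have "(SUP k. ?H (T \<inter> F) + ?H (T - F) + (\<Sum>j<k. ?H (R j))) = ?H (T \<inter> F) + ?H (T - F) + (\<Sum>j. ?H (R j))"
    by (subst suminf_eq_SUP, subst ennreal_SUP_add_right) auto
  finally show ?thesis
    using sum_fin by (auto simp: add.commute ennreal_add_left_cancel_le)
qed

lemma hausdorff_measure_space:
  "measure_space (UNIV :: 'a::metric_space set) (sets borel) (hausdorff_outer s)"
proof -
  interpret P: sigma_algebra "UNIV :: 'a set" "Pow UNIV" by (rule sigma_algebra_Pow)
  let ?L = "lambda_system (UNIV :: 'a set) (Pow UNIV) (hausdorff_outer s)"
  have oms: "outer_measure_space (Pow (UNIV :: 'a set)) (hausdorff_outer s)"
    unfolding outer_measure_space_def positive_def increasing_def countably_subadditive_def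
    using hausdorff_outer_UN by (auto simp: hausdorff_outer_empty intro: hausdorff_outer_mono)
  have ms: "measure_space UNIV ?L (hausdorff_outer s)"
    using P.caratheodory_lemma[OF oms] .
  have "closed F \<Longrightarrow> F \<in> ?L" for F
  proof -
    assume "closed F"
    have "hausdorff_outer s (x \<inter> F) + hausdorff_outer s (x - F) = hausdorff_outer s x" for x
      using hausdorff_outer_closed_split[OF \<open>closed F\<close>, of s x] hausdorff_outer_Un[of s "x \<inter> F" "x - F"]
      by (simp add: Int_Diff_Un antisym)
    then show ?thesis using P.lambda_system_eq[of "hausdorff_outer s"] by simp
  qed
  moreover have "sigma_algebra UNIV ?L" using ms by (simp add: measure_space_def)
  ultimately have "sets borel \<subseteq> ?L"
    using sigma_algebra.sigma_sets_subset[of UNIV ?L "Collect closed"]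
    by (auto simp: borel_eq_closed)
  then show ?thesis
    using measure_down[OF ms] sets.sigma_algebra_axioms[of borel] by (simp add: space_borel)
qed

lemma sets_hausdorff_measure [simp, measurable_cong]: "sets (hausdorff_measure s) = sets borel"
  unfolding hausdorff_measure_def using sets.sigma_sets_eq[of borel] by (simp add: space_borel)

lemma space_hausdorff_measure [simp]: "space (hausdorff_measure s) = UNIV"
  unfolding hausdorff_measure_def by simp

lemma emeasure_hausdorff_measure:
  assumes "A \<in> sets borel"
  shows "emeasure (hausdorff_measure s) A = hausdorff_outer s A"
  unfolding hausdorff_measure_def
  using hausdorff_measure_space[of s] assms
  by (intro emeasure_measure_of_sigma) (auto simp: measure_space_def)

section \<open>A smooth mollifier\<close>

text \<open>The smooth function exp(-1/t) on t > 0, extended by 0, times a polynomial in 1/t. The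
  polynomial closes the family under differentiation: with y = 1/t the derivative of P(y) exp(-y)
  with respect to t is y^2 (P(y) - P'(y)) exp(-y).\<close>

definition exp_inv :: "real poly \<Rightarrow> real \<Rightarrow> real" where
  "exp_inv P t = (if t > 0 then poly P (1 / t) * exp (- 1 / t) else 0)"

lemma tendsto_poly_exp_neg: "((\<lambda>y. poly P y * exp (- y)) \<longlongrightarrow> (0::real)) at_top"
proof -
  have "((\<lambda>y. \<Sum>i\<le>degree P. coeff P i * (y ^ i / exp y)) \<longlongrightarrow> (\<Sum>i\<le>degree P. coeff P i * 0)) at_top"
    by (intro tendsto_sum tendsto_mult tendsto_const tendsto_power_div_exp_0)
  then show ?thesis
    by (simp add: poly_altdef sum_distrib_right exp_minus divide_inverse mult.assoc)
qed

lemma exp_inv_deriv: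
  "(exp_inv P has_real_derivative exp_inv ([:0, 0, 1:] * (P - pderiv P)) t) (at t)"
proof -
  consider "t > 0" | "t < 0" | "t = 0" by linarith
  then show ?thesis
  proof cases
    case 1
    have "((\<lambda>t. poly P (1 / t) * exp (- 1 / t)) has_real_derivative
        exp_inv ([:0, 0, 1:] * (P - pderiv P)) t) (at t)"
      using 1 unfolding exp_inv_def
      by (auto intro!: derivative_eq_intros DERIV_chain2[OF poly_DERIV]
          simp: field_simps power2_eq_square)
    then show ?thesis
      by (rule DERIV_cong_ev[THEN iffD1, rotated 3])
         (use 1 in \<open>auto simp: exp_inv_def eventually_nhds intro!: exI[of _ "{0<..}"]\<close>)
  next
    case 2
    have "((\<lambda>t. 0) has_real_derivative exp_inv ([:0, 0, 1:] * (P - pderiv P)) t) (at t)"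
      using 2 by (auto simp: exp_inv_def)
    then show ?thesis
      by (rule DERIV_cong_ev[THEN iffD1, rotated 3])
         (use 2 in \<open>auto simp: exp_inv_def eventually_nhds intro!: exI[of _ "{..<0}"]\<close>)
  next
    case 3
    have "((\<lambda>h. exp_inv P h / h) \<longlongrightarrow> 0) (at_left 0)"
      by (rule tendsto_eventually)
         (auto simp: exp_inv_def eventually_at_left_field intro!: exI[of _ "-1"])
    moreover have "((\<lambda>h. exp_inv P h / h) \<longlongrightarrow> 0) (at_right 0)"
    proof -
      \<comment> \<open>The difference quotient at 0 has one more factor y = 1/h, which is absorbed
        in the polynomial.\<close>
      have "((\<lambda>h. poly ([:0, 1:] * P) (inverse h) * exp (- inverse h)) \<longlongrightarrow> 0) (at_right 0)"
        by (rule filterlim_compose[OF tendsto_poly_exp_neg filterlim_inverse_at_top_right])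
      then show ?thesis
      proof (rule Lim_transform_eventually)
        show "\<forall>\<^sub>F h in at_right 0. poly ([:0, 1:] * P) (inverse h) * exp (- inverse h) = exp_inv P h / h"
          by (auto simp: exp_inv_def eventually_at_right_field field_simps intro!: exI[of _ 1])
      qed
    qed
    ultimately have "((\<lambda>h. exp_inv P h / h) \<longlongrightarrow> 0) (at 0)"
      by (simp add: filterlim_split_at)
    then show ?thesis
      using 3 by (simp add: DERIV_def exp_inv_def)
  qed
qed

lemma continuous_on_exp_inv [continuous_intros]:
  assumes "continuous_on S f"
  shows "continuous_on S (\<lambda>x. exp_inv P (f x))"
  using continuous_on_compose2[OF DERIV_continuous_on[OF has_field_derivative_at_within[OF exp_inv_deriv]] assms]
  by blast

text \<open>An algebra that contains the bumps and is closed under partial derivatives; for the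
  second property \<open>core\<close> admits every polynomial P. Smoothness of a bump then follows
  by induction on the list of derivatives, none of which is computed.\<close>

inductive bump_algebra :: "(real ^ 'n::finite \<Rightarrow> real) \<Rightarrow> bool" where
  core: "bump_algebra (\<lambda>x. exp_inv P (1 - a * ((x - w) \<bullet> (x - w))))"
| coord: "bump_algebra (\<lambda>x. x $ i)"
| const: "bump_algebra (\<lambda>x. c)"
| add: "bump_algebra f \<Longrightarrow> bump_algebra g \<Longrightarrow> bump_algebra (\<lambda>x. f x + g x)"
| mult: "bump_algebra f \<Longrightarrow> bump_algebra g \<Longrightarrow> bump_algebra (\<lambda>x. f x * g x)"

lemma exp_inv_radial_derivative:
  fixes w :: "real ^ 'n::finite"
  shows "((\<lambda>x. exp_inv P (1 - a * ((x - w) \<bullet> (x - w)))) has_derivative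
     (\<lambda>v. exp_inv ([:0, 0, 1:] * (P - pderiv P)) (1 - a * ((x - w) \<bullet> (x - w))) * (- 2 * a * ((x - w) \<bullet> v)))) (at x)"
proof -
  have "((\<lambda>x. 1 - a * ((x - w) \<bullet> (x - w))) has_derivative (\<lambda>v. - 2 * a * ((x - w) \<bullet> v))) (at x)"
    by (auto intro!: derivative_eq_intros simp: inner_commute)
  from has_derivative_compose[OF this exp_inv_deriv[unfolded has_field_derivative_def, of P]]
  show ?thesis by simp
qed

lemma bump_algebra_derivative:
  fixes f :: "real ^ 'n::finite \<Rightarrow> real"
  assumes "bump_algebra f"
  shows "\<exists>D. (\<forall>x. (f has_derivative D x) (at x)) \<and> (\<forall>i. bump_algebra (\<lambda>x. D x (axis i 1)))"
  using assms
proof induction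
  case (core P a w)
  let ?D = "\<lambda>x v. exp_inv ([:0, 0, 1:] * (P - pderiv P)) (1 - a * ((x - w) \<bullet> (x - w))) * (- 2 * a * ((x - w) \<bullet> v))"
  have "bump_algebra (\<lambda>x. ?D x (axis i 1))" for i
  proof -
    have "bump_algebra (\<lambda>x. exp_inv ([:0, 0, 1:] * (P - pderiv P)) (1 - a * ((x - w) \<bullet> (x - w)))
             * (- 2 * a * (x $ i + - w $ i)))"
      by (intro bump_algebra.intros)
    then show ?thesis by (simp add: inner_axis)
  qed
  then show ?case using exp_inv_radial_derivative[of P a w] by (intro exI[of _ ?D]) blast
next
  case (coord i)
  have "((\<lambda>x. x $ i) has_derivative (\<lambda>v. v $ i)) (at x)" for x :: "real ^ 'n"
    by (rule bounded_linear_imp_has_derivative[OF bounded_linear_vec_nth])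
  then show ?case
    by (intro exI[of _ "\<lambda>x v. v $ i"]) (auto intro: bump_algebra.intros)
next
  case (const c)
  show ?case
    by (intro exI[of _ "\<lambda>x v. 0"]) (auto intro: bump_algebra.intros)
next
  case (add f g)
  then obtain D E where D: "\<forall>x. (f has_derivative D x) (at x)" "\<forall>i. bump_algebra (\<lambda>x. D x (axis i 1))"
    and E: "\<forall>x. (g has_derivative E x) (at x)" "\<forall>i. bump_algebra (\<lambda>x. E x (axis i 1))" by blast
  then show ?case
    by (intro exI[of _ "\<lambda>x v. D x v + E x v"]) (auto intro: bump_algebra.intros has_derivative_add)
next
  case (mult f g)
  then obtain D E where D: "\<forall>x. (f has_derivative D x) (at x)" "\<forall>i. bump_algebra (\<lambda>x. D x (axis i 1))"
    and E: "\<forall>x. (g has_derivative E x) (at x)" "\<forall>i. bump_algebra (\<lambda>x. E x (axis i 1))" by blast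
  then show ?case
    using mult.hyps
    by (intro exI[of _ "\<lambda>x v. f x * E x v + D x v * g x"]) (auto intro!: bump_algebra.intros has_derivative_mult)
qed

lemma bump_algebra_iterated_partial:
  assumes "bump_algebra f"
  shows "bump_algebra (iterated_partial is f)"
proof (induction "is")
  case (Cons i "is")
  then obtain D where D: "\<And>x. (iterated_partial is f has_derivative D x) (at x)"
      "bump_algebra (\<lambda>x. D x (axis i 1))"
    using bump_algebra_derivative by blast
  have "frechet_derivative (iterated_partial is f) (at x) = D x" for x
    using frechet_derivative_at[OF D(1)] by simp
  then show ?case using D(2) by (simp add: partial_def[abs_def])
qed (use assms in simp)

text \<open>Supported in the ball of radius 1/a about w, and bounded by 1 instead of having mass 1;
  the mass, a fixed multiple of (1/a)^n, is divided out in \<open>mollified_ray\<close>.\<close>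

definition mollifier :: "real \<Rightarrow> real ^ 'n::finite \<Rightarrow> real ^ 'n \<Rightarrow> real" where
  "mollifier a w y = exp_inv 1 (1 - a\<^sup>2 * ((y - w) \<bullet> (y - w)))"

text \<open>The scalar factor of the gradient: the derivative at y in direction v is this factor
  times (y - w) \<bullet> v. The polynomial is the y^2 (P - P') of \<open>exp_inv_deriv\<close> for
  P = 1.\<close>

definition mollifier_grad :: "real \<Rightarrow> real ^ 'n::finite \<Rightarrow> real ^ 'n \<Rightarrow> real" where
  "mollifier_grad a w y = exp_inv [:0, 0, 1:] (1 - a\<^sup>2 * ((y - w) \<bullet> (y - w))) * (- 2 * a\<^sup>2)"

lemma mollifier_nonneg [simp]: "0 \<le> mollifier a w y"
  by (simp add: mollifier_def exp_inv_def)

lemma mollifier_le_1: "mollifier a w y \<le> 1"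
  by (simp add: mollifier_def exp_inv_def)

lemma mollifier_eq_0:
  assumes "a > 0" "dist w y \<ge> 1 / a"
  shows "mollifier a w y = 0" "mollifier_grad a w y = 0"
proof -
  have "1 \<le> a * dist y w" using assms by (simp add: field_simps dist_commute)
  then have "1\<^sup>2 \<le> (a * dist y w)\<^sup>2" by (intro power_mono) auto
  then have "1 - a\<^sup>2 * ((y - w) \<bullet> (y - w)) \<le> 0"
    by (simp add: power_mult_distrib dist_norm power2_norm_eq_inner)
  then show "mollifier a w y = 0" "mollifier_grad a w y = 0"
    by (simp_all add: mollifier_def mollifier_grad_def exp_inv_def)
qed

lemma mollifier_lower:
  assumes "a > 0" "dist w y \<le> 1 / (2 * a)"
  shows "exp (- 2) \<le> mollifier a w y"
proof -
  have "a * dist y w \<le> 1 / 2" using assms by (simp add: field_simps dist_commute)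
  then have "(a * dist y w)\<^sup>2 \<le> (1 / 2)\<^sup>2" using assms by (intro power_mono) auto
  then have *: "1 - a\<^sup>2 * ((y - w) \<bullet> (y - w)) \<ge> 1 / 2"
    by (simp add: power_mult_distrib dist_norm power2_norm_eq_inner) (simp add: power2_eq_square field_simps)
  have "- 2 \<le> - 1 / (1 - a\<^sup>2 * ((y - w) \<bullet> (y - w)))"
    using * by (simp add: field_simps)
  then show ?thesis using * by (simp add: mollifier_def exp_inv_def)
qed

lemma continuous_on_mollifier [continuous_intros]:
  assumes "continuous_on S f" "continuous_on S g"
  shows "continuous_on S (\<lambda>x. mollifier a (f x) (g x))"
  unfolding mollifier_def by (intro continuous_intros assms)

lemma continuous_on_mollifier_grad [continuous_intros]:
  assumes "continuous_on S f" "continuous_on S g"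
  shows "continuous_on S (\<lambda>x. mollifier_grad a (f x) (g x))"
  unfolding mollifier_grad_def by (intro continuous_intros assms)

lemma mollifier_has_derivative:
  "((\<lambda>y. mollifier a w y) has_derivative (\<lambda>v. mollifier_grad a w y * ((y - w) \<bullet> v))) (at y)"
  using exp_inv_radial_derivative[of 1 "a\<^sup>2" w y]
  by (simp add: mollifier_def mollifier_grad_def mult_ac)

lemma partial_mollifier: "partial i (mollifier a w) y = mollifier_grad a w y * (y - w) $ i"
  unfolding partial_def
  using frechet_derivative_at[OF mollifier_has_derivative[of a w y], symmetric]
  by (simp add: inner_axis)

lemma mollifier_test_function:
  fixes w :: "real ^ 'n::finite"
  assumes "a > 0" "cball w (1 / a) \<subseteq> \<Omega>"
  shows "mollifier a w \<in> test_functions \<Omega>"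
proof -
  have "{x. mollifier a w x \<noteq> 0} \<subseteq> cball w (1 / a)"
    using mollifier_eq_0[OF assms(1)] by (force simp: not_le)
  then have sub: "closure {x. mollifier a w x \<noteq> 0} \<subseteq> cball w (1 / a)"
    by (simp add: closure_minimal)
  then have "compact (closure {x. mollifier a w x \<noteq> 0})"
    by (meson bounded_cball bounded_subset closed_closure compact_eq_bounded_closed)
  moreover have "bump_algebra (mollifier a w)"
    unfolding mollifier_def[abs_def] by (rule bump_algebra.core)
  then have "iterated_partial is (mollifier a w) differentiable_on UNIV" for "is"
    using bump_algebra_derivative[OF bump_algebra_iterated_partial, of "mollifier a w" "is"]
    unfolding differentiable_on_def differentiable_def by auto
  ultimately show ?thesis
    using sub assms unfolding test_functions_def by auto
qed

section \<open>The symmetric gradient along a line\<close>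

text \<open>The quadratic form is the Frobenius inner product of G with the matrix (z_i z_j), whose
  Frobenius norm is |z|^2.\<close>

lemma norm_quadratic_form_le:
  fixes G :: "real ^ 'n::finite ^ 'n" and z :: "real ^ 'n"
  shows "\<bar>\<Sum>i\<in>UNIV. \<Sum>j\<in>UNIV. z $ i * z $ j * G $ i $ j\<bar> \<le> norm G * (norm z)\<^sup>2"
proof -
  have "(\<Sum>i\<in>UNIV. \<Sum>j\<in>UNIV. z $ i * z $ j * G $ i $ j) = G \<bullet> (\<chi> i. z $ i *\<^sub>R z)"
    by (simp add: inner_vec_def sum_distrib_left sum_distrib_right mult_ac)
  moreover have "norm (\<chi> i. z $ i *\<^sub>R z) = (norm z)\<^sup>2"
  proof -
    have "norm (\<chi> i. z $ i *\<^sub>R z) = L2_set (\<lambda>i. \<bar>z $ i\<bar> * norm z) UNIV"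
      by (simp add: norm_vec_def[where 'a = "real ^ 'n"])
    also have "\<dots> = norm z * L2_set (\<lambda>i. \<bar>z $ i\<bar>) UNIV"
      using L2_set_left_distrib[of "norm z" "\<lambda>i. \<bar>z $ i\<bar>" UNIV] by (simp add: mult.commute)
    also have "\<dots> = (norm z)\<^sup>2"
      by (simp add: norm_vec_def[where 'a = real] power2_eq_square)
    finally show ?thesis .
  qed
  ultimately show ?thesis using Cauchy_Schwarz_ineq2[of G "\<chi> i. z $ i *\<^sub>R z"] by simp
qed


lemma integrable_compact_support:
  fixes \<phi> :: "real ^ 'n::finite \<Rightarrow> real" and g :: "real ^ 'n \<Rightarrow> 'b::euclidean_space"
  assumes g: "locally_integrable \<Omega> g" and K: "compact K" "K \<subseteq> \<Omega>" and \<Omega>: "open \<Omega>"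
    and \<phi>: "continuous_on UNIV \<phi>" "\<And>x. x \<notin> K \<Longrightarrow> \<phi> x = 0"
  shows "integrable (lebesgue_on \<Omega>) (\<lambda>x. \<phi> x *\<^sub>R g x)"
proof -
  have "g absolutely_integrable_on K" using g K by (auto simp: locally_integrable_def)
  moreover have "\<phi> \<in> borel_measurable (lebesgue_on K)"
    using \<phi>(1) K by (intro continuous_imp_measurable_on_sets_lebesgue)
      (auto intro: continuous_on_subset lmeasurable_compact fmeasurableD)
  moreover have "bounded (\<phi> ` K)"
    using \<phi>(1) K by (intro compact_imp_bounded compact_continuous_image) (auto intro: continuous_on_subset)
  ultimately have "(\<lambda>x. \<phi> x *\<^sub>R g x) absolutely_integrable_on K"
    using K by (intro absolutely_integrable_bounded_measurable_product
        [OF bilinear_conv_bounded_bilinear[THEN iffD2, OF bounded_bilinear_scaleR]])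
      (auto intro: lmeasurable_compact fmeasurableD)
  then have "integrable lebesgue (\<lambda>x. indicator K x *\<^sub>R (\<phi> x *\<^sub>R g x))"
    by (simp add: set_integrable_def)
  also have "(\<lambda>x. indicator K x *\<^sub>R (\<phi> x *\<^sub>R g x)) = (\<lambda>x. indicator \<Omega> x *\<^sub>R (\<phi> x *\<^sub>R g x))"
    using K \<phi>(2) by (auto simp: fun_eq_iff indicator_def)
  finally show ?thesis
    using \<Omega> by (subst integrable_restrict_space) auto
qed

text \<open>Contracting the weak identity with z_i z_j undoes the symmetrisation: the sum of z_i z_j
  (p_i q_j + p_j q_i)/2 is (p \<bullet> z)(q \<bullet> z). The integral on the left is therefore, up
  to sign, the derivative of the mollified u \<bullet> z in direction z.\<close>

lemma has_sym_grad_test_direction: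
  fixes u :: "real ^ 'n::finite \<Rightarrow> real ^ 'n" and G :: "real ^ 'n \<Rightarrow> real ^ 'n ^ 'n"
  assumes "open \<Omega>" and u: "continuous_on UNIV u" and G: "has_sym_grad \<Omega> u G"
    and a: "a > 0" and w: "cball w (1 / a) \<subseteq> \<Omega>" and z: "norm z \<le> 1"
  shows "ennreal \<bar>LINT y|lborel. (u y \<bullet> z) * mollifier_grad a w y * ((y - w) \<bullet> z)\<bar>
    \<le> (\<integral>\<^sup>+ y. ennreal (norm (G y)) * ennreal (mollifier a w y) \<partial>lebesgue_on \<Omega>)"
proof -
  let ?\<phi> = "mollifier a w" and ?d = "mollifier_grad a w"
  let ?q = "\<lambda>y. \<Sum>i\<in>UNIV. \<Sum>j\<in>UNIV. z $ i * z $ j * G y $ i $ j"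
  have out: "?\<phi> y = 0" "?d y = 0" if "y \<notin> cball w (1 / a)" for y
    using mollifier_eq_0[OF a, of w y] that by auto
  have G_loc: "locally_integrable \<Omega> G" using G by (simp add: has_sym_grad_def)
  have intG: "integrable (lebesgue_on \<Omega>) (\<lambda>y. ?\<phi> y *\<^sub>R G y)"
    using assms out by (intro integrable_compact_support[OF G_loc, of "cball w (1 / a)"] continuous_intros) auto
  have intGij: "integrable (lebesgue_on \<Omega>) (\<lambda>y. G y $ i $ j * ?\<phi> y)" for i j
  proof -
    have "bounded_linear (\<lambda>M :: real ^ 'n ^ 'n. M $ i $ j)"
      by (rule bounded_linear_compose[OF bounded_linear_vec_nth bounded_linear_vec_nth])
    from integrable_bounded_linear[OF this intG] show ?thesis by (simp add: mult.commute)
  qed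
  have loc1: "locally_integrable \<Omega> (\<lambda>x. 1 :: real)"
    by (auto simp: locally_integrable_def intro: absolutely_integrable_on_const lmeasurable_compact)
  have intc: "integrable (lebesgue_on \<Omega>) (\<lambda>y. ?d y * f y)" if "continuous_on UNIV f" for f :: "real ^ 'n \<Rightarrow> real"
  proof -
    have "integrable (lebesgue_on \<Omega>) (\<lambda>y. (?d y * f y) *\<^sub>R (1::real))"
      using assms out that by (intro integrable_compact_support[OF loc1, of "cball w (1 / a)"] continuous_intros) auto
    then show ?thesis by simp
  qed
  have weak: "(LINT y|lebesgue_on \<Omega>. G y $ i $ j * ?\<phi> y) =
      - (LINT y|lebesgue_on \<Omega>. ?d y * ((1/2) * (u y $ i * (y - w) $ j + u y $ j * (y - w) $ i)))" for i j
    using G mollifier_test_function[OF a w]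
    by (auto simp: has_sym_grad_def partial_mollifier algebra_simps add_divide_distrib diff_divide_distrib)
  have "(LINT y|lebesgue_on \<Omega>. ?q y * ?\<phi> y) =
      (\<Sum>i\<in>UNIV. \<Sum>j\<in>UNIV. z $ i * z $ j * (LINT y|lebesgue_on \<Omega>. G y $ i $ j * ?\<phi> y))"
    using intGij by (simp add: sum_distrib_right mult.assoc)
  also have "\<dots> = (\<Sum>i\<in>UNIV. \<Sum>j\<in>UNIV. - (LINT y|lebesgue_on \<Omega>.
      z $ i * z $ j * (?d y * ((1/2) * (u y $ i * (y - w) $ j + u y $ j * (y - w) $ i)))))"
    by (simp add: weak)
  also have "\<dots> = - (LINT y|lebesgue_on \<Omega>. (\<Sum>i\<in>UNIV. \<Sum>j\<in>UNIV.
      z $ i * z $ j * (?d y * ((1/2) * (u y $ i * (y - w) $ j + u y $ j * (y - w) $ i)))))"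
  proof -
    have "integrable (lebesgue_on \<Omega>) (\<lambda>y. z $ i * z $ j *
       (?d y * ((1/2) * (u y $ i * (y - w) $ j + u y $ j * (y - w) $ i))))" for i j
      using u by (intro integrable_mult_right intc continuous_intros)
    then show ?thesis by (simp add: sum_negf)
  qed
  also have "\<dots> = - (LINT y|lebesgue_on \<Omega>. (u y \<bullet> z) * ?d y * ((y - w) \<bullet> z))"
  proof -
    have "(\<Sum>i\<in>UNIV. \<Sum>j\<in>UNIV. z $ i * z $ j * (d * ((1/2) * (p $ i * q $ j + p $ j * q $ i)))) = (p \<bullet> z) * d * (q \<bullet> z)"
      for p q :: "real ^ 'n" and d
    proof -
      have "(p \<bullet> z) * (q \<bullet> z) = (\<Sum>i\<in>UNIV. \<Sum>j\<in>UNIV. z $ i * z $ j * (p $ i * q $ j))"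
        by (simp add: inner_vec_def sum_product mult_ac)
      moreover have "(p \<bullet> z) * (q \<bullet> z) = (\<Sum>i\<in>UNIV. \<Sum>j\<in>UNIV. z $ i * z $ j * (p $ j * q $ i))"
        by (subst sum.swap) (simp add: inner_vec_def sum_product mult_ac)
      ultimately have "(p \<bullet> z) * (q \<bullet> z) = (\<Sum>i\<in>UNIV. \<Sum>j\<in>UNIV. z $ i * z $ j * ((1/2) * (p $ i * q $ j + p $ j * q $ i)))"
        by (simp add: distrib_left sum.distrib sum_divide_distrib[symmetric])
      then have "d * ((p \<bullet> z) * (q \<bullet> z)) = d * (\<Sum>i\<in>UNIV. \<Sum>j\<in>UNIV. z $ i * z $ j * ((1/2) * (p $ i * q $ j + p $ j * q $ i)))"
        by simp
      then show ?thesis by (simp add: sum_distrib_left mult_ac)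
    qed
    then show ?thesis by (simp only:)
  qed
  also have "(LINT y|lebesgue_on \<Omega>. (u y \<bullet> z) * ?d y * ((y - w) \<bullet> z)) =
      (LINT y|lborel. (u y \<bullet> z) * ?d y * ((y - w) \<bullet> z))"
  proof -
    have "(LINT y|lebesgue_on \<Omega>. (u y \<bullet> z) * ?d y * ((y - w) \<bullet> z)) =
       (LINT y|lebesgue. indicator \<Omega> y *\<^sub>R ((u y \<bullet> z) * ?d y * ((y - w) \<bullet> z)))"
      using \<open>open \<Omega>\<close> by (subst integral_restrict_space) auto
    also have "\<dots> = (LINT y|lebesgue. (u y \<bullet> z) * ?d y * ((y - w) \<bullet> z))"
    proof (intro Bochner_Integration.integral_cong refl)
      fix y
      show "indicator \<Omega> y *\<^sub>R ((u y \<bullet> z) * ?d y * ((y - w) \<bullet> z)) = (u y \<bullet> z) * ?d y * ((y - w) \<bullet> z)"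
        using w out(2)[of y] by (cases "y \<in> cball w (1 / a)") (auto dest: subsetD simp del: mem_cball)
    qed
    also have "\<dots> = (LINT y|lborel. (u y \<bullet> z) * ?d y * ((y - w) \<bullet> z))"
      using u by (intro integral_completion) (auto intro!: borel_measurable_continuous_onI continuous_intros)
    finally show ?thesis .
  qed
  finally have "ennreal \<bar>LINT y|lborel. (u y \<bullet> z) * ?d y * ((y - w) \<bullet> z)\<bar> =
      ennreal (norm (LINT y|lebesgue_on \<Omega>. ?q y * ?\<phi> y))" by simp
  also have "\<dots> \<le> (\<integral>\<^sup>+ y. ennreal (norm (?q y * ?\<phi> y)) \<partial>lebesgue_on \<Omega>)"
  proof (rule integral_norm_bound_ennreal)
    show "integrable (lebesgue_on \<Omega>) (\<lambda>y. ?q y * ?\<phi> y)"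
      using intGij by (simp add: sum_distrib_right mult.assoc)
  qed
  also have "\<dots> \<le> (\<integral>\<^sup>+ y. ennreal (norm (G y)) * ennreal (?\<phi> y) \<partial>lebesgue_on \<Omega>)"
  proof (rule nn_integral_mono)
    fix y
    have "norm (?q y) \<le> norm (G y)"
      using norm_quadratic_form_le[of z "G y"] z
      by (smt (verit) mult_left_le norm_ge_zero power_le_one real_norm_def)
    then show "ennreal (norm (?q y * ?\<phi> y)) \<le> ennreal (norm (G y)) * ennreal (?\<phi> y)"
      by (auto simp: abs_mult ennreal_mult[symmetric] intro!: ennreal_leI mult_right_mono)
  qed
  finally show ?thesis .
qed

text \<open>Fundamental theorem of calculus for the mollified u \<bullet> z along the segment, with
  the derivative bounded by \<open>has_sym_grad_test_direction\<close>. The right side runs over the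
  whole half-line s \<ge> 0, so it does not depend on t and can later be integrated over z whatever
  the exit time is.\<close>

lemma mollified_ray_estimate:
  fixes u :: "real ^ 'n::finite \<Rightarrow> real ^ 'n" and G :: "real ^ 'n \<Rightarrow> real ^ 'n ^ 'n"
  assumes "open \<Omega>" and u: "continuous_on UNIV u" and G: "has_sym_grad \<Omega> u G"
    and a: "a > 0" and t: "t \<ge> 0" and z: "norm z \<le> 1"
    and seg: "\<And>s. s \<in> {0..t} \<Longrightarrow> cball (x + s *\<^sub>R z) (1 / a) \<subseteq> \<Omega>"
  shows "ennreal \<bar>(LINT y|lborel. (u y \<bullet> z) * mollifier a (x + t *\<^sub>R z) y)
                   - (LINT y|lborel. (u y \<bullet> z) * mollifier a x y)\<bar>
    \<le> (\<integral>\<^sup>+ s. indicator {0..} s *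
         (\<integral>\<^sup>+ y. ennreal (norm (G y)) * ennreal (mollifier a (x + s *\<^sub>R z) y) \<partial>lebesgue_on \<Omega>) \<partial>lborel)"
proof -
  let ?w = "\<lambda>s. x + s *\<^sub>R z"
  define m where "m s = (LINT y|lborel. (u y \<bullet> z) * mollifier a (?w s) y)" for s
  define m' where "m' s = - (LINT y|lborel. (u y \<bullet> z) * mollifier_grad a (?w s) y * ((y - ?w s) \<bullet> z))" for s
  \<comment> \<open>One box contains the supports for all s, so that the differentiation under the
    integral takes place over a fixed compact domain.\<close>
  have "bounded (\<Union>s\<in>{0..t}. cball (?w s) (1 / a))"
  proof (rule boundedI)
    fix y assume "y \<in> (\<Union>s\<in>{0..t}. cball (?w s) (1 / a))"
    then obtain s where s: "0 \<le> s" "s \<le> t" "dist (?w s) y \<le> 1 / a" by auto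
    have "norm y \<le> dist (?w s) y + norm x + s * norm z"
      by (smt (verit) dist_commute dist_norm norm_scaleR norm_triangle_ineq norm_triangle_sub real_norm_def s(1))
    also have "\<dots> \<le> 1 / a + norm x + t * 1"
      using s z t by (intro add_mono mult_mono) auto
    finally show "norm y \<le> 1 / a + norm x + t" by simp
  qed
  then obtain c d where cd: "(\<Union>s\<in>{0..t}. cball (?w s) (1 / a)) \<subseteq> cbox c d"
    using bounded_subset_cbox_symmetric by metis
  have box: "(LINT y|lborel. f y) = integral (cbox c d) f"
    if f: "continuous_on UNIV f" and z: "\<And>y. y \<notin> cball (?w s) (1 / a) \<Longrightarrow> f y = 0" and s: "s \<in> {0..t}" for f :: "real ^ 'n \<Rightarrow> real" and s
  proof -
    have "y \<notin> cball (?w s) (1 / a)" if "y \<notin> cbox c d" for y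
      using cd s that by blast
    then have "(LINT y|lborel. f y) = (LINT y|lborel. indicator (cbox c d) y *\<^sub>R f y)"
      using z by (intro Bochner_Integration.integral_cong) (auto simp: indicator_def)
    also have "\<dots> = integral (cbox c d) f"
      using borel_integrable_compact[OF compact_cbox continuous_on_subset[OF f subset_UNIV], of c d]
      by (subst set_borel_integral_eq_integral(2)[unfolded set_lebesgue_integral_def, symmetric])
         (auto simp: set_integrable_def indicator_def if_distrib cong: if_cong)
    finally show ?thesis .
  qed
  have z0: "mollifier a (?w s) y = 0" "mollifier_grad a (?w s) y = 0" if "y \<notin> cball (?w s) (1 / a)" for s y
    using mollifier_eq_0[OF a, of "?w s" y] that by auto
  have m_box: "m s = integral (cbox c d) (\<lambda>y. (u y \<bullet> z) * mollifier a (?w s) y)" if "s \<in> {0..t}" for s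
    unfolding m_def using that z0 u by (intro box[of _ s] continuous_intros) auto
  have m'_box: "m' s = integral (cbox c d) (\<lambda>y. - ((u y \<bullet> z) * mollifier_grad a (?w s) y * ((y - ?w s) \<bullet> z)))" if "s \<in> {0..t}" for s
    unfolding m'_def integral_minus[symmetric] Bochner_Integration.integral_minus[symmetric]
    using that z0 u by (intro box[of _ s] continuous_intros) auto
  have cont: "continuous_on ({0..t} \<times> cbox c d) (\<lambda>(s, y). - ((u y \<bullet> z) * mollifier_grad a (?w s) y * ((y - ?w s) \<bullet> z)))"
    unfolding case_prod_unfold
    by (intro continuous_intros continuous_on_compose2[OF u]) auto
  have deriv: "(m has_real_derivative m' s) (at s within {0..t})" if s: "s \<in> {0..t}" for s
  proof -
    have "((\<lambda>s. integral (cbox c d) (\<lambda>y. (u y \<bullet> z) * mollifier a (?w s) y)) has_vector_derivative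
       integral (cbox c d) (\<lambda>y. - ((u y \<bullet> z) * mollifier_grad a (?w s) y * ((y - ?w s) \<bullet> z)))) (at s within {0..t})"
    proof (rule leibniz_rule_vector_derivative[OF _ _ cont s])
      fix r y assume "r \<in> {0..t}"
      have "((\<lambda>s. mollifier a (?w s) y) has_derivative (\<lambda>h. mollifier_grad a (?w r) y * ((y - ?w r) \<bullet> (- (h *\<^sub>R z))))) (at r within {0..t})"
      proof -
        have eq: "mollifier a (?w s) y = mollifier a 0 (y - ?w s)" "mollifier_grad a (?w s) y = mollifier_grad a 0 (y - ?w s)" for s
          by (simp_all add: mollifier_def mollifier_grad_def)
        have "((\<lambda>s. y - ?w s) has_derivative (\<lambda>h. - (h *\<^sub>R z))) (at r within {0..t})"
          by (auto intro!: derivative_eq_intros)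
        from has_derivative_compose[OF this mollifier_has_derivative[of a 0]]
        show ?thesis unfolding eq by simp
      qed
      then have "((\<lambda>s. mollifier a (?w s) y) has_real_derivative - (mollifier_grad a (?w r) y * ((y - ?w r) \<bullet> z))) (at r within {0..t})"
        unfolding has_field_derivative_def by (rule has_derivative_eq_rhs) (auto simp: fun_eq_iff mult_ac)
      from DERIV_cmult[OF this, of "u y \<bullet> z"]
      show "((\<lambda>s. (u y \<bullet> z) * mollifier a (?w s) y) has_vector_derivative
        - ((u y \<bullet> z) * mollifier_grad a (?w r) y * ((y - ?w r) \<bullet> z))) (at r within {0..t})"
        by (simp add: has_real_derivative_iff_has_vector_derivative mult_ac)
    next
      fix r :: real assume "r \<in> {0..t}"
      show "(\<lambda>y. (u y \<bullet> z) * mollifier a (?w r) y) integrable_on cbox c d"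
        by (intro integrable_continuous continuous_intros continuous_on_subset[OF u]) auto
    qed auto
    then have "((\<lambda>s. integral (cbox c d) (\<lambda>y. (u y \<bullet> z) * mollifier a (?w s) y)) has_real_derivative m' s) (at s within {0..t})"
      using m'_box[OF s] by (simp add: has_real_derivative_iff_has_vector_derivative)
    then show ?thesis
      by (rule has_field_derivative_transform_within[OF _ zero_less_one s]) (use m_box in auto)
  qed
  have cont': "continuous_on {0..t} m'"
    using integral_continuous_on_param[OF cont] by (rule continuous_on_eq) (use m'_box in auto)
  have "has_bochner_integral lborel (\<lambda>s. indicator {0..t} s *\<^sub>R m' s) (m t - m 0)"
    using deriv cont' t
    by (intro has_bochner_integral_FTC_Icc) (auto simp: has_real_derivative_iff_has_vector_derivative)
  then have "ennreal (norm (m t - m 0)) \<le> (\<integral>\<^sup>+ s. ennreal (norm (indicator {0..t} s *\<^sub>R m' s)) \<partial>lborel)"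
    using integral_norm_bound_ennreal[of lborel "\<lambda>s. indicator {0..t} s *\<^sub>R m' s"]
    by (simp add: has_bochner_integral_iff)
  also have "\<dots> \<le> (\<integral>\<^sup>+ s. indicator {0..} s *
         (\<integral>\<^sup>+ y. ennreal (norm (G y)) * ennreal (mollifier a (?w s) y) \<partial>lebesgue_on \<Omega>) \<partial>lborel)"
  proof (rule nn_integral_mono)
    fix s
    show "ennreal (norm (indicator {0..t} s *\<^sub>R m' s)) \<le> indicator {0..} s *
         (\<integral>\<^sup>+ y. ennreal (norm (G y)) * ennreal (mollifier a (?w s) y) \<partial>lebesgue_on \<Omega>)"
      using has_sym_grad_test_direction[OF assms(1) u G a seg z, of s]
      by (cases "s \<in> {0..t}") (auto simp: m'_def)
  qed
  finally show ?thesis by (simp add: m_def)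
qed

section \<open>Kernel estimates\<close>

text \<open>The kernel of the potential of order one, up to normalisation. \<open>powr\<close> gives
  it the value 0 at the origin, so estimates from above by the kernel at a point y - x are made for
  y \<noteq> x or almost everywhere.\<close>

definition riesz_kernel :: "'a::euclidean_space \<Rightarrow> ennreal" where
  "riesz_kernel w = ennreal (norm w powr (1 - real DIM('a)))"

lemma borel_measurable_riesz_kernel [measurable]: "riesz_kernel \<in> borel_measurable borel"
  unfolding riesz_kernel_def[abs_def] by measurable

lemma riesz_kernel_minus_commute: "riesz_kernel (x - y) = riesz_kernel (y - x)"
  by (simp add: riesz_kernel_def norm_minus_commute)

lemma AE_lborel_neq: "AE y in lborel. y \<noteq> (x :: 'a::euclidean_space)"
  by (rule AE_I[of _ _ "{x}"]) auto

lemma nn_integral_power_tail: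
  fixes n :: nat
  assumes "n \<ge> 2" "r > 0"
  shows "(\<integral>\<^sup>+ s. indicator {r..} s * ennreal (1 / s ^ n) \<partial>lborel) \<le> ennreal (1 / (real n - 1) * r powr (1 - real n))"
proof -
  let ?F = "\<lambda>s. - (s powr (1 - real n) / (real n - 1))"
  have "(\<integral>\<^sup>+ s. ennreal (s powr (- real n)) * indicator {r..} s \<partial>lborel) = ennreal (0 - ?F r)"
  proof (rule nn_integral_FTC_atLeast)
    fix s assume "r \<le> s"
    then have "((\<lambda>s. s powr (1 - real n)) has_real_derivative (1 - real n) * s powr (1 - real n - 1)) (at s)"
      using assms by (intro has_real_derivative_powr) auto
    from DERIV_minus[OF DERIV_cdivide[OF this, of "real n - 1"]]
    have "(?F has_real_derivative - ((1 - real n) * s powr (1 - real n - 1) / (real n - 1))) (at s)" .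
    moreover have "- ((1 - real n) * s powr (1 - real n - 1) / (real n - 1)) = s powr (- real n)"
      using assms by (simp add: field_simps)
    ultimately show "(?F has_real_derivative s powr (- real n)) (at s)" by simp
  next
    have "((\<lambda>s::real. s powr (1 - real n)) \<longlongrightarrow> 0) at_top"
      using assms by (intro tendsto_neg_powr filterlim_ident) auto
    then have "(?F \<longlongrightarrow> - (0 / (real n - 1))) at_top"
      using assms by (intro tendsto_intros) auto
    then show "(?F \<longlongrightarrow> 0) at_top" by simp
  qed auto
  moreover have "(\<integral>\<^sup>+ s. indicator {r..} s * ennreal (1 / s ^ n) \<partial>lborel) =
      (\<integral>\<^sup>+ s. ennreal (s powr (- real n)) * indicator {r..} s \<partial>lborel)"
    using assms by (intro nn_integral_cong) (auto simp: indicator_def powr_minus powr_realpow field_simps)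
  ultimately show ?thesis by simp
qed

text \<open>For fixed s the substitution y = x + s z has Jacobian s^n and maps the unit ball onto
  the ball of radius s about x. Exchanging the integrals leaves the integral of s^(-n) over s \<ge>
  |y - x|, which is the kernel divided by n - 1.\<close>

lemma nn_integral_rays_eq_riesz:
  fixes f :: "'a::euclidean_space \<Rightarrow> ennreal"
  assumes [measurable]: "f \<in> borel_measurable borel" and dim: "DIM('a) \<ge> 2"
  shows "(\<integral>\<^sup>+ z. indicator (ball 0 1) z * (\<integral>\<^sup>+ s. indicator {0..} s * f (x + s *\<^sub>R z) \<partial>lborel) \<partial>lborel)
    \<le> ennreal (1 / (real DIM('a) - 1)) * (\<integral>\<^sup>+ y. riesz_kernel (y - x) * f y \<partial>lborel)"
proof -
  let ?n = "DIM('a)"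
  have [measurable]: "ball (0::'a) 1 \<in> sets borel" by simp
  have [measurable]: "(\<lambda>p. f (x + snd p *\<^sub>R fst p)) \<in> borel_measurable (borel \<Otimes>\<^sub>M borel)"
    "(\<lambda>p. f (x + fst p *\<^sub>R snd p)) \<in> borel_measurable (borel \<Otimes>\<^sub>M borel)"
    by measurable
  have "(\<integral>\<^sup>+ z. indicator (ball 0 1) z * (\<integral>\<^sup>+ s. indicator {0..} s * f (x + s *\<^sub>R z) \<partial>lborel) \<partial>lborel)
     = (\<integral>\<^sup>+ z. \<integral>\<^sup>+ s. indicator (ball 0 1) z * (indicator {0..} s * f (x + s *\<^sub>R z)) \<partial>lborel \<partial>(lborel::'a measure))"
    by (subst nn_integral_cmult[symmetric]) auto
  also have "\<dots> = (\<integral>\<^sup>+ s. \<integral>\<^sup>+ z. indicator (ball 0 1) z * (indicator {0..} s * f (x + s *\<^sub>R z)) \<partial>lborel \<partial>lborel)"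
    by (rule lborel_pair.Fubini', subst measurable_cong_sets[OF sets_pair_measure_cong[OF sets_lborel sets_lborel] refl])
       (unfold case_prod_unfold, measurable)
  also have "\<dots> \<le> (\<integral>\<^sup>+ s. \<integral>\<^sup>+ y. indicator {dist x y..} s * ennreal (1 / s ^ ?n) * f y \<partial>lborel \<partial>lborel)"
  proof (rule nn_integral_mono_AE)
    show "AE s in lborel. (\<integral>\<^sup>+ z. indicator (ball 0 1) z * (indicator {0..} s * f (x + s *\<^sub>R z)) \<partial>lborel)
       \<le> (\<integral>\<^sup>+ y. indicator {dist x y..} s * ennreal (1 / s ^ ?n) * f y \<partial>lborel)"
      using AE_lborel_neq[of 0]
    proof eventually_elim
      fix s :: real assume "s \<noteq> 0"
      show "(\<integral>\<^sup>+ z. indicator (ball 0 1) z * (indicator {0..} s * f (x + s *\<^sub>R z)) \<partial>lborel)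
       \<le> (\<integral>\<^sup>+ y. indicator {dist x y..} s * ennreal (1 / s ^ ?n) * f y \<partial>lborel)"
      proof (cases "s > 0")
        case True
        have "(\<integral>\<^sup>+ y. indicator {dist x y..} s * ennreal (1 / s ^ ?n) * f y \<partial>lborel)
          = (\<integral>\<^sup>+ z. ennreal (s ^ ?n) * (indicator {dist x (x + s *\<^sub>R z)..} s * ennreal (1 / s ^ ?n) * f (x + s *\<^sub>R z)) \<partial>lborel)"
        proof -
          have [measurable]: "(\<lambda>y. indicator {dist x y..} s :: ennreal) \<in> borel_measurable borel"
            unfolding indicator_def atLeast_iff by measurable
          show ?thesis
            using True by (subst lborel_affine[of s x]) (simp_all add: nn_integral_density nn_integral_distr)
        qed
        also have "\<dots> \<ge> (\<integral>\<^sup>+ z. indicator (ball 0 1) z * (indicator {0..} s * f (x + s *\<^sub>R z)) \<partial>lborel)"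
        proof (rule nn_integral_mono)
          fix z :: 'a
          have "ennreal (s ^ ?n) * ennreal (1 / s ^ ?n) = 1"
            using True by (simp add: ennreal_mult[symmetric])
          then have "ennreal (s ^ ?n) * (indicator {dist x (x + s *\<^sub>R z)..} s * ennreal (1 / s ^ ?n) * f (x + s *\<^sub>R z))
             = indicator {dist x (x + s *\<^sub>R z)..} s * f (x + s *\<^sub>R z)"
            by (simp add: indicator_def mult.assoc[symmetric])
          moreover have "dist x (x + s *\<^sub>R z) \<le> s" if "norm z < 1"
            using that True by (simp add: dist_norm mult_le_cancel_left2)
          ultimately show "indicator (ball 0 1) z * (indicator {0..} s * f (x + s *\<^sub>R z)) \<le>
             ennreal (s ^ ?n) * (indicator {dist x (x + s *\<^sub>R z)..} s * ennreal (1 / s ^ ?n) * f (x + s *\<^sub>R z))"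
            using True by (auto simp: indicator_def)
        qed
        finally show ?thesis .
      qed (use \<open>s \<noteq> 0\<close> in auto)
    qed
  qed
  also have "\<dots> = (\<integral>\<^sup>+ y. \<integral>\<^sup>+ s. indicator {dist x y..} s * ennreal (1 / s ^ ?n) * f y \<partial>lborel \<partial>lborel)"
  proof (rule lborel_pair.Fubini')
    have "(\<lambda>p. (if dist x (fst p) \<le> snd p then 1 else 0) * ennreal (1 / snd p ^ ?n) * f (fst p)) \<in> borel_measurable (borel \<Otimes>\<^sub>M borel)"
      by measurable
    then show "(\<lambda>(y, s). indicator {dist x y..} s * ennreal (1 / s ^ ?n) * f y) \<in> borel_measurable (lborel \<Otimes>\<^sub>M lborel)"
      by (subst measurable_cong_sets[OF sets_pair_measure_cong[OF sets_lborel sets_lborel] refl])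
         (simp add: case_prod_unfold indicator_def)
  qed
  also have "\<dots> \<le> (\<integral>\<^sup>+ y. ennreal (1 / (real ?n - 1)) * (riesz_kernel (y - x) * f y) \<partial>lborel)"
  proof (rule nn_integral_mono_AE)
    show "AE y in lborel. (\<integral>\<^sup>+ s. indicator {dist x y..} s * ennreal (1 / s ^ ?n) * f y \<partial>lborel)
       \<le> ennreal (1 / (real ?n - 1)) * (riesz_kernel (y - x) * f y)"
      using AE_lborel_neq[of x]
    proof eventually_elim
      fix y assume "y \<noteq> x"
      then have "(\<integral>\<^sup>+ s. indicator {dist x y..} s * ennreal (1 / s ^ ?n) \<partial>lborel) \<le> ennreal (1 / (real ?n - 1) * dist x y powr (1 - real ?n))"
        using dim by (intro nn_integral_power_tail) auto
      also have "\<dots> = ennreal (1 / (real ?n - 1)) * riesz_kernel (y - x)"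
        using dim by (simp add: riesz_kernel_def ennreal_mult[symmetric] dist_norm norm_minus_commute)
      finally show "(\<integral>\<^sup>+ s. indicator {dist x y..} s * ennreal (1 / s ^ ?n) * f y \<partial>lborel)
       \<le> ennreal (1 / (real ?n - 1)) * (riesz_kernel (y - x) * f y)"
        by (subst nn_integral_multc) (auto simp: mult.assoc[symmetric] intro: mult_right_mono)
    qed
  qed
  also have "\<dots> = ennreal (1 / (real ?n - 1)) * (\<integral>\<^sup>+ y. riesz_kernel (y - x) * f y \<partial>lborel)"
    by (rule nn_integral_cmult) measurable
  finally show ?thesis .
qed

lemma ennreal_le_suminf: "f i \<le> (\<Sum>i. f i :: ennreal)"
  using ennreal_suminf_lessD[of f "f i" i] by (meson not_le order.irrefl)

text \<open>For 0 < d < R one summand suffices, that of the dyadic annulus containing d; for d \<ge>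
  R the first term does. At d = 0 the left side is 0 by the convention for
  \<open>powr\<close>.\<close>

lemma powr_kernel_dyadic_le:
  fixes \<beta> R d :: real
  assumes "\<beta> > 0" "R > 0" "d \<ge> 0"
  shows "ennreal (d powr (- \<beta>)) \<le> ennreal (R powr (- \<beta>)) +
    (\<Sum>j. ennreal ((R / 2 ^ Suc j) powr (- \<beta>)) * indicator {..<R / 2 ^ j} d)"
proof (cases "d = 0 \<or> d \<ge> R")
  case True
  then have "d powr (- \<beta>) \<le> R powr (- \<beta>)"
    using assms by (cases "d = 0") (auto intro!: powr_mono2')
  then show ?thesis by (simp add: add_increasing2 ennreal_leI)
next
  case False
  then have d: "0 < d" "d < R" using assms by auto
  define P where "P j \<longleftrightarrow> R / 2 ^ Suc j \<le> d" for j
  obtain k where "R / d < 2 ^ k" using real_arch_pow[of 2 "R / d"] by auto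
  then have "P k" using d by (simp add: P_def field_simps)
  define j where "j = (LEAST j. P j)"
  have Pj: "P j" unfolding j_def using \<open>P k\<close> by (rule LeastI)
  have "d < R / 2 ^ j"
  proof (cases j)
    case (Suc i)
    then have "\<not> P i" using not_less_Least[of i P] by (simp add: j_def[symmetric])
    then show ?thesis using Suc by (simp add: P_def)
  qed (use d in simp)
  have "ennreal (d powr (- \<beta>)) \<le> ennreal ((R / 2 ^ Suc j) powr (- \<beta>)) * indicator {..<R / 2 ^ j} d"
    using Pj assms \<open>d < R / 2 ^ j\<close> by (auto simp: P_def intro!: ennreal_leI powr_mono2')
  also have "\<dots> \<le> (\<Sum>j. ennreal ((R / 2 ^ Suc j) powr (- \<beta>)) * indicator {..<R / 2 ^ j} d)"
    by (rule ennreal_le_suminf)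
  finally show ?thesis by (simp add: add_increasing)
qed

text \<open>With m the measure of E, the radius R = m^(1/\<alpha>) balances two bounds. Beyond R the
  kernel is at most R^(-\<beta>) and contributes at most R^(-\<beta>) m; the dyadic balls up to R
  give a geometric series of ratio 2^(\<beta> - \<alpha>) < 1 with sum of order R^(\<alpha> -
  \<beta>). Both are multiples of m^(1 - \<beta>/\<alpha>). Applied to Lebesgue measure and to
  \<mu>.\<close>

lemma nn_integral_kernel_frostman:
  fixes M :: "'a::euclidean_space measure" and y :: 'a
  assumes meas [measurable]: "(\<lambda>x. x) \<in> measurable M borel"
    and ball: "\<And>r. r > 0 \<Longrightarrow> emeasure M {x \<in> space M. dist x y < r} \<le> ennreal (c * r powr \<alpha>)"
    and par: "0 < \<beta>" "\<beta> < \<alpha>" "c \<ge> 0"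
    and E [measurable]: "E \<in> sets M" "emeasure M E < \<infinity>"
  shows "(\<integral>\<^sup>+ x. indicator E x * ennreal (norm (x - y) powr (- \<beta>)) \<partial>M)
    \<le> ennreal ((1 + c * 2 powr \<beta> / (1 - 2 powr (\<beta> - \<alpha>))) * measure M E powr (1 - \<beta> / \<alpha>))"
proof (cases "measure M E = 0")
  case True
  then have "emeasure M E = 0" using E by (simp add: emeasure_eq_ennreal_measure)
  then have "AE x in M. x \<notin> E" using E(1) by (intro AE_not_in) (auto simp: null_sets_def)
  then have "(\<integral>\<^sup>+ x. indicator E x * ennreal (norm (x - y) powr (- \<beta>)) \<partial>M) = (\<integral>\<^sup>+ x. 0 \<partial>M)"
    by (intro nn_integral_cong_AE) auto
  then show ?thesis using True by simp
next
  case False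
  define m where "m = measure M E"
  have m: "m > 0" using False by (simp add: m_def less_le)
  define R where "R = m powr (1 / \<alpha>)"
  have R: "R > 0" using m by (simp add: R_def)
  have \<alpha>: "\<alpha> > 0" using par by simp
  define q where "q = 2 powr (\<beta> - \<alpha>)"
  have q: "0 < q" "q < 1" using par by (auto simp: q_def powr_less_one)
  have "(\<integral>\<^sup>+ x. indicator E x * ennreal (norm (x - y) powr (- \<beta>)) \<partial>M) \<le>
     (\<integral>\<^sup>+ x. ennreal (R powr (- \<beta>)) * indicator E x + (\<Sum>j. ennreal ((R / 2 ^ Suc j) powr (- \<beta>)) * indicator {x \<in> space M. dist x y < R / 2 ^ j} x) \<partial>M)"
  proof (rule nn_integral_mono)
    fix x assume x: "x \<in> space M"
    show "indicator E x * ennreal (norm (x - y) powr (- \<beta>)) \<le> ennreal (R powr (- \<beta>)) * indicator E x + (\<Sum>j. ennreal ((R / 2 ^ Suc j) powr (- \<beta>)) * indicator {x \<in> space M. dist x y < R / 2 ^ j} x)"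
    proof (cases "x \<in> E")
      case True
      have "indicator {..<R / 2 ^ j} (norm (x - y)) = (indicator {x \<in> space M. dist x y < R / 2 ^ j} x :: ennreal)" for j
        using x by (auto simp: indicator_def dist_norm)
      then show ?thesis
        using True powr_kernel_dyadic_le[OF par(1) R, of "norm (x - y)"] by simp
    qed auto
  qed
  also have "\<dots> = ennreal (R powr (- \<beta>)) * emeasure M E +
      (\<Sum>j. ennreal ((R / 2 ^ Suc j) powr (- \<beta>)) * emeasure M {x \<in> space M. dist x y < R / 2 ^ j})"
    by (simp add: nn_integral_add nn_integral_suminf nn_integral_cmult_indicator)
  also have "\<dots> \<le> ennreal (R powr (- \<beta>)) * ennreal m + (\<Sum>j. ennreal (c * 2 powr \<beta> * R powr (\<alpha> - \<beta>) * q ^ j))"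
  proof (intro add_mono suminf_le)
    fix j
    have "ennreal ((R / 2 ^ Suc j) powr (- \<beta>)) * emeasure M {x \<in> space M. dist x y < R / 2 ^ j}
       \<le> ennreal ((R / 2 ^ Suc j) powr (- \<beta>)) * ennreal (c * (R / 2 ^ j) powr \<alpha>)"
      using R by (intro mult_left_mono ball) auto
    also have "\<dots> = ennreal (c * 2 powr \<beta> * R powr (\<alpha> - \<beta>) * q ^ j)"
    proof -
      have "(R / 2 ^ Suc j) powr (- \<beta>) * (c * (R / 2 ^ j) powr \<alpha>) = c * 2 powr \<beta> * R powr (\<alpha> - \<beta>) * q ^ j"
      proof -
        have e1: "(R / 2 ^ Suc j) = R * 2 powr (- real (Suc j))" "(R / 2 ^ j) = R * 2 powr (- real j)"
          by (simp_all only: powr_minus powr_realpow divide_inverse)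
        have e2: "q ^ j = 2 powr ((\<beta> - \<alpha>) * real j)"
          by (simp add: q_def powr_powr[symmetric] powr_realpow)
        have "(R / 2 ^ Suc j) powr (- \<beta>) * (c * (R / 2 ^ j) powr \<alpha>) =
          c * (R powr (- \<beta>) * R powr \<alpha>) * (2 powr (real (Suc j) * \<beta>) * 2 powr (- real j * \<alpha>))"
          unfolding e1 using R by (simp add: powr_mult powr_powr) (simp add: algebra_simps)
        also have "\<dots> = c * R powr (\<alpha> - \<beta>) * (2 powr (\<beta> + (\<beta> - \<alpha>) * real j))"
          unfolding powr_add[symmetric] by (simp add: algebra_simps)
        finally show ?thesis unfolding e2 by (simp add: powr_add mult_ac)
      qed
      moreover have "ennreal ((R / 2 ^ Suc j) powr (- \<beta>)) * ennreal (c * (R / 2 ^ j) powr \<alpha>) =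
          ennreal ((R / 2 ^ Suc j) powr (- \<beta>) * (c * (R / 2 ^ j) powr \<alpha>))"
        using par by (intro ennreal_mult[symmetric]) auto
      ultimately show ?thesis by (simp only:)
    qed
    finally show "ennreal ((R / 2 ^ Suc j) powr (- \<beta>)) * emeasure M {x \<in> space M. dist x y < R / 2 ^ j} \<le>
       ennreal (c * 2 powr \<beta> * R powr (\<alpha> - \<beta>) * q ^ j)" .
  qed (use E in \<open>auto simp: m_def emeasure_eq_ennreal_measure\<close>)
  also have "(\<Sum>j. ennreal (c * 2 powr \<beta> * R powr (\<alpha> - \<beta>) * q ^ j)) = ennreal (c * 2 powr \<beta> * R powr (\<alpha> - \<beta>) * (1 / (1 - q)))"
    using par q by (intro suminf_ennreal_eq sums_mult geometric_sums) auto
  also have "ennreal (R powr (- \<beta>)) * ennreal m = ennreal (m powr (1 - \<beta> / \<alpha>))"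
    using m by (simp add: R_def ennreal_mult[symmetric] powr_powr powr_diff powr_minus field_simps)
  also have "R powr (\<alpha> - \<beta>) = m powr (1 - \<beta> / \<alpha>)"
    using \<alpha> by (simp add: R_def powr_powr diff_divide_distrib)
  also have "ennreal (m powr (1 - \<beta> / \<alpha>)) + ennreal (c * 2 powr \<beta> * m powr (1 - \<beta> / \<alpha>) * (1 / (1 - q))) =
     ennreal ((1 + c * 2 powr \<beta> / (1 - q)) * m powr (1 - \<beta> / \<alpha>))"
    using par q by (simp add: ennreal_plus[symmetric] algebra_simps del: ennreal_plus)
  finally show ?thesis unfolding m_def q_def .
qed

lemma nn_integral_riesz_le_emeasure:
  fixes F :: "'a::euclidean_space set"
  assumes "DIM('a) \<ge> 2"
  shows "\<exists>C>0. \<forall>(F :: 'a set) y. F \<in> sets borel \<and> emeasure lborel F < \<infinity> \<longrightarrow>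
    (\<integral>\<^sup>+ x. indicator F x * riesz_kernel (x - y) \<partial>lborel) \<le> ennreal (C * measure lborel F powr (1 / real DIM('a)))"
proof -
  let ?n = "real DIM('a)"
  let ?C = "1 + unit_ball_vol ?n * 2 powr (?n - 1) / (1 - 2 powr ((?n - 1) - ?n))"
  have "?C > 0" by (simp add: add_pos_nonneg powr_minus)
  moreover have "(\<integral>\<^sup>+ x. indicator F x * riesz_kernel (x - y) \<partial>lborel) \<le> ennreal (?C * measure lborel F powr (1 / ?n))"
    if "F \<in> sets borel" "emeasure lborel F < \<infinity>" for F and y :: 'a
  proof -
    have "(\<integral>\<^sup>+ x. indicator F x * ennreal (norm (x - y) powr (- (?n - 1))) \<partial>lborel)
      \<le> ennreal (?C * measure lborel F powr (1 - (?n - 1) / ?n))"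
    proof (rule nn_integral_kernel_frostman)
      fix r :: real assume "r > 0"
      moreover have "{x \<in> space lborel. dist x y < r} = ball y r" by (auto simp: dist_commute)
      ultimately show "emeasure lborel {x \<in> space lborel. dist x y < r} \<le> ennreal (unit_ball_vol ?n * r powr ?n)"
        by (simp add: emeasure_ball powr_realpow)
    qed (use that assms in auto)
    then show ?thesis by (simp add: riesz_kernel_def diff_divide_distrib)
  qed
  ultimately show ?thesis by blast
qed

text \<open>If x is at least 2r away from y, the kernel is comparable to its value at y throughout
  the ball. Otherwise the integral is at most a constant times r, and r \<le> 2^(n-1) r^n |y -
  x|^(1-n) because |y - x| < 2r. The constant does not depend on r, which makes the mollification
  harmless at every scale.\<close>

lemma nn_integral_riesz_ball_le:
  assumes "DIM('a::euclidean_space) \<ge> 2"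
  shows "\<exists>C>0. \<forall>(x::'a) y r. r > 0 \<and> y \<noteq> x \<longrightarrow>
    (\<integral>\<^sup>+ w. indicator (ball y r) w * riesz_kernel (w - x) \<partial>lborel) \<le> ennreal (C * r ^ DIM('a)) * riesz_kernel (y - x)"
proof -
  let ?n = "real DIM('a)"
  obtain C where C: "C > 0" "\<And>(F :: 'a set) y. F \<in> sets borel \<Longrightarrow> emeasure lborel F < \<infinity> \<Longrightarrow>
    (\<integral>\<^sup>+ x. indicator F x * riesz_kernel (x - y) \<partial>lborel) \<le> ennreal (C * measure lborel F powr (1 / ?n))"
    using nn_integral_riesz_le_emeasure[OF assms] by blast
  define C' where "C' = max (unit_ball_vol ?n) (C * unit_ball_vol ?n powr (1 / ?n)) * 2 powr (?n - 1)"
  have ub: "unit_ball_vol ?n > 0" by simp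
  have "C' > 0" using ub by (simp add: C'_def less_max_iff_disj)
  moreover have "(\<integral>\<^sup>+ w. indicator (ball y r) w * riesz_kernel (w - x) \<partial>lborel) \<le> ennreal (C' * r ^ DIM('a)) * riesz_kernel (y - x)"
    if r: "r > 0" and yx: "y \<noteq> x" for x y :: 'a and r
  proof -
    have rhs: "ennreal (C' * r ^ DIM('a)) * riesz_kernel (y - x) = ennreal (C' * r ^ DIM('a) * norm (y - x) powr (1 - ?n))"
      using r \<open>C' > 0\<close> by (simp add: riesz_kernel_def ennreal_mult)
    show ?thesis
    proof (cases "norm (y - x) \<ge> 2 * r")
      case True
      have "(\<integral>\<^sup>+ w. indicator (ball y r) w * riesz_kernel (w - x) \<partial>lborel) \<le>
        (\<integral>\<^sup>+ w. ennreal (2 powr (?n - 1) * norm (y - x) powr (1 - ?n)) * indicator (ball y r) w \<partial>lborel)"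
      proof (rule nn_integral_mono)
        fix w
        show "indicator (ball y r) w * riesz_kernel (w - x) \<le> ennreal (2 powr (?n - 1) * norm (y - x) powr (1 - ?n)) * indicator (ball y r) w"
        proof (cases "w \<in> ball y r")
          case w: True
          have "norm (y - x) \<le> dist y w + norm (w - x)"
            by (metis dist_norm dist_triangle)
          then have "norm (y - x) / 2 \<le> norm (w - x)" using w True by auto
          then have "norm (w - x) powr (1 - ?n) \<le> (norm (y - x) / 2) powr (1 - ?n)"
            using assms yx by (intro powr_mono2') auto
          also have "\<dots> = 2 powr (?n - 1) * norm (y - x) powr (1 - ?n)"
            using powr_minus[of 2 "?n - 1"] by (simp add: powr_divide field_simps)
          finally show ?thesis using w by (simp add: riesz_kernel_def ennreal_leI)
        qed auto
      qed
      also have "\<dots> = ennreal (2 powr (?n - 1) * norm (y - x) powr (1 - ?n)) * ennreal (unit_ball_vol ?n * r ^ DIM('a))"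
        using r by (subst nn_integral_cmult_indicator) (simp_all add: emeasure_ball)
      also have "\<dots> = ennreal ((2 powr (?n - 1) * norm (y - x) powr (1 - ?n)) * (unit_ball_vol ?n * r ^ DIM('a)))"
        using r by (simp add: ennreal_mult[symmetric])
      also have "\<dots> \<le> ennreal (C' * r ^ DIM('a) * norm (y - x) powr (1 - ?n))"
      proof (rule ennreal_leI)
        have "2 powr (?n - 1) * unit_ball_vol ?n \<le> C'" by (simp add: C'_def mult.commute)
        then have "(2 powr (?n - 1) * unit_ball_vol ?n) * (r ^ DIM('a) * norm (y - x) powr (1 - ?n)) \<le> C' * (r ^ DIM('a) * norm (y - x) powr (1 - ?n))"
          using r by (intro mult_right_mono) auto
        then show "(2 powr (?n - 1) * norm (y - x) powr (1 - ?n)) * (unit_ball_vol ?n * r ^ DIM('a)) \<le> C' * r ^ DIM('a) * norm (y - x) powr (1 - ?n)"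
          by (simp add: mult_ac)
      qed
      finally show ?thesis unfolding rhs .
    next
      case False
      have "(\<integral>\<^sup>+ w. indicator (ball y r) w * riesz_kernel (w - x) \<partial>lborel) \<le> ennreal (C * measure lborel (ball y r) powr (1 / ?n))"
        by (rule C(2)) (auto simp: emeasure_ball r less_imp_le)
      also have "\<dots> \<le> ennreal (C' * r ^ DIM('a) * norm (y - x) powr (1 - ?n))"
      proof (rule ennreal_leI)
        have "measure lborel (ball y r) = unit_ball_vol ?n * r powr ?n"
          using r content_ball[of r y] by (simp add: powr_realpow)
        then have "C * measure lborel (ball y r) powr (1 / ?n) = C * unit_ball_vol ?n powr (1 / ?n) * r"
          using r by (simp add: powr_mult powr_powr)
        also have "\<dots> = C * unit_ball_vol ?n powr (1 / ?n) * (2 powr (?n - 1) * r powr ?n * (2 * r) powr (1 - ?n))"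
        proof -
          have "2 powr (?n - 1) * r powr ?n * (2 * r) powr (1 - ?n) = (2 powr (?n - 1) * 2 powr (1 - ?n)) * (r powr ?n * r powr (1 - ?n))"
            using r by (simp add: powr_mult)
          also have "\<dots> = r" using r by (simp add: powr_add[symmetric])
          finally show ?thesis by simp
        qed
        also have "\<dots> \<le> C * unit_ball_vol ?n powr (1 / ?n) * (2 powr (?n - 1) * r powr ?n * norm (y - x) powr (1 - ?n))"
          using False r yx assms C(1) by (intro mult_left_mono powr_mono2') auto
        also have "\<dots> = (C * unit_ball_vol ?n powr (1 / ?n) * 2 powr (?n - 1)) * (r powr ?n * norm (y - x) powr (1 - ?n))"
          by (simp add: mult_ac)
        also have "\<dots> \<le> C' * (r powr ?n * norm (y - x) powr (1 - ?n))"
          unfolding C'_def by (intro mult_right_mono) auto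
        finally show "C * measure lborel (ball y r) powr (1 / ?n) \<le> C' * r ^ DIM('a) * norm (y - x) powr (1 - ?n)"
          using r by (simp add: powr_realpow mult_ac)
      qed
      finally show ?thesis unfolding rhs .
    qed
  qed
  ultimately show ?thesis by blast
qed

section \<open>Directions in which a ball is seen from a point\<close>

definition ray_tube :: "'a::euclidean_space \<Rightarrow> 'a \<Rightarrow> real \<Rightarrow> 'a set" where
  "ray_tube x y d = {z \<in> ball 0 1. \<exists>t>0. dist (x + t *\<^sub>R z) y < d}"

lemma borel_ray_tube [measurable]: "ray_tube x y d \<in> sets borel"
proof -
  have "ray_tube x y d = ball 0 1 \<inter> (\<Union>t\<in>{0<..}. {z. dist (x + t *\<^sub>R z) y < d})"
    by (auto simp: ray_tube_def)
  moreover have "open \<dots>"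
    by (intro open_Int open_ball open_UN ballI open_Collect_less continuous_intros)
  ultimately show ?thesis by simp
qed

text \<open>Let r = |x - y|, let e be the unit vector from x towards y, and \<delta> = 2d/r. If
  \<delta> \<ge> 1, the volume of the unit ball is bound enough. If \<delta> < 1, a ray hitting the
  ball at parameter t has t \<ge> r/2, so z is within \<delta> of the point (r/t) e of the segment
  from 0 to 2e. At most 4/\<delta> balls of radius 2\<delta> cover the \<delta>-neighbourhood of
  this segment, and their volumes add up to a multiple of \<delta>^(n-1).\<close>

lemma emeasure_ray_tube_le:
  assumes "DIM('a::euclidean_space) \<ge> 2"
  shows "\<exists>C>0. \<forall>(x::'a) y d. d > 0 \<and> y \<noteq> x \<longrightarrow>
    emeasure lborel (ray_tube x y d) \<le> ennreal (C * d powr (real DIM('a) - 1)) * riesz_kernel (x - y)"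
proof -
  let ?n = "real DIM('a)"
  let ?b = "unit_ball_vol ?n"
  define C where "C = ?b * 2 powr (?n - 1) * 4 * 2 powr ?n"
  have b: "?b > 0" by simp
  then have "C > 0" by (simp add: C_def)
  moreover have "emeasure lborel (ray_tube x y d) \<le> ennreal (C * d powr (?n - 1)) * riesz_kernel (x - y)"
    if d: "d > 0" and yx: "y \<noteq> x" for x y :: 'a and d
  proof -
    define r where "r = norm (x - y)"
    have r: "r > 0" using yx by (simp add: r_def)
    define \<delta> where "\<delta> = 2 * d / r"
    have \<delta>: "\<delta> > 0" using r d by (simp add: \<delta>_def)
    have rhs: "ennreal (C * d powr (?n - 1)) * riesz_kernel (x - y) = ennreal (?b * 4 * 2 powr ?n * \<delta> powr (?n - 1))"
    proof -
      have "C * d powr (?n - 1) * r powr (1 - ?n) = ?b * 4 * 2 powr ?n * \<delta> powr (?n - 1)"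
        using r d powr_minus[of r "?n - 1"] by (simp add: C_def \<delta>_def powr_mult powr_divide field_simps)
      moreover have "ennreal (C * d powr (?n - 1)) * riesz_kernel (x - y) = ennreal (C * d powr (?n - 1) * r powr (1 - ?n))"
        using \<open>C > 0\<close> by (simp add: riesz_kernel_def ennreal_mult r_def)
      ultimately show ?thesis by simp
    qed
    show ?thesis
    proof (cases "\<delta> < 1")
      case False
      have "emeasure lborel (ray_tube x y d) \<le> emeasure lborel (ball (0::'a) 1)"
        by (rule emeasure_mono) (auto simp: ray_tube_def)
      also have "\<dots> = ennreal ?b" by (simp add: emeasure_ball)
      also have "\<dots> \<le> ennreal (?b * 4 * 2 powr ?n * \<delta> powr (?n - 1))"
      proof (rule ennreal_leI)
        have "1 * 1 \<le> (4 * 2 powr ?n) * \<delta> powr (?n - 1)"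
          using False assms ge_one_powr_ge_zero[of \<delta> "?n - 1"] ge_one_powr_ge_zero[of 2 ?n]
          by (intro mult_mono) auto
        then show "?b \<le> ?b * 4 * 2 powr ?n * \<delta> powr (?n - 1)"
          using b by (simp add: mult.assoc)
      qed
      finally show ?thesis unfolding rhs .
    next
      case True
      define e where "e = (1 / r) *\<^sub>R (y - x)"
      have e: "norm e = 1" using r by (simp add: e_def r_def norm_minus_commute)
      define N where "N = nat \<lceil>2 / \<delta>\<rceil>"
      have sub: "ray_tube x y d \<subseteq> (\<Union>j\<in>{..N}. cball ((real j * \<delta>) *\<^sub>R e) (2 * \<delta>))"
      proof
        fix z assume "z \<in> ray_tube x y d"
        then obtain t where z: "norm z < 1" and t: "t > 0" "dist (x + t *\<^sub>R z) y < d"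
          by (auto simp: ray_tube_def)
        have "r \<le> norm (t *\<^sub>R z) + dist (x + t *\<^sub>R z) y"
          unfolding r_def dist_norm
          using norm_triangle_ineq4[of "x + t *\<^sub>R z - y" "t *\<^sub>R z"] by (simp add: algebra_simps)
        also have "\<dots> \<le> t * 1 + d" using t z by (intro add_mono) auto
        finally have tr: "r \<le> t + d" by simp
        moreover have "d < r / 2" using True r by (simp add: \<delta>_def field_simps)
        ultimately have t2: "t \<ge> r / 2" by simp
        define s where "s = r / t"
        have s: "0 \<le> s" "s \<le> 2" using t2 r t by (auto simp: s_def field_simps)
        have "z - s *\<^sub>R e = (1 / t) *\<^sub>R (x + t *\<^sub>R z - y)"
          using r t by (simp add: s_def e_def algebra_simps)
        then have "norm (z - s *\<^sub>R e) = dist (x + t *\<^sub>R z) y / t" using t by (simp add: dist_norm)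
        also have "\<dots> \<le> d / (r / 2)" using t t2 r d by (intro frac_le) auto
        finally have zs: "norm (z - s *\<^sub>R e) \<le> \<delta>" by (simp add: \<delta>_def mult.commute)
        define j where "j = nat \<lfloor>s / \<delta>\<rfloor>"
        have jn: "real j = of_int \<lfloor>s / \<delta>\<rfloor>" using s \<delta> by (simp add: j_def)
        then have "real j \<le> s / \<delta>" "s / \<delta> < real j + 1" by linarith+
        then have "\<bar>s - real j * \<delta>\<bar> \<le> \<delta>" using \<delta> by (simp add: field_simps abs_le_iff)
        then have "norm (s *\<^sub>R e - (real j * \<delta>) *\<^sub>R e) \<le> \<delta>"
          using e by (simp add: scaleR_left_diff_distrib[symmetric])
        then have "norm (z - (real j * \<delta>) *\<^sub>R e) \<le> 2 * \<delta>"
          using zs norm_triangle_ineq[of "z - s *\<^sub>R e" "s *\<^sub>R e - (real j * \<delta>) *\<^sub>R e"] by simp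
        moreover have "j \<le> N"
        proof -
          have "s / \<delta> \<le> 2 / \<delta>" using s \<delta> by (simp add: divide_right_mono)
          then have "\<lfloor>s / \<delta>\<rfloor> \<le> \<lceil>2 / \<delta>\<rceil>" by linarith
          then show ?thesis by (simp add: j_def N_def nat_mono)
        qed
        ultimately show "z \<in> (\<Union>j\<in>{..N}. cball ((real j * \<delta>) *\<^sub>R e) (2 * \<delta>))"
          by (auto simp: dist_norm norm_minus_commute)
      qed
      have "emeasure lborel (ray_tube x y d) \<le> emeasure lborel (\<Union>j\<in>{..N}. cball ((real j * \<delta>) *\<^sub>R e) (2 * \<delta>))"
        using sub by (rule emeasure_mono) auto
      also have "\<dots> \<le> (\<Sum>j\<in>{..N}. emeasure lborel (cball ((real j * \<delta>) *\<^sub>R e) (2 * \<delta>)))"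
        by (rule emeasure_subadditive_finite) auto
      also have "\<dots> = ennreal (real (Suc N) * (?b * (2 * \<delta>) powr ?n))"
      proof -
        have "(\<Sum>j\<in>{..N}. emeasure lborel (cball ((real j * \<delta>) *\<^sub>R e) (2 * \<delta>))) =
            (\<Sum>j\<in>{..N}. ennreal (?b * (2 * \<delta>) powr ?n))"
          using \<delta> by (intro sum.cong) (simp_all add: emeasure_cball powr_realpow)
        also have "\<dots> = ennreal (\<Sum>j\<in>{..N}. ?b * (2 * \<delta>) powr ?n)"
          by (rule sum_ennreal) auto
        finally show ?thesis by simp
      qed
      also have "\<dots> \<le> ennreal (?b * 4 * 2 powr ?n * \<delta> powr (?n - 1))"
      proof (rule ennreal_leI)
        have "real N \<le> 2 / \<delta> + 1" using \<delta> by (simp add: N_def)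
        then have "real (Suc N) \<le> 4 / \<delta>" using \<delta> True by (simp add: field_simps)
        then have "real (Suc N) * (?b * (2 * \<delta>) powr ?n) \<le> 4 / \<delta> * (?b * (2 * \<delta>) powr ?n)"
          by (intro mult_right_mono) auto
        also have "\<dots> = ?b * 4 * 2 powr ?n * \<delta> powr (?n - 1)"
          using \<delta> by (simp add: powr_mult powr_diff)
        finally show "real (Suc N) * (?b * (2 * \<delta>) powr ?n) \<le> ?b * 4 * 2 powr ?n * \<delta> powr (?n - 1)" .
      qed
      finally show ?thesis unfolding rhs .
    qed
  qed
  ultimately show ?thesis by blast
qed

section \<open>Pointwise representation\<close>

lemma integrable_continuous_bounded_support:
  fixes f :: "'a::euclidean_space \<Rightarrow> real"
  assumes "continuous_on UNIV f" "\<And>y. y \<notin> cball w r \<Longrightarrow> f y = 0"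
  shows "integrable lborel f"
proof -
  have "integrable lborel (\<lambda>y. indicator (cball w r) y *\<^sub>R f y)"
    using borel_integrable_compact[OF compact_cball continuous_on_subset[OF assms(1) subset_UNIV], of w r]
    by (simp add: indicator_def if_distrib cong: if_cong)
  also have "(\<lambda>y. indicator (cball w r) y *\<^sub>R f y) = f"
    using assms(2) by (auto simp: fun_eq_iff indicator_def)
  finally show ?thesis .
qed

lemma integrable_mollifier:
  assumes "a > 0" "continuous_on UNIV g"
  shows "integrable lborel (\<lambda>y. g y * mollifier a w y)"
  using assms mollifier_eq_0[OF assms(1), of w]
  by (intro integrable_continuous_bounded_support[of _ w "1 / a"] continuous_intros) auto

definition mollifier_mass :: "'n::finite itself \<Rightarrow> real" where
  "mollifier_mass _ = (LINT y|lborel. mollifier 1 (0 :: real ^ 'n) y)"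

lemma mollifier_mass_pos: "mollifier_mass TYPE('n::finite) > 0"
proof -
  have "0 < exp (- 2) * measure lborel (ball (0 :: real ^ 'n) (1/2))"
    by (simp add: content_ball_pos)
  also have "\<dots> = (LINT y|lborel. exp (- 2) * indicator (ball (0 :: real ^ 'n) (1/2)) y)"
    by simp
  also have "\<dots> \<le> (LINT y|lborel. mollifier 1 (0 :: real ^ 'n) y)"
  proof (rule integral_mono)
    have "integrable lborel (indicator (ball (0 :: real ^ 'n) (1/2)) :: real ^ 'n \<Rightarrow> real)"
      by (rule integrable_real_indicator) (simp_all add: emeasure_ball)
    then show "integrable lborel (\<lambda>y. exp (- 2) * indicator (ball (0 :: real ^ 'n) (1/2)) y :: real)"
      by (rule integrable_mult_right)
    show "integrable lborel (mollifier 1 (0 :: real ^ 'n))"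
      using integrable_mollifier[of 1 "\<lambda>_. 1" 0] by simp
    fix y :: "real ^ 'n"
    show "exp (- 2) * indicator (ball 0 (1/2)) y \<le> mollifier 1 0 y"
      using mollifier_lower[of 1 0 y] by (auto simp: indicator_def)
  qed
  finally show ?thesis by (simp add: mollifier_mass_def)
qed

lemma integral_mollifier:
  fixes w :: "real ^ 'n::finite"
  assumes "a > 0"
  shows "(LINT y|lborel. mollifier a w y) = (1 / a) ^ CARD('n) * mollifier_mass TYPE('n)"
proof -
  have [measurable]: "mollifier a w \<in> borel_measurable borel" for a and w :: "real ^ 'n"
    by (intro borel_measurable_continuous_onI continuous_intros)
  have "mollifier a w (w + (1 / a) *\<^sub>R y) = mollifier 1 0 y" for y
    using assms by (simp add: mollifier_def power2_eq_square)
  note scale = this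
  have "(LINT y|lborel. mollifier a w y) =
     (LINT y|density (distr lborel borel (\<lambda>x. w + (1 / a) *\<^sub>R x)) (\<lambda>_. ennreal (\<bar>1 / a\<bar> ^ DIM(real ^ 'n))). mollifier a w y)"
    by (rule arg_cong[where f = "\<lambda>M. integral\<^sup>L M (mollifier a w)"], rule lborel_affine) (use assms in simp)
  also have "\<dots> = (LINT y|lborel. (1 / a) ^ CARD('n) * mollifier a w (w + (1 / a) *\<^sub>R y))"
    using assms by (simp add: integral_density integral_distr)
  finally show ?thesis by (simp add: scale mollifier_mass_def)
qed

lemma mollifier_approximation:
  fixes w :: "real ^ 'n::finite" and g :: "real ^ 'n \<Rightarrow> real"
  assumes g: "continuous_on UNIV g" and e: "e > 0"
  shows "\<exists>A>0. \<forall>a\<ge>A. \<bar>(LINT y|lborel. g y * mollifier a w y) - g w * (LINT y|lborel. mollifier a w y)\<bar>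
     \<le> e * (LINT y|lborel. mollifier a w y)"
proof -
  obtain d where d: "d > 0" "\<And>y. dist y w < d \<Longrightarrow> \<bar>g y - g w\<bar> < e"
    using g e by (auto simp: continuous_on_iff dist_real_def) (metis UNIV_I)
  have "\<bar>(LINT y|lborel. g y * mollifier a w y) - g w * (LINT y|lborel. mollifier a w y)\<bar>
     \<le> e * (LINT y|lborel. mollifier a w y)" if "a \<ge> 1 / d" for a
  proof -
    have "0 < 1 / d" using d(1) by simp
    then have "a > 0" using that by linarith
    then have a: "a > 0" "1 / a \<le> d" using that d(1) by (simp_all add: divide_le_eq mult.commute)
    have int: "integrable lborel (\<lambda>y. h y * mollifier a w y)" if "continuous_on UNIV h" for h
      using integrable_mollifier[OF a(1) that] .
    have "(LINT y|lborel. g y * mollifier a w y) - g w * (LINT y|lborel. mollifier a w y) =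
       (LINT y|lborel. (g y - g w) * mollifier a w y)"
      using int[OF g] int[of "\<lambda>_. 1"] by (simp add: left_diff_distrib)
    also have "\<bar>\<dots>\<bar> \<le> (LINT y|lborel. e * mollifier a w y)"
    proof (rule integral_abs_bound_integral)
      show "integrable lborel (\<lambda>y. (g y - g w) * mollifier a w y)" "integrable lborel (\<lambda>y. e * mollifier a w y)"
        using g by (intro int continuous_intros; simp)+
      fix y
      show "\<bar>(g y - g w) * mollifier a w y\<bar> \<le> e * mollifier a w y"
      proof (cases "dist w y \<ge> 1 / a")
        case False
        then have "\<bar>g y - g w\<bar> \<le> e" using d(2)[of y] a(2) by (simp add: dist_commute)
        then show ?thesis by (simp add: abs_mult mult_right_mono)
      qed (simp add: mollifier_eq_0(1)[OF a(1)])
    qed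
    finally show ?thesis by simp
  qed
  then show ?thesis using d(1) by (intro exI[of _ "1 / d"]) auto
qed

text \<open>The right side of \<open>mollified_ray_estimate\<close> at scale a = k + 1, divided by
  the mass of the mollifier.\<close>

definition mollified_ray ::
  "(real ^ 'n::finite) set \<Rightarrow> (real ^ 'n \<Rightarrow> real ^ 'n ^ 'n) \<Rightarrow> nat \<Rightarrow> real ^ 'n \<Rightarrow> real ^ 'n \<Rightarrow> ennreal" where
  "mollified_ray \<Omega> G k x z =
     ennreal (real (Suc k) ^ CARD('n) / mollifier_mass TYPE('n)) *
     (\<integral>\<^sup>+ s. indicator {0..} s *
         (\<integral>\<^sup>+ y. ennreal (norm (G y)) * ennreal (mollifier (real (Suc k)) (x + s *\<^sub>R z) y) \<partial>lebesgue_on \<Omega>) \<partial>lborel)"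

text \<open>The segment is compact, so from some k on the supports of the mollifiers along it stay
  in \<Omega>, and the mollified values at both ends are within e/2 of those of u \<bullet> z. The
  liminf is left as it stands, in the form to which Fatou's lemma applies.\<close>

lemma segment_estimate:
  fixes u :: "real ^ 'n::finite \<Rightarrow> real ^ 'n" and G :: "real ^ 'n \<Rightarrow> real ^ 'n ^ 'n"
  assumes "open \<Omega>" and u: "continuous_on UNIV u" and G: "has_sym_grad \<Omega> u G"
    and t: "t \<ge> 0" and z: "norm z \<le> 1"
    and seg: "\<And>s. s \<in> {0..t} \<Longrightarrow> x + s *\<^sub>R z \<in> \<Omega>"
  shows "ennreal \<bar>u x \<bullet> z\<bar> \<le> ennreal \<bar>u (x + t *\<^sub>R z) \<bullet> z\<bar> + liminf (\<lambda>k. mollified_ray \<Omega> G k x z)"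
proof (rule ennreal_le_epsilon)
  fix e :: real assume "e > 0"
  define d where "d = e / 2"
  have d: "d > 0" using \<open>e > 0\<close> by (simp add: d_def)
  let ?x = "x + t *\<^sub>R z"
  let ?I = "\<lambda>a w. (LINT y|lborel. mollifier a w y)"
  let ?J = "\<lambda>a w. (LINT y|lborel. (u y \<bullet> z) * mollifier a w y)"
  have uz: "continuous_on UNIV (\<lambda>y. u y \<bullet> z)" by (intro continuous_intros u)
  have "compact ((\<lambda>s. x + s *\<^sub>R z) ` {0..t})"
    by (intro compact_continuous_image continuous_intros) auto
  then obtain r where r: "r > 0" "(\<Union>y\<in>(\<lambda>s. x + s *\<^sub>R z) ` {0..t}. cball y r) \<subseteq> \<Omega>"
    using compact_subset_open_imp_cball_epsilon_subset[of "(\<lambda>s. x + s *\<^sub>R z) ` {0..t}" \<Omega>] seg \<open>open \<Omega>\<close> by blast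
  obtain A where A: "A > 0" "\<And>a. a \<ge> A \<Longrightarrow> \<bar>?J a x - (u x \<bullet> z) * ?I a x\<bar> \<le> d * ?I a x"
    using mollifier_approximation[OF uz d, of x] by blast
  obtain B where B: "B > 0" "\<And>a. a \<ge> B \<Longrightarrow> \<bar>?J a ?x - (u ?x \<bullet> z) * ?I a ?x\<bar> \<le> d * ?I a ?x"
    using mollifier_approximation[OF uz d, of ?x] by blast
  have "ennreal (\<bar>u x \<bullet> z\<bar> - \<bar>u ?x \<bullet> z\<bar> - e) \<le> liminf (\<lambda>k. mollified_ray \<Omega> G k x z)"
  proof (rule Liminf_bounded)
    obtain m where "real m \<ge> max (max A B) (1 / r)" using real_arch_simple by blast
    then have "\<forall>\<^sub>F k in sequentially. real (Suc k) \<ge> max (max A B) (1 / r)"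
      by (intro eventually_sequentiallyI[of m]) (simp add: order_trans)
    then show "\<forall>\<^sub>F k in sequentially. ennreal (\<bar>u x \<bullet> z\<bar> - \<bar>u ?x \<bullet> z\<bar> - e) \<le> mollified_ray \<Omega> G k x z"
    proof eventually_elim
      fix k
      assume k: "real (Suc k) \<ge> max (max A B) (1 / r)"
      define a where "a = real (Suc k)"
      have a: "a > 0" "a \<ge> A" "a \<ge> B" "1 / a \<le> r" using k r by (auto simp: a_def field_simps)
      define I where "I = (1 / a) ^ CARD('n) * mollifier_mass TYPE('n)"
      have I: "I > 0" using a mollifier_mass_pos[where 'n = 'n] by (simp add: I_def)
      have II: "?I a w = I" for w :: "real ^ 'n" unfolding I_def by (rule integral_mollifier[OF a(1)])
      let ?R = "(\<integral>\<^sup>+ s. indicator {0..} s *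
         (\<integral>\<^sup>+ y. ennreal (norm (G y)) * ennreal (mollifier a (x + s *\<^sub>R z) y) \<partial>lebesgue_on \<Omega>) \<partial>lborel)"
      have "ennreal \<bar>?J a ?x - ?J a x\<bar> \<le> ?R"
      proof (rule mollified_ray_estimate[OF assms(1) u G a(1) t z])
        fix s assume "s \<in> {0..t}"
        then have "cball (x + s *\<^sub>R z) r \<subseteq> \<Omega>" using r by blast
        then show "cball (x + s *\<^sub>R z) (1 / a) \<subseteq> \<Omega>" using a(4) by (meson order_trans subset_cball)
      qed
      moreover have "(\<bar>u x \<bullet> z\<bar> - \<bar>u ?x \<bullet> z\<bar> - e) * I \<le> \<bar>?J a ?x - ?J a x\<bar>"
      proof -
        have "\<bar>u x \<bullet> z\<bar> * I = \<bar>(u x \<bullet> z) * I\<bar>" "\<bar>u ?x \<bullet> z\<bar> * I = \<bar>(u ?x \<bullet> z) * I\<bar>" using I by (simp_all add: abs_mult)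
        moreover have "e * I = d * I + d * I" by (simp add: d_def)
        ultimately show ?thesis
          using A(2)[OF a(2)] B(2)[OF a(3)] unfolding II left_diff_distrib by linarith
      qed
      ultimately have *: "ennreal ((\<bar>u x \<bullet> z\<bar> - \<bar>u ?x \<bullet> z\<bar> - e) * I) \<le> ?R"
        by (meson ennreal_leI order_trans)
      have "ennreal (\<bar>u x \<bullet> z\<bar> - \<bar>u ?x \<bullet> z\<bar> - e) = ennreal (1 / I) * ennreal ((\<bar>u x \<bullet> z\<bar> - \<bar>u ?x \<bullet> z\<bar> - e) * I)"
        using I by (subst ennreal_mult'[symmetric]) auto
      also have "\<dots> \<le> ennreal (1 / I) * ?R" by (rule mult_left_mono[OF *]) simp
      also have "\<dots> = mollified_ray \<Omega> G k x z"
        by (simp add: mollified_ray_def I_def a_def power_one_over)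
      finally show "ennreal (\<bar>u x \<bullet> z\<bar> - \<bar>u ?x \<bullet> z\<bar> - e) \<le> mollified_ray \<Omega> G k x z" .
    qed
  qed
  have "ennreal \<bar>u x \<bullet> z\<bar> \<le> ennreal (\<bar>u ?x \<bullet> z\<bar> + max 0 (\<bar>u x \<bullet> z\<bar> - \<bar>u ?x \<bullet> z\<bar> - e) + e)"
    by (rule ennreal_leI) linarith
  also have "\<dots> = ennreal \<bar>u ?x \<bullet> z\<bar> + ennreal (\<bar>u x \<bullet> z\<bar> - \<bar>u ?x \<bullet> z\<bar> - e) + ennreal e"
    using \<open>e > 0\<close> by (simp add: ennreal_plus max_def ennreal_neg)
  also have "\<dots> \<le> ennreal \<bar>u ?x \<bullet> z\<bar> + liminf (\<lambda>k. mollified_ray \<Omega> G k x z) + ennreal e"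
    by (intro add_mono order_refl) fact
  finally show "ennreal \<bar>u x \<bullet> z\<bar> \<le> ennreal \<bar>u ?x \<bullet> z\<bar> + liminf (\<lambda>k. mollified_ray \<Omega> G k x z) + ennreal e" .
qed

text \<open>If the ray never leaves \<Omega>, the bounded support of u makes the far end vanish.
  Otherwise the exit point lies outside the open set \<Omega>, where the segment estimate does not
  reach; it is applied for t below the exit time \<tau>, and the continuity of u carries the bound
  to \<tau>.\<close>

lemma first_exit_estimate:
  fixes u :: "real ^ 'n::finite \<Rightarrow> real ^ 'n" and G :: "real ^ 'n \<Rightarrow> real ^ 'n ^ 'n"
  assumes "open \<Omega>" and u: "continuous_on UNIV u" and supp: "bounded {y \<in> \<Omega>. u y \<noteq> 0}"
    and G: "has_sym_grad \<Omega> u G" and x: "x \<in> \<Omega>" and z: "norm z \<le> 1"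
    and b: "\<And>t. t > 0 \<Longrightarrow> x + t *\<^sub>R z \<in> frontier \<Omega> \<Longrightarrow> norm (u (x + t *\<^sub>R z)) \<le> b" and "b \<ge> 0"
  shows "ennreal \<bar>u x \<bullet> z\<bar> \<le> ennreal b + liminf (\<lambda>k. mollified_ray \<Omega> G k x z)"
proof -
  let ?p = "\<lambda>t. x + t *\<^sub>R z"
  have dot: "\<bar>u y \<bullet> z\<bar> \<le> norm (u y)" for y
    using Cauchy_Schwarz_ineq2[of "u y" z] z by (smt (verit) mult_left_le norm_ge_zero)
  define T where "T = {t. 0 \<le> t \<and> ?p t \<notin> \<Omega>}"
  show ?thesis
  proof (cases "T = {}")
    case True
    then have inside: "?p s \<in> \<Omega>" if "s \<ge> 0" for s using that by (auto simp: T_def)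
    show ?thesis
    proof (cases "z = 0")
      case False
      obtain R where R: "R > 0" "\<And>y. y \<in> \<Omega> \<Longrightarrow> u y \<noteq> 0 \<Longrightarrow> norm y \<le> R"
        using supp unfolding bounded_pos by blast
      define t where "t = (R + norm x + 1) / norm z"
      have "t \<ge> 0" using R by (simp add: t_def)
      have "norm (t *\<^sub>R z) = R + norm x + 1" using False R by (simp add: t_def)
      then have "norm (?p t) > R" using norm_triangle_ineq4[of "?p t" x] by simp
      then have "u (?p t) = 0" using R(2)[OF inside[OF \<open>t \<ge> 0\<close>]] by force
      then have "ennreal \<bar>u x \<bullet> z\<bar> \<le> liminf (\<lambda>k. mollified_ray \<Omega> G k x z)"
        using segment_estimate[OF assms(1) u G \<open>t \<ge> 0\<close> z, of x] inside by auto
      then show ?thesis by (simp add: add_increasing)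
    qed simp
  next
    case False
    have "closed {t. ?p t \<notin> \<Omega>}"
    proof -
      have "open (?p -` \<Omega>)" by (rule open_vimage[OF \<open>open \<Omega>\<close>]) (intro continuous_intros)
      then show ?thesis by (simp add: closed_def vimage_def Compl_eq)
    qed
    then have "closed T" unfolding T_def by (intro closed_Collect_conj closed_Collect_le continuous_intros) auto
    define \<tau> where "\<tau> = Inf T"
    have bdd: "bdd_below T" by (auto simp: T_def bdd_below_def)
    have "\<tau> \<in> T" unfolding \<tau>_def by (rule closed_contains_Inf[OF False bdd \<open>closed T\<close>])
    then have \<tau>: "?p \<tau> \<notin> \<Omega>" "\<tau> > 0" using x by (auto simp: T_def less_le)
    have inside: "?p s \<in> \<Omega>" if "0 \<le> s" "s < \<tau>" for s
      using that cInf_lower[OF _ bdd, of s] by (force simp: T_def \<tau>_def)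
    have lim: "((\<lambda>t. u (?p t)) \<longlongrightarrow> u (?p \<tau>)) (at_left \<tau>)"
    proof -
      have "continuous_on UNIV (\<lambda>t. u (?p t))"
        by (intro continuous_intros continuous_on_compose2[OF u]) auto
      then show ?thesis by (simp add: continuous_on_eq_continuous_within isCont_def filterlim_at_split)
    qed
    have ev: "\<forall>\<^sub>F t in at_left \<tau>. 0 \<le> t \<and> t < \<tau>"
      using \<tau>(2) eventually_at_left_field[of "\<lambda>t. 0 \<le> t \<and> t < \<tau>" \<tau>] by (auto intro!: exI[of _ 0])
    have "?p \<tau> \<in> closure \<Omega>"
    proof (rule Lim_in_closed_set[OF closed_closure])
      show "\<forall>\<^sub>F t in at_left \<tau>. ?p t \<in> closure \<Omega>"
        using ev by eventually_elim (use inside closure_subset in blast)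
      show "(?p \<longlongrightarrow> ?p \<tau>) (at_left \<tau>)" by (intro tendsto_intros)
    qed simp
    then have "?p \<tau> \<in> frontier \<Omega>" using \<tau>(1) \<open>open \<Omega>\<close> by (simp add: frontier_def interior_open)
    then have b\<tau>: "norm (u (?p \<tau>)) \<le> b" using b \<tau>(2) by blast
    let ?L = "liminf (\<lambda>k. mollified_ray \<Omega> G k x z)"
    have "ennreal \<bar>u x \<bullet> z\<bar> \<le> ennreal (norm (u (?p \<tau>))) + ?L"
    proof (rule tendsto_lowerbound)
      show "((\<lambda>t. ennreal (norm (u (?p t))) + ?L) \<longlongrightarrow> ennreal (norm (u (?p \<tau>))) + ?L) (at_left \<tau>)"
        by (intro tendsto_intros lim tendsto_ennrealI)
      show "\<forall>\<^sub>F t in at_left \<tau>. ennreal \<bar>u x \<bullet> z\<bar> \<le> ennreal (norm (u (?p t))) + ?L"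
        using ev
      proof eventually_elim
        fix t assume t: "0 \<le> t \<and> t < \<tau>"
        have "ennreal \<bar>u x \<bullet> z\<bar> \<le> ennreal \<bar>u (?p t) \<bullet> z\<bar> + ?L"
          using t inside by (intro segment_estimate[OF assms(1) u G _ z]) auto
        also have "\<dots> \<le> ennreal (norm (u (?p t))) + ?L"
          by (intro add_right_mono ennreal_leI dot)
        finally show "ennreal \<bar>u x \<bullet> z\<bar> \<le> ennreal (norm (u (?p t))) + ?L" .
      qed
    qed simp
    also have "\<dots> \<le> ennreal b + ?L" by (intro add_right_mono ennreal_leI b\<tau>)
    finally show ?thesis .
  qed
qed

text \<open>Fubini moves the mollifier from the gradient to the kernel, where
  \<open>nn_integral_riesz_ball_le\<close> removes it; the powers of a cancel, so the bound is
  uniform in k. The Borel function \<open>f\<close> stands for the norm of G, which is only Lebesgue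
  measurable, since the product measures used here are Borel.\<close>

lemma nn_integral_mollified_ray_le:
  assumes "CARD('n::finite) \<ge> 2"
  shows "\<exists>C>0. \<forall>\<Omega> (G :: real ^ 'n \<Rightarrow> real ^ 'n ^ 'n) f x k.
    open \<Omega> \<and> f \<in> borel_measurable borel \<and> (AE y in lebesgue. f y = indicator \<Omega> y * ennreal (norm (G y))) \<longrightarrow>
    mollified_ray \<Omega> G k x \<in> borel_measurable borel \<and>
    (\<integral>\<^sup>+ z. indicator (ball 0 1) z * mollified_ray \<Omega> G k x z \<partial>lborel)
      \<le> ennreal C * (\<integral>\<^sup>+ y. riesz_kernel (y - x) * f y \<partial>lborel)"
proof -
  obtain C where C: "C > 0" "\<And>(x :: real ^ 'n) y r. r > 0 \<Longrightarrow> y \<noteq> x \<Longrightarrow>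
    (\<integral>\<^sup>+ w. indicator (ball y r) w * riesz_kernel (w - x) \<partial>lborel) \<le> ennreal (C * r ^ CARD('n)) * riesz_kernel (y - x)"
    using nn_integral_riesz_ball_le[where 'a = "real ^ 'n"] assms by auto
  let ?m = "mollifier_mass TYPE('n)"
  have m: "?m > 0" by (rule mollifier_mass_pos)
  let ?n = "real CARD('n)"
  define C' where "C' = C / (?m * (?n - 1))"
  have "C' > 0" using C m assms by (simp add: C'_def)
  moreover have "mollified_ray \<Omega> G k x \<in> borel_measurable borel \<and>
    (\<integral>\<^sup>+ z. indicator (ball 0 1) z * mollified_ray \<Omega> G k x z \<partial>lborel)
      \<le> ennreal C' * (\<integral>\<^sup>+ y. riesz_kernel (y - x) * f y \<partial>lborel)"
    if \<Omega>: "open \<Omega>" and f [measurable]: "f \<in> borel_measurable borel"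
      and fG: "AE y in lebesgue. f y = indicator \<Omega> y * ennreal (norm (G y))"
    for \<Omega> and G :: "real ^ 'n \<Rightarrow> real ^ 'n ^ 'n" and f x k
  proof -
    define a where "a = real (Suc k)"
    have a: "a > 0" by (simp add: a_def)
    define q where "q w = (\<integral>\<^sup>+ y. f y * ennreal (mollifier a w y) \<partial>lborel)" for w
    have [measurable]: "(\<lambda>p. mollifier a (fst p) (snd p)) \<in> borel_measurable (borel \<Otimes>\<^sub>M (borel :: (real ^ 'n) measure))"
      unfolding borel_prod by (intro borel_measurable_continuous_onI continuous_intros)
    have [measurable]: "(\<lambda>p. f (snd p) * ennreal (mollifier a (fst p) (snd p))) \<in> borel_measurable (borel \<Otimes>\<^sub>M (borel :: (real ^ 'n) measure))"
      "(\<lambda>p. f (fst p) * ennreal (mollifier a (snd p) (fst p))) \<in> borel_measurable (borel \<Otimes>\<^sub>M (borel :: (real ^ 'n) measure))"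
    proof -
      show "(\<lambda>p. f (snd p) * ennreal (mollifier a (fst p) (snd p))) \<in> borel_measurable (borel \<Otimes>\<^sub>M (borel :: (real ^ 'n) measure))"
        by measurable
      from measurable_compose[OF measurable_pair_swap' this]
      show "(\<lambda>p. f (fst p) * ennreal (mollifier a (snd p) (fst p))) \<in> borel_measurable (borel \<Otimes>\<^sub>M (borel :: (real ^ 'n) measure))"
        by (simp add: case_prod_unfold)
    qed
    have q_meas [measurable]: "q \<in> borel_measurable borel"
      unfolding q_def[abs_def]
      by (rule lborel.borel_measurable_nn_integral, subst measurable_cong_sets[OF sets_pair_measure_cong[OF refl sets_lborel] refl])
         (simp add: case_prod_unfold)
    have inner: "(\<integral>\<^sup>+ y. ennreal (norm (G y)) * ennreal (mollifier a w y) \<partial>lebesgue_on \<Omega>) = q w" for w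
    proof -
      have "(\<integral>\<^sup>+ y. ennreal (norm (G y)) * ennreal (mollifier a w y) \<partial>lebesgue_on \<Omega>) =
          (\<integral>\<^sup>+ y. ennreal (norm (G y)) * ennreal (mollifier a w y) * indicator \<Omega> y \<partial>lebesgue)"
        using \<Omega> by (intro nn_integral_restrict_space) auto
      also have "\<dots> = (\<integral>\<^sup>+ y. f y * ennreal (mollifier a w y) \<partial>lebesgue)"
        by (rule nn_integral_cong_AE, use fG in eventually_elim) (simp add: mult_ac)
      finally show ?thesis by (simp add: q_def nn_integral_completion)
    qed
    have ray: "mollified_ray \<Omega> G k x z = ennreal (a ^ CARD('n) / ?m) * (\<integral>\<^sup>+ s. indicator {0..} s * q (x + s *\<^sub>R z) \<partial>lborel)" for z
      by (simp add: mollified_ray_def inner[symmetric] a_def)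
    have "(\<lambda>p. indicator {0..} (snd p) * q (x + snd p *\<^sub>R fst p)) \<in> borel_measurable (borel \<Otimes>\<^sub>M (borel :: real measure))"
      by measurable
    then have [measurable]: "(\<lambda>z. \<integral>\<^sup>+ s. indicator {0..} s * q (x + s *\<^sub>R z) \<partial>lborel) \<in> borel_measurable borel"
      by (intro lborel.borel_measurable_nn_integral, subst measurable_cong_sets[OF sets_pair_measure_cong[OF refl sets_lborel] refl])
         (simp add: case_prod_unfold)
    have meas: "mollified_ray \<Omega> G k x \<in> borel_measurable borel"
      unfolding ray[abs_def] by measurable
    have b [measurable]: "ball (0 :: real ^ 'n) 1 \<in> sets borel" by simp
    have "(\<integral>\<^sup>+ z. indicator (ball 0 1) z * mollified_ray \<Omega> G k x z \<partial>lborel) =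
       ennreal (a ^ CARD('n) / ?m) * (\<integral>\<^sup>+ z. indicator (ball 0 1) z * (\<integral>\<^sup>+ s. indicator {0..} s * q (x + s *\<^sub>R z) \<partial>lborel) \<partial>lborel)"
      unfolding ray by (subst nn_integral_cmult[symmetric]) (auto simp: mult_ac)
    also have "\<dots> \<le> ennreal (a ^ CARD('n) / ?m) * (ennreal (1 / (?n - 1)) * (\<integral>\<^sup>+ w. riesz_kernel (w - x) * q w \<partial>lborel))"
      using nn_integral_rays_eq_riesz[OF q_meas, of x] assms by (intro mult_left_mono) auto
    also have "(\<integral>\<^sup>+ w. riesz_kernel (w - x) * q w \<partial>lborel) =
       (\<integral>\<^sup>+ w. \<integral>\<^sup>+ y. riesz_kernel (w - x) * (f y * ennreal (mollifier a w y)) \<partial>lborel \<partial>lborel)"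
    proof -
      have [measurable]: "mollifier a w \<in> borel_measurable borel" for w :: "real ^ 'n"
        by (intro borel_measurable_continuous_onI continuous_intros)
      show ?thesis unfolding q_def by (subst nn_integral_cmult[symmetric]) auto
    qed
    also have "\<dots> = (\<integral>\<^sup>+ y. \<integral>\<^sup>+ w. riesz_kernel (w - x) * (f y * ennreal (mollifier a w y)) \<partial>lborel \<partial>lborel)"
    proof (rule lborel_pair.Fubini')
      have "(\<lambda>p. riesz_kernel (snd p - x) * (f (fst p) * ennreal (mollifier a (snd p) (fst p)))) \<in> borel_measurable (borel \<Otimes>\<^sub>M (borel :: (real ^ 'n) measure))"
        by measurable
      then show "(\<lambda>(y, w). riesz_kernel (w - x) * (f y * ennreal (mollifier a w y))) \<in> borel_measurable (lborel \<Otimes>\<^sub>M (lborel :: (real ^ 'n) measure))"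
        by (subst measurable_cong_sets[OF sets_pair_measure_cong[OF sets_lborel sets_lborel] refl])
           (simp add: case_prod_unfold)
    qed
    also have "\<dots> \<le> (\<integral>\<^sup>+ y. ennreal (C * (1 / a) ^ CARD('n)) * (riesz_kernel (y - x) * f y) \<partial>lborel)"
    proof (rule nn_integral_mono_AE)
      show "AE y in lborel. (\<integral>\<^sup>+ w. riesz_kernel (w - x) * (f y * ennreal (mollifier a w y)) \<partial>lborel)
          \<le> ennreal (C * (1 / a) ^ CARD('n)) * (riesz_kernel (y - x) * f y)"
        using AE_lborel_neq[of x]
      proof eventually_elim
        fix y assume y: "y \<noteq> x"
        have [measurable]: "ball y (1 / a) \<in> sets borel" by simp
        have "(\<integral>\<^sup>+ w. riesz_kernel (w - x) * (f y * ennreal (mollifier a w y)) \<partial>lborel) \<le>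
            (\<integral>\<^sup>+ w. f y * (indicator (ball y (1 / a)) w * riesz_kernel (w - x)) \<partial>lborel)"
        proof (rule nn_integral_mono)
          fix w
          have "ennreal (mollifier a w y) \<le> indicator (ball y (1 / a)) w"
            using mollifier_eq_0(1)[OF a, of w y] mollifier_le_1[of a w y]
            by (cases "w \<in> ball y (1 / a)") (auto simp: dist_commute)
          then have "riesz_kernel (w - x) * f y * ennreal (mollifier a w y) \<le> riesz_kernel (w - x) * f y * indicator (ball y (1 / a)) w"
            by (intro mult_left_mono) auto
          then show "riesz_kernel (w - x) * (f y * ennreal (mollifier a w y)) \<le> f y * (indicator (ball y (1 / a)) w * riesz_kernel (w - x))"
            by (simp add: mult_ac)
        qed
        also have "\<dots> = f y * (\<integral>\<^sup>+ w. indicator (ball y (1 / a)) w * riesz_kernel (w - x) \<partial>lborel)"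
          by (rule nn_integral_cmult) measurable
        also have "\<dots> \<le> f y * (ennreal (C * (1 / a) ^ CARD('n)) * riesz_kernel (y - x))"
          using a y by (intro mult_left_mono C(2)) auto
        finally show "(\<integral>\<^sup>+ w. riesz_kernel (w - x) * (f y * ennreal (mollifier a w y)) \<partial>lborel)
          \<le> ennreal (C * (1 / a) ^ CARD('n)) * (riesz_kernel (y - x) * f y)"
          by (simp add: mult_ac)
      qed
    qed
    also have "\<dots> = ennreal (C * (1 / a) ^ CARD('n)) * (\<integral>\<^sup>+ y. riesz_kernel (y - x) * f y \<partial>lborel)"
      by (rule nn_integral_cmult) measurable
    finally have "(\<integral>\<^sup>+ z. indicator (ball 0 1) z * mollified_ray \<Omega> G k x z \<partial>lborel) \<le>
       ennreal (a ^ CARD('n) / ?m) * (ennreal (1 / (?n - 1)) *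
         (ennreal (C * (1 / a) ^ CARD('n)) * (\<integral>\<^sup>+ y. riesz_kernel (y - x) * f y \<partial>lborel)))"
      by (simp add: mult_left_mono)
    also have "\<dots> = ennreal (a ^ CARD('n) / ?m * (1 / (?n - 1)) * (C * (1 / a) ^ CARD('n))) * (\<integral>\<^sup>+ y. riesz_kernel (y - x) * f y \<partial>lborel)"
      using a m C(1) assms by (simp only: ennreal_mult'[symmetric] mult.assoc[symmetric] divide_nonneg_nonneg zero_le_power less_imp_le)
    also have "a ^ CARD('n) / ?m * (1 / (?n - 1)) * (C * (1 / a) ^ CARD('n)) = C'"
      using a by (simp add: C'_def power_divide)
    finally show ?thesis using meas by blast
  qed
  ultimately show ?thesis by blast
qed

text \<open>The norm of u x is recovered by integrating u x \<bullet> z over directions z close to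
  that of u x, and Fatou's lemma moves the liminf over the mollification scales out of the integral.
  The majorant \<open>b\<close> of the exit values may be infinite.\<close>

lemma pointwise_representation:
  assumes n2: "CARD('n::finite) \<ge> 2"
  shows "\<exists>C>0. \<forall>\<Omega> (u :: real ^ 'n \<Rightarrow> real ^ 'n) G f b x.
    open \<Omega> \<and> u \<in> Cb (closure \<Omega>) \<and> has_sym_grad \<Omega> u G \<and> x \<in> \<Omega> \<and>
    f \<in> borel_measurable borel \<and> (AE y in lebesgue. f y = indicator \<Omega> y * ennreal (norm (G y))) \<and>
    b \<in> borel_measurable borel \<and>
    (\<forall>z\<in>ball 0 1. \<forall>t>0. x + t *\<^sub>R z \<in> frontier \<Omega> \<longrightarrow> ennreal (norm (u (x + t *\<^sub>R z))) \<le> b z) \<longrightarrow>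
    ennreal (norm (u x)) \<le> ennreal C * ((\<integral>\<^sup>+ z. indicator (ball 0 1) z * b z \<partial>lborel)
        + (\<integral>\<^sup>+ y. riesz_kernel (y - x) * f y \<partial>lborel))"
proof -
  obtain C where C: "C > 0" "\<And>\<Omega> (G :: real ^ 'n \<Rightarrow> real ^ 'n ^ 'n) f x k.
    open \<Omega> \<Longrightarrow> f \<in> borel_measurable borel \<Longrightarrow> (AE y in lebesgue. f y = indicator \<Omega> y * ennreal (norm (G y))) \<Longrightarrow>
    mollified_ray \<Omega> G k x \<in> borel_measurable borel \<and>
    (\<integral>\<^sup>+ z. indicator (ball 0 1) z * mollified_ray \<Omega> G k x z \<partial>lborel)
      \<le> ennreal C * (\<integral>\<^sup>+ y. riesz_kernel (y - x) * f y \<partial>lborel)"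
    using nn_integral_mollified_ray_le[OF n2] by blast
  define v where "v = measure lborel (ball (0 :: real ^ 'n) (1/4)) / 4"
  have v: "v > 0" by (simp add: v_def content_ball_pos)
  define C' where "C' = max 1 C / v"
  have "C' > 0" using v by (simp add: C'_def)
  moreover have "ennreal (norm (u x)) \<le> ennreal C' * ((\<integral>\<^sup>+ z. indicator (ball 0 1) z * b z \<partial>lborel)
        + (\<integral>\<^sup>+ y. riesz_kernel (y - x) * f y \<partial>lborel))"
    if \<Omega>: "open \<Omega>" and u: "u \<in> Cb (closure \<Omega>)" and G: "has_sym_grad \<Omega> u G" and x: "x \<in> \<Omega>"
      and f [measurable]: "f \<in> borel_measurable borel" and fG: "AE y in lebesgue. f y = indicator \<Omega> y * ennreal (norm (G y))"
      and b [measurable]: "b \<in> borel_measurable borel"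
      and bdry: "\<forall>z\<in>ball 0 1. \<forall>t>0. x + t *\<^sub>R z \<in> frontier \<Omega> \<longrightarrow> ennreal (norm (u (x + t *\<^sub>R z))) \<le> b z"
    for \<Omega> and u :: "real ^ 'n \<Rightarrow> real ^ 'n" and G f b x
  proof (cases "u x = 0")
    case False
    have [measurable]: "ball (0 :: real ^ 'n) 1 \<in> sets borel" by simp
    \<comment> \<open>Mollification uses values on the whole space, so u is extended continuously
      from the closure by Tietze's theorem. Inside \<Omega> nothing changes, hence \<open>G\<close>
      is also the symmetric gradient of the extension.\<close>
    obtain g where g: "continuous_on UNIV g" "\<And>y. y \<in> closure \<Omega> \<Longrightarrow> g y = u y"
      using u Tietze_unbounded[of "closure \<Omega>" u UNIV] by (auto simp: Cb_def closedin_closed_Int)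
    have gu: "g y = u y" if "y \<in> \<Omega>" for y using g(2) that closure_subset by blast
    have "has_sym_grad \<Omega> g G"
    proof -
      have "(LINT y|lebesgue_on \<Omega>. (1/2) * (g y $ i * p y + g y $ j * r y)) =
         (LINT y|lebesgue_on \<Omega>. (1/2) * (u y $ i * p y + u y $ j * r y))" for i j p r
        using \<Omega> gu by (intro Bochner_Integration.integral_cong) auto
      then show ?thesis using G unfolding has_sym_grad_def by simp
    qed
    moreover have "bounded {y \<in> \<Omega>. g y \<noteq> 0}"
      using u gu closure_subset[of \<Omega>] unfolding Cb_def by (auto intro: bounded_subset)
    ultimately have exit: "ennreal \<bar>u x \<bullet> z\<bar> \<le> b z + liminf (\<lambda>k. mollified_ray \<Omega> G k x z)" if z: "z \<in> ball 0 1" for z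
    proof (cases "b z")
      case (real r)
      have "norm (g (x + t *\<^sub>R z)) \<le> r" if "t > 0" "x + t *\<^sub>R z \<in> frontier \<Omega>" for t
      proof -
        have "ennreal (norm (u (x + t *\<^sub>R z))) \<le> ennreal r" using bdry z that real by metis
        moreover have "x + t *\<^sub>R z \<in> closure \<Omega>" using that by (simp add: frontier_def)
        ultimately show ?thesis using g(2) real by simp
      qed
      then show ?thesis
        using first_exit_estimate[OF \<Omega> g(1) \<open>bounded _\<close> \<open>has_sym_grad \<Omega> g G\<close> x, of z r] z real gu[OF x] by simp
    qed simp
    define e where "e = (1 / norm (u x)) *\<^sub>R u x"
    have e: "norm e = 1" "u x \<bullet> e = norm (u x)"
      using False by (simp_all add: e_def power2_norm_eq_inner[symmetric] power2_eq_square)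
    \<comment> \<open>Within 1/4 of e/2 one has |z| < 1 and u x \<bullet> z \<ge> |u x|/2 - |u x|/4.
      The division by 4 in \<open>v\<close> comes from this bound.\<close>
    let ?Z = "ball ((1/2) *\<^sub>R e) (1/4)"
    have Z: "z \<in> ball 0 1 \<and> \<bar>u x \<bullet> z\<bar> \<ge> norm (u x) / 4" if "z \<in> ?Z" for z
    proof -
      have d: "norm (z - (1/2) *\<^sub>R e) < 1/4" using that by (simp add: dist_norm norm_minus_commute)
      have "norm z \<le> norm (z - (1/2) *\<^sub>R e) + norm ((1/2) *\<^sub>R e)"
        using norm_triangle_ineq[of "z - (1/2) *\<^sub>R e" "(1/2) *\<^sub>R e"] by simp
      then have "norm z < 1" using d e by simp
      moreover have "\<bar>u x \<bullet> (z - (1/2) *\<^sub>R e)\<bar> \<le> norm (u x) * (1/4)"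
        using order_trans[OF Cauchy_Schwarz_ineq2 mult_left_mono[OF less_imp_le[OF d] norm_ge_zero]] .
      then have "u x \<bullet> z \<ge> norm (u x) / 4"
        using e abs_le_D2[of "u x \<bullet> (z - (1/2) *\<^sub>R e)"] by (fastforce simp: inner_diff_right)
      ultimately show ?thesis by simp
    qed
    have "ennreal (v * norm (u x)) = (\<integral>\<^sup>+ z. ennreal (norm (u x) / 4) * indicator ?Z z \<partial>lborel)"
    proof -
      have "measure lborel ?Z = measure lborel (ball (0 :: real ^ 'n) (1/4))"
        by (simp add: content_ball)
      then have "emeasure lborel ?Z = ennreal (4 * v)"
        using emeasure_eq_ennreal_measure[of lborel ?Z] by (simp add: v_def emeasure_ball)
      then show ?thesis
        using v by (subst nn_integral_cmult_indicator) (auto simp: ennreal_mult'[symmetric] mult_ac)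
    qed
    also have "\<dots> \<le> (\<integral>\<^sup>+ z. indicator (ball 0 1) z * b z + liminf (\<lambda>k. indicator (ball 0 1) z * mollified_ray \<Omega> G k x z) \<partial>lborel)"
    proof (rule nn_integral_mono)
      fix z
      show "ennreal (norm (u x) / 4) * indicator ?Z z \<le> indicator (ball 0 1) z * b z + liminf (\<lambda>k. indicator (ball 0 1) z * mollified_ray \<Omega> G k x z)"
      proof (cases "z \<in> ?Z")
        case True
        then have "ennreal (norm (u x) / 4) \<le> ennreal \<bar>u x \<bullet> z\<bar>" using Z by (intro ennreal_leI) auto
        then have "ennreal (norm (u x) / 4) \<le> b z + liminf (\<lambda>k. mollified_ray \<Omega> G k x z)"
          using exit[of z] Z[OF True] order_trans by blast
        then show ?thesis using Z[OF True] True by simp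
      qed simp
    qed
    also have "\<dots> = (\<integral>\<^sup>+ z. indicator (ball 0 1) z * b z \<partial>lborel) + (\<integral>\<^sup>+ z. liminf (\<lambda>k. indicator (ball 0 1) z * mollified_ray \<Omega> G k x z) \<partial>lborel)"
      using C(2)[OF \<Omega> f fG] by (intro nn_integral_add) (measurable, auto)
    also have "\<dots> \<le> (\<integral>\<^sup>+ z. indicator (ball 0 1) z * b z \<partial>lborel) + liminf (\<lambda>k. \<integral>\<^sup>+ z. indicator (ball 0 1) z * mollified_ray \<Omega> G k x z \<partial>lborel)"
      using C(2)[OF \<Omega> f fG] by (intro add_left_mono nn_integral_liminf) (measurable, auto)
    also have "\<dots> \<le> (\<integral>\<^sup>+ z. indicator (ball 0 1) z * b z \<partial>lborel) + liminf (\<lambda>k::nat. ennreal C * (\<integral>\<^sup>+ y. riesz_kernel (y - x) * f y \<partial>lborel))"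
      using C(2)[OF \<Omega> f fG] by (intro add_left_mono Liminf_mono always_eventually) auto
    also have "\<dots> = (\<integral>\<^sup>+ z. indicator (ball 0 1) z * b z \<partial>lborel) + ennreal C * (\<integral>\<^sup>+ y. riesz_kernel (y - x) * f y \<partial>lborel)"
      by (simp add: Liminf_const)
    also have "\<dots> \<le> ennreal (max 1 C) * (\<integral>\<^sup>+ z. indicator (ball 0 1) z * b z \<partial>lborel) + ennreal (max 1 C) * (\<integral>\<^sup>+ y. riesz_kernel (y - x) * f y \<partial>lborel)"
    proof (intro add_mono)
      have "1 * (\<integral>\<^sup>+ z. indicator (ball 0 1) z * b z \<partial>lborel) \<le> ennreal (max 1 C) * (\<integral>\<^sup>+ z. indicator (ball 0 1) z * b z \<partial>lborel)"
        by (intro mult_right_mono) auto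
      then show "(\<integral>\<^sup>+ z. indicator (ball 0 1) z * b z \<partial>lborel) \<le> ennreal (max 1 C) * (\<integral>\<^sup>+ z. indicator (ball 0 1) z * b z \<partial>lborel)" by simp
    qed (intro mult_right_mono ennreal_leI, auto)
    finally have *: "ennreal (v * norm (u x)) \<le> ennreal (max 1 C) * ((\<integral>\<^sup>+ z. indicator (ball 0 1) z * b z \<partial>lborel)
        + (\<integral>\<^sup>+ y. riesz_kernel (y - x) * f y \<partial>lborel))"
      by (simp add: distrib_left)
    have "ennreal (norm (u x)) = ennreal (1 / v) * ennreal (v * norm (u x))"
      using v by (simp add: ennreal_mult'[symmetric])
    also have "\<dots> \<le> ennreal (1 / v) * (ennreal (max 1 C) * ((\<integral>\<^sup>+ z. indicator (ball 0 1) z * b z \<partial>lborel)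
        + (\<integral>\<^sup>+ y. riesz_kernel (y - x) * f y \<partial>lborel)))"
      by (rule mult_left_mono[OF *]) simp
    also have "\<dots> = ennreal C' * ((\<integral>\<^sup>+ z. indicator (ball 0 1) z * b z \<partial>lborel)
        + (\<integral>\<^sup>+ y. riesz_kernel (y - x) * f y \<partial>lborel))"
      using v by (simp add: C'_def mult.assoc[symmetric] ennreal_mult'[symmetric])
    finally show ?thesis .
  qed simp
  ultimately show ?thesis by blast
qed

section \<open>Averages over sets\<close>

lemma powr_right_approx:
  fixes s :: real
  assumes "s > 0" "D \<ge> 0" "e > 0"
  shows "\<exists>d>D. (d / 2) powr s \<le> (D / 2) powr s + e"
proof -
  have "continuous_on {0..} (\<lambda>x::real. x powr s)"
    using assms by (intro continuous_on_powr' continuous_intros) auto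
  then obtain \<delta> where \<delta>: "\<delta> > 0" "\<And>x. x \<ge> 0 \<Longrightarrow> dist x (D / 2) < \<delta> \<Longrightarrow> dist (x powr s) ((D / 2) powr s) < e"
    using assms unfolding continuous_on_iff by (metis atLeast_iff divide_nonneg_nonneg zero_le_numeral)
  have "dist ((D / 2 + \<delta> / 2) powr s) ((D / 2) powr s) < e"
    using assms \<delta>(1) by (intro \<delta>(2)) (auto simp: dist_real_def)
  then show ?thesis
    using \<delta>(1) by (intro exI[of _ "D + \<delta>"]) (auto simp: dist_real_def add_divide_distrib)
qed

text \<open>A covering set of diameter D that meets A lies in every open ball of radius d > D about
  one of its points in A; the enlargement from D to d is paid by a geometric share of e. Covering
  sets that miss A get the dummy centre p. Centres in S matter because S will be the frontier. The
  content at scale 1 suffices, as the size of the balls plays no part in the tube estimate.\<close>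

lemma hausdorff_cover_balls:
  fixes A S :: "'a::metric_space set"
  assumes s: "s > 0" and fin: "hausdorff_outer s A < \<infinity>" and e: "e > 0" and S: "A \<subseteq> S" "S \<noteq> {}"
  shows "\<exists>(y :: nat \<Rightarrow> 'a) d. (\<forall>i. y i \<in> S \<and> d i > 0) \<and> A \<subseteq> (\<Union>i. ball (y i) (d i)) \<and>
    (\<Sum>i. ennreal (unit_ball_vol s * (d i / 2) powr s)) \<le> hausdorff_outer s A + ennreal e"
proof -
  let ?b = "unit_ball_vol s"
  have b: "?b > 0" using s by simp
  let ?g = "\<lambda>d. ennreal (?b * (d / 2) powr s)"
  have le: "hausdorff_content s 1 A \<le> hausdorff_outer s A" by (rule hausdorff_content_le_outer) simp
  then have "hausdorff_content s 1 A < hausdorff_content s 1 A + ennreal (e / 2)"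
    using fin e by (auto simp: ennreal_less_iff)
  then obtain U :: "nat \<Rightarrow> 'a set" where U: "A \<subseteq> (\<Union>i. U i)" "\<And>i. bounded (U i)"
      "(\<Sum>i. ?g (diameter (U i))) \<le> hausdorff_content s 1 A + ennreal (e / 2)"
    unfolding hausdorff_content_def[of s 1 A] INF_less_iff by (auto intro: less_imp_le)
  have "\<exists>d>diameter (U i). (d / 2) powr s \<le> (diameter (U i) / 2) powr s + e / 2 * (1/2) ^ Suc i / ?b" for i
    using s e b U(2) by (intro powr_right_approx diameter_ge_0) auto
  then obtain d where d: "\<And>i. d i > diameter (U i)"
    "\<And>i. (d i / 2) powr s \<le> (diameter (U i) / 2) powr s + e / 2 * (1/2) ^ Suc i / ?b" by metis
  obtain p where p: "p \<in> S" using S by blast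
  define y where "y i = (if U i \<inter> A = {} then p else SOME q. q \<in> U i \<inter> A)" for i
  have y: "y i \<in> U i \<inter> A" if "U i \<inter> A \<noteq> {}" for i
    using that someI_ex[of "\<lambda>q. q \<in> U i \<inter> A"] by (auto simp: y_def)
  have "y i \<in> S" for i using y[of i] p S by (cases "U i \<inter> A = {}") (auto simp: y_def)
  moreover have "d i > 0" for i using d(1)[of i] diameter_ge_0[OF U(2), of i] by linarith
  moreover have "A \<subseteq> (\<Union>i. ball (y i) (d i))"
  proof
    fix x assume x: "x \<in> A"
    then obtain i where i: "x \<in> U i" using U(1) by blast
    then have "dist (y i) x \<le> diameter (U i)"
      using y[of i] x by (intro diameter_bounded_bound[OF U(2)]) auto
    then show "x \<in> (\<Union>i. ball (y i) (d i))" using d(1)[of i] by (auto intro: le_less_trans)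
  qed
  moreover have "(\<Sum>i. ?g (d i)) \<le> hausdorff_outer s A + ennreal e"
  proof -
    have "(\<Sum>i. ?g (d i)) \<le> (\<Sum>i. ?g (diameter (U i)) + ennreal (e / 2 * (1/2) ^ Suc i))"
    proof (rule suminf_le)
      fix i
      have "?b * (d i / 2) powr s \<le> ?b * ((diameter (U i) / 2) powr s + e / 2 * (1/2) ^ Suc i / ?b)"
        using d(2)[of i] b by (intro mult_left_mono) auto
      also have "\<dots> = ?b * (diameter (U i) / 2) powr s + e / 2 * (1/2) ^ Suc i"
        using b by (simp add: distrib_left)
      finally have "?g (d i) \<le> ennreal (?b * (diameter (U i) / 2) powr s + e / 2 * (1/2) ^ Suc i)"
        by (rule ennreal_leI)
      also have "\<dots> = ?g (diameter (U i)) + ennreal (e / 2 * (1/2) ^ Suc i)"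
        using e b by (intro ennreal_plus) auto
      finally show "?g (d i) \<le> ?g (diameter (U i)) + ennreal (e / 2 * (1/2) ^ Suc i)" .
    qed auto
    also have "\<dots> = (\<Sum>i. ?g (diameter (U i))) + (\<Sum>i. ennreal (e / 2 * (1/2) ^ Suc i))"
      by (intro suminf_add[symmetric]) auto
    also have "(\<Sum>i. ennreal (e / 2 * (1/2) ^ Suc i)) = ennreal (e / 2)"
      using e sums_mult[OF power_half_series, of "e / 2"] by (intro suminf_ennreal_eq) auto
    also have "(\<Sum>i. ?g (diameter (U i))) + ennreal (e / 2) \<le> (hausdorff_outer s A + ennreal (e / 2)) + ennreal (e / 2)"
      using U(3) le by (intro add_right_mono) (meson add_right_mono order_trans)
    also have "\<dots> = hausdorff_outer s A + ennreal e"
      using e by (simp add: add.assoc ennreal_plus[symmetric] del: ennreal_plus)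
    finally show ?thesis .
  qed
  ultimately show ?thesis by blast
qed

text \<open>The set where |u| > T is cut into the dyadic level sets \<open>F k\<close>. Each is
  covered on its own, and its balls carry the upper level T 2^(k+1) as value v. On
  \<open>F k\<close> this value is at most 2|u|, so the weighted sum over all balls is comparable to
  the integral of |u| over that set.\<close>

lemma boundary_level_cover:
  fixes u :: "'a::{metric_space,second_countable_topology} \<Rightarrow> 'b::real_normed_vector"
  assumes s: "s > 0" and S: "closed S" "S \<noteq> {}" and u: "continuous_on S u"
    and fin: "emeasure (hausdorff_measure s) S < \<infinity>" and T: "T > 0" and e: "e > 0"
  shows "\<exists>v (y :: nat \<Rightarrow> 'a) d. (\<forall>j. v j \<ge> 0 \<and> y j \<in> S \<and> d j > 0) \<and>
    (\<forall>p\<in>S. T < norm (u p) \<longrightarrow> (\<exists>j. p \<in> ball (y j) (d j) \<and> norm (u p) \<le> v j)) \<and>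
    (\<Sum>j. ennreal (v j * d j powr s)) \<le> ennreal (2 * 2 powr s / unit_ball_vol s) *
      ((\<integral>\<^sup>+ p. indicator {p \<in> S. T < norm (u p)} p * ennreal (norm (u p)) \<partial>hausdorff_measure s) + ennreal e)"
proof -
  let ?b = "unit_ball_vol s" and ?H = "hausdorff_measure s :: 'a measure"
  have b: "?b > 0" using s by simp
  define F where "F k = {p \<in> S. T * 2 ^ k < norm (u p) \<and> norm (u p) \<le> T * 2 ^ Suc k}" for k :: nat
  have lev: "{p \<in> S. norm (u p) \<le> r} \<in> sets borel" for r
  proof -
    have "closedin (top_of_set S) (S \<inter> (\<lambda>p. norm (u p)) -` {..r})"
      using u by (intro continuous_closedin_preimage continuous_intros) auto
    then have "closed (S \<inter> (\<lambda>p. norm (u p)) -` {..r})" using S(1) closedin_closed_trans by blast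
    then show ?thesis by (simp add: vimage_def Int_def borel_closed)
  qed
  have S_borel: "S \<in> sets borel" using S by simp
  have F_eq: "F k = {p \<in> S. norm (u p) \<le> T * 2 ^ Suc k} - {p \<in> S. norm (u p) \<le> T * 2 ^ k}" for k
    by (auto simp: F_def not_le)
  have F [measurable]: "F k \<in> sets borel" for k unfolding F_eq using lev by blast
  have FS: "F k \<subseteq> S" for k by (auto simp: F_def)
  have HF: "hausdorff_outer s (F k) = emeasure ?H (F k)" for k
    by (rule emeasure_hausdorff_measure[symmetric]) simp
  have "hausdorff_outer s (F k) < \<infinity>" for k
    using emeasure_mono[of "F k" S ?H] FS S_borel fin unfolding HF by (auto intro: le_less_trans)
  \<comment> \<open>Chosen such that T 2^(k+1) \<epsilon> k = e / 2^(k+1): after weighting with the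
    level value the errors add up to e.\<close>
  define \<epsilon> where "\<epsilon> k = e / T / 2 ^ Suc k * (1/2) ^ Suc k" for k :: nat
  have \<epsilon>: "\<epsilon> k > 0" for k using e T by (simp add: \<epsilon>_def)
  define Q where "Q k y d \<longleftrightarrow> (\<forall>i. y i \<in> S \<and> d i > 0) \<and> F k \<subseteq> (\<Union>i. ball (y i) (d i)) \<and>
    (\<Sum>i. ennreal (?b * (d i / 2) powr s)) \<le> emeasure ?H (F k) + ennreal (\<epsilon> k)" for k and y :: "nat \<Rightarrow> 'a" and d
  have "\<exists>y d. Q k y d" for k
    using hausdorff_cover_balls[OF s \<open>hausdorff_outer s (F k) < \<infinity>\<close> \<epsilon> FS S(2)] unfolding HF Q_def .
  then obtain y d where "\<And>k. Q k (y k) (d k)" by metis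
  then have yd: "\<And>k i. y k i \<in> S \<and> d k i > 0"
     "\<And>k. F k \<subseteq> (\<Union>i. ball (y k i) (d k i))"
     "\<And>k. (\<Sum>i. ennreal (?b * (d k i / 2) powr s)) \<le> emeasure ?H (F k) + ennreal (\<epsilon> k)"
    unfolding Q_def by blast+
  define v where "v j = T * 2 ^ Suc (fst (prod_decode j))" for j
  define y' where "y' j = y (fst (prod_decode j)) (snd (prod_decode j))" for j
  define d' where "d' j = d (fst (prod_decode j)) (snd (prod_decode j))" for j
  have "\<exists>j. p \<in> ball (y' j) (d' j) \<and> norm (u p) \<le> v j" if p: "p \<in> S" "T < norm (u p)" for p
  proof -
    obtain k0 where k0: "norm (u p) / T < 2 ^ k0" using real_arch_pow[of 2] by auto
    then have "norm (u p) \<le> T * 2 ^ k0" using T by (simp add: field_simps)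
    also have "\<dots> \<le> T * 2 ^ Suc k0" using T by simp
    finally have k0': "norm (u p) \<le> T * 2 ^ Suc k0" .
    define k where "k = (LEAST k. norm (u p) \<le> T * 2 ^ Suc k)"
    have k: "norm (u p) \<le> T * 2 ^ Suc k" unfolding k_def using k0' by (rule LeastI)
    have "T * 2 ^ k < norm (u p)"
    proof (cases k)
      case (Suc i)
      then have "i < (LEAST k. norm (u p) \<le> T * 2 ^ Suc k)" unfolding k_def by simp
      then have "\<not> norm (u p) \<le> T * 2 ^ Suc i" by (rule not_less_Least)
      then show ?thesis using Suc by simp
    qed (use p in simp)
    then have "p \<in> F k" using p k by (simp add: F_def)
    then obtain i where "p \<in> ball (y k i) (d k i)" using yd(2) by blast
    then show ?thesis using k by (intro exI[of _ "prod_encode (k, i)"]) (simp add: y'_def d'_def v_def)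
  qed
  moreover have "(\<Sum>j. ennreal (v j * d' j powr s)) \<le> ennreal (2 * 2 powr s / ?b) *
      ((\<integral>\<^sup>+ p. indicator {p \<in> S. T < norm (u p)} p * ennreal (norm (u p)) \<partial>?H) + ennreal e)"
  proof -
    have "(\<Sum>j. ennreal (v j * d' j powr s)) = (\<Sum>k. \<Sum>i. ennreal (T * 2 ^ Suc k * d k i powr s))"
      using suminf_ennreal_2dimen[of "\<lambda>k. \<Sum>i. ennreal (T * 2 ^ Suc k * d k i powr s)" "\<lambda>(k, i). ennreal (T * 2 ^ Suc k * d k i powr s)"]
      by (simp add: v_def d'_def case_prod_unfold)
    also have "\<dots> \<le> (\<Sum>k. ennreal (2 powr s / ?b) * (ennreal (T * 2 ^ Suc k) * (emeasure ?H (F k) + ennreal (\<epsilon> k))))"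
    proof (rule suminf_le)
      fix k
      have "ennreal (T * 2 ^ Suc k * d k i powr s) = ennreal (2 powr s / ?b) * (ennreal (T * 2 ^ Suc k) * ennreal (?b * (d k i / 2) powr s))" for i
        using b T yd(1)[of k i] by (simp add: ennreal_mult'[symmetric] powr_divide)
      then have "(\<Sum>i. ennreal (T * 2 ^ Suc k * d k i powr s)) = ennreal (2 powr s / ?b) * (ennreal (T * 2 ^ Suc k) * (\<Sum>i. ennreal (?b * (d k i / 2) powr s)))"
        by simp
      then show "(\<Sum>i. ennreal (T * 2 ^ Suc k * d k i powr s)) \<le> ennreal (2 powr s / ?b) * (ennreal (T * 2 ^ Suc k) * (emeasure ?H (F k) + ennreal (\<epsilon> k)))"
        using yd(3)[of k] by (simp add: mult_left_mono)
    qed auto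
    also have "\<dots> = ennreal (2 powr s / ?b) * ((\<Sum>k. ennreal (T * 2 ^ Suc k) * emeasure ?H (F k)) + (\<Sum>k. ennreal (T * 2 ^ Suc k) * ennreal (\<epsilon> k)))"
    proof -
      have "(\<Sum>k. ennreal (T * 2 ^ Suc k) * (emeasure ?H (F k) + ennreal (\<epsilon> k))) =
          (\<Sum>k. ennreal (T * 2 ^ Suc k) * emeasure ?H (F k)) + (\<Sum>k. ennreal (T * 2 ^ Suc k) * ennreal (\<epsilon> k))"
        by (subst suminf_add) (simp_all only: summableI distrib_left)
      then show ?thesis by (simp only: ennreal_suminf_cmult)
    qed
    also have "(\<Sum>k. ennreal (T * 2 ^ Suc k) * ennreal (\<epsilon> k)) = (\<Sum>k. ennreal (e * (1/2) ^ Suc k))"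
      using T e by (intro suminf_cong) (simp add: \<epsilon>_def ennreal_mult'[symmetric])
    also have "(\<Sum>k. ennreal (e * (1/2) ^ Suc k)) = ennreal e"
      using e sums_mult[OF power_half_series, of e] by (intro suminf_ennreal_eq) auto
    also have "(\<Sum>k. ennreal (T * 2 ^ Suc k) * emeasure ?H (F k)) = (\<integral>\<^sup>+ p. (\<Sum>k. ennreal (T * 2 ^ Suc k) * indicator (F k) p) \<partial>?H)"
      by (subst nn_integral_suminf) (simp_all add: nn_integral_cmult_indicator)
    also have "\<dots> \<le> (\<integral>\<^sup>+ p. 2 * (indicator {p \<in> S. T < norm (u p)} p * ennreal (norm (u p))) \<partial>?H)"
    proof (rule nn_integral_mono)
      fix p
      have sep: False if "i < j" "q \<in> F i" "q \<in> F j" for i j q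
      proof -
        have "(2::real) ^ Suc i \<le> 2 ^ j" using that by (intro power_increasing) auto
        then have "T * 2 ^ Suc i \<le> T * 2 ^ j" using T by simp
        then show False using that by (simp add: F_def)
      qed
      have disj: "disjoint_family F"
        unfolding disjoint_family_on_def
      proof (intro ballI impI, rule equals0I)
        fix i j q assume "i \<noteq> j" "q \<in> F i \<inter> F j"
        then show False using sep[of i j q] sep[of j i q] by (cases "i < j") auto
      qed
      show "(\<Sum>k. ennreal (T * 2 ^ Suc k) * indicator (F k) p) \<le> 2 * (indicator {p \<in> S. T < norm (u p)} p * ennreal (norm (u p)))"
      proof (cases "\<exists>k. p \<in> F k")
        case True
        then obtain k where k: "p \<in> F k" by blast
        have "1 * T \<le> 2 ^ k * T" using T by (intro mult_right_mono) auto
        then have "p \<in> {p \<in> S. T < norm (u p)}" using k by (auto simp: F_def mult.commute)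
        moreover have "ennreal (T * 2 ^ Suc k) \<le> 2 * ennreal (norm (u p))"
          using k T by (auto simp: F_def ennreal_numeral[symmetric] ennreal_mult'[symmetric] simp del: ennreal_numeral intro!: ennreal_leI)
        ultimately show ?thesis using suminf_cmult_indicator[OF disj k, of "\<lambda>k. ennreal (T * 2 ^ Suc k)"] by simp
      qed simp
    qed
    also have "\<dots> = 2 * (\<integral>\<^sup>+ p. indicator {p \<in> S. T < norm (u p)} p * ennreal (norm (u p)) \<partial>?H)"
    proof (rule nn_integral_cmult)
      have "(\<lambda>p. indicator {p \<in> S. T < norm (u p)} p * ennreal (norm (u p))) = (\<lambda>p. ennreal (if T < indicator S p * norm (u p) then indicator S p * norm (u p) else 0))"
        using T by (auto simp: indicator_def fun_eq_iff)
      moreover have "(\<lambda>p. indicator S p *\<^sub>R norm (u p)) \<in> borel_measurable borel"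
        using borel_measurable_continuous_on_indicator[OF S_borel, of "\<lambda>p. norm (u p)"] u by (simp add: continuous_on_norm)
      then have [measurable]: "(\<lambda>p. indicator S p * norm (u p)) \<in> borel_measurable borel" by simp
      ultimately show "(\<lambda>p. indicator {p \<in> S. T < norm (u p)} p * ennreal (norm (u p))) \<in> borel_measurable ?H"
        by simp
    qed
    finally have "(\<Sum>j. ennreal (v j * d' j powr s)) \<le> ennreal (2 powr s / ?b) *
       (2 * (\<integral>\<^sup>+ p. indicator {p \<in> S. T < norm (u p)} p * ennreal (norm (u p)) \<partial>?H) + ennreal e)"
      by (simp add: mult_left_mono)
    also have "\<dots> \<le> ennreal (2 powr s / ?b) *
       (2 * (\<integral>\<^sup>+ p. indicator {p \<in> S. T < norm (u p)} p * ennreal (norm (u p)) \<partial>?H) + 2 * ennreal e)"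
      using e by (intro mult_left_mono add_left_mono) (auto simp: ennreal_numeral[symmetric] ennreal_mult'[symmetric] simp del: ennreal_numeral intro!: ennreal_leI)
    also have "\<dots> = ennreal (2 * 2 powr s / ?b) *
       ((\<integral>\<^sup>+ p. indicator {p \<in> S. T < norm (u p)} p * ennreal (norm (u p)) \<partial>?H) + ennreal e)"
    proof -
      have "ennreal (2 * 2 powr s / ?b) = ennreal (2 powr s / ?b) * 2"
        using b by (simp add: ennreal_numeral[symmetric] ennreal_mult'[symmetric] del: ennreal_numeral)
      then show ?thesis by (simp add: distrib_left mult.assoc)
    qed
    finally show ?thesis .
  qed
  moreover have "v j \<ge> 0 \<and> y' j \<in> S \<and> d' j > 0" for j
    using yd(1) T by (simp add: v_def y'_def d'_def)
  ultimately show ?thesis by blast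
qed

text \<open>The growth condition is given for centres in \<Omega>, but the kernel estimate needs
  centres anywhere, in particular on the frontier. A ball that meets \<Omega> lies in the ball of
  twice the radius about a point of \<Omega>, whence the factor 2^\<alpha>.\<close>

lemma frostman_recenter:
  fixes \<mu> :: "'a::metric_space measure"
  assumes frost: "\<forall>x\<in>\<Omega>. \<forall>r>0. emeasure \<mu> (ball x r \<inter> \<Omega>) \<le> ennreal (c * r powr \<alpha>)"
    and "sets \<mu> = sets (restrict_space borel \<Omega>)" and "r > 0" and \<Omega>: "open \<Omega>"
  shows "emeasure \<mu> {x \<in> space \<mu>. dist x y < r} \<le> ennreal ((c * 2 powr \<alpha>) * r powr \<alpha>)"
proof -
  have sp: "space \<mu> = \<Omega>" using sets_eq_imp_space_eq[OF assms(2)] by (simp add: space_restrict_space)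
  show ?thesis
  proof (cases "\<exists>x0\<in>\<Omega>. dist x0 y < r")
    case True
    then obtain x0 where x0: "x0 \<in> \<Omega>" "dist x0 y < r" by blast
    have "{x \<in> space \<mu>. dist x y < r} \<subseteq> ball x0 (2 * r) \<inter> \<Omega>"
    proof
      fix x assume "x \<in> {x \<in> space \<mu>. dist x y < r}"
      then have "x \<in> \<Omega>" "dist x y < r" by (auto simp: sp)
      then show "x \<in> ball x0 (2 * r) \<inter> \<Omega>" using dist_triangle[of x0 x y] x0 by (auto simp: dist_commute)
    qed
    then have "emeasure \<mu> {x \<in> space \<mu>. dist x y < r} \<le> emeasure \<mu> (ball x0 (2 * r) \<inter> \<Omega>)"
      using \<Omega> by (intro emeasure_mono) (auto simp: assms(2) sets_restrict_space)
    also have "\<dots> \<le> ennreal (c * (2 * r) powr \<alpha>)" using frost x0 \<open>r > 0\<close> by auto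
    also have "c * (2 * r) powr \<alpha> = (c * 2 powr \<alpha>) * r powr \<alpha>" using \<open>r > 0\<close> by (simp add: powr_mult)
    finally show ?thesis .
  next
    case False
    then have "{x \<in> space \<mu>. dist x y < r} = {}" using sp by auto
    then show ?thesis by (simp only: emeasure_empty zero_le)
  qed
qed

text \<open>The pointwise representation is integrated over E against \<mu>. What is bounded
  pointwise, namely the potential of \<open>f1\<close> and the boundary values up to T, costs a
  factor \<mu>(E). In the remaining potentials, of \<open>f2\<close> and of the cover of the large
  boundary values, Fubini leaves the integral of the kernel over E, which
  \<open>nn_integral_kernel_frostman\<close> bounds by a multiple of \<mu>(E)^(1 -
  (n-1)/\<alpha>).\<close>

lemma core_estimate:
  fixes \<alpha> c :: real
  assumes n2: "CARD('n::finite) \<ge> 2" and \<alpha>: "real CARD('n) - 1 < \<alpha>" and c: "c > 0"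
  shows "\<exists>C>0. \<forall>(\<Omega> :: (real ^ 'n) set) \<mu> u G f f1 f2 P T E.
    open \<Omega> \<and> \<Omega> \<noteq> UNIV \<and> sets \<mu> = sets (restrict_space borel \<Omega>) \<and>
    (\<forall>x\<in>\<Omega>. \<forall>r>0. emeasure \<mu> (ball x r \<inter> \<Omega>) \<le> ennreal (c * r powr \<alpha>)) \<and> emeasure \<mu> \<Omega> < \<infinity> \<and>
    emeasure (hausdorff_measure (real CARD('n) - 1)) (frontier \<Omega>) < \<infinity> \<and>
    u \<in> Cb (closure \<Omega>) \<and> has_sym_grad \<Omega> u G \<and>
    f \<in> borel_measurable borel \<and> (AE y in lebesgue. f y = indicator \<Omega> y * ennreal (norm (G y))) \<and>
    f1 \<in> borel_measurable borel \<and> f2 \<in> borel_measurable borel \<and> (\<forall>y. f y \<le> f1 y + f2 y) \<and>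
    (\<forall>x. (\<integral>\<^sup>+ y. riesz_kernel (y - x) * f1 y \<partial>lborel) \<le> P) \<and> T > 0 \<and> E \<in> sets \<mu> \<longrightarrow>
    (\<integral>\<^sup>+ x. indicator E x * ennreal (norm (u x)) \<partial>\<mu>) \<le> ennreal C *
      (emeasure \<mu> E * (P + ennreal T) + ennreal (measure \<mu> E powr (1 - (real CARD('n) - 1) / \<alpha>)) *
        ((\<integral>\<^sup>+ y. f2 y \<partial>lborel) +
         (\<integral>\<^sup>+ p. indicator {p \<in> frontier \<Omega>. T < norm (u p)} p * ennreal (norm (u p)) \<partial>hausdorff_measure (real CARD('n) - 1))))"
proof -
  let ?n = "real CARD('n)" and ?s = "real CARD('n) - 1"
  have s: "?s > 0" using n2 by simp
  obtain C1 where C1: "C1 > 0" "\<And>\<Omega> (u :: real ^ 'n \<Rightarrow> real ^ 'n) G f b x.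
    open \<Omega> \<and> u \<in> Cb (closure \<Omega>) \<and> has_sym_grad \<Omega> u G \<and> x \<in> \<Omega> \<and>
    f \<in> borel_measurable borel \<and> (AE y in lebesgue. f y = indicator \<Omega> y * ennreal (norm (G y))) \<and>
    b \<in> borel_measurable borel \<and>
    (\<forall>z\<in>ball 0 1. \<forall>t>0. x + t *\<^sub>R z \<in> frontier \<Omega> \<longrightarrow> ennreal (norm (u (x + t *\<^sub>R z))) \<le> b z) \<Longrightarrow>
    ennreal (norm (u x)) \<le> ennreal C1 * ((\<integral>\<^sup>+ z. indicator (ball 0 1) z * b z \<partial>lborel)
        + (\<integral>\<^sup>+ y. riesz_kernel (y - x) * f y \<partial>lborel))"
    using pointwise_representation[OF n2] by blast
  obtain C2 where C2: "C2 > 0" "\<And>(x :: real ^ 'n) y d. d > 0 \<Longrightarrow> y \<noteq> x \<Longrightarrow>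
    emeasure lborel (ray_tube x y d) \<le> ennreal (C2 * d powr ?s) * riesz_kernel (x - y)"
    using emeasure_ray_tube_le[where 'a = "real ^ 'n"] n2 by auto
  define C3 where "C3 = 1 + (c * 2 powr \<alpha>) * 2 powr ?s / (1 - 2 powr (?s - \<alpha>))"
  have "2 powr (?s - \<alpha>) < 1" using \<alpha> by (simp add: powr_less_one)
  then have C3: "C3 > 0" using c by (simp add: C3_def add_pos_nonneg)
  define C4 where "C4 = 2 * 2 powr ?s / unit_ball_vol ?s"
  have C4: "C4 > 0" using s by (simp add: C4_def)
  let ?\<omega> = "unit_ball_vol ?n"
  \<comment> \<open>The maximum dominates the coefficients of the four terms: 1 for P, the volume of
    the unit ball for T, C3 for \<open>f2\<close>, and C2 C3 C4 for the boundary integral.\<close>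
  define C where "C = C1 * max (max 1 ?\<omega>) (max C3 (C2 * C3 * C4))"
  have "C > 0" using C1 by (simp add: C_def less_max_iff_disj)
  have "(\<integral>\<^sup>+ x. indicator E x * ennreal (norm (u x)) \<partial>\<mu>) \<le> ennreal C *
      (emeasure \<mu> E * (P + ennreal T) + ennreal (measure \<mu> E powr (1 - ?s / \<alpha>)) *
        ((\<integral>\<^sup>+ y. f2 y \<partial>lborel) +
         (\<integral>\<^sup>+ p. indicator {p \<in> frontier \<Omega>. T < norm (u p)} p * ennreal (norm (u p)) \<partial>hausdorff_measure ?s)))"
    if \<Omega>: "open \<Omega>" and nU: "\<Omega> \<noteq> UNIV" and sets\<mu>: "sets \<mu> = sets (restrict_space borel \<Omega>)"
    and frost: "\<forall>x\<in>\<Omega>. \<forall>r>0. emeasure \<mu> (ball x r \<inter> \<Omega>) \<le> ennreal (c * r powr \<alpha>)" and fin: "emeasure \<mu> \<Omega> < \<infinity>"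
    and H: "emeasure (hausdorff_measure ?s) (frontier \<Omega>) < \<infinity>"
    and u: "u \<in> Cb (closure \<Omega>)" and G: "has_sym_grad \<Omega> u G"
    and f [measurable]: "f \<in> borel_measurable borel" and fG: "AE y in lebesgue. f y = indicator \<Omega> y * ennreal (norm (G y))"
    and f1 [measurable]: "f1 \<in> borel_measurable borel" and f2 [measurable]: "f2 \<in> borel_measurable borel"
    and f12: "\<forall>y. f y \<le> f1 y + f2 y"
    and P: "\<forall>x. (\<integral>\<^sup>+ y. riesz_kernel (y - x) * f1 y \<partial>lborel) \<le> P" and T: "T > 0" and E: "E \<in> sets \<mu>"
    for \<Omega> :: "(real ^ 'n) set" and \<mu> u G f f1 f2 P T E
  proof -
    let ?M = "ennreal (measure \<mu> E powr (1 - ?s / \<alpha>))"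
    let ?B = "(\<integral>\<^sup>+ p. indicator {p \<in> frontier \<Omega>. T < norm (u p)} p * ennreal (norm (u p)) \<partial>hausdorff_measure ?s)"
    have sp: "space \<mu> = \<Omega>" using sets_eq_imp_space_eq[OF sets\<mu>] by (simp add: space_restrict_space)
    interpret \<mu>: finite_measure \<mu> using fin by (intro finite_measureI) (simp add: sp)
    interpret lmu: pair_sigma_finite \<mu> "lborel :: (real ^ 'n) measure" ..
    note E [measurable]
    have id: "(\<lambda>x. x) \<in> measurable \<mu> borel"
      by (subst measurable_cong_sets[OF sets\<mu> refl]) (rule measurable_restrict_space1, simp)
    have kern: "(\<integral>\<^sup>+ x. indicator E x * riesz_kernel (x - y) \<partial>\<mu>) \<le> ennreal C3 * ?M" for y
    proof -
      have "(\<integral>\<^sup>+ x. indicator E x * ennreal (norm (x - y) powr (- ?s)) \<partial>\<mu>) \<le>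
         ennreal (C3 * measure \<mu> E powr (1 - ?s / \<alpha>))"
        unfolding C3_def
        by (rule nn_integral_kernel_frostman[OF id frostman_recenter[OF frost sets\<mu> _ \<Omega>]])
           (use s \<alpha> c E \<mu>.emeasure_finite[of E] in \<open>auto simp: less_top[symmetric]\<close>)
      then show ?thesis using C3 by (simp add: riesz_kernel_def ennreal_mult)
    qed
    have main: "(\<integral>\<^sup>+ x. indicator E x * ennreal (norm (u x)) \<partial>\<mu>) \<le> ennreal C1 *
        (emeasure \<mu> E * (ennreal (T * ?\<omega>) + P) + ennreal C3 * ?M * (\<integral>\<^sup>+ y. f2 y \<partial>lborel) + ennreal C3 * ?M * K)"
      if vyd: "\<And>j. v j \<ge> 0 \<and> y j \<notin> \<Omega> \<and> d j > 0"
        and cov: "\<And>p. p \<in> frontier \<Omega> \<Longrightarrow> T < norm (u p) \<Longrightarrow> \<exists>j. p \<in> ball (y j) (d j) \<and> norm (u p) \<le> v j"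
        and K: "K = (\<Sum>j. ennreal (C2 * (v j * d j powr ?s)))"
      for v d :: "nat \<Rightarrow> real" and y K
    proof -
      have pw: "ennreal (norm (u x)) \<le> ennreal C1 * (ennreal (T * ?\<omega>) + P + (\<integral>\<^sup>+ y. riesz_kernel (y - x) * f2 y \<partial>lborel)
          + (\<Sum>j. ennreal (C2 * (v j * d j powr ?s)) * riesz_kernel (x - y j)))"
        if x: "x \<in> \<Omega>" for x
      proof -
        \<comment> \<open>Wherever a ray in direction z meets the frontier, |u| is either at most T
          or at most the value v j of a ball that contains the meeting point, and then z lies in the
          tube of that ball. This sum is measurable in z, while the first exit value need not
          be.\<close>
        define b where "b z = ennreal T + (\<Sum>j. ennreal (v j) * indicator (ray_tube x (y j) (d j)) z)" for z
        have b [measurable]: "b \<in> borel_measurable borel" unfolding b_def[abs_def] by measurable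
        have [measurable]: "ball (0 :: real ^ 'n) 1 \<in> sets borel" by simp
        have bb: "ennreal (norm (u (x + t *\<^sub>R z))) \<le> b z"
          if z: "z \<in> ball 0 1" "t > 0" "x + t *\<^sub>R z \<in> frontier \<Omega>" for z t
        proof (cases "T < norm (u (x + t *\<^sub>R z))")
          case True
          then obtain j where j: "x + t *\<^sub>R z \<in> ball (y j) (d j)" "norm (u (x + t *\<^sub>R z)) \<le> v j"
            using cov z by blast
          then have "z \<in> ray_tube x (y j) (d j)" using z by (auto simp: ray_tube_def dist_commute)
          then have "ennreal (norm (u (x + t *\<^sub>R z))) \<le> ennreal (v j) * indicator (ray_tube x (y j) (d j)) z"
            using j by (simp add: ennreal_leI)
          also have "\<dots> \<le> (\<Sum>j. ennreal (v j) * indicator (ray_tube x (y j) (d j)) z)" by (rule ennreal_le_suminf)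
          finally show ?thesis by (simp add: b_def add_increasing)
        next
          case False
          then have "ennreal (norm (u (x + t *\<^sub>R z))) \<le> ennreal T" by (intro ennreal_leI) simp
          then show ?thesis by (simp add: b_def add_increasing2)
        qed
        have "ennreal (norm (u x)) \<le> ennreal C1 * ((\<integral>\<^sup>+ z. indicator (ball 0 1) z * b z \<partial>lborel)
             + (\<integral>\<^sup>+ y. riesz_kernel (y - x) * f y \<partial>lborel))"
          by (rule C1(2)[of \<Omega> u G x f b]) (intro conjI ballI allI impI \<Omega> u G x f fG b bb)
        also have "\<dots> \<le> ennreal C1 * ((ennreal (T * ?\<omega>) + (\<Sum>j. ennreal (C2 * (v j * d j powr ?s)) * riesz_kernel (x - y j)))
             + (P + (\<integral>\<^sup>+ y. riesz_kernel (y - x) * f2 y \<partial>lborel)))"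
        proof (intro mult_left_mono add_mono)
          have "(\<integral>\<^sup>+ z. indicator (ball 0 1) z * b z \<partial>lborel) \<le>
             (\<integral>\<^sup>+ z. ennreal T * indicator (ball 0 1) z + (\<Sum>j. ennreal (v j) * indicator (ray_tube x (y j) (d j)) z) \<partial>lborel)"
            by (intro nn_integral_mono) (auto simp: b_def indicator_def)
          also have "\<dots> = ennreal T * emeasure lborel (ball (0 :: real ^ 'n) 1) + (\<Sum>j. ennreal (v j) * emeasure lborel (ray_tube x (y j) (d j)))"
            by (subst nn_integral_add, simp, simp, subst nn_integral_suminf) (simp_all add: nn_integral_cmult_indicator)
          also have "\<dots> \<le> ennreal (T * ?\<omega>) + (\<Sum>j. ennreal (C2 * (v j * d j powr ?s)) * riesz_kernel (x - y j))"
          proof (intro add_mono suminf_le)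
            show "ennreal T * emeasure lborel (ball (0 :: real ^ 'n) 1) \<le> ennreal (T * ?\<omega>)"
              using T by (simp add: emeasure_ball ennreal_mult)
            fix j
            have "ennreal (v j) * emeasure lborel (ray_tube x (y j) (d j)) \<le> ennreal (v j) * (ennreal (C2 * d j powr ?s) * riesz_kernel (x - y j))"
              using vyd[of j] x by (intro mult_left_mono C2(2)) auto
            also have "\<dots> = ennreal (C2 * (v j * d j powr ?s)) * riesz_kernel (x - y j)"
            proof -
              have "C2 * (v j * d j powr ?s) = v j * (C2 * d j powr ?s)" by simp
              moreover have "ennreal (v j * (C2 * d j powr ?s)) = ennreal (v j) * ennreal (C2 * d j powr ?s)"
                using vyd[of j] C2(1) by (intro ennreal_mult) auto
              ultimately have "ennreal (C2 * (v j * d j powr ?s)) = ennreal (v j) * ennreal (C2 * d j powr ?s)"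
                by (simp only:)
              then show ?thesis by (simp only: mult.assoc)
            qed
            finally show "ennreal (v j) * emeasure lborel (ray_tube x (y j) (d j)) \<le> ennreal (C2 * (v j * d j powr ?s)) * riesz_kernel (x - y j)" .
          qed auto
          finally show "(\<integral>\<^sup>+ z. indicator (ball 0 1) z * b z \<partial>lborel) \<le> ennreal (T * ?\<omega>) + (\<Sum>j. ennreal (C2 * (v j * d j powr ?s)) * riesz_kernel (x - y j))" .
        next
          have "(\<integral>\<^sup>+ y. riesz_kernel (y - x) * f y \<partial>lborel) \<le> (\<integral>\<^sup>+ y. riesz_kernel (y - x) * f1 y + riesz_kernel (y - x) * f2 y \<partial>lborel)"
            using f12 by (intro nn_integral_mono) (simp add: distrib_left[symmetric] mult_left_mono)
          also have "\<dots> = (\<integral>\<^sup>+ y. riesz_kernel (y - x) * f1 y \<partial>lborel) + (\<integral>\<^sup>+ y. riesz_kernel (y - x) * f2 y \<partial>lborel)"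
            by (rule nn_integral_add) measurable
          also have "\<dots> \<le> P + (\<integral>\<^sup>+ y. riesz_kernel (y - x) * f2 y \<partial>lborel)"
            using P by (intro add_right_mono) auto
          finally show "(\<integral>\<^sup>+ y. riesz_kernel (y - x) * f y \<partial>lborel) \<le> P + (\<integral>\<^sup>+ y. riesz_kernel (y - x) * f2 y \<partial>lborel)" .
        qed simp
        finally show ?thesis by (simp add: ac_simps)
      qed
      have pm: "(\<lambda>p. riesz_kernel (snd p - fst p) * f2 (snd p)) \<in> borel_measurable (borel \<Otimes>\<^sub>M borel)" by measurable
      have "(\<lambda>p. (fst p, snd p)) \<in> measurable (\<mu> \<Otimes>\<^sub>M lborel) (borel \<Otimes>\<^sub>M (borel :: (real ^ 'n) measure))"
        by (intro measurable_Pair measurable_compose[OF measurable_fst id] measurable_compose[OF measurable_snd]) simp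
      from measurable_compose[OF this pm]
      have pm2 [measurable]: "(\<lambda>p. riesz_kernel (snd p - fst p) * f2 (snd p)) \<in> borel_measurable (\<mu> \<Otimes>\<^sub>M lborel)" by simp
      have f2m [measurable]: "(\<lambda>x. \<integral>\<^sup>+ y. riesz_kernel (y - x) * f2 y \<partial>lborel) \<in> borel_measurable \<mu>"
        by (rule lborel.borel_measurable_nn_integral) (use pm2 in \<open>simp add: case_prod_unfold\<close>)
      have rk [measurable]: "(\<lambda>x. riesz_kernel (x - q)) \<in> borel_measurable \<mu>" for q
        by (rule measurable_compose[OF id]) measurable
      have "(\<integral>\<^sup>+ x. indicator E x * ennreal (norm (u x)) \<partial>\<mu>) \<le>
        (\<integral>\<^sup>+ x. ennreal C1 * ((ennreal (T * ?\<omega>) + P) * indicator E x + indicator E x * (\<integral>\<^sup>+ y. riesz_kernel (y - x) * f2 y \<partial>lborel)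
          + (\<Sum>j. ennreal (C2 * (v j * d j powr ?s)) * (indicator E x * riesz_kernel (x - y j)))) \<partial>\<mu>)"
        by (intro nn_integral_mono) (use pw sp in \<open>auto simp: indicator_def\<close>)
      also have "\<dots> = ennreal C1 * ((ennreal (T * ?\<omega>) + P) * emeasure \<mu> E + (\<integral>\<^sup>+ x. indicator E x * (\<integral>\<^sup>+ y. riesz_kernel (y - x) * f2 y \<partial>lborel) \<partial>\<mu>)
          + (\<Sum>j. ennreal (C2 * (v j * d j powr ?s)) * (\<integral>\<^sup>+ x. indicator E x * riesz_kernel (x - y j) \<partial>\<mu>)))"
        by (simp add: nn_integral_cmult nn_integral_add nn_integral_suminf nn_integral_cmult_indicator)
      also have "(\<integral>\<^sup>+ x. indicator E x * (\<integral>\<^sup>+ y. riesz_kernel (y - x) * f2 y \<partial>lborel) \<partial>\<mu>) =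
          (\<integral>\<^sup>+ x. \<integral>\<^sup>+ y. indicator E x * (riesz_kernel (y - x) * f2 y) \<partial>lborel \<partial>\<mu>)"
        by (subst nn_integral_cmult[symmetric]) auto
      also have "\<dots> = (\<integral>\<^sup>+ y. \<integral>\<^sup>+ x. indicator E x * (riesz_kernel (y - x) * f2 y) \<partial>\<mu> \<partial>lborel)"
      proof (rule lmu.Fubini'[symmetric])
        have "(\<lambda>p. indicator E (fst p) * (riesz_kernel (snd p - fst p) * f2 (snd p))) \<in> borel_measurable (\<mu> \<Otimes>\<^sub>M lborel)"
          by measurable
        then show "(\<lambda>(x, y). indicator E x * (riesz_kernel (y - x) * f2 y)) \<in> borel_measurable (\<mu> \<Otimes>\<^sub>M lborel)"
          by (simp add: case_prod_unfold)
      qed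
      also have "\<dots> \<le> (\<integral>\<^sup>+ y. (ennreal C3 * ?M) * f2 y \<partial>lborel)"
      proof (rule nn_integral_mono)
        fix q
        have "(\<integral>\<^sup>+ x. indicator E x * (riesz_kernel (q - x) * f2 q) \<partial>\<mu>) = (\<integral>\<^sup>+ x. indicator E x * riesz_kernel (x - q) \<partial>\<mu>) * f2 q"
          by (subst nn_integral_multc[symmetric]) (auto simp: mult.assoc riesz_kernel_minus_commute[of q])
        also have "\<dots> \<le> (ennreal C3 * ?M) * f2 q" by (intro mult_right_mono kern) simp
        finally show "(\<integral>\<^sup>+ x. indicator E x * (riesz_kernel (q - x) * f2 q) \<partial>\<mu>) \<le> (ennreal C3 * ?M) * f2 q" .
      qed
      also have "\<dots> = (ennreal C3 * ?M) * (\<integral>\<^sup>+ y. f2 y \<partial>lborel)" by (rule nn_integral_cmult) simp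
      also have "(\<Sum>j. ennreal (C2 * (v j * d j powr ?s)) * (\<integral>\<^sup>+ x. indicator E x * riesz_kernel (x - y j) \<partial>\<mu>))
          \<le> (\<Sum>j. ennreal (C2 * (v j * d j powr ?s)) * (ennreal C3 * ?M))"
        by (intro suminf_le mult_left_mono kern) auto
      also have "\<dots> = ennreal C3 * ?M * K" by (simp add: K mult.commute)
      finally show ?thesis
        by (simp add: mult.commute[of "emeasure \<mu> E"] add_left_mono add_right_mono mult_left_mono)
    qed
    have fin_step: "(\<integral>\<^sup>+ x. indicator E x * ennreal (norm (u x)) \<partial>\<mu>) \<le> ennreal C *
      (emeasure \<mu> E * (P + ennreal T) + ?M * ((\<integral>\<^sup>+ y. f2 y \<partial>lborel) + L))"
      if "(\<integral>\<^sup>+ x. indicator E x * ennreal (norm (u x)) \<partial>\<mu>) \<le> ennreal C1 *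
        (emeasure \<mu> E * (ennreal (T * ?\<omega>) + P) + ennreal C3 * ?M * (\<integral>\<^sup>+ y. f2 y \<partial>lborel) + ennreal C3 * ?M * (ennreal (C2 * C4) * L))" for L
    proof -
      define D where "D = max (max 1 ?\<omega>) (max C3 (C2 * C3 * C4))"
      have D: "D \<ge> 1" "D \<ge> ?\<omega>" "D \<ge> C3" "D \<ge> C2 * C3 * C4" "D \<ge> 0" by (auto simp: D_def)
      have "emeasure \<mu> E * (ennreal (T * ?\<omega>) + P) + ennreal C3 * ?M * (\<integral>\<^sup>+ y. f2 y \<partial>lborel) + ennreal C3 * ?M * (ennreal (C2 * C4) * L)
         \<le> emeasure \<mu> E * (ennreal D * ennreal T + ennreal D * P) + ennreal D * ?M * (\<integral>\<^sup>+ y. f2 y \<partial>lborel) + ennreal D * ?M * L"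
      proof (intro add_mono mult_left_mono mult_right_mono)
        show "ennreal (T * ?\<omega>) \<le> ennreal D * ennreal T"
          using D T by (simp add: ennreal_mult[symmetric] mult.commute mult_right_mono ennreal_leI)
        have "1 * P \<le> ennreal D * P" using D by (intro mult_right_mono) auto
        then show "P \<le> ennreal D * P" by simp
        have "ennreal C3 * ?M * (ennreal (C2 * C4) * L) = ennreal (C2 * C3 * C4) * (?M * L)"
          using C2(1) C3 C4 by (simp add: ennreal_mult mult_ac)
        also have "\<dots> \<le> ennreal D * (?M * L)" using D by (intro mult_right_mono ennreal_leI) auto
        finally show "ennreal C3 * ?M * (ennreal (C2 * C4) * L) \<le> ennreal D * ?M * L" by (simp add: mult.assoc)
      qed (use D in \<open>auto intro: ennreal_leI\<close>)
      also have "\<dots> = ennreal D * (emeasure \<mu> E * (P + ennreal T) + ?M * ((\<integral>\<^sup>+ y. f2 y \<partial>lborel) + L))"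
        by (simp only: distrib_left distrib_right mult_ac add_ac)
      finally have "ennreal C1 * (emeasure \<mu> E * (ennreal (T * ?\<omega>) + P) + ennreal C3 * ?M * (\<integral>\<^sup>+ y. f2 y \<partial>lborel) + ennreal C3 * ?M * (ennreal (C2 * C4) * L))
         \<le> ennreal C1 * (ennreal D * (emeasure \<mu> E * (P + ennreal T) + ?M * ((\<integral>\<^sup>+ y. f2 y \<partial>lborel) + L)))"
        by (intro mult_left_mono) auto
      also have "\<dots> = ennreal C * (emeasure \<mu> E * (P + ennreal T) + ?M * ((\<integral>\<^sup>+ y. f2 y \<partial>lborel) + L))"
      proof -
        have "C = C1 * D" by (simp only: C_def D_def)
        then show ?thesis using C1(1) D by (simp add: ennreal_mult mult.assoc)
      qed
      finally show ?thesis using that order_trans by blast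
    qed
    show ?thesis
    proof (cases "frontier \<Omega> = {}")
      \<comment> \<open>An open set with empty frontier is empty or the whole space, and the latter
        is excluded.\<close>
      case True
      then have "space \<mu> = {}" using nU sp by (simp add: frontier_eq_empty)
      then show ?thesis by (simp add: nn_integral_empty)
    next
      case False
      have eps: "(\<integral>\<^sup>+ x. indicator E x * ennreal (norm (u x)) \<partial>\<mu>) \<le> ennreal C *
        (emeasure \<mu> E * (P + ennreal T) + ?M * ((\<integral>\<^sup>+ y. f2 y \<partial>lborel) + (?B + ennreal e)))" if e: "e > 0" for e
      proof (rule fin_step)
        have cont: "continuous_on (frontier \<Omega>) u"
          using u by (auto simp: Cb_def frontier_def intro: continuous_on_subset)
        obtain v and y :: "nat \<Rightarrow> real ^ 'n" and d where vyd: "\<forall>j. v j \<ge> 0 \<and> y j \<in> frontier \<Omega> \<and> d j > 0"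
          "\<forall>p\<in>frontier \<Omega>. T < norm (u p) \<longrightarrow> (\<exists>j. p \<in> ball (y j) (d j) \<and> norm (u p) \<le> v j)"
          "(\<Sum>j. ennreal (v j * d j powr ?s)) \<le> ennreal C4 * (?B + ennreal e)"
          using boundary_level_cover[OF s frontier_closed False cont H T e] unfolding C4_def by blast
        \<comment> \<open>Centres on the frontier lie outside the open set \<Omega>, hence differ
          from every x in \<Omega>, as the tube estimate demands.\<close>
        have "y j \<notin> \<Omega>" for j using vyd(1) \<Omega> by (auto simp: frontier_def interior_open)
        then have "(\<integral>\<^sup>+ x. indicator E x * ennreal (norm (u x)) \<partial>\<mu>) \<le> ennreal C1 *
          (emeasure \<mu> E * (ennreal (T * ?\<omega>) + P) + ennreal C3 * ?M * (\<integral>\<^sup>+ y. f2 y \<partial>lborel) + ennreal C3 * ?M * (\<Sum>j. ennreal (C2 * (v j * d j powr ?s))))"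
          using vyd by (intro main[of v y d]) auto
        also have "(\<Sum>j. ennreal (C2 * (v j * d j powr ?s))) = ennreal C2 * (\<Sum>j. ennreal (v j * d j powr ?s))"
          using C2(1) by (simp add: ennreal_mult')
        also have "\<dots> \<le> ennreal C2 * (ennreal C4 * (?B + ennreal e))" using vyd(3) by (intro mult_left_mono) auto
        also have "\<dots> = ennreal (C2 * C4) * (?B + ennreal e)" using C2 C4 by (simp add: ennreal_mult mult.assoc)
        finally show "(\<integral>\<^sup>+ x. indicator E x * ennreal (norm (u x)) \<partial>\<mu>) \<le> ennreal C1 *
          (emeasure \<mu> E * (ennreal (T * ?\<omega>) + P) + ennreal C3 * ?M * (\<integral>\<^sup>+ y. f2 y \<partial>lborel) + ennreal C3 * ?M * (ennreal (C2 * C4) * (?B + ennreal e)))"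
          by (simp add: mult_left_mono add_left_mono)
      qed
      have step: "(\<integral>\<^sup>+ x. indicator E x * ennreal (norm (u x)) \<partial>\<mu>) \<le> ennreal C *
        (emeasure \<mu> E * (P + ennreal T) + ?M * ((\<integral>\<^sup>+ y. f2 y \<partial>lborel) + ?B)) + ennreal (C * measure \<mu> E powr (1 - ?s / \<alpha>)) * ennreal e" if "e > 0" for e
      proof -
        have "ennreal (C * measure \<mu> E powr (1 - ?s / \<alpha>)) = ennreal C * ?M"
          using \<open>C > 0\<close> by (intro ennreal_mult) auto
        then show ?thesis using eps[OF that] by (simp only: distrib_left add.assoc mult.assoc)
      qed
      show ?thesis
      proof (rule ennreal_le_epsilon)
        fix e :: real assume e: "e > 0"
        \<comment> \<open>The error of the cover enters with the factor k; a cover with error e/(k +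
          1) is therefore used, which is also meaningful for k = 0.\<close>
        define k where "k = C * measure \<mu> E powr (1 - ?s / \<alpha>)"
        have k: "k \<ge> 0" using \<open>C > 0\<close> by (simp add: k_def)
        have le: "ennreal k * ennreal (e / (k + 1)) \<le> ennreal e"
        proof -
          have "k * (e / (k + 1)) \<le> e" using k e by (simp add: field_simps)
          moreover have "ennreal k * ennreal (e / (k + 1)) = ennreal (k * (e / (k + 1)))"
            using k e by (intro ennreal_mult[symmetric]) auto
          ultimately show ?thesis by (simp only: ennreal_leI)
        qed
        have pos: "0 < e / (k + 1)" using k e by (simp add: add_nonneg_pos)
        show "(\<integral>\<^sup>+ x. indicator E x * ennreal (norm (u x)) \<partial>\<mu>) \<le> ennreal C *
        (emeasure \<mu> E * (P + ennreal T) + ?M * ((\<integral>\<^sup>+ y. f2 y \<partial>lborel) + ?B)) + ennreal e"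
          by (rule order_trans[OF step[OF pos, folded k_def] add_left_mono[OF le]])
      qed
    qed
  qed
  note est = this
  show ?thesis
    by (intro exI[of _ C] conjI allI impI \<open>C > 0\<close>; elim conjE; rule est; assumption)
qed

section \<open>Measure of level sets\<close>

text \<open>\<open>superlinear t0 W A\<close> is what is used of \<open>A\<close>: \<open>W t \<le> A s / s\<close> for \<open>t0 \<le> t \<le> s\<close>, a Chebyshev bound for the excess over \<open>t\<close>.\<close>

definition superlinear :: "real \<Rightarrow> (real \<Rightarrow> real) \<Rightarrow> (real \<Rightarrow> ennreal) \<Rightarrow> bool" where
  "superlinear t0 W A \<longleftrightarrow> t0 > 0 \<and> (\<forall>t\<ge>t0. W t > 0) \<and> (\<forall>t s. t0 \<le> t \<and> t \<le> s \<longrightarrow> ennreal (s * W t) \<le> A s)"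

lemma nn_integral_excess_le:
  assumes "superlinear t0 W A" "t0 \<le> T" and int: "(\<integral>\<^sup>+ x. indicator S x * A (g x) \<partial>M) \<le> 1"
    and meas: "(\<lambda>x. indicator S x * ennreal (g x) * indicator {x. T < g x} x) \<in> borel_measurable M"
  shows "(\<integral>\<^sup>+ x. indicator S x * ennreal (g x) * indicator {x. T < g x} x \<partial>M) \<le> ennreal (1 / W T)"
proof -
  have W: "W T > 0" using assms by (auto simp: superlinear_def)
  have "(\<integral>\<^sup>+ x. ennreal (W T) * (indicator S x * ennreal (g x) * indicator {x. T < g x} x) \<partial>M) \<le> (\<integral>\<^sup>+ x. indicator S x * A (g x) \<partial>M)"
  proof (rule nn_integral_mono)
    fix x
    show "ennreal (W T) * (indicator S x * ennreal (g x) * indicator {x. T < g x} x) \<le> indicator S x * A (g x)"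
    proof (cases "x \<in> S \<and> T < g x")
      case True
      then have "ennreal (g x * W T) \<le> A (g x)" using assms(1,2) by (auto simp: superlinear_def)
      then show ?thesis using True W by (simp add: ennreal_mult' mult.commute)
    qed auto
  qed
  then have "ennreal (W T) * (\<integral>\<^sup>+ x. indicator S x * ennreal (g x) * indicator {x. T < g x} x \<partial>M) \<le> 1"
    using int meas by (simp add: nn_integral_cmult order_trans)
  then have "ennreal (1 / W T) * (ennreal (W T) * (\<integral>\<^sup>+ x. indicator S x * ennreal (g x) * indicator {x. T < g x} x \<partial>M)) \<le> ennreal (1 / W T) * 1"
    by (rule mult_left_mono) simp
  then show ?thesis
    using W by (simp add: mult.assoc[symmetric] ennreal_mult[symmetric])
qed

section \<open>The potential of the gradient truncated at a level\<close>

lemma layer_cake_riesz: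
  fixes f :: "'a::euclidean_space \<Rightarrow> real"
  assumes [measurable]: "f \<in> borel_measurable borel" and f0: "\<And>y. f y \<ge> 0"
  shows "(\<integral>\<^sup>+ y. riesz_kernel (y - x) * (ennreal (f y) * indicator {y. f y \<le> T} y) \<partial>lborel)
    \<le> (\<integral>\<^sup>+ t. indicator {0..T} t * (\<integral>\<^sup>+ y. indicator {y. t < f y} y * riesz_kernel (y - x) \<partial>lborel) \<partial>lborel)"
proof -
  have "(\<integral>\<^sup>+ y. riesz_kernel (y - x) * (ennreal (f y) * indicator {y. f y \<le> T} y) \<partial>lborel)
      \<le> (\<integral>\<^sup>+ y. \<integral>\<^sup>+ t. riesz_kernel (y - x) * (indicator {0..T} t * indicator {y. t < f y} y) \<partial>lborel \<partial>lborel)"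
  proof (rule nn_integral_mono)
    fix y
    have "ennreal (f y) * indicator {y. f y \<le> T} y \<le> (\<integral>\<^sup>+ t. indicator {0..T} t * indicator {y. t < f y} y \<partial>lborel)"
    proof (cases "f y \<le> T")
      case True
      have "ennreal (f y) = (\<integral>\<^sup>+ t. indicator {0..<f y} t \<partial>lborel)" using f0[of y] by simp
      also have "\<dots> \<le> (\<integral>\<^sup>+ t. indicator {0..T} t * indicator {y. t < f y} y \<partial>lborel)"
        using True by (intro nn_integral_mono) (auto simp: indicator_def)
      finally show ?thesis using True by simp
    qed simp
    then have "riesz_kernel (y - x) * (ennreal (f y) * indicator {y. f y \<le> T} y) \<le>
       riesz_kernel (y - x) * (\<integral>\<^sup>+ t. indicator {0..T} t * indicator {y. t < f y} y \<partial>lborel)"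
      by (rule mult_left_mono) simp
    also have "\<dots> = (\<integral>\<^sup>+ t. riesz_kernel (y - x) * (indicator {0..T} t * indicator {y. t < f y} y) \<partial>lborel)"
    proof (rule nn_integral_cmult[symmetric])
      have "(\<lambda>t. indicator {0..T} t * indicator {..<f y} t :: ennreal) \<in> borel_measurable (borel :: real measure)"
        by (subst indicator_inter_arith[symmetric]) simp
      then show "(\<lambda>t. indicator {0..T} t * indicator {y. t < f y} y) \<in> borel_measurable (lborel :: real measure)"
        by (simp add: indicator_def)
    qed
    finally show "riesz_kernel (y - x) * (ennreal (f y) * indicator {y. f y \<le> T} y) \<le>
      (\<integral>\<^sup>+ t. riesz_kernel (y - x) * (indicator {0..T} t * indicator {y. t < f y} y) \<partial>lborel)" .
  qed
  also have "\<dots> = (\<integral>\<^sup>+ t. \<integral>\<^sup>+ y. riesz_kernel (y - x) * (indicator {0..T} t * indicator {y. t < f y} y) \<partial>lborel \<partial>lborel)"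
  proof (rule lborel_pair.Fubini'[symmetric])
    have "(\<lambda>p. riesz_kernel (fst p - x) * (indicator {0..T} (snd p) * (if snd p < f (fst p) then 1 else 0))) \<in> borel_measurable (borel \<Otimes>\<^sub>M (borel :: real measure))"
      by measurable
    then show "(\<lambda>(y, t). riesz_kernel (y - x) * (indicator {0..T} t * indicator {y. t < f y} y)) \<in> borel_measurable (lborel \<Otimes>\<^sub>M (lborel :: real measure))"
      by (subst measurable_cong_sets[OF sets_pair_measure_cong[OF sets_lborel sets_lborel] refl])
         (simp add: case_prod_unfold indicator_def)
  qed
  also have "\<dots> = (\<integral>\<^sup>+ t. indicator {0..T} t * (\<integral>\<^sup>+ y. indicator {y. t < f y} y * riesz_kernel (y - x) \<partial>lborel) \<partial>lborel)"
  proof (rule nn_integral_cong)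
    fix t :: real
    have [measurable]: "{y. t < f y} \<in> sets borel" by measurable
    show "(\<integral>\<^sup>+ y. riesz_kernel (y - x) * (indicator {0..T} t * indicator {y. t < f y} y) \<partial>lborel) =
       indicator {0..T} t * (\<integral>\<^sup>+ y. indicator {y. t < f y} y * riesz_kernel (y - x) \<partial>lborel)"
      by (subst nn_integral_cmult[symmetric]) (auto simp: mult_ac)
  qed
  finally show ?thesis .
qed

text \<open>The two summands exchange dominance where m^(1/n) = (M w)^(-1/(n-1)). Up to that value
  the second summand bounds m^(1/n); beyond it M w m^((n-1)/n) \<ge> 1, which gives the first. For m
  the measure of a level set and w = W(t), the first summand is paid by the modular and the second
  integrates to Y; the parameter M is for balancing them.\<close>

lemma level_measure_young:
  fixes m n w M :: real
  assumes "n > 1" "m \<ge> 0" "w > 0" "M > 0"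
  shows "m powr (1 / n) \<le> M * w * m + M powr (- 1 / (n - 1)) * w powr (- 1 / (n - 1))"
proof (cases "m powr (1 / n) \<le> (M * w) powr (- 1 / (n - 1))")
  case True
  then show ?thesis using assms by (simp add: powr_mult add_increasing)
next
  case False
  then have m: "m > 0" using assms by (cases "m = 0") auto
  have "(M * w) powr (- 1 / (n - 1)) \<le> m powr (1 / n)" using False by simp
  then have "((M * w) powr (- 1 / (n - 1))) powr (n - 1) \<le> (m powr (1 / n)) powr (n - 1)"
    using assms by (intro powr_mono2) auto
  moreover have "((M * w) powr (- 1 / (n - 1))) powr (n - 1) = inverse (M * w)"
    unfolding powr_powr using assms powr_minus[of "M * w" 1] by simp
  ultimately have "inverse (M * w) \<le> m powr ((n - 1) / n)"
    using assms by (simp add: powr_powr)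
  then have "1 \<le> M * w * m powr ((n - 1) / n)" using assms by (simp add: field_simps)
  then have "m powr (1 / n) * 1 \<le> m powr (1 / n) * (M * w * m powr ((n - 1) / n))"
    by (intro mult_left_mono) auto
  also have "\<dots> = M * w * (m powr (1 / n) * m powr ((n - 1) / n))" by (simp add: mult_ac)
  also have "m powr (1 / n) * m powr ((n - 1) / n) = m"
    using m assms by (simp add: powr_add[symmetric] add_divide_distrib[symmetric])
  finally show ?thesis by (simp add: add_increasing2)
qed

text \<open>After Fubini the inner integral is that of W over the levels from \<open>t0\<close> to f
  y. On this range \<open>superlinear\<close> gives W t \<le> A(f y)/f y, and the length of the
  range is at most f y. When A(f y) is infinite the bound is trivial.\<close>

lemma nn_integral_level_weight_le:
  fixes f :: "'a::euclidean_space \<Rightarrow> real"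
  assumes [measurable]: "f \<in> borel_measurable borel" "W \<in> borel_measurable borel"
    and sl: "superlinear t0 W A" and int: "(\<integral>\<^sup>+ y. A (f y) \<partial>lborel) \<le> 1"
  shows "(\<integral>\<^sup>+ t. indicator {t0..} t * (ennreal (W t) * emeasure lborel {y. t < f y}) \<partial>lborel) \<le> 1"
proof -
  have t0: "t0 > 0" using sl by (simp add: superlinear_def)
  have "(\<integral>\<^sup>+ t. indicator {t0..} t * (ennreal (W t) * emeasure lborel {y. t < f y}) \<partial>lborel) =
     (\<integral>\<^sup>+ t. \<integral>\<^sup>+ y. indicator {t0..} t * ennreal (W t) * indicator {y. t < f y} y \<partial>lborel \<partial>lborel)"
  proof (rule nn_integral_cong)
    fix t :: real
    have [measurable]: "{y. t < f y} \<in> sets borel" by measurable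
    show "indicator {t0..} t * (ennreal (W t) * emeasure lborel {y. t < f y}) =
       (\<integral>\<^sup>+ y. indicator {t0..} t * ennreal (W t) * indicator {y. t < f y} y \<partial>lborel)"
      by (subst nn_integral_cmult_indicator) (auto simp: mult.assoc)
  qed
  also have "\<dots> = (\<integral>\<^sup>+ y. \<integral>\<^sup>+ t. indicator {t0..} t * ennreal (W t) * indicator {y. t < f y} y \<partial>lborel \<partial>lborel)"
  proof (rule lborel_pair.Fubini')
    have "(\<lambda>p. indicator {t0..} (snd p) * ennreal (W (snd p)) * (if snd p < f (fst p) then 1 else 0)) \<in> borel_measurable (borel \<Otimes>\<^sub>M (borel :: real measure))"
      by measurable
    then show "(\<lambda>(y, t). indicator {t0..} t * ennreal (W t) * indicator {y. t < f y} y) \<in> borel_measurable (lborel \<Otimes>\<^sub>M (lborel :: real measure))"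
      by (subst measurable_cong_sets[OF sets_pair_measure_cong[OF sets_lborel sets_lborel] refl])
         (simp add: case_prod_unfold indicator_def)
  qed
  also have "\<dots> \<le> (\<integral>\<^sup>+ y. A (f y) \<partial>lborel)"
  proof (rule nn_integral_mono)
    fix y
    show "(\<integral>\<^sup>+ t. indicator {t0..} t * ennreal (W t) * indicator {y. t < f y} y \<partial>lborel) \<le> A (f y)"
    proof (cases "t0 < f y")
      case False
      then have "(\<lambda>t. indicator {t0..} t * ennreal (W t) * indicator {y. t < f y} y) = (\<lambda>_. 0)"
        by (auto simp: indicator_def fun_eq_iff)
      then show ?thesis by simp
    next
      case True
      show ?thesis
      proof (cases "A (f y)")
        case (real a)
        have "(\<integral>\<^sup>+ t. indicator {t0..} t * ennreal (W t) * indicator {y. t < f y} y \<partial>lborel) \<le> (\<integral>\<^sup>+ t. ennreal (a / f y) * indicator {0..f y} t \<partial>lborel)"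
        proof (rule nn_integral_mono)
          fix t
          show "indicator {t0..} t * ennreal (W t) * indicator {y. t < f y} y \<le> ennreal (a / f y) * indicator {0..f y} t"
          proof (cases "t0 \<le> t \<and> t < f y")
            case t: True
            then have "ennreal (f y * W t) \<le> A (f y)" using sl by (auto simp: superlinear_def)
            then have "f y * W t \<le> a" using real by (metis ennreal_le_iff)
            then have "W t \<le> a / f y" using t t0 by (simp add: field_simps)
            then have "ennreal (W t) \<le> ennreal (a / f y)" by (rule ennreal_leI)
            moreover have "indicator {t0..} t = (1 :: ennreal)" "indicator {y. t < f y} y = (1 :: ennreal)"
              "indicator {0..f y} t = (1 :: ennreal)"
              using t t0 by auto
            ultimately show ?thesis by (simp only: mult_1 mult_1_right)
          qed auto
        qed
        also have "\<dots> = ennreal (a / f y) * ennreal (f y)"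
          using True t0 by (subst nn_integral_cmult_indicator) auto
        also have "\<dots> = A (f y)" using True t0 real by (simp add: ennreal_mult[symmetric])
        finally show ?thesis .
      qed simp
    qed
  qed
  finally show ?thesis using int by simp
qed

text \<open>By the layer cake formula and \<open>nn_integral_riesz_le_emeasure\<close> the potential
  is at most a constant times the integral over levels t \<le> T of the 1/n-th power of the measure
  of the level set. Below \<open>t0\<close> that measure is bounded by V; above \<open>t0\<close> it
  is split by \<open>level_measure_young\<close>.\<close>

lemma riesz_bounded_part:
  assumes dim: "DIM('a::euclidean_space) \<ge> 2"
  shows "\<exists>C>0. \<forall>(f :: 'a \<Rightarrow> real) W A Y y' t0 V T x.
    f \<in> borel_measurable borel \<and> (\<forall>y. f y \<ge> 0) \<and> V \<ge> 0 \<and> emeasure lborel {y. 0 < f y} \<le> ennreal V \<and>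
    W \<in> borel_measurable borel \<and> superlinear t0 W A \<and> (\<integral>\<^sup>+ y. A (f y) \<partial>lborel) \<le> 1 \<and>
    y' \<in> borel_measurable borel \<and> (\<forall>t\<ge>t0. DERIV Y t :> y' t \<and> W t powr (- 1 / (real DIM('a) - 1)) \<le> y' t \<and> Y t > 0) \<and>
    t0 \<le> T \<longrightarrow>
    (\<integral>\<^sup>+ y. riesz_kernel (y - x) * (ennreal (f y) * indicator {y. f y \<le> T} y) \<partial>lborel)
      \<le> ennreal (C * (t0 * V powr (1 / real DIM('a)) + 2 * Y T powr ((real DIM('a) - 1) / real DIM('a))))"
proof -
  let ?n = "real DIM('a)"
  obtain C where C: "C > 0" "\<And>(F :: 'a set) y. F \<in> sets borel \<Longrightarrow> emeasure lborel F < \<infinity> \<Longrightarrow>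
    (\<integral>\<^sup>+ x. indicator F x * riesz_kernel (x - y) \<partial>lborel) \<le> ennreal (C * measure lborel F powr (1 / ?n))"
    using nn_integral_riesz_le_emeasure[OF dim] by blast
  have est: "(\<integral>\<^sup>+ y. riesz_kernel (y - x) * (ennreal (f y) * indicator {y. f y \<le> T} y) \<partial>lborel)
      \<le> ennreal (C * (t0 * V powr (1 / ?n) + 2 * Y T powr ((?n - 1) / ?n)))"
    if f [measurable]: "f \<in> borel_measurable borel" and f0: "\<forall>y. f y \<ge> 0" and V: "V \<ge> 0" "emeasure lborel {y. 0 < f y} \<le> ennreal V"
      and W [measurable]: "W \<in> borel_measurable borel" and sl: "superlinear t0 W A" and int: "(\<integral>\<^sup>+ y. A (f y) \<partial>lborel) \<le> 1"
      and y' [measurable]: "y' \<in> borel_measurable borel"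
      and Y: "\<forall>t\<ge>t0. DERIV Y t :> y' t \<and> W t powr (- 1 / (?n - 1)) \<le> y' t \<and> Y t > 0" and T: "t0 \<le> T"
    for f :: "'a \<Rightarrow> real" and W A Y y' t0 V T x
  proof -
    have t0: "t0 > 0" and Wpos: "\<And>t. t \<ge> t0 \<Longrightarrow> W t > 0" using sl by (auto simp: superlinear_def)
    \<comment> \<open>The two parts above \<open>t0\<close> contribute at most M and M^(-1/(n-1)) Y
      T. This M makes them equal, which explains the factor 2 and the exponent (n-1)/n.\<close>
    define M where "M = Y T powr ((?n - 1) / ?n)"
    have YT: "Y T > 0" using Y T by blast
    then have M: "M > 0" by (simp add: M_def)
    define \<kappa> where "\<kappa> t = measure lborel {y. t < f y} powr (1 / ?n)" for t
    have Fm [measurable]: "{y. t < f y} \<in> sets borel" for t by measurable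
    have Fle: "emeasure lborel {y. t < f y} \<le> ennreal V" if "t \<ge> 0" for t
      by (rule order_trans[OF _ V(2)], rule emeasure_mono) (use that in auto)
    have Ffin: "emeasure lborel {y. t < f y} < \<infinity>" if "t \<ge> 0" for t
      using Fle[OF that] by (auto intro: le_less_trans)
    have mV: "measure lborel {y. t < f y} \<le> V" if "t \<ge> 0" for t
      using Fle[OF that] V(1) by (simp add: measure_def enn2real_leI)
    have "(\<integral>\<^sup>+ y. riesz_kernel (y - x) * (ennreal (f y) * indicator {y. f y \<le> T} y) \<partial>lborel) \<le>
        (\<integral>\<^sup>+ t. indicator {0..T} t * (\<integral>\<^sup>+ y. indicator {y. t < f y} y * riesz_kernel (y - x) \<partial>lborel) \<partial>lborel)"
      using f0 by (intro layer_cake_riesz) auto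
    also have "\<dots> \<le> (\<integral>\<^sup>+ t. ennreal C * (ennreal (V powr (1 / ?n)) * indicator {0..t0} t
        + ennreal M * (indicator {t0..} t * (ennreal (W t) * emeasure lborel {y. t < f y}))
        + ennreal (M powr (- 1 / (?n - 1))) * (ennreal (y' t) * indicator {t0..T} t)) \<partial>lborel)"
    proof (rule nn_integral_mono)
      fix t
      show "indicator {0..T} t * (\<integral>\<^sup>+ y. indicator {y. t < f y} y * riesz_kernel (y - x) \<partial>lborel) \<le>
        ennreal C * (ennreal (V powr (1 / ?n)) * indicator {0..t0} t
        + ennreal M * (indicator {t0..} t * (ennreal (W t) * emeasure lborel {y. t < f y}))
        + ennreal (M powr (- 1 / (?n - 1))) * (ennreal (y' t) * indicator {t0..T} t))"
      proof (cases "0 \<le> t \<and> t \<le> T")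
        case t: True
        have "(\<integral>\<^sup>+ y. indicator {y. t < f y} y * riesz_kernel (y - x) \<partial>lborel) \<le> ennreal (C * \<kappa> t)"
          unfolding \<kappa>_def using t by (intro C(2) Ffin) auto
        also have "\<dots> = ennreal C * ennreal (\<kappa> t)" using C(1) by (simp add: ennreal_mult')
        finally have 1: "(\<integral>\<^sup>+ y. indicator {y. t < f y} y * riesz_kernel (y - x) \<partial>lborel) \<le> ennreal C * ennreal (\<kappa> t)" .
        have 2: "ennreal (\<kappa> t) \<le> ennreal (V powr (1 / ?n)) * indicator {0..t0} t
          + ennreal M * (indicator {t0..} t * (ennreal (W t) * emeasure lborel {y. t < f y}))
          + ennreal (M powr (- 1 / (?n - 1))) * (ennreal (y' t) * indicator {t0..T} t)"
        proof (cases "t \<le> t0")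
          case True
          have "\<kappa> t \<le> V powr (1 / ?n)" unfolding \<kappa>_def using mV t dim by (intro powr_mono2) auto
          then have "ennreal (\<kappa> t) \<le> ennreal (V powr (1 / ?n)) * indicator {0..t0} t"
            using True t by (simp add: ennreal_leI)
          then show ?thesis by (simp add: add_increasing2 add.assoc)
        next
          case False
          have em: "emeasure lborel {y. t < f y} = ennreal (measure lborel {y. t < f y})"
            using Ffin[of t] t by (simp add: emeasure_eq_ennreal_measure)
          have "\<kappa> t \<le> M * W t * measure lborel {y. t < f y} + M powr (- 1 / (?n - 1)) * W t powr (- 1 / (?n - 1))"
            unfolding \<kappa>_def using dim M Wpos[of t] False by (intro level_measure_young) auto
          also have "\<dots> \<le> M * W t * measure lborel {y. t < f y} + M powr (- 1 / (?n - 1)) * y' t"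
            using Y False by (intro add_left_mono mult_left_mono) auto
          finally have "ennreal (\<kappa> t) \<le> ennreal (M * W t * measure lborel {y. t < f y} + M powr (- 1 / (?n - 1)) * y' t)"
            by (rule ennreal_leI)
          also have "\<dots> = ennreal (M * W t * measure lborel {y. t < f y}) + ennreal (M powr (- 1 / (?n - 1)) * y' t)"
          proof (rule ennreal_plus)
            have "0 \<le> W t powr (- 1 / (?n - 1))" "W t powr (- 1 / (?n - 1)) \<le> y' t" using Y False by auto
            then have "0 \<le> y' t" by (rule order_trans)
            then show "0 \<le> M powr (- 1 / (?n - 1)) * y' t" by simp
          qed (use M Wpos[of t] False in auto)
          also have "\<dots> = ennreal M * (ennreal (W t) * emeasure lborel {y. t < f y}) + ennreal (M powr (- 1 / (?n - 1))) * ennreal (y' t)"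
            using M Wpos[of t] False by (simp add: em ennreal_mult' mult.assoc)
          finally show ?thesis using False t by simp
        qed
        show ?thesis using t order_trans[OF 1 mult_left_mono[OF 2]] by simp
      qed auto
    qed
    also have "\<dots> = ennreal C * (ennreal (V powr (1 / ?n)) * ennreal t0
        + ennreal M * (\<integral>\<^sup>+ t. indicator {t0..} t * (ennreal (W t) * emeasure lborel {y. t < f y}) \<partial>lborel)
        + ennreal (M powr (- 1 / (?n - 1))) * (\<integral>\<^sup>+ t. ennreal (y' t) * indicator {t0..T} t \<partial>lborel))"
    proof -
      have "(\<lambda>p. if fst p < f (snd p) then 1 else 0 :: ennreal) \<in> borel_measurable (borel \<Otimes>\<^sub>M (borel :: 'a measure))"
        by measurable
      then have "(\<lambda>t. \<integral>\<^sup>+ y. indicator {y. t < f y} y \<partial>lborel) \<in> borel_measurable (borel :: real measure)"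
        by (intro lborel.borel_measurable_nn_integral, subst measurable_cong_sets[OF sets_pair_measure_cong[OF refl sets_lborel] refl])
           (simp add: case_prod_unfold indicator_def)
      then have [measurable]: "(\<lambda>t. emeasure lborel {y. t < f y}) \<in> borel_measurable (borel :: real measure)" by simp
      show ?thesis using t0 by (simp add: nn_integral_cmult nn_integral_add nn_integral_cmult_indicator)
    qed
    also have "(\<integral>\<^sup>+ t. ennreal (y' t) * indicator {t0..T} t \<partial>lborel) = ennreal (Y T - Y t0)"
    proof (rule nn_integral_FTC_Icc)
      show "DERIV Y t :> y' t" if "t \<in> {t0..T}" for t using Y that by simp
      show "0 \<le> y' t" if "t \<in> {t0..T}" for t
      proof (rule order_trans)
        show "0 \<le> W t powr (- 1 / (?n - 1))" by simp
        show "W t powr (- 1 / (?n - 1)) \<le> y' t" using Y that by simp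
      qed
    qed (use T in auto)
    also have "\<dots> \<le> ennreal (Y T)" using Y by (intro ennreal_leI) (simp add: less_imp_le)
    also have "(\<integral>\<^sup>+ t. indicator {t0..} t * (ennreal (W t) * emeasure lborel {y. t < f y}) \<partial>lborel) \<le> 1"
      by (rule nn_integral_level_weight_le[OF f W sl int])
    finally have "(\<integral>\<^sup>+ y. riesz_kernel (y - x) * (ennreal (f y) * indicator {y. f y \<le> T} y) \<partial>lborel) \<le>
       ennreal C * (ennreal (V powr (1 / ?n)) * ennreal t0 + ennreal M * 1 + ennreal (M powr (- 1 / (?n - 1))) * ennreal (Y T))"
      by (simp add: add_mono mult_left_mono)
    also have "\<dots> = ennreal (C * (V powr (1 / ?n) * t0 + M + M powr (- 1 / (?n - 1)) * Y T))"
      using C(1) M YT t0 by (simp add: ennreal_mult ennreal_plus)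
    also have "M powr (- 1 / (?n - 1)) * Y T = M"
    proof -
      have "M powr (- 1 / (?n - 1)) * Y T = Y T powr (- 1 / ?n) * Y T powr 1"
        using dim YT by (simp add: M_def powr_powr field_simps)
      also have "\<dots> = M" unfolding powr_add[symmetric] M_def using dim by (simp add: field_simps)
      finally show ?thesis .
    qed
    finally show ?thesis by (simp add: M_def[symmetric] mult_ac add_ac)
  qed
  show ?thesis
    by (intro exI[of _ C] conjI allI impI \<open>C > 0\<close>; elim conjE; rule est; assumption)
qed

text \<open>\<open>f\<close> is a Borel version of the norm of G that vanishes everywhere outside
  \<Omega>; G itself is determined only up to Lebesgue null sets and is only Lebesgue
  measurable.\<close>

definition sobolev_data where
  "sobolev_data \<alpha> c V m h \<Omega> \<mu> (u :: real ^ 'n::finite \<Rightarrow> real ^ 'n) G f \<longleftrightarrow>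
     admissible \<alpha> c V m h \<Omega> \<mu> \<and> u \<in> Cb (closure \<Omega>) \<and> has_sym_grad \<Omega> u G \<and>
     f \<in> borel_measurable borel \<and> (\<forall>y. 0 \<le> f y) \<and> (\<forall>y. y \<notin> \<Omega> \<longrightarrow> f y = 0) \<and>
     (AE y in lebesgue. f y = indicator \<Omega> y * norm (G y))"

definition interior_excess :: "(real ^ 'n::finite \<Rightarrow> real) \<Rightarrow> real \<Rightarrow> ennreal" where
  "interior_excess f T = (\<integral>\<^sup>+ y. ennreal (f y) * indicator {y. T < f y} y \<partial>lborel)"

definition boundary_excess :: "(real ^ 'n::finite) set \<Rightarrow> (real ^ 'n \<Rightarrow> real ^ 'n) \<Rightarrow> real \<Rightarrow> ennreal" where
  "boundary_excess \<Omega> u T =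
     (\<integral>\<^sup>+ p. indicator {p \<in> frontier \<Omega>. T < norm (u p)} p * ennreal (norm (u p)) \<partial>hausdorff_measure (real CARD('n) - 1))"

lemma measurable_on_admissible:
  assumes "admissible \<alpha> c V m h \<Omega> \<mu>" "u \<in> Cb (closure \<Omega>)"
  shows "u \<in> borel_measurable \<mu>" "space \<mu> = \<Omega>"
proof -
  have s: "sets \<mu> = sets (restrict_space borel \<Omega>)" and "open \<Omega>" using assms by (auto simp: admissible_def)
  have "continuous_on \<Omega> u" using assms(2) closure_subset by (auto simp: Cb_def intro: continuous_on_subset)
  then have "u \<in> borel_measurable (restrict_space borel \<Omega>)" by (rule borel_measurable_continuous_on_restrict)
  then show "u \<in> borel_measurable \<mu>" using s by (simp cong: measurable_cong_sets)
  show "space \<mu> = \<Omega>" using sets_eq_imp_space_eq[OF s] by (simp add: space_restrict_space)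
qed

text \<open>\<open>core_estimate\<close> for E the level set itself, where the integral on the left
  is at least l \<mu>(E). After absorption there remains \<mu>(E)^((n-1)/\<alpha>) l/2 \<le> C1
  \<phi>. T1 and T2 are left free: choosing them as functions of l is what distinguishes the
  regimes.\<close>

lemma level_set_estimate:
  fixes \<alpha> c :: real and V m h :: ennreal
  assumes n2: "CARD('n::finite) \<ge> 2" and \<alpha>: "real CARD('n) - 1 < \<alpha>" and c: "c > 0"
    and fin: "V < \<infinity>" "m < \<infinity>" "h < \<infinity>"
    and W: "W \<in> borel_measurable borel" "superlinear t0 W A"
    and Y: "y' \<in> borel_measurable borel"
      "\<forall>t\<ge>t0. DERIV Y t :> y' t \<and> W t powr (- 1 / (real CARD('n) - 1)) \<le> y' t \<and> Y t > 0"
  shows "\<exists>C>0. \<forall>\<Omega> \<mu> (u :: real ^ 'n \<Rightarrow> real ^ 'n) G f l T1 T2 \<phi>.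
    sobolev_data \<alpha> c V m h \<Omega> \<mu> u G f \<and> (\<integral>\<^sup>+ y. A (f y) \<partial>lborel) \<le> 1 \<and>
    l > 0 \<and> t0 \<le> T1 \<and> T2 > 0 \<and> \<phi> \<ge> 0 \<and>
    C * (1 + Y T1 powr ((real CARD('n) - 1) / real CARD('n)) + T2) \<le> l \<and>
    interior_excess f T1 + boundary_excess \<Omega> u T2 \<le> ennreal \<phi> \<longrightarrow>
    emeasure \<mu> {x \<in> \<Omega>. l < norm (u x)} \<le> ennreal ((C * \<phi> / l) powr (\<alpha> / (real CARD('n) - 1)))"
proof -
  let ?n = "real CARD('n)" and ?s = "real CARD('n) - 1"
  have s: "?s > 0" using n2 by simp
  obtain C1 where C1: "C1 > 0" "\<And>(\<Omega> :: (real ^ 'n) set) \<mu> u G f f1 f2 P T E.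
    open \<Omega> \<and> \<Omega> \<noteq> UNIV \<and> sets \<mu> = sets (restrict_space borel \<Omega>) \<and>
    (\<forall>x\<in>\<Omega>. \<forall>r>0. emeasure \<mu> (ball x r \<inter> \<Omega>) \<le> ennreal (c * r powr \<alpha>)) \<and> emeasure \<mu> \<Omega> < \<infinity> \<and>
    emeasure (hausdorff_measure ?s) (frontier \<Omega>) < \<infinity> \<and>
    u \<in> Cb (closure \<Omega>) \<and> has_sym_grad \<Omega> u G \<and>
    f \<in> borel_measurable borel \<and> (AE y in lebesgue. f y = indicator \<Omega> y * ennreal (norm (G y))) \<and>
    f1 \<in> borel_measurable borel \<and> f2 \<in> borel_measurable borel \<and> (\<forall>y. f y \<le> f1 y + f2 y) \<and>
    (\<forall>x. (\<integral>\<^sup>+ y. riesz_kernel (y - x) * f1 y \<partial>lborel) \<le> P) \<and> T > 0 \<and> E \<in> sets \<mu> \<Longrightarrow>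
    (\<integral>\<^sup>+ x. indicator E x * ennreal (norm (u x)) \<partial>\<mu>) \<le> ennreal C1 *
      (emeasure \<mu> E * (P + ennreal T) + ennreal (measure \<mu> E powr (1 - ?s / \<alpha>)) *
        ((\<integral>\<^sup>+ y. f2 y \<partial>lborel) +
         (\<integral>\<^sup>+ p. indicator {p \<in> frontier \<Omega>. T < norm (u p)} p * ennreal (norm (u p)) \<partial>hausdorff_measure ?s)))"
    using core_estimate[OF n2 \<alpha> c]
    by (elim exE conjE) (rule that, assumption, (drule spec)+, drule (1) mp, assumption)
  obtain C2 where C2: "C2 > 0" "\<And>(f :: real ^ 'n \<Rightarrow> real) W A Y y' t0 V T x.
    f \<in> borel_measurable borel \<and> (\<forall>y. f y \<ge> 0) \<and> V \<ge> 0 \<and> emeasure lborel {y. 0 < f y} \<le> ennreal V \<and>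
    W \<in> borel_measurable borel \<and> superlinear t0 W A \<and> (\<integral>\<^sup>+ y. A (f y) \<partial>lborel) \<le> 1 \<and>
    y' \<in> borel_measurable borel \<and> (\<forall>t\<ge>t0. DERIV Y t :> y' t \<and> W t powr (- 1 / ?s) \<le> y' t \<and> Y t > 0) \<and>
    t0 \<le> T \<Longrightarrow>
    (\<integral>\<^sup>+ y. riesz_kernel (y - x) * (ennreal (f y) * indicator {y. f y \<le> T} y) \<partial>lborel)
      \<le> ennreal (C2 * (t0 * V powr (1 / ?n) + 2 * Y T powr (?s / ?n)))"
    using riesz_bounded_part[where 'a = "real ^ 'n", unfolded DIM_cart DIM_real mult_1_right, OF n2]
    by (elim exE conjE) (rule that, assumption, (drule spec)+, drule (1) mp, assumption)
  define v where "v = enn2real V"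
  have v: "V = ennreal v" "v \<ge> 0" using fin(1) by (simp_all add: v_def)
  have t0: "t0 > 0" using W(2) by (simp add: superlinear_def)
  define D where "D = max 1 (C2 * max (t0 * v powr (1 / ?n)) 2)"
  have D: "D \<ge> 1" by (simp add: D_def)
  define C where "C = 2 * C1 * D"
  have C: "C > 0" using C1(1) D by (simp add: C_def)
  have est: "emeasure \<mu> {x \<in> \<Omega>. l < norm (u x)} \<le> ennreal ((C * \<phi> / l) powr (\<alpha> / ?s))"
    if data: "sobolev_data \<alpha> c V m h \<Omega> \<mu> u G f" and int: "(\<integral>\<^sup>+ y. A (f y) \<partial>lborel) \<le> 1"
      and par: "l > 0" "t0 \<le> T1" "T2 > 0" "\<phi> \<ge> 0" "C * (1 + Y T1 powr (?s / ?n) + T2) \<le> l"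
      and exc: "interior_excess f T1 + boundary_excess \<Omega> u T2 \<le> ennreal \<phi>"
    for \<Omega> \<mu> and u :: "real ^ 'n \<Rightarrow> real ^ 'n" and G f l T1 T2 \<phi>
  proof -
    have adm: "admissible \<alpha> c V m h \<Omega> \<mu>" and u: "u \<in> Cb (closure \<Omega>)" and G: "has_sym_grad \<Omega> u G"
      and f [measurable]: "f \<in> borel_measurable borel" and f0: "\<forall>y. 0 \<le> f y" and fout: "\<forall>y. y \<notin> \<Omega> \<longrightarrow> f y = 0"
      and fG: "AE y in lebesgue. f y = indicator \<Omega> y * norm (G y)"
      using data by (simp_all add: sobolev_data_def)
    have \<Omega>: "open \<Omega>" and sets\<mu>: "sets \<mu> = sets (restrict_space borel \<Omega>)" and
      frost: "\<forall>x\<in>\<Omega>. \<forall>r>0. emeasure \<mu> (ball x r \<inter> \<Omega>) \<le> ennreal (c * r powr \<alpha>)" and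
      vol: "emeasure lebesgue \<Omega> = V" and mm: "emeasure \<mu> \<Omega> = m" and hh: "emeasure (hausdorff_measure ?s) (frontier \<Omega>) = h"
      using adm by (auto simp: admissible_def)
    note [measurable] = measurable_on_admissible(1)[OF adm u]
    have sp: "space \<mu> = \<Omega>" by (rule measurable_on_admissible(2)[OF adm u])
    have nU: "\<Omega> \<noteq> UNIV" using vol fin(1) by auto
    define E where "E = {x \<in> \<Omega>. l < norm (u x)}"
    have E: "E \<in> sets \<mu>" unfolding E_def sp[symmetric] by measurable
    define P where "P = C2 * (t0 * v powr (1 / ?n) + 2 * Y T1 powr (?s / ?n))"
    have Yp: "Y T1 powr (?s / ?n) \<ge> 0" by simp
    have P0: "P \<ge> 0" using C2(1) t0 by (simp add: P_def)
    have PD: "P + T2 \<le> D * (1 + Y T1 powr (?s / ?n) + T2)"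
    proof -
      have "C2 * (t0 * v powr (1 / ?n)) \<le> D * 1" "C2 * 2 \<le> D" using C2(1) by (auto simp: D_def max_mult_distrib_left)
      then have "P \<le> D * 1 + D * Y T1 powr (?s / ?n)"
        using mult_right_mono[OF \<open>C2 * 2 \<le> D\<close> Yp] by (simp add: P_def distrib_left)
      moreover have "T2 \<le> D * T2" using D par(3) by simp
      ultimately show ?thesis by (simp add: distrib_left)
    qed
    have "(\<integral>\<^sup>+ x. indicator E x * ennreal (norm (u x)) \<partial>\<mu>) \<le> ennreal C1 *
      (emeasure \<mu> E * (ennreal P + ennreal T2) + ennreal (measure \<mu> E powr (1 - ?s / \<alpha>)) *
        ((\<integral>\<^sup>+ y. ennreal (f y) * indicator {y. T1 < f y} y \<partial>lborel) +
         (\<integral>\<^sup>+ p. indicator {p \<in> frontier \<Omega>. T2 < norm (u p)} p * ennreal (norm (u p)) \<partial>hausdorff_measure ?s)))"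
    proof (rule C1(2)[of \<Omega> \<mu> u G "\<lambda>y. ennreal (f y)" "\<lambda>y. ennreal (f y) * indicator {y. f y \<le> T1} y"], intro conjI)
      show "\<forall>y. ennreal (f y) \<le> ennreal (f y) * indicator {y. f y \<le> T1} y + ennreal (f y) * indicator {y. T1 < f y} y"
        by (auto simp: indicator_def)
      show "AE y in lebesgue. ennreal (f y) = indicator \<Omega> y * ennreal (norm (G y))"
        using fG by eventually_elim (auto simp: indicator_def)
      show "\<forall>x. (\<integral>\<^sup>+ y. riesz_kernel (y - x) * (ennreal (f y) * indicator {y. f y \<le> T1} y) \<partial>lborel) \<le> ennreal P"
      proof
        fix x
        have "{y. 0 < f y} \<subseteq> \<Omega>" using fout by (metis less_irrefl mem_Collect_eq subsetI)
        then have "emeasure lborel {y. 0 < f y} \<le> emeasure lborel \<Omega>" using \<Omega> by (intro emeasure_mono) auto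
        also have "\<dots> = ennreal v" using vol v \<Omega> by simp
        finally show "(\<integral>\<^sup>+ y. riesz_kernel (y - x) * (ennreal (f y) * indicator {y. f y \<le> T1} y) \<partial>lborel) \<le> ennreal P"
          unfolding P_def by (intro C2(2)[of f v W t0 A y' Y]) (use f f0 v W int Y par(2) in simp)
      qed
    qed (use \<Omega> nU sets\<mu> frost mm hh fin u G par(3) E in auto)
    also have "\<dots> = ennreal C1 * (emeasure \<mu> E * ennreal (P + T2) + ennreal (measure \<mu> E powr (1 - ?s / \<alpha>)) * (interior_excess f T1 + boundary_excess \<Omega> u T2))"
      using P0 par(3) by (simp add: interior_excess_def boundary_excess_def)
    also have "\<dots> \<le> ennreal C1 * (emeasure \<mu> E * ennreal (P + T2) + ennreal (measure \<mu> E powr (1 - ?s / \<alpha>)) * ennreal \<phi>)"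
      by (intro mult_left_mono add_left_mono exc) auto
    finally have up: "(\<integral>\<^sup>+ x. indicator E x * ennreal (norm (u x)) \<partial>\<mu>) \<le> \<dots>" .
    have "emeasure \<mu> E \<le> emeasure \<mu> \<Omega>" unfolding sp[symmetric] by (rule emeasure_space)
    then have Efin: "emeasure \<mu> E < \<infinity>" using mm fin(2) by (auto intro: le_less_trans)
    define k where "k = measure \<mu> E"
    have k: "emeasure \<mu> E = ennreal k" "k \<ge> 0" using Efin by (simp_all add: k_def emeasure_eq_ennreal_measure)
    have "ennreal (l * k) = (\<integral>\<^sup>+ x. ennreal l * indicator E x \<partial>\<mu>)"
      using E par(1) k by (simp add: nn_integral_cmult_indicator ennreal_mult)
    also have "\<dots> \<le> (\<integral>\<^sup>+ x. indicator E x * ennreal (norm (u x)) \<partial>\<mu>)"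
      by (intro nn_integral_mono) (auto simp: E_def indicator_def intro!: ennreal_leI)
    also note up
    also have "ennreal C1 * (emeasure \<mu> E * ennreal (P + T2) + ennreal (measure \<mu> E powr (1 - ?s / \<alpha>)) * ennreal \<phi>) =
       ennreal (C1 * (k * (P + T2) + k powr (1 - ?s / \<alpha>) * \<phi>))"
      using C1(1) P0 par k by (simp add: k_def[symmetric] ennreal_mult ennreal_plus)
    finally have "l * k \<le> C1 * (k * (P + T2) + k powr (1 - ?s / \<alpha>) * \<phi>)"
      using C1(1) P0 par k by (subst (asm) ennreal_le_iff) auto
    \<comment> \<open>The lower bound on l is made for this: the term proportional to k, finite
      since \<mu> is, becomes at most half of the left side and is absorbed there.\<close>
    moreover have "C1 * (P + T2) \<le> l / 2"
    proof -
      have "C1 * (P + T2) \<le> C1 * (D * (1 + Y T1 powr (?s / ?n) + T2))" using PD C1(1) by (intro mult_left_mono) auto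
      also have "\<dots> \<le> l / 2" using par(5) by (simp add: C_def)
      finally show ?thesis .
    qed
    then have "k * (C1 * (P + T2)) \<le> k * (l / 2)" using k(2) by (rule mult_left_mono)
    ultimately have main: "k * (l / 2) \<le> C1 * (k powr (1 - ?s / \<alpha>) * \<phi>)" by (simp add: algebra_simps)
    have \<alpha>0: "\<alpha> > 0" using \<alpha> s by simp
    have "k \<le> (C * \<phi> / l) powr (\<alpha> / ?s)"
    proof (cases "k = 0")
      case False
      then have k0: "k > 0" using k by simp
      have "k = k powr (1 - ?s / \<alpha>) * k powr (?s / \<alpha>)" using k0 by (simp add: powr_add[symmetric])
      then have "k powr (1 - ?s / \<alpha>) * (k powr (?s / \<alpha>) * (l / 2)) \<le> k powr (1 - ?s / \<alpha>) * (C1 * \<phi>)"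
        using main by (simp add: mult_ac)
      then have "k powr (?s / \<alpha>) * (l / 2) \<le> C1 * \<phi>" using k0 by simp
      then have "k powr (?s / \<alpha>) \<le> 2 * C1 * \<phi> / l" using par(1) by (simp add: field_simps)
      also have "\<dots> \<le> C * \<phi> / l"
        using D C1(1) par by (intro divide_right_mono mult_right_mono) (auto simp: C_def)
      finally have "(k powr (?s / \<alpha>)) powr (\<alpha> / ?s) \<le> (C * \<phi> / l) powr (\<alpha> / ?s)"
        using \<alpha>0 s by (intro powr_mono2) auto
      then show ?thesis using k0 \<alpha>0 s by (simp add: powr_powr)
    qed simp
    then show ?thesis using k by (simp add: E_def ennreal_leI)
  qed
  show ?thesis
    by (intro exI[of _ C] conjI allI impI C; elim conjE; rule est; assumption)
qed

section \<open>Modular estimates\<close>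

text \<open>A value above L 0 lies in some interval from L j to L (Suc j). As L is only assumed to
  tend to infinity, the interval is found by taking Suc j as the least index whose level is at least
  the value.\<close>

lemma nn_integral_le_level_sum:
  fixes F :: "'a \<Rightarrow> real" and b :: "real \<Rightarrow> real"
  assumes F [measurable]: "F \<in> borel_measurable M" and L: "filterlim L at_top sequentially"
    and mono: "\<And>s t. L 0 \<le> s \<Longrightarrow> s \<le> t \<Longrightarrow> b s \<le> b t"
  shows "(\<integral>\<^sup>+ x. indicator {x \<in> space M. L 0 < F x} x * ennreal (b (F x)) \<partial>M)
    \<le> (\<Sum>j. ennreal (b (L (Suc j))) * emeasure M {x \<in> space M. L j < F x})"
proof -
  have "(\<integral>\<^sup>+ x. indicator {x \<in> space M. L 0 < F x} x * ennreal (b (F x)) \<partial>M)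
    \<le> (\<integral>\<^sup>+ x. (\<Sum>j. ennreal (b (L (Suc j))) * indicator {x \<in> space M. L j < F x} x) \<partial>M)"
  proof (rule nn_integral_mono)
    fix x assume x: "x \<in> space M"
    show "indicator {x \<in> space M. L 0 < F x} x * ennreal (b (F x)) \<le>
      (\<Sum>j. ennreal (b (L (Suc j))) * indicator {x \<in> space M. L j < F x} x)"
    proof (cases "L 0 < F x")
      case True
      obtain k0 where k0: "F x \<le> L k0"
        using L by (metis eventually_sequentially filterlim_at_top order_refl)
      define k where "k = (LEAST k. F x \<le> L k)"
      have k: "F x \<le> L k" unfolding k_def using k0 by (rule LeastI)
      then obtain j where j: "k = Suc j" using True by (cases k) auto
      then have "j < (LEAST k. F x \<le> L k)" by (simp add: k_def)
      then have "L j < F x" using not_less_Least[of j "\<lambda>k. F x \<le> L k"] by simp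
      have "ennreal (b (F x)) \<le> ennreal (b (L (Suc j)))"
        using mono[of "F x" "L (Suc j)"] True k j by (simp add: ennreal_leI)
      also have "\<dots> = ennreal (b (L (Suc j))) * indicator {x \<in> space M. L j < F x} x"
        using \<open>L j < F x\<close> x by simp
      also have "\<dots> \<le> (\<Sum>j. ennreal (b (L (Suc j))) * indicator {x \<in> space M. L j < F x} x)"
        by (rule ennreal_le_suminf)
      finally show ?thesis using True x by simp
    qed simp
  qed
  also have "\<dots> = (\<Sum>j. ennreal (b (L (Suc j))) * emeasure M {x \<in> space M. L j < F x})"
    by (subst nn_integral_suminf) (auto simp: nn_integral_cmult_indicator)
  finally show ?thesis .
qed

section \<open>Summing the excesses over a sequence of levels\<close>

lemma geometric_growth_sum_le:
  fixes g :: "nat \<Rightarrow> real"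
  assumes "\<rho> > 1" and g: "\<And>j. g j \<ge> 0" "\<And>j. \<rho> * g j \<le> g (Suc j)"
  shows "(\<Sum>j\<le>J. g j) \<le> \<rho> / (\<rho> - 1) * g J"
proof (induction J)
  case 0
  have "1 \<le> \<rho> / (\<rho> - 1)" using assms(1) by simp
  then have "1 * g 0 \<le> \<rho> / (\<rho> - 1) * g 0" using g by (intro mult_right_mono) auto
  then show ?case by simp
next
  case (Suc J)
  have "(\<Sum>j\<le>Suc J. g j) \<le> \<rho> / (\<rho> - 1) * g J + g (Suc J)" using Suc by simp
  also have "\<rho> / (\<rho> - 1) * g J = 1 / (\<rho> - 1) * (\<rho> * g J)" by simp
  also have "\<dots> \<le> 1 / (\<rho> - 1) * g (Suc J)" using g(2)[of J] assms(1) by (intro mult_left_mono) auto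
  also have "1 / (\<rho> - 1) * g (Suc J) + g (Suc J) = \<rho> / (\<rho> - 1) * g (Suc J)"
    using assms(1) by (simp add: field_simps)
  finally show ?case by simp
qed

text \<open>Only indices with T j < v contribute, and for each of them \<open>superlinear\<close>
  gives g j v \<le> A(v)/\<epsilon>. Since g grows geometrically, the sum is dominated by its last
  contributing term, at the index \<open>J\<close> below; so the bound has the factor \<rho>/(\<rho>
  - 1) and not the number of terms. This summation is sharper than adding Chebyshev bounds level by
  level.\<close>

lemma geometric_excess_pointwise:
  fixes g T :: "nat \<Rightarrow> real"
  assumes \<rho>: "\<rho> > 1" and g: "\<And>j. g j > 0" "\<And>j. \<rho> * g j \<le> g (Suc j)" and sl: "superlinear t0 W A"
    and T: "\<And>j. t0 \<le> T j" and \<epsilon>: "\<epsilon> > 0" "\<And>j. \<epsilon> * g j \<le> W (T j)"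
  shows "(\<Sum>j. ennreal (g j) * (ennreal v * indicator {v. T j < v} v)) \<le> ennreal (\<rho> / (\<rho> - 1) / \<epsilon>) * A v"
proof (cases "A v")
  case (real a)
  have t0: "t0 > 0" using sl by (simp add: superlinear_def)
  have bound: "g j * v \<le> a / \<epsilon>" if "T j < v" for j
  proof -
    have "ennreal (v * W (T j)) \<le> A v" using sl T[of j] that by (auto simp: superlinear_def)
    then have "v * W (T j) \<le> a" using real by (metis ennreal_le_iff)
    moreover have "v > 0" using T[of j] t0 that by linarith
    then have "v * (\<epsilon> * g j) \<le> v * W (T j)" using \<epsilon>(2)[of j] by (intro mult_left_mono) auto
    ultimately show ?thesis using \<epsilon>(1) by (simp add: field_simps)
  qed
  have "(\<Sum>j. ennreal (g j) * (ennreal v * indicator {v. T j < v} v)) \<le> ennreal (\<rho> / (\<rho> - 1) / \<epsilon> * a)"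
  proof (rule suminf_le_const)
    fix N
    show "(\<Sum>j<N. ennreal (g j) * (ennreal v * indicator {v. T j < v} v)) \<le> ennreal (\<rho> / (\<rho> - 1) / \<epsilon> * a)"
    proof (cases "{j. j < N \<and> T j < v} = {}")
      case True
      then have "(\<Sum>j<N. ennreal (g j) * (ennreal v * indicator {v. T j < v} v)) = (\<Sum>j<N. 0)"
        by (intro sum.cong) auto
      then show ?thesis by (simp only: sum.neutral_const zero_le)
    next
      case False
      define J where "J = Max {j. j < N \<and> T j < v}"
      have J: "T J < v" and Jmax: "\<And>j. j < N \<Longrightarrow> T j < v \<Longrightarrow> j \<le> J"
        using Max_in[OF _ False] by (auto simp: J_def)
      have v: "v > 0" using T[of J] t0 J by linarith
      have "(\<Sum>j<N. ennreal (g j) * (ennreal v * indicator {v. T j < v} v)) \<le> (\<Sum>j<N. ennreal (g j * v) * indicator {..J} j)"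
        using v g(1) Jmax by (intro sum_mono) (auto simp: indicator_def ennreal_mult less_imp_le)
      also have "\<dots> \<le> (\<Sum>j\<in>{..J} \<union> {..<N}. ennreal (g j * v) * indicator {..J} j)"
        by (intro sum_mono2) auto
      also have "\<dots> = (\<Sum>j\<le>J. ennreal (g j * v))"
        by (rule sum.mono_neutral_cong_right) (auto simp: indicator_def)
      also have "\<dots> = ennreal (\<Sum>j\<le>J. g j * v)" using g v by (intro sum_ennreal) (simp add: less_imp_le)
      also have "(\<Sum>j\<le>J. g j * v) \<le> \<rho> / (\<rho> - 1) * g J * v"
        unfolding sum_distrib_right[symmetric]
        using v by (intro mult_right_mono geometric_growth_sum_le[OF \<rho>]) (use g in \<open>auto intro: less_imp_le\<close>)
      also have "\<dots> \<le> \<rho> / (\<rho> - 1) * (a / \<epsilon>)"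
        using mult_left_mono[OF bound[OF J], of "\<rho> / (\<rho> - 1)"] \<rho> by (simp add: mult_ac)
      finally show ?thesis by (simp add: mult_ac ennreal_leI)
    qed
  qed simp
  also have "\<dots> = ennreal (\<rho> / (\<rho> - 1) / \<epsilon>) * A v" using real \<rho> \<epsilon>(1) by (simp add: ennreal_mult[symmetric])
  finally show ?thesis .
next
  case top
  then show ?thesis using \<rho> \<epsilon>(1) by (simp add: ennreal_mult_top)
qed

text \<open>Measurability is assumed of the \<open>H j\<close> and not of \<open>B\<close>, which
  will be a Young function applied to a function. A constant can therefore be taken out of the
  integral only on the side of \<open>H\<close>, and k is moved there as 1/k before the integrands
  are compared.\<close>

lemma nn_integral_weighted_sum_le:
  fixes H :: "nat \<Rightarrow> 'a \<Rightarrow> ennreal" and k :: real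
  assumes [measurable]: "\<And>j. H j \<in> borel_measurable M" and k: "k > 0"
    and le: "\<And>x. (\<Sum>j. w j * H j x) \<le> ennreal k * B x" and int: "(\<integral>\<^sup>+ x. B x \<partial>M) \<le> 1"
  shows "(\<Sum>j. w j * (\<integral>\<^sup>+ x. H j x \<partial>M)) \<le> ennreal k"
proof -
  have inv: "ennreal k * ennreal (1 / k) = 1" "ennreal (1 / k) * ennreal k = 1"
    using k by (simp_all add: ennreal_mult[symmetric])
  have "(\<Sum>j. w j * (\<integral>\<^sup>+ x. H j x \<partial>M)) = (\<integral>\<^sup>+ x. (\<Sum>j. w j * H j x) \<partial>M)"
    by (subst nn_integral_suminf) (simp_all add: nn_integral_cmult)
  also have "\<dots> = ennreal k * (ennreal (1 / k) * (\<integral>\<^sup>+ x. (\<Sum>j. w j * H j x) \<partial>M))"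
    by (simp only: mult.assoc[symmetric] inv mult_1)
  also have "\<dots> = ennreal k * (\<integral>\<^sup>+ x. ennreal (1 / k) * (\<Sum>j. w j * H j x) \<partial>M)"
    by (simp add: nn_integral_cmult)
  also have "\<dots> \<le> ennreal k * (\<integral>\<^sup>+ x. B x \<partial>M)"
  proof (intro mult_left_mono nn_integral_mono)
    fix x
    have "ennreal (1 / k) * (\<Sum>j. w j * H j x) \<le> ennreal (1 / k) * (ennreal k * B x)"
      by (intro mult_left_mono le) simp
    then show "ennreal (1 / k) * (\<Sum>j. w j * H j x) \<le> B x"
      by (simp only: mult.assoc[symmetric] inv mult_1)
  qed simp
  also have "\<dots> \<le> ennreal k * 1" by (intro mult_left_mono int) simp
  finally show ?thesis by simp
qed

lemma sum_excess_le:
  fixes g T :: "nat \<Rightarrow> real" and F :: "'a \<Rightarrow> real"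
  assumes \<rho>: "\<rho> > 1" and g: "\<And>j. g j > 0" "\<And>j. \<rho> * g j \<le> g (Suc j)" and sl: "superlinear t0 W A"
    and T: "\<And>j. t0 \<le> T j" and \<epsilon>: "\<epsilon> > 0" "\<And>j. \<epsilon> * g j \<le> W (T j)"
    and int: "(\<integral>\<^sup>+ x. indicator S x * A (F x) \<partial>M) \<le> 1"
    and meas: "\<And>j. (\<lambda>x. indicator S x * ennreal (F x) * indicator {x. T j < F x} x) \<in> borel_measurable M"
  shows "(\<Sum>j. ennreal (g j) * (\<integral>\<^sup>+ x. indicator S x * ennreal (F x) * indicator {x. T j < F x} x \<partial>M))
    \<le> ennreal (\<rho> / (\<rho> - 1) / \<epsilon>)"
proof (rule nn_integral_weighted_sum_le[OF meas _ _ int])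
  show "\<rho> / (\<rho> - 1) / \<epsilon> > 0" using \<rho> \<epsilon>(1) by simp
  fix x
  show "(\<Sum>j. ennreal (g j) * (indicator S x * ennreal (F x) * indicator {x. T j < F x} x))
    \<le> ennreal (\<rho> / (\<rho> - 1) / \<epsilon>) * (indicator S x * A (F x))"
  proof (cases "x \<in> S")
    case True
    have "(\<Sum>j. ennreal (g j) * (indicator S x * ennreal (F x) * indicator {x. T j < F x} x)) =
      (\<Sum>j. ennreal (g j) * (ennreal (F x) * indicator {v. T j < v} (F x)))"
      using True by (simp add: indicator_def)
    also have "\<dots> \<le> ennreal (\<rho> / (\<rho> - 1) / \<epsilon>) * A (F x)"
      by (rule geometric_excess_pointwise[where g = g and T = T and W = W]) (use \<rho> g sl T \<epsilon> in auto)
    finally show ?thesis using True by simp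
  qed simp
qed

definition boundary_modular :: "(real ^ 'n::finite) set \<Rightarrow> (real \<Rightarrow> ennreal) \<Rightarrow> (real ^ 'n \<Rightarrow> real ^ 'n) \<Rightarrow> ennreal" where
  "boundary_modular \<Omega> D u = (\<integral>\<^sup>+ p. indicator (frontier \<Omega>) p * D (norm (u p)) \<partial>hausdorff_measure (real CARD('n) - 1))"

lemma boundary_excess_eq:
  "boundary_excess \<Omega> (u :: real ^ 'n::finite \<Rightarrow> real ^ 'n) T = (\<integral>\<^sup>+ p. indicator (frontier \<Omega>) p * ennreal (norm (u p)) * indicator {p. T < norm (u p)} p \<partial>hausdorff_measure (real CARD('n) - 1))"
  unfolding boundary_excess_def by (intro nn_integral_cong) (auto simp: indicator_def)

lemma boundary_norm_measurable:
  fixes u :: "real ^ 'n::finite \<Rightarrow> real ^ 'n"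
  assumes "u \<in> Cb (closure \<Omega>)"
  shows "(\<lambda>p. indicator (frontier \<Omega>) p * norm (u p)) \<in> borel_measurable borel"
proof -
  have "continuous_on (frontier \<Omega>) u"
    using assms by (auto simp: Cb_def frontier_def intro: continuous_on_subset)
  then show ?thesis
    using borel_measurable_continuous_on_indicator[of "frontier \<Omega>" "\<lambda>p. norm (u p)"]
    by (simp add: continuous_on_norm frontier_closed)
qed

lemma boundary_excess_measurable:
  fixes u :: "real ^ 'n::finite \<Rightarrow> real ^ 'n"
  assumes "u \<in> Cb (closure \<Omega>)" "T > 0"
  shows "(\<lambda>p. indicator (frontier \<Omega>) p * ennreal (norm (u p)) * indicator {p. T < norm (u p)} p) \<in> borel_measurable (hausdorff_measure s)"
proof -
  note [measurable] = boundary_norm_measurable[OF assms(1)]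
  have "(\<lambda>p. indicator (frontier \<Omega>) p * ennreal (norm (u p)) * indicator {p. T < norm (u p)} p) =
    (\<lambda>p. ennreal (if T < indicator (frontier \<Omega>) p * norm (u p) then indicator (frontier \<Omega>) p * norm (u p) else 0))"
    using assms(2) by (auto simp: indicator_def fun_eq_iff)
  then show ?thesis by simp
qed

text \<open>A strong-type bound from the weak-type one. Along the levels L j = l0 2^j the weighted
  excesses x j = g(L j) \<Phi> j have a finite sum, because g stays below both W(T1) and WD(T2) up
  to the factor 1/\<epsilon>. By \<open>level_set_estimate\<close> and the bound on b the j-th
  summand of the modular is at most K (C x j)^r with r = \<alpha>/(n-1), and r \<ge> 1 makes it
  summable.\<close>

lemma power_modular_estimate:
  fixes \<alpha> c :: real and V m h :: ennreal and b g :: "real \<Rightarrow> real"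
  assumes n2: "CARD('n::finite) \<ge> 2" and \<alpha>: "real CARD('n) - 1 < \<alpha>" and c: "c > 0"
    and fin: "V < \<infinity>" "m < \<infinity>" "h < \<infinity>"
    and W: "W \<in> borel_measurable borel" "superlinear t0 W A"
    and Y: "y' \<in> borel_measurable borel"
      "\<forall>t\<ge>t0. DERIV Y t :> y' t \<and> W t powr (- 1 / (real CARD('n) - 1)) \<le> y' t \<and> Y t > 0"
    and WD: "superlinear s0 WD D"
    and choice: "\<And>C. C > 0 \<Longrightarrow> \<exists>\<epsilon>>0. \<exists>T1 T2. \<forall>\<^sub>F l in at_top. t0 \<le> T1 l \<and> s0 \<le> T2 l \<and>
       C * (1 + Y (T1 l) powr ((real CARD('n) - 1) / real CARD('n)) + T2 l) \<le> l \<and>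
       \<epsilon> * g l \<le> W (T1 l) \<and> \<epsilon> * g l \<le> WD (T2 l)"
    and growth: "\<rho> > 1" "\<forall>\<^sub>F l in at_top. g l > 0 \<and> \<rho> * g l \<le> g (2 * l)"
    and b: "K > 0" "\<forall>\<^sub>F l in at_top. b (2 * l) \<le> K * (l * g l) powr (\<alpha> / (real CARD('n) - 1))"
      "\<forall>\<^sub>F l in at_top. \<forall>s\<ge>l. b l \<le> b s"
  shows "\<exists>l0>0. \<exists>Q\<ge>0. \<forall>\<Omega> \<mu> (u :: real ^ 'n \<Rightarrow> real ^ 'n) G f.
    sobolev_data \<alpha> c V m h \<Omega> \<mu> u G f \<and> (\<integral>\<^sup>+ y. A (f y) \<partial>lborel) \<le> 1 \<and> boundary_modular \<Omega> D u \<le> 1 \<longrightarrow>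
    (\<integral>\<^sup>+ x. indicator {x \<in> \<Omega>. l0 < norm (u x)} x * ennreal (b (norm (u x))) \<partial>\<mu>) \<le> ennreal Q"
proof -
  let ?n = "real CARD('n)" and ?s = "real CARD('n) - 1"
  define r where "r = \<alpha> / ?s"
  have r: "r \<ge> 1" using n2 \<alpha> by (simp add: r_def)
  obtain C where C: "C > 0" "\<And>\<Omega> \<mu> (u :: real ^ 'n \<Rightarrow> real ^ 'n) G f l T1 T2 \<phi>.
    sobolev_data \<alpha> c V m h \<Omega> \<mu> u G f \<and> (\<integral>\<^sup>+ y. A (f y) \<partial>lborel) \<le> 1 \<and>
    l > 0 \<and> t0 \<le> T1 \<and> T2 > 0 \<and> \<phi> \<ge> 0 \<and>
    C * (1 + Y T1 powr (?s / ?n) + T2) \<le> l \<and>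
    interior_excess f T1 + boundary_excess \<Omega> u T2 \<le> ennreal \<phi> \<Longrightarrow>
    emeasure \<mu> {x \<in> \<Omega>. l < norm (u x)} \<le> ennreal ((C * \<phi> / l) powr r)"
    using level_set_estimate[OF n2 \<alpha> c fin W Y, folded r_def]
    by (elim exE conjE) (rule that, assumption, (drule spec)+, drule (1) mp, assumption)
  obtain \<epsilon> T1 T2 where ch: "\<epsilon> > 0" "\<forall>\<^sub>F l in at_top. t0 \<le> T1 l \<and> s0 \<le> T2 l \<and>
       C * (1 + Y (T1 l) powr (?s / ?n) + T2 l) \<le> l \<and> \<epsilon> * g l \<le> W (T1 l) \<and> \<epsilon> * g l \<le> WD (T2 l)"
    using choice[OF C(1)] by blast
  have s0: "s0 > 0" using WD by (simp add: superlinear_def)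
  obtain l0 where l0: "l0 \<ge> 1" "\<And>l. l \<ge> l0 \<Longrightarrow> t0 \<le> T1 l \<and> s0 \<le> T2 l \<and>
       C * (1 + Y (T1 l) powr (?s / ?n) + T2 l) \<le> l \<and> \<epsilon> * g l \<le> W (T1 l) \<and> \<epsilon> * g l \<le> WD (T2 l)"
     "\<And>l. l \<ge> l0 \<Longrightarrow> g l > 0 \<and> \<rho> * g l \<le> g (2 * l)" "\<And>l. l \<ge> l0 \<Longrightarrow> b (2 * l) \<le> K * (l * g l) powr r"
     "\<And>l. l \<ge> l0 \<Longrightarrow> \<forall>s\<ge>l. b l \<le> b s"
  proof -
    have "\<forall>\<^sub>F l in at_top. (t0 \<le> T1 l \<and> s0 \<le> T2 l \<and>
       C * (1 + Y (T1 l) powr (?s / ?n) + T2 l) \<le> l \<and> \<epsilon> * g l \<le> W (T1 l) \<and> \<epsilon> * g l \<le> WD (T2 l)) \<and>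
       (g l > 0 \<and> \<rho> * g l \<le> g (2 * l)) \<and> b (2 * l) \<le> K * (l * g l) powr r \<and> (\<forall>s\<ge>l. b l \<le> b s)"
      using ch(2) growth(2) b(2,3) unfolding r_def[symmetric] by eventually_elim blast
    then obtain N where N: "\<And>l. l \<ge> N \<Longrightarrow> (t0 \<le> T1 l \<and> s0 \<le> T2 l \<and>
       C * (1 + Y (T1 l) powr (?s / ?n) + T2 l) \<le> l \<and> \<epsilon> * g l \<le> W (T1 l) \<and> \<epsilon> * g l \<le> WD (T2 l)) \<and>
       (g l > 0 \<and> \<rho> * g l \<le> g (2 * l)) \<and> b (2 * l) \<le> K * (l * g l) powr r \<and> (\<forall>s\<ge>l. b l \<le> b s)"
      unfolding eventually_at_top_linorder by blast
    show ?thesis by (rule that[of "max 1 N"]) (use N in auto)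
  qed
  define L where "L j = l0 * 2 ^ j" for j :: nat
  have L: "L j \<ge> l0" "L j > 0" for j
  proof -
    have "l0 * 1 \<le> l0 * 2 ^ j" using l0(1) by (intro mult_left_mono) auto
    then show "L j \<ge> l0" by (simp add: L_def)
    then show "L j > 0" using l0(1) by linarith
  qed
  have LSuc: "L (Suc j) = 2 * L j" for j by (simp add: L_def)
  have Lim: "filterlim L at_top sequentially"
  proof -
    have "filterlim (\<lambda>j. (2::real) ^ j) at_top sequentially"
      by (rule filterlim_at_top_mono[OF filterlim_real_sequentially])
         (auto intro!: always_eventually less_imp_le of_nat_less_two_power)
    then show ?thesis unfolding L_def using l0(1) by (intro filterlim_tendsto_pos_mult_at_top[OF tendsto_const]) auto
  qed
  define \<kappa> where "\<kappa> = \<rho> / (\<rho> - 1) / \<epsilon>"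
  have \<kappa>: "\<kappa> > 0" using growth(1) ch(1) by (simp add: \<kappa>_def)
  \<comment> \<open>One \<kappa> for the sum of the interior excesses and one for the boundary
    excesses.\<close>
  define X where "X = 2 * \<kappa>"
  define Q where "Q = K * C powr r * X powr r"
  have est: "(\<integral>\<^sup>+ x. indicator {x \<in> \<Omega>. l0 < norm (u x)} x * ennreal (b (norm (u x))) \<partial>\<mu>) \<le> ennreal Q"
    if data: "sobolev_data \<alpha> c V m h \<Omega> \<mu> u G f" and intA: "(\<integral>\<^sup>+ y. A (f y) \<partial>lborel) \<le> 1" and intD: "boundary_modular \<Omega> D u \<le> 1"
    for \<Omega> \<mu> and u :: "real ^ 'n \<Rightarrow> real ^ 'n" and G f
  proof -
    have adm: "admissible \<alpha> c V m h \<Omega> \<mu>" and u: "u \<in> Cb (closure \<Omega>)" and f [measurable]: "f \<in> borel_measurable borel"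
      using data by (simp_all add: sobolev_data_def)
    note [measurable] = measurable_on_admissible(1)[OF adm u]
    have sp: "space \<mu> = \<Omega>" by (rule measurable_on_admissible(2)[OF adm u])
    define \<Phi> where "\<Phi> j = interior_excess f (T1 (L j)) + boundary_excess \<Omega> u (T2 (L j))" for j
    have g: "g (L j) > 0" "\<rho> * g (L j) \<le> g (L (Suc j))" for j using l0(3)[OF L(1)] by (auto simp: LSuc)
    have S1: "(\<Sum>j. ennreal (g (L j)) * interior_excess f (T1 (L j))) \<le> ennreal \<kappa>"
    proof -
      have "(\<lambda>x. ennreal (f x) * (if T < f x then 1 else 0)) \<in> borel_measurable lborel" for T
        by measurable
      then have mm: "(\<lambda>x. indicator UNIV x * ennreal (f x) * indicator {x. T < f x} x) \<in> borel_measurable lborel" for T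
        by (simp add: indicator_def)
      have "interior_excess f T = (\<integral>\<^sup>+ x. indicator UNIV x * ennreal (f x) * indicator {x. T < f x} x \<partial>lborel)" for T
        by (simp add: interior_excess_def)
      then show ?thesis
        unfolding \<kappa>_def using l0(2)[OF L(1)] intA ch(1) growth(1) g W(2)
        by (simp only:)
           (rule sum_excess_le[where g = "\<lambda>j. g (L j)" and T = "\<lambda>j. T1 (L j)" and S = UNIV and W = W and A = A, OF _ _ _ _ _ _ _ _ mm], auto)
    qed
    have S2: "(\<Sum>j. ennreal (g (L j)) * boundary_excess \<Omega> u (T2 (L j))) \<le> ennreal \<kappa>"
      unfolding \<kappa>_def boundary_excess_eq
    proof (rule sum_excess_le[where g = "\<lambda>j. g (L j)" and T = "\<lambda>j. T2 (L j)" and W = WD and A = D])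
      show "(\<integral>\<^sup>+ p. indicator (frontier \<Omega>) p * D (norm (u p)) \<partial>hausdorff_measure ?s) \<le> 1"
        using intD by (simp add: boundary_modular_def)
      show "(\<lambda>p. indicator (frontier \<Omega>) p * ennreal (norm (u p)) * indicator {p. T2 (L j) < norm (u p)} p) \<in> borel_measurable (hausdorff_measure ?s)" for j
        using l0(2)[OF L(1)[of j]] s0 by (intro boundary_excess_measurable[OF u]) auto
    qed (use l0(2)[OF L(1)] growth(1) g WD ch(1) in auto)
    have "(\<Sum>j. ennreal (g (L j)) * \<Phi> j) = (\<Sum>j. ennreal (g (L j)) * interior_excess f (T1 (L j))) + (\<Sum>j. ennreal (g (L j)) * boundary_excess \<Omega> u (T2 (L j)))"
      unfolding \<Phi>_def distrib_left by (rule suminf_add[symmetric]) auto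
    also have "\<dots> \<le> ennreal \<kappa> + ennreal \<kappa>" by (intro add_mono S1 S2)
    also have "\<dots> = ennreal X" using \<kappa> by (simp add: X_def ennreal_plus[symmetric] del: ennreal_plus)
    finally have S: "(\<Sum>j. ennreal (g (L j)) * \<Phi> j) \<le> ennreal X" .
    then have Sj: "ennreal (g (L j)) * \<Phi> j \<le> ennreal X" for j using ennreal_le_suminf order_trans by blast
    define x where "x j = enn2real (ennreal (g (L j)) * \<Phi> j)" for j
    have x: "ennreal (x j) = ennreal (g (L j)) * \<Phi> j" "0 \<le> x j" "x j \<le> X" for j
    proof -
      have "ennreal (g (L j)) * \<Phi> j < top" using Sj[of j] by (auto intro: le_less_trans)
      then show "ennreal (x j) = ennreal (g (L j)) * \<Phi> j" by (simp add: x_def)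
      show "0 \<le> x j" by (simp add: x_def)
      show "x j \<le> X" using Sj[of j] \<kappa> by (simp add: x_def X_def enn2real_leI)
    qed
    have \<Phi>x: "\<Phi> j = ennreal (x j / g (L j))" for j
    proof -
      have "ennreal (x j / g (L j)) = ennreal (1 / g (L j)) * ennreal (x j)" using g(1)[of j] x(2)[of j] by (simp add: ennreal_mult[symmetric])
      also have "\<dots> = (ennreal (1 / g (L j)) * ennreal (g (L j))) * \<Phi> j" by (simp only: x(1) mult.assoc)
      also have "ennreal (1 / g (L j)) * ennreal (g (L j)) = 1" using g(1)[of j] by (simp add: ennreal_mult[symmetric])
      finally show ?thesis by simp
    qed
    have summand: "ennreal (b (L (Suc j))) * emeasure \<mu> {x \<in> space \<mu>. L j < norm (u x)} \<le> ennreal (K * C powr r * X powr (r - 1)) * ennreal (x j)" for j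
    proof -
      have gj: "g (L j) > 0" by (rule g)
      have "emeasure \<mu> {x \<in> \<Omega>. L j < norm (u x)} \<le> ennreal ((C * (x j / g (L j)) / L j) powr r)"
      proof (rule C(2)[of \<Omega> \<mu> u G f "L j" "T1 (L j)" "T2 (L j)"], intro conjI)
        show "interior_excess f (T1 (L j)) + boundary_excess \<Omega> u (T2 (L j)) \<le> ennreal (x j / g (L j))"
          using \<Phi>x[of j] by (simp add: \<Phi>_def)
        show "0 < T2 (L j)" using l0(2)[OF L(1)[of j]] s0 by linarith
        show "0 \<le> x j / g (L j)" using x(2)[of j] gj by simp
      qed (use data intA L l0(2)[OF L(1)[of j]] in auto)
      moreover have "b (L (Suc j)) \<le> K * (L j * g (L j)) powr r" using l0(4)[OF L(1)[of j]] by (simp add: LSuc)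
      ultimately have "ennreal (b (L (Suc j))) * emeasure \<mu> {x \<in> space \<mu>. L j < norm (u x)} \<le>
          ennreal (K * (L j * g (L j)) powr r) * ennreal ((C * (x j / g (L j)) / L j) powr r)"
        unfolding sp by (intro mult_mono ennreal_leI) auto
      also have "\<dots> = ennreal (K * (L j * g (L j)) powr r * (C * (x j / g (L j)) / L j) powr r)"
        using b(1) by (simp add: ennreal_mult[symmetric])
      also have "K * (L j * g (L j)) powr r * (C * (x j / g (L j)) / L j) powr r = K * ((L j * g (L j)) powr r * (C * (x j / g (L j)) / L j) powr r)"
        by simp
      also have "(L j * g (L j)) powr r * (C * (x j / g (L j)) / L j) powr r = (C * x j) powr r"
        using L(2)[of j] gj C(1) x(2)[of j] by (subst powr_mult[symmetric]) auto
      \<comment> \<open>All but one of the r powers of x j are bounded by powers of X; the first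
        power that remains is summable over j.\<close>
      also have "(C * x j) powr r \<le> C powr r * (X powr (r - 1) * x j)"
      proof (cases "x j = 0")
        case False
        then have xj: "x j > 0" using x(2)[of j] by simp
        have "x j powr r = x j powr (r - 1) * x j" using xj by (simp add: powr_diff)
        also have "\<dots> \<le> X powr (r - 1) * x j" using xj x(3)[of j] r by (intro mult_right_mono powr_mono2) auto
        finally show ?thesis using C(1) xj by (simp add: powr_mult)
      qed simp
      finally have "ennreal (b (L (Suc j))) * emeasure \<mu> {x \<in> space \<mu>. L j < norm (u x)} \<le> ennreal (K * (C powr r * (X powr (r - 1) * x j)))"
        using b(1) by (simp add: ennreal_leI)
      then show ?thesis using b(1) x(2)[of j] by (simp add: ennreal_mult[symmetric] mult_ac)
    qed
    have "L 0 = l0" by (simp add: L_def)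
    have "(\<integral>\<^sup>+ x. indicator {x \<in> space \<mu>. L 0 < norm (u x)} x * ennreal (b (norm (u x))) \<partial>\<mu>) \<le>
      (\<Sum>j. ennreal (b (L (Suc j))) * emeasure \<mu> {x \<in> space \<mu>. L j < norm (u x)})"
      by (rule nn_integral_le_level_sum[OF _ Lim]) (use l0(5) in \<open>auto simp: \<open>L 0 = l0\<close>\<close>)
    also have "\<dots> \<le> (\<Sum>j. ennreal (K * C powr r * X powr (r - 1)) * ennreal (x j))"
      by (intro suminf_le summand) auto
    also have "\<dots> = ennreal (K * C powr r * X powr (r - 1)) * (\<Sum>j. ennreal (x j))" by simp
    also have "\<dots> \<le> ennreal (K * C powr r * X powr (r - 1)) * ennreal X"
      using S unfolding x(1)[symmetric] by (intro mult_left_mono) auto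
    also have "\<dots> = ennreal Q"
    proof -
      have "X > 0" using \<kappa> by (simp add: X_def)
      then have "X powr (r - 1) * X = X powr r" by (simp add: powr_diff)
      then have "K * C powr r * X powr (r - 1) * X = Q" by (simp add: Q_def mult.assoc)
      then show ?thesis using b(1) \<open>X > 0\<close> by (simp add: ennreal_mult[symmetric])
    qed
    finally show ?thesis by (simp add: sp \<open>L 0 = l0\<close>)
  qed
  have "Q \<ge> 0" using b(1) by (simp add: Q_def)
  show ?thesis
    by (rule exI[of _ l0], intro conjI, use l0(1) in simp, rule exI[of _ Q], intro conjI allI impI \<open>Q \<ge> 0\<close>; elim conjE; rule est; assumption)
qed

lemma interior_excess_le:
  assumes "f \<in> borel_measurable borel" "superlinear t0 W A" "t0 \<le> T" "(\<integral>\<^sup>+ y. A (f y) \<partial>lborel) \<le> 1"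
  shows "interior_excess f T \<le> ennreal (1 / W T)"
proof -
  note [measurable] = assms(1)
  have "(\<lambda>x. ennreal (f x) * (if T < f x then 1 else 0)) \<in> borel_measurable lborel" by measurable
  then have "(\<lambda>x. indicator UNIV x * ennreal (f x) * indicator {x. T < f x} x) \<in> borel_measurable lborel"
    by (simp add: indicator_def)
  from nn_integral_excess_le[OF assms(2,3) _ this] assms(4) show ?thesis
    by (simp add: interior_excess_def)
qed

lemma boundary_excess_le:
  fixes u :: "real ^ 'n::finite \<Rightarrow> real ^ 'n"
  assumes "u \<in> Cb (closure \<Omega>)" "superlinear s0 W D" "s0 \<le> T" "boundary_modular \<Omega> D u \<le> 1"
  shows "boundary_excess \<Omega> u T \<le> ennreal (1 / W T)"
proof -
  have "T > 0" using assms(2,3) by (simp add: superlinear_def)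
  from nn_integral_excess_le[OF assms(2,3) _ boundary_excess_measurable[OF assms(1) this]] assms(4)
  show ?thesis by (simp add: boundary_excess_eq boundary_modular_def)
qed

text \<open>For exponential targets the bounds 1/W and 1/WD on single excesses are enough. \<psi> j
  is a level at which b is at most e^j. At the level C' \<psi> j both excesses are at most e^(-2j),
  hence so is the measure of the level set, while b at the next level is at most e^(j+1); the
  products form a convergent geometric series. The dilation C' is harmless because the conclusion is
  stated for b of norm (u x)/C.\<close>

lemma exp_modular_estimate:
  fixes \<alpha> c :: real and V m h :: ennreal and b :: "real \<Rightarrow> real" and \<psi> :: "nat \<Rightarrow> real"
  assumes n2: "CARD('n::finite) \<ge> 2" and \<alpha>: "real CARD('n) - 1 < \<alpha>" and c: "c > 0"
    and fin: "V < \<infinity>" "m < \<infinity>" "h < \<infinity>"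
    and W: "W \<in> borel_measurable borel" "superlinear t0 W A"
    and Y: "y' \<in> borel_measurable borel"
      "\<forall>t\<ge>t0. DERIV Y t :> y' t \<and> W t powr (- 1 / (real CARD('n) - 1)) \<le> y' t \<and> Y t > 0"
    and WD: "superlinear s0 WD D"
    and \<psi>: "filterlim \<psi> at_top sequentially"
    and K: "K \<ge> 0" "\<forall>\<^sub>F j in sequentially. t0 \<le> T j \<and>
       Y (T j) powr ((real CARD('n) - 1) / real CARD('n)) \<le> K * \<psi> j \<and> exp (2 * real j) \<le> W (T j)"
    and L0: "\<And>L. L \<ge> L0 \<Longrightarrow> \<forall>\<^sub>F j in sequentially. exp (2 * real j) \<le> WD (L * \<psi> j)"
    and b: "\<forall>\<^sub>F j in sequentially. b (\<psi> j) \<le> exp (real j)" "\<forall>\<^sub>F l in at_top. \<forall>s\<ge>l. b l \<le> b s"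
  shows "\<exists>C>0. \<exists>l0>0. \<exists>Q\<ge>0. \<forall>\<Omega> \<mu> (u :: real ^ 'n \<Rightarrow> real ^ 'n) G f.
    sobolev_data \<alpha> c V m h \<Omega> \<mu> u G f \<and> (\<integral>\<^sup>+ y. A (f y) \<partial>lborel) \<le> 1 \<and> boundary_modular \<Omega> D u \<le> 1 \<longrightarrow>
    (\<integral>\<^sup>+ x. indicator {x \<in> \<Omega>. l0 < norm (u x)} x * ennreal (b (norm (u x) / C)) \<partial>\<mu>) \<le> ennreal Q"
proof -
  let ?n = "real CARD('n)" and ?s = "real CARD('n) - 1"
  define r where "r = \<alpha> / ?s"
  have r: "r \<ge> 1" using n2 \<alpha> by (simp add: r_def)
  obtain C where C: "C > 0" "\<And>\<Omega> \<mu> (u :: real ^ 'n \<Rightarrow> real ^ 'n) G f l T1 T2 \<phi>.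
    sobolev_data \<alpha> c V m h \<Omega> \<mu> u G f \<and> (\<integral>\<^sup>+ y. A (f y) \<partial>lborel) \<le> 1 \<and>
    l > 0 \<and> t0 \<le> T1 \<and> T2 > 0 \<and> \<phi> \<ge> 0 \<and>
    C * (1 + Y T1 powr (?s / ?n) + T2) \<le> l \<and>
    interior_excess f T1 + boundary_excess \<Omega> u T2 \<le> ennreal \<phi> \<Longrightarrow>
    emeasure \<mu> {x \<in> \<Omega>. l < norm (u x)} \<le> ennreal ((C * \<phi> / l) powr r)"
    using level_set_estimate[OF n2 \<alpha> c fin W Y, folded r_def]
    by (elim exE conjE) (rule that, assumption, (drule spec)+, drule (1) mp, assumption)
  have s0: "s0 > 0" using WD by (simp add: superlinear_def)
  \<comment> \<open>L \<ge> 1 + K puts 1 + Y(T j)^((n-1)/n) below L \<psi> j, and L \<ge> L0 makes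
    WD(L \<psi> j) at least e^(2j). With T2 = L \<psi> j the requirement of
    \<open>level_set_estimate\<close> then holds at the level C' \<psi> j for C' = 2 C L.\<close>
  define L where "L = max (1 + K) L0"
  have L: "L \<ge> 1 + K" "L \<ge> L0" by (simp_all add: L_def)
  have L1: "L \<ge> 1" using L(1) K(1) by linarith
  define C' where "C' = 2 * C * L"
  have C': "C' > 0" using C(1) L1 by (simp add: C'_def)
  obtain l1 where l1: "\<And>l s. l \<ge> l1 \<Longrightarrow> s \<ge> l \<Longrightarrow> b l \<le> b s"
    using b(2) unfolding eventually_at_top_linorder by blast
  have "\<forall>\<^sub>F j in sequentially. \<psi> j \<ge> max (max 1 s0) l1"
    using \<psi> unfolding filterlim_at_top by blast
  then have "\<forall>\<^sub>F j in sequentially. \<psi> j \<ge> max (max 1 s0) l1 \<and> (t0 \<le> T j \<and>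
       Y (T j) powr (?s / ?n) \<le> K * \<psi> j \<and> exp (2 * real j) \<le> W (T j)) \<and> exp (2 * real j) \<le> WD (L * \<psi> j) \<and> b (\<psi> j) \<le> exp (real j)"
    using K(2) L0[OF L(2)] b(1) by eventually_elim blast
  then obtain N where N: "\<And>j. j \<ge> N \<Longrightarrow> \<psi> j \<ge> max (max 1 s0) l1 \<and> (t0 \<le> T j \<and>
       Y (T j) powr (?s / ?n) \<le> K * \<psi> j \<and> exp (2 * real j) \<le> W (T j)) \<and> exp (2 * real j) \<le> WD (L * \<psi> j) \<and> b (\<psi> j) \<le> exp (real j)"
    unfolding eventually_sequentially by blast
  define \<Lambda> where "\<Lambda> j = C' * \<psi> (j + N)" for j
  have \<psi>N: "\<psi> (j + N) \<ge> 1" "\<psi> (j + N) \<ge> s0" "\<psi> (j + N) \<ge> l1" "t0 \<le> T (j + N)"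
    "Y (T (j + N)) powr (?s / ?n) \<le> K * \<psi> (j + N)" "exp (2 * real (j + N)) \<le> W (T (j + N))"
    "exp (2 * real (j + N)) \<le> WD (L * \<psi> (j + N))" "b (\<psi> (j + N)) \<le> exp (real (j + N))" for j
    using N[of "j + N"] by auto
  have \<Lambda>: "\<Lambda> j > 0" for j using C' \<psi>N(1)[of j] by (auto simp: \<Lambda>_def intro!: mult_pos_pos)
  have lim: "filterlim \<Lambda> at_top sequentially"
  proof -
    have "filterlim (\<lambda>j. \<psi> (j + N)) at_top sequentially"
      by (rule filterlim_compose[OF \<psi> filterlim_add_const_nat_at_top])
    then show ?thesis unfolding \<Lambda>_def by (rule filterlim_tendsto_pos_mult_at_top[OF tendsto_const C'])
  qed
  define Q :: real where "Q = exp 1 * (1 / (1 - exp (- 1)))"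
  have Q: "Q \<ge> 0" by (simp add: Q_def)
  have est: "(\<integral>\<^sup>+ x. indicator {x \<in> \<Omega>. \<Lambda> 0 < norm (u x)} x * ennreal (b (norm (u x) / C')) \<partial>\<mu>) \<le> ennreal Q"
    if data: "sobolev_data \<alpha> c V m h \<Omega> \<mu> u G f" and intA: "(\<integral>\<^sup>+ y. A (f y) \<partial>lborel) \<le> 1" and intD: "boundary_modular \<Omega> D u \<le> 1"
    for \<Omega> \<mu> and u :: "real ^ 'n \<Rightarrow> real ^ 'n" and G f
  proof -
    have adm: "admissible \<alpha> c V m h \<Omega> \<mu>" and u: "u \<in> Cb (closure \<Omega>)" and f: "f \<in> borel_measurable borel"
      using data by (simp_all add: sobolev_data_def)
    note [measurable] = measurable_on_admissible(1)[OF adm u]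
    have sp: "space \<mu> = \<Omega>" by (rule measurable_on_admissible(2)[OF adm u])
    have tail: "emeasure \<mu> {x \<in> space \<mu>. \<Lambda> j < norm (u x)} \<le> ennreal (exp (- 2 * real (j + N)))" for j
    proof -
      let ?p = "\<psi> (j + N)" and ?e = "exp (- 2 * real (j + N))"
      have inv: "1 / w \<le> ?e" if "exp (2 * real (j + N)) \<le> w" for w
      proof -
        have "w > 0" using that exp_gt_zero less_le_trans by blast
        then have "1 / w \<le> 1 / exp (2 * real (j + N))" using that by (intro divide_left_mono) auto
        also have "\<dots> = ?e" using exp_minus[of "2 * real (j + N)"] by (simp only: mult_minus_left inverse_eq_divide)
        finally show ?thesis .
      qed
      have "emeasure \<mu> {x \<in> \<Omega>. \<Lambda> j < norm (u x)} \<le> ennreal ((C * (2 * ?e) / \<Lambda> j) powr r)"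
      proof (rule C(2)[of \<Omega> \<mu> u G f "\<Lambda> j" "T (j + N)" "L * ?p"], intro conjI)
        show "C * (1 + Y (T (j + N)) powr (?s / ?n) + L * ?p) \<le> \<Lambda> j"
        proof -
          have "1 + Y (T (j + N)) powr (?s / ?n) \<le> ?p + K * ?p" using \<psi>N(1,5)[of j] by linarith
          also have "\<dots> = (1 + K) * ?p" by (simp add: distrib_right)
          also have "\<dots> \<le> L * ?p" using L(1) \<psi>N(1)[of j] by (intro mult_right_mono) auto
          finally have "1 + Y (T (j + N)) powr (?s / ?n) + L * ?p \<le> 2 * (L * ?p)" by simp
          then have "C * (1 + Y (T (j + N)) powr (?s / ?n) + L * ?p) \<le> C * (2 * (L * ?p))"
            using C(1) by (intro mult_left_mono) auto
          then show ?thesis by (simp add: \<Lambda>_def C'_def mult_ac)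
        qed
        have Lp: "s0 \<le> L * ?p"
        proof -
          have "1 * ?p \<le> L * ?p" using L1 \<psi>N(1)[of j] by (intro mult_right_mono) auto
          then show ?thesis using \<psi>N(2)[of j] by linarith
        qed
        then show "0 < L * ?p" using s0 by linarith
        have "interior_excess f (T (j + N)) + boundary_excess \<Omega> u (L * ?p) \<le> ennreal (1 / W (T (j + N))) + ennreal (1 / WD (L * ?p))"
          by (intro add_mono interior_excess_le[OF f W(2) _ intA] boundary_excess_le[OF u WD Lp intD]) (rule \<psi>N)
        also have "\<dots> \<le> ennreal ?e + ennreal ?e"
          by (intro add_mono ennreal_leI inv \<psi>N)
        also have "\<dots> = ennreal (2 * ?e)" by (simp add: ennreal_plus[symmetric] del: ennreal_plus)
        finally show "interior_excess f (T (j + N)) + boundary_excess \<Omega> u (L * ?p) \<le> ennreal (2 * ?e)" .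
      qed (use data intA \<Lambda> \<psi>N in auto)
      \<comment> \<open>The level is at least 2C, so the base is at most \<open>?e\<close>, which is
        at most 1; raising it to a power r \<ge> 1 does not increase it.\<close>
      also have "(C * (2 * ?e) / \<Lambda> j) powr r \<le> ?e"
      proof -
        have "2 * C * 1 \<le> 2 * C * (L * ?p)" using L1 \<psi>N(1)[of j] C(1) mult_mono[of 1 L 1 ?p] by (intro mult_left_mono) auto
        then have "2 * C \<le> \<Lambda> j" by (simp add: \<Lambda>_def C'_def mult.assoc)
        then have "C * (2 * ?e) / \<Lambda> j \<le> ?e" using \<Lambda>[of j] by (simp add: divide_le_eq mult_ac)
        then have "(C * (2 * ?e) / \<Lambda> j) powr r \<le> ?e powr r"
          using r C(1) \<Lambda>[of j] by (intro powr_mono2) auto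
        also have "\<dots> \<le> ?e powr 1" using r by (intro powr_mono') auto
        finally show ?thesis by simp
      qed
      finally show ?thesis by (simp add: sp ennreal_leI)
    qed
    have "(\<integral>\<^sup>+ x. indicator {x \<in> space \<mu>. \<Lambda> 0 < norm (u x)} x * ennreal (b (norm (u x) / C')) \<partial>\<mu>) \<le>
      (\<Sum>j. ennreal (b (\<Lambda> (Suc j) / C')) * emeasure \<mu> {x \<in> space \<mu>. \<Lambda> j < norm (u x)})"
    proof (rule nn_integral_le_level_sum[OF _ lim])
      fix s t assume st: "\<Lambda> 0 \<le> s" "s \<le> t"
      have "\<psi> N \<le> s / C'" using st(1) C' by (simp add: \<Lambda>_def field_simps)
      then show "b (s / C') \<le> b (t / C')"
        using l1[of "s / C'" "t / C'"] \<psi>N(3)[of 0] st(2) C' by (simp add: divide_right_mono)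
    qed simp
    also have "\<dots> \<le> (\<Sum>j. ennreal (exp 1 * exp (- 1) ^ j))"
    proof (rule suminf_le)
      fix j
      have "\<Lambda> (Suc j) / C' = \<psi> (Suc j + N)" using C' by (simp add: \<Lambda>_def)
      then have "ennreal (b (\<Lambda> (Suc j) / C')) * emeasure \<mu> {x \<in> space \<mu>. \<Lambda> j < norm (u x)} \<le>
         ennreal (exp (real (Suc j + N))) * ennreal (exp (- 2 * real (j + N)))"
        using \<psi>N(8)[of "Suc j"] by (intro mult_mono tail ennreal_leI) auto
      also have "\<dots> = ennreal (exp (real (Suc j + N)) * exp (- 2 * real (j + N)))" by (simp add: ennreal_mult)
      also have "exp (real (Suc j + N)) * exp (- 2 * real (j + N)) \<le> exp 1 * exp (- 1) ^ j"
        unfolding exp_of_nat_mult[symmetric] exp_add[symmetric] by simp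
      finally show "ennreal (b (\<Lambda> (Suc j) / C')) * emeasure \<mu> {x \<in> space \<mu>. \<Lambda> j < norm (u x)} \<le> ennreal (exp 1 * exp (- 1) ^ j)"
        by (simp add: ennreal_leI)
    qed auto
    also have "\<dots> = ennreal Q"
      unfolding Q_def by (intro suminf_ennreal_eq sums_mult geometric_sums) auto
    finally show ?thesis by (simp add: sp)
  qed
  show ?thesis
    by (rule exI[of _ C'], intro conjI C', rule exI[of _ "\<Lambda> 0"], intro conjI \<Lambda>, rule exI[of _ Q], intro conjI allI impI Q; elim conjE; rule est; assumption)
qed

text \<open>Lebesgue measure on \<Omega> satisfies the growth condition with exponent n and the
  volume of the unit ball as constant. The supremum bound is proved with this measure in place of
  \<mu>, so its constant involves neither \<alpha> nor \<mu>.\<close>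

lemma admissible_lborel:
  assumes "admissible \<alpha> c V m h (\<Omega> :: (real ^ 'n::finite) set) \<mu>"
  shows "admissible (real CARD('n)) (unit_ball_vol (real CARD('n))) V V h \<Omega> (restrict_space lborel \<Omega>)"
proof -
  have \<Omega>: "open \<Omega>" and vol: "emeasure lebesgue \<Omega> = V" and hh: "emeasure (hausdorff_measure (real CARD('n) - 1)) (frontier \<Omega>) = h"
    using assms by (auto simp: admissible_def)
  have em: "emeasure (restrict_space lborel \<Omega>) B = emeasure lborel B" if "B \<subseteq> \<Omega>" for B
    using \<Omega> that by (intro emeasure_restrict_space) auto
  have "emeasure (restrict_space lborel \<Omega>) (ball x r \<inter> \<Omega>) \<le> ennreal (unit_ball_vol (real CARD('n)) * r powr real CARD('n))"
    if "r > 0" for x r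
  proof -
    have "emeasure (restrict_space lborel \<Omega>) (ball x r \<inter> \<Omega>) = emeasure lborel (ball x r \<inter> \<Omega>)" by (rule em) simp
    also have "\<dots> \<le> emeasure lborel (ball x r)" by (rule emeasure_mono) auto
    finally show ?thesis using that by (simp add: emeasure_ball powr_realpow)
  qed
  moreover have "emeasure (restrict_space lborel \<Omega>) \<Omega> = V" using em[of \<Omega>] vol \<Omega> by simp
  moreover have "sets (restrict_space lborel \<Omega>) = sets (restrict_space borel \<Omega>)" by (simp add: sets_restrict_space)
  ultimately show ?thesis using \<Omega> vol hh by (simp add: admissible_def)
qed

text \<open>As Y is bounded by K, one level l meets the requirement of
  \<open>level_set_estimate\<close> for every truncation level t of the gradient. The interior
  excess is at most 1/W t and tends to 0 as t grows, the boundary excess above 2 is 0, so the level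
  set of l is null.\<close>

lemma sup_estimate:
  fixes V m h :: ennreal
  assumes n2: "CARD('n::finite) \<ge> 2" and fin: "V < \<infinity>" "h < \<infinity>"
    and W: "W \<in> borel_measurable borel" "superlinear t0 W A" "filterlim W at_top at_top"
    and Y: "y' \<in> borel_measurable borel"
      "\<forall>t\<ge>t0. DERIV Y t :> y' t \<and> W t powr (- 1 / (real CARD('n) - 1)) \<le> y' t \<and> Y t > 0 \<and> Y t \<le> K"
  shows "\<exists>C>0. \<forall>\<alpha> c m \<Omega> \<mu> (u :: real ^ 'n \<Rightarrow> real ^ 'n) G f.
    sobolev_data \<alpha> c V m h \<Omega> \<mu> u G f \<and> (\<integral>\<^sup>+ y. A (f y) \<partial>lborel) \<le> 1 \<and> boundary_excess \<Omega> u 2 = 0 \<longrightarrow>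
    emeasure lborel {x \<in> \<Omega>. C < norm (u x)} = 0"
proof -
  let ?n = "real CARD('n)" and ?s = "real CARD('n) - 1"
  define r where "r = ?n / ?s"
  have r: "r > 0" using n2 by (simp add: r_def)
  have b: "unit_ball_vol ?n > 0" by simp
  obtain C where C: "C > 0" "\<And>\<Omega> \<mu> (u :: real ^ 'n \<Rightarrow> real ^ 'n) G f l T1 T2 \<phi>.
    sobolev_data ?n (unit_ball_vol ?n) V V h \<Omega> \<mu> u G f \<and> (\<integral>\<^sup>+ y. A (f y) \<partial>lborel) \<le> 1 \<and>
    l > 0 \<and> t0 \<le> T1 \<and> T2 > 0 \<and> \<phi> \<ge> 0 \<and>
    C * (1 + Y T1 powr (?s / ?n) + T2) \<le> l \<and>
    interior_excess f T1 + boundary_excess \<Omega> u T2 \<le> ennreal \<phi> \<Longrightarrow>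
    emeasure \<mu> {x \<in> \<Omega>. l < norm (u x)} \<le> ennreal ((C * \<phi> / l) powr r)"
    using level_set_estimate[OF n2 _ b fin(1) fin(1) fin(2) W(1,2) Y(1), of ?n Y, folded r_def] Y(2)
    by simp (elim exE conjE, rule that, assumption, (drule spec)+, drule (1) mp, assumption)
  define l where "l = C * (1 + K powr (?s / ?n) + 2)"
  have "1 + K powr (?s / ?n) + 2 > 0" using powr_ge_zero[of K "?s / ?n"] by linarith
  then have l: "l > 0" unfolding l_def using C(1) by (rule mult_pos_pos[rotated])
  have est: "emeasure lborel {x \<in> \<Omega>. l < norm (u x)} = 0"
    if data: "sobolev_data \<alpha> c V m h \<Omega> \<mu> u G f" and intA: "(\<integral>\<^sup>+ y. A (f y) \<partial>lborel) \<le> 1" and bdry: "boundary_excess \<Omega> u 2 = 0"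
    for \<alpha> c m \<Omega> \<mu> and u :: "real ^ 'n \<Rightarrow> real ^ 'n" and G f
  proof -
    have adm: "admissible \<alpha> c V m h \<Omega> \<mu>" and f: "f \<in> borel_measurable borel"
      using data by (simp_all add: sobolev_data_def)
    have \<Omega>: "open \<Omega>" using adm by (simp add: admissible_def)
    have data': "sobolev_data ?n (unit_ball_vol ?n) V V h \<Omega> (restrict_space lborel \<Omega>) u G f"
      using data admissible_lborel[OF adm] by (simp add: sobolev_data_def)
    have le: "emeasure lborel {x \<in> \<Omega>. l < norm (u x)} \<le> ennreal ((C * (1 / W t) / l) powr r)" if t: "t \<ge> t0" for t
    proof -
      have Wt: "W t > 0" using W(2) t by (simp add: superlinear_def)
      have "emeasure (restrict_space lborel \<Omega>) {x \<in> \<Omega>. l < norm (u x)} \<le> ennreal ((C * (1 / W t) / l) powr r)"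
      proof (rule C(2)[of \<Omega> _ u G f l t 2], intro conjI)
        show "C * (1 + Y t powr (?s / ?n) + 2) \<le> l"
          unfolding l_def using C(1) Y(2) t n2 by (intro mult_left_mono add_mono powr_mono2) (auto simp: less_imp_le)
        show "interior_excess f t + boundary_excess \<Omega> u 2 \<le> ennreal (1 / W t)"
          using interior_excess_le[OF f W(2) t intA] bdry by simp
      qed (use data' intA l t Wt in auto)
      then show ?thesis using \<Omega> by (subst (asm) emeasure_restrict_space) auto
    qed
    have "((\<lambda>t. inverse (W t)) \<longlongrightarrow> 0) at_top"
      by (rule tendsto_inverse_0_at_top[OF W(3)])
    then have "((\<lambda>t. C * (1 / W t) / l) \<longlongrightarrow> C * 0 / l) at_top"
      unfolding inverse_eq_divide using l by (intro tendsto_intros) auto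
    then have "((\<lambda>t. (C * (1 / W t) / l) powr r) \<longlongrightarrow> 0 powr r) at_top"
      using r by (intro tendsto_powr') (auto intro!: eventually_mono[OF eventually_ge_at_top[of t0]] simp: C(1) less_imp_le l W(2)[unfolded superlinear_def])
    then have "((\<lambda>t. ennreal ((C * (1 / W t) / l) powr r)) \<longlongrightarrow> ennreal 0) at_top"
      using tendsto_ennrealI by fastforce
    moreover have "\<forall>\<^sub>F t in at_top. emeasure lborel {x \<in> \<Omega>. l < norm (u x)} \<le> ennreal ((C * (1 / W t) / l) powr r)"
      by (rule eventually_mono[OF eventually_ge_at_top[of t0]]) (rule le)
    ultimately have "emeasure lborel {x \<in> \<Omega>. l < norm (u x)} \<le> ennreal 0"
      by (rule tendsto_lowerbound) simp
    then show ?thesis by simp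
  qed
  show ?thesis
    by (intro exI[of _ l] conjI allI impI l; elim conjE; rule est; assumption)
qed

section \<open>Young functions and norms\<close>

lemma young_function_contract:
  assumes "young_function A" "t \<ge> 0" "0 \<le> \<theta>" "\<theta> \<le> 1"
  shows "A (\<theta> * t) \<le> ennreal \<theta> * A t"
proof -
  have A0: "A 0 = 0"
    and convex: "\<forall>s\<ge>0. \<forall>t\<ge>0. \<forall>\<theta>\<in>{0..1}. A ((1 - \<theta>) * s + \<theta> * t) \<le> ennreal (1 - \<theta>) * A s + ennreal \<theta> * A t"
    using assms(1) unfolding young_function_def by blast+
  show ?thesis using convex[rule_format, of 0 t \<theta>] A0 assms by simp
qed

lemma young_function_mono:
  assumes "young_function A" "0 \<le> s" "s \<le> t"
  shows "A s \<le> A t"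
proof (cases "t = 0")
  case False
  then have t: "t > 0" using assms by simp
  have "A (s / t * t) \<le> ennreal (s / t) * A t"
    using assms t by (intro young_function_contract) auto
  also have "\<dots> \<le> 1 * A t" using assms t by (intro mult_right_mono) auto
  finally show ?thesis using t by simp
qed (use assms in simp)

lemma young_function_expand:
  assumes "young_function A" "0 < t" "t \<le> s"
  shows "ennreal (s / t) * A t \<le> A s"
proof -
  have "A (t / s * s) \<le> ennreal (t / s) * A s"
    using assms by (intro young_function_contract) auto
  then have "A t \<le> ennreal (t / s) * A s" using assms by simp
  then have "ennreal (s / t) * A t \<le> ennreal (s / t) * (ennreal (t / s) * A s)" by (intro mult_left_mono) auto
  also have "\<dots> = (ennreal (s / t) * ennreal (t / s)) * A s" by (simp only: mult.assoc)
  also have "ennreal (s / t) * ennreal (t / s) = 1" using assms by (simp add: ennreal_mult[symmetric])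
  finally show ?thesis by simp
qed

text \<open>By convexity and A 0 = 0 the quotient A(s)/s is nondecreasing, so s W t = (s/t) a(t)
  \<le> (s/t) A(k t) \<le> A(k s). The dilation k from the equivalence stays in the argument of A
  and is absorbed only when norms are formed. All large t0 are allowed, so that further conditions
  can be imposed on t0.\<close>

lemma superlinear_of_equivalent:
  assumes A: "young_function A" and eq: "equivalent_near_infinity A (\<lambda>t. ennreal (a t))"
    and a: "\<forall>\<^sub>F t in at_top. a t = t * W t \<and> W t > 0"
  shows "\<exists>k\<ge>1. \<forall>\<^sub>F t0 in at_top. superlinear t0 W (\<lambda>t. A (k * t))"
proof -
  obtain k where k: "k \<ge> 1" "\<forall>\<^sub>F t in at_top. A (t / k) \<le> ennreal (a t) \<and> ennreal (a t) \<le> A (k * t)"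
    using eq by (auto simp: equivalent_near_infinity_def)
  have "\<forall>\<^sub>F t in at_top. a t = t * W t \<and> W t > 0 \<and> ennreal (a t) \<le> A (k * t) \<and> t > 0"
    using a k(2) eventually_gt_at_top[of 0] by eventually_elim auto
  then obtain N where N: "\<And>t. t \<ge> N \<Longrightarrow> a t = t * W t \<and> W t > 0 \<and> ennreal (a t) \<le> A (k * t) \<and> t > 0"
    unfolding eventually_at_top_linorder by blast
  have "superlinear t0 W (\<lambda>t. A (k * t))" if "t0 \<ge> N" for t0
    unfolding superlinear_def
  proof (intro conjI allI impI)
    show "t0 > 0" using N[OF that] by simp
    show "W t > 0" if "t0 \<le> t" for t using N[of t] that \<open>t0 \<ge> N\<close> by simp
    fix t s assume ts: "t0 \<le> t \<and> t \<le> s"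
    then have t: "a t = t * W t" "W t > 0" "ennreal (a t) \<le> A (k * t)" "t > 0" using N[of t] \<open>t0 \<ge> N\<close> by auto
    have "ennreal (s * W t) = ennreal (s / t * a t)" using t by simp
    also have "\<dots> = ennreal (s / t) * ennreal (a t)" using t ts by (intro ennreal_mult) auto
    also have "\<dots> \<le> ennreal (s / t) * A (k * t)" by (intro mult_left_mono t) simp
    also have "\<dots> = ennreal (k * s / (k * t)) * A (k * t)" using k by simp
    also have "\<dots> \<le> A (k * s)" using k t ts by (intro young_function_expand[OF A]) auto
    finally show "ennreal (s * W t) \<le> A (k * s)" .
  qed
  then show ?thesis using k(1) unfolding eventually_at_top_linorder by blast
qed

lemma upper_of_equivalent:
  assumes "equivalent_near_infinity A a"
  shows "\<exists>k\<ge>1. \<forall>\<^sub>F t in at_top. A (t / k) \<le> a t"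
  using assms unfolding equivalent_near_infinity_def by (auto elim: eventually_mono)

section \<open>Normalisation, and the passage from modulars to norms\<close>

lemma has_sym_grad_scale:
  fixes u :: "real ^ 'n::finite \<Rightarrow> real ^ 'n"
  assumes "has_sym_grad \<Omega> u G"
  shows "has_sym_grad \<Omega> (\<lambda>x. k *\<^sub>R u x) (\<lambda>x. k *\<^sub>R G x)"
  unfolding has_sym_grad_def
proof (intro conjI ballI allI)
  show "locally_integrable \<Omega> (\<lambda>x. k *\<^sub>R G x)"
    using assms by (auto simp: has_sym_grad_def locally_integrable_def intro: absolutely_integrable_scaleR_left)
  fix \<phi> i j assume "\<phi> \<in> test_functions \<Omega>"
  then have eq: "(LINT x|lebesgue_on \<Omega>. G x $ i $ j * \<phi> x) =
        - (LINT x|lebesgue_on \<Omega>. (1/2) * (u x $ i * partial j \<phi> x + u x $ j * partial i \<phi> x))"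
    using assms by (simp add: has_sym_grad_def)
  have "(LINT x|lebesgue_on \<Omega>. (k *\<^sub>R G x) $ i $ j * \<phi> x) = k * (LINT x|lebesgue_on \<Omega>. G x $ i $ j * \<phi> x)"
    by (simp add: mult.assoc)
  also have "\<dots> = - (LINT x|lebesgue_on \<Omega>. k * ((1/2) * (u x $ i * partial j \<phi> x + u x $ j * partial i \<phi> x)))"
    unfolding eq by (simp only: integral_mult_right_zero mult_minus_right)
  also have "(\<lambda>x. k * ((1/2) * (u x $ i * partial j \<phi> x + u x $ j * partial i \<phi> x))) =
     (\<lambda>x. (1/2) * ((k *\<^sub>R u x) $ i * partial j \<phi> x + (k *\<^sub>R u x) $ j * partial i \<phi> x))"
    by (auto simp: fun_eq_iff algebra_simps)
  finally show "(LINT x|lebesgue_on \<Omega>. (k *\<^sub>R G x) $ i $ j * \<phi> x) =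
     - (LINT x|lebesgue_on \<Omega>. (1/2) * ((k *\<^sub>R u x) $ i * partial j \<phi> x + (k *\<^sub>R u x) $ j * partial i \<phi> x))" .
qed

lemma Cb_scale:
  assumes "u \<in> Cb S"
  shows "(\<lambda>x. k *\<^sub>R u x) \<in> Cb S"
  using assms by (auto simp: Cb_def intro!: continuous_intros elim: bounded_subset)

lemma has_sym_grad_sym_grad:
  assumes "u \<in> E1 \<Omega> X"
  shows "has_sym_grad \<Omega> u (sym_grad \<Omega> u)"
proof -
  have "\<exists>G. has_sym_grad \<Omega> u G" using assms by (simp add: E1_def)
  from someI_ex[OF this] show ?thesis by (simp add: sym_grad_def)
qed

text \<open>The completion supplies a Borel function almost everywhere equal to the scaled norm of
  G; its absolute value, cut off to \<Omega>, is nonnegative and supported in \<Omega> at every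
  point.\<close>

lemma sobolev_data_exists:
  fixes u :: "real ^ 'n::finite \<Rightarrow> real ^ 'n"
  assumes adm: "admissible \<alpha> c V m h \<Omega> \<mu>" and u: "u \<in> Cb (closure \<Omega>)" and G: "has_sym_grad \<Omega> u G"
    and meas: "(\<lambda>x. norm (G x)) \<in> borel_measurable (lebesgue_on \<Omega>)" and k: "k > 0"
  shows "\<exists>f. sobolev_data \<alpha> c V m h \<Omega> \<mu> (\<lambda>x. k *\<^sub>R u x) (\<lambda>x. k *\<^sub>R G x) f"
proof -
  have \<Omega>: "open \<Omega>" using adm by (simp add: admissible_def)
  have "(\<lambda>x. indicator \<Omega> x *\<^sub>R norm (G x)) \<in> borel_measurable lebesgue"
    using meas \<Omega> by (subst (asm) borel_measurable_restrict_space_iff) auto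
  then have "(\<lambda>x. k * (indicator \<Omega> x * norm (G x))) \<in> borel_measurable lebesgue" by simp
  then obtain g where g [measurable]: "g \<in> borel_measurable lborel" and ae: "AE x in lborel. k * (indicator \<Omega> x * norm (G x)) = g x"
    using completion_ex_borel_measurable_real by blast
  define f where "f x = indicator \<Omega> x * \<bar>g x\<bar>" for x
  have [measurable]: "\<Omega> \<in> sets borel" using \<Omega> by simp
  have "f \<in> borel_measurable lborel" unfolding f_def[abs_def] by measurable
  then have "f \<in> borel_measurable borel" by simp
  moreover have "AE y in lebesgue. f y = indicator \<Omega> y * norm (k *\<^sub>R G y)"
    using AE_completion[OF ae]
  proof eventually_elim
    fix y assume eq: "k * (indicator \<Omega> y * norm (G y)) = g y"
    show "f y = indicator \<Omega> y * norm (k *\<^sub>R G y)"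
      unfolding f_def eq[symmetric] using k by (auto simp: indicator_def abs_mult)
  qed
  ultimately have "sobolev_data \<alpha> c V m h \<Omega> \<mu> (\<lambda>x. k *\<^sub>R u x) (\<lambda>x. k *\<^sub>R G x) f"
    using adm Cb_scale[OF u] has_sym_grad_scale[OF G] by (auto simp: sobolev_data_def f_def)
  then show ?thesis by blast
qed

lemma nn_integral_young_gradient_le:
  fixes u :: "real ^ 'n::finite \<Rightarrow> real ^ 'n"
  assumes A: "young_function A" and data: "sobolev_data \<alpha> c V m h \<Omega> \<mu> (\<lambda>x. k *\<^sub>R u x) (\<lambda>x. k *\<^sub>R G x) f"
    and kl: "k > 0" "l > 0" "q \<ge> 0" "q * k \<le> 1 / l" and int: "(\<integral>\<^sup>+ x. A (norm (G x) / l) \<partial>lebesgue_on \<Omega>) \<le> 1"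
  shows "(\<integral>\<^sup>+ y. A (q * f y) \<partial>lborel) \<le> 1"
proof -
  have \<Omega>: "open \<Omega>" and fG: "AE y in lebesgue. f y = indicator \<Omega> y * norm (k *\<^sub>R G y)"
    using data by (auto simp: sobolev_data_def admissible_def)
  have A0: "A 0 = 0" using A by (simp add: young_function_def)
  have "(\<integral>\<^sup>+ y. A (q * f y) \<partial>lborel) = (\<integral>\<^sup>+ y. A (q * f y) \<partial>lebesgue)" by (simp add: nn_integral_completion)
  also have "\<dots> \<le> (\<integral>\<^sup>+ y. A (norm (G y) / l) * indicator \<Omega> y \<partial>lebesgue)"
  proof (rule nn_integral_mono_AE)
    show "AE y in lebesgue. A (q * f y) \<le> A (norm (G y) / l) * indicator \<Omega> y"
      using fG
    proof eventually_elim
      fix y assume fy: "f y = indicator \<Omega> y * norm (k *\<^sub>R G y)"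
      show "A (q * f y) \<le> A (norm (G y) / l) * indicator \<Omega> y"
      proof (cases "y \<in> \<Omega>")
        case True
        have "q * (k * norm (G y)) = (q * k) * norm (G y)" by simp
        also have "\<dots> \<le> 1 / l * norm (G y)" using kl by (intro mult_right_mono) auto
        finally show ?thesis using True fy kl by (auto intro!: young_function_mono[OF A])
      qed (use fy A0 in simp)
    qed
  qed
  also have "\<dots> = (\<integral>\<^sup>+ x. A (norm (G x) / l) \<partial>lebesgue_on \<Omega>)"
    using \<Omega> by (intro nn_integral_restrict_space[symmetric]) auto
  finally show ?thesis using int by simp
qed

text \<open>A norm inequality is proved for each pair of admissible scales r and s; this lemma
  replaces them by the two infima. If one set is empty, its infimum is infinite and so is the right
  side.\<close>

lemma ennreal_le_mult_add_INF:
  fixes x a b :: ennreal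
  assumes C: "C > 0" and le: "\<And>r s. r \<in> R \<Longrightarrow> s \<in> S \<Longrightarrow> x \<le> ennreal (C * (r + s))"
    and pos: "\<And>r. r \<in> R \<Longrightarrow> r \<ge> 0" "\<And>s. s \<in> S \<Longrightarrow> s \<ge> 0"
  shows "x \<le> ennreal C * ((INF r\<in>R. ennreal r) + (INF s\<in>S. ennreal s))"
proof (rule ennreal_le_epsilon)
  fix e :: real
  assume fin: "ennreal C * ((INF r\<in>R. ennreal r) + (INF s\<in>S. ennreal s)) < top" and e: "e > 0"
  define d where "d = e / (2 * C)"
  have d: "d > 0" using e C by (simp add: d_def)
  have "(INF r\<in>R. ennreal r) + (INF s\<in>S. ennreal s) < top"
    using fin C by (auto simp: ennreal_mult_less_top)
  then have "(INF r\<in>R. ennreal r) < (INF r\<in>R. ennreal r) + ennreal d" "(INF s\<in>S. ennreal s) < (INF s\<in>S. ennreal s) + ennreal d"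
    using d by (auto simp: ennreal_less_iff)
  then obtain r s where r: "r \<in> R" "ennreal r < (INF r\<in>R. ennreal r) + ennreal d" and s: "s \<in> S" "ennreal s < (INF s\<in>S. ennreal s) + ennreal d"
    by (auto simp: INF_less_iff)
  have "x \<le> ennreal (C * (r + s))" using le r s by blast
  also have "\<dots> = ennreal C * (ennreal r + ennreal s)" using C pos r s by (simp add: ennreal_mult)
  also have "\<dots> \<le> ennreal C * (((INF r\<in>R. ennreal r) + ennreal d) + ((INF s\<in>S. ennreal s) + ennreal d))"
    using r s by (intro mult_left_mono add_mono) auto
  also have "\<dots> = ennreal C * ((INF r\<in>R. ennreal r) + (INF s\<in>S. ennreal s)) + ennreal C * (ennreal d + ennreal d)"
    by (simp only: distrib_left add_ac)
  also have "ennreal C * (ennreal d + ennreal d) = ennreal e"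
    using C d by (simp add: ennreal_plus[symmetric] ennreal_mult[symmetric] del: ennreal_plus) (simp add: d_def)
  finally show "x \<le> ennreal C * ((INF r\<in>R. ennreal r) + (INF s\<in>S. ennreal s)) + ennreal e" .
qed

text \<open>Homogeneity: u divided by a multiple of r + s has gradient and boundary modulars at most
  1, so the modular estimate applies to it. The resulting bound on the modular of B is a constant Q'
  rather than 1, and convexity repairs this by B(t/Q') \<le> B(t)/Q'.\<close>

lemma luxemburg_of_modular:
  fixes \<alpha> c :: real and V m h :: ennreal and b :: "real \<Rightarrow> real"
  assumes A: "young_function A" and B: "young_function B" and D: "young_function D" and m: "m < \<infinity>"
    and k: "kA \<ge> 1" "kD \<ge> 1" and kB: "kB \<ge> 1" "\<forall>\<^sub>F t in at_top. B (t / kB) \<le> ennreal (b t)"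
    and b: "b \<in> borel_measurable borel"
    and mod: "\<exists>C>0. \<exists>l0>0. \<exists>Q\<ge>0. \<forall>\<Omega> \<mu> (u :: real ^ 'n::finite \<Rightarrow> real ^ 'n) G f.
      sobolev_data \<alpha> c V m h \<Omega> \<mu> u G f \<and> (\<integral>\<^sup>+ y. A (kA * f y) \<partial>lborel) \<le> 1 \<and> boundary_modular \<Omega> (\<lambda>t. D (kD * t)) u \<le> 1 \<longrightarrow>
      (\<integral>\<^sup>+ x. indicator {x \<in> \<Omega>. l0 < norm (u x)} x * ennreal (b (norm (u x) / C)) \<partial>\<mu>) \<le> ennreal Q"
  shows "\<exists>C>0. \<forall>(\<Omega> :: (real ^ 'n) set) \<mu>. admissible \<alpha> c V m h \<Omega> \<mu> \<longrightarrow>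
          (\<forall>u \<in> E1 \<Omega> (orlicz_space (lebesgue_on \<Omega>) A) \<inter> Cb (closure \<Omega>).
             luxemburg_norm \<mu> B u \<le>
               ennreal C * (luxemburg_norm (lebesgue_on \<Omega>) A (sym_grad \<Omega> u)
                            + luxemburg_norm (boundary_measure \<Omega>) D u))"
proof -
  obtain C l0 Q where C: "C > 0" and l0: "l0 > 0" and Q: "Q \<ge> 0" and
    est: "\<And>\<Omega> \<mu> (u :: real ^ 'n \<Rightarrow> real ^ 'n) G f.
      sobolev_data \<alpha> c V m h \<Omega> \<mu> u G f \<and> (\<integral>\<^sup>+ y. A (kA * f y) \<partial>lborel) \<le> 1 \<and> boundary_modular \<Omega> (\<lambda>t. D (kD * t)) u \<le> 1 \<Longrightarrow>
      (\<integral>\<^sup>+ x. indicator {x \<in> \<Omega>. l0 < norm (u x)} x * ennreal (b (norm (u x) / C)) \<partial>\<mu>) \<le> ennreal Q"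
    using mod by (elim exE conjE) (rule that, assumption, assumption, assumption, (drule spec)+, drule (1) mp, assumption)
  obtain t1 where t1: "\<And>t. t \<ge> t1 \<Longrightarrow> B (t / kB) \<le> ennreal (b t)"
    using kB(2) unfolding eventually_at_top_linorder by blast
  \<comment> \<open>Where |v| \<le> L, the Young function B is at most the constant R; where |v| >
    L, both the comparison of B with b and the modular estimate above \<open>l0\<close> are in
    force.\<close>
  define L where "L = max l0 (C * t1)"
  have L: "L \<ge> l0" "L / C \<ge> t1" "L > 0" using C l0 by (auto simp: L_def field_simps)
  define R where "R = B (L / C / kB)"
  have "R < \<infinity>" using t1[OF L(2)] by (auto simp: R_def intro: le_less_trans)
  \<comment> \<open>Bounds the whole modular of B, the low values through R times the mass m and the
    high ones through Q; being at least 1 makes 1/Q' a convexity weight.\<close>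
  define Q' where "Q' = max 1 (enn2real R * enn2real m + Q)"
  have Q': "Q' \<ge> 1" by (simp add: Q'_def)
  have RmQ: "R * m + ennreal Q \<le> ennreal Q'"
  proof -
    have "R * m + ennreal Q = ennreal (enn2real R) * ennreal (enn2real m) + ennreal Q"
      using \<open>R < \<infinity>\<close> m by simp
    also have "\<dots> = ennreal (enn2real R * enn2real m + Q)" using Q by (simp add: ennreal_mult)
    also have "\<dots> \<le> ennreal Q'" by (intro ennreal_leI) (simp add: Q'_def)
    finally show ?thesis .
  qed
  have bound: "(\<integral>\<^sup>+ x. B (norm (v x) / (C * kB * Q')) \<partial>\<mu>) \<le> 1"
    if data: "sobolev_data \<alpha> c V m h \<Omega> \<mu> v G f" and mA: "(\<integral>\<^sup>+ y. A (kA * f y) \<partial>lborel) \<le> 1"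
      and mD: "boundary_modular \<Omega> (\<lambda>t. D (kD * t)) v \<le> 1"
    for \<Omega> \<mu> and v :: "real ^ 'n \<Rightarrow> real ^ 'n" and G f
  proof -
    have adm: "admissible \<alpha> c V m h \<Omega> \<mu>" and v: "v \<in> Cb (closure \<Omega>)"
      using data by (simp_all add: sobolev_data_def)
    note [measurable] = measurable_on_admissible(1)[OF adm v] b
    have sp: "space \<mu> = \<Omega>" by (rule measurable_on_admissible(2)[OF adm v])
    have em: "emeasure \<mu> (space \<mu>) = m" using adm sp by (simp add: admissible_def)
    have "(\<integral>\<^sup>+ x. B (norm (v x) / (C * kB * Q')) \<partial>\<mu>) \<le>
       (\<integral>\<^sup>+ x. ennreal (1 / Q') * (R + indicator {x \<in> space \<mu>. l0 < norm (v x)} x * ennreal (b (norm (v x) / C))) \<partial>\<mu>)"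
    proof (rule nn_integral_mono)
      fix x assume x: "x \<in> space \<mu>"
      have "B (norm (v x) / (C * kB * Q')) = B (1 / Q' * (norm (v x) / C / kB))"
        by (simp add: field_simps)
      also have "\<dots> \<le> ennreal (1 / Q') * B (norm (v x) / C / kB)"
        using Q' C kB(1) by (intro young_function_contract[OF B]) auto
      also have "\<dots> \<le> ennreal (1 / Q') * (R + indicator {x \<in> space \<mu>. l0 < norm (v x)} x * ennreal (b (norm (v x) / C)))"
      proof (rule mult_left_mono)
        show "B (norm (v x) / C / kB) \<le> R + indicator {x \<in> space \<mu>. l0 < norm (v x)} x * ennreal (b (norm (v x) / C))"
        proof (cases "norm (v x) \<le> L")
          case True
          then have "B (norm (v x) / C / kB) \<le> R" unfolding R_def
            using C kB(1) by (intro young_function_mono[OF B]) (auto intro!: divide_right_mono)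
          then show ?thesis by (simp add: add_increasing2)
        next
          case False
          then have "L / C \<le> norm (v x) / C" using C by (intro divide_right_mono) auto
          then have "B (norm (v x) / C / kB) \<le> ennreal (b (norm (v x) / C))" using L(2) by (intro t1) linarith
          then show ?thesis using False L(1) x by (simp add: add_increasing)
        qed
      qed simp
      finally show "B (norm (v x) / (C * kB * Q')) \<le> ennreal (1 / Q') * (R + indicator {x \<in> space \<mu>. l0 < norm (v x)} x * ennreal (b (norm (v x) / C)))" .
    qed
    also have "\<dots> = ennreal (1 / Q') * (R * m + (\<integral>\<^sup>+ x. indicator {x \<in> space \<mu>. l0 < norm (v x)} x * ennreal (b (norm (v x) / C)) \<partial>\<mu>))"
      by (simp add: nn_integral_cmult nn_integral_add em)
    also have "\<dots> \<le> ennreal (1 / Q') * (R * m + ennreal Q)"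
      unfolding sp by (intro mult_left_mono add_left_mono est[of \<Omega> \<mu> v G f]) (use data mA mD in auto)
    also have "\<dots> \<le> ennreal (1 / Q') * ennreal Q'" by (intro mult_left_mono RmQ) simp
    also have "\<dots> = 1" using Q' by (simp add: ennreal_mult[symmetric])
    finally show ?thesis .
  qed
  \<comment> \<open>Dividing u by K (r + s) compensates the dilations kA and kD: kA / (K (r + s))
    \<le> 1/r and kD / (K (r + s)) \<le> 1/s.\<close>
  define K where "K = max kA kD"
  have K: "K \<ge> kA" "K \<ge> kD" "K \<ge> 1" using k by (auto simp: K_def)
  define C' where "C' = K * (C * kB * Q')"
  have C': "C' > 0" using K C kB Q' by (auto simp: C'_def intro!: mult_pos_pos)
  have main: "luxemburg_norm \<mu> B u \<le> ennreal C' * (luxemburg_norm (lebesgue_on \<Omega>) A (sym_grad \<Omega> u) + luxemburg_norm (boundary_measure \<Omega>) D u)"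
    if adm: "admissible \<alpha> c V m h \<Omega> \<mu>" and u: "u \<in> E1 \<Omega> (orlicz_space (lebesgue_on \<Omega>) A)" "u \<in> Cb (closure \<Omega>)"
    for \<Omega> \<mu> and u :: "real ^ 'n \<Rightarrow> real ^ 'n"
    unfolding luxemburg_norm_def[of "lebesgue_on \<Omega>"] luxemburg_norm_def[of "boundary_measure \<Omega>"]
  proof (rule ennreal_le_mult_add_INF[OF C'])
    let ?G = "sym_grad \<Omega> u"
    have G: "has_sym_grad \<Omega> u ?G" using u(1) by (rule has_sym_grad_sym_grad)
    have meas: "(\<lambda>x. norm (?G x)) \<in> borel_measurable (lebesgue_on \<Omega>)"
      using u(1) by (simp add: E1_def orlicz_space_def)
    fix r s assume r: "r \<in> {l. 0 < l \<and> (\<integral>\<^sup>+ x. A (norm (?G x) / l) \<partial>lebesgue_on \<Omega>) \<le> 1}"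
      and s: "s \<in> {l. 0 < l \<and> (\<integral>\<^sup>+ x. D (norm (u x) / l) \<partial>boundary_measure \<Omega>) \<le> 1}"
    then have rs: "r > 0" "s > 0" by auto
    define l where "l = K * (r + s)"
    have l: "l > 0" using rs K by (auto simp: l_def intro!: mult_pos_pos)
    obtain f where data: "sobolev_data \<alpha> c V m h \<Omega> \<mu> (\<lambda>x. (1 / l) *\<^sub>R u x) (\<lambda>x. (1 / l) *\<^sub>R ?G x) f"
      using sobolev_data_exists[OF adm u(2) G meas, of "1 / l"] l by auto
    have q: "kA * (1 / l) \<le> 1 / r" "kD * (1 / l) \<le> 1 / s"
    proof -
      have "kA * r \<le> K * (r + s)" "kD * s \<le> K * (r + s)" using K k rs by (auto intro!: mult_mono)
      then show "kA * (1 / l) \<le> 1 / r" "kD * (1 / l) \<le> 1 / s" using l rs by (auto simp: l_def[symmetric] field_simps)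
    qed
    have mA: "(\<integral>\<^sup>+ y. A (kA * f y) \<partial>lborel) \<le> 1"
      by (rule nn_integral_young_gradient_le[OF A data _ rs(1) _ q(1)]) (use l k r in auto)
    have mD: "boundary_modular \<Omega> (\<lambda>t. D (kD * t)) (\<lambda>x. (1 / l) *\<^sub>R u x) \<le> 1"
    proof -
      have "boundary_modular \<Omega> (\<lambda>t. D (kD * t)) (\<lambda>x. (1 / l) *\<^sub>R u x) \<le>
        (\<integral>\<^sup>+ p. D (norm (u p) / s) * indicator (frontier \<Omega>) p \<partial>hausdorff_measure (real CARD('n) - 1))"
        unfolding boundary_modular_def
      proof (rule nn_integral_mono)
        fix p
        have "kD * (1 / l) * norm (u p) \<le> 1 / s * norm (u p)" using q(2) by (rule mult_right_mono) simp
        then have "D (kD * norm ((1 / l) *\<^sub>R u p)) \<le> D (norm (u p) / s)"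
          using l k by (intro young_function_mono[OF D]) auto
        then show "indicator (frontier \<Omega>) p * D (kD * norm ((1 / l) *\<^sub>R u p)) \<le> D (norm (u p) / s) * indicator (frontier \<Omega>) p"
          by (simp add: indicator_def)
      qed
      also have "\<dots> = (\<integral>\<^sup>+ x. D (norm (u x) / s) \<partial>boundary_measure \<Omega>)"
        by (intro nn_integral_restrict_space[symmetric]) (simp add: frontier_closed)
      also have "\<dots> \<le> 1" using s by simp
      finally show ?thesis .
    qed
    have "(\<integral>\<^sup>+ x. B (norm ((1 / l) *\<^sub>R u x) / (C * kB * Q')) \<partial>\<mu>) \<le> 1"
      by (rule bound[OF data mA mD])
    then have "(\<integral>\<^sup>+ x. B (norm (u x) / (C' * (r + s))) \<partial>\<mu>) \<le> 1"
      using l by (simp add: C'_def l_def mult_ac)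
    then show "luxemburg_norm \<mu> B u \<le> ennreal (C' * (r + s))"
      unfolding luxemburg_norm_def using C' rs by (intro INF_lower) (auto intro!: mult_pos_pos)
  qed auto
  show ?thesis by (intro exI[of _ C'] conjI C') (use main in blast)
qed

text \<open>The same normalisation with the boundary norm written as the infimum of the positive s
  above it, so that \<open>ennreal_le_mult_add_INF\<close> serves here as well.\<close>

lemma linfty_of_modular:
  fixes V h :: ennreal
  assumes A: "young_function A" and k: "kA \<ge> 1"
    and mod: "\<exists>C>0. \<forall>\<alpha> c m \<Omega> \<mu> (u :: real ^ 'n::finite \<Rightarrow> real ^ 'n) G f.
      sobolev_data \<alpha> c V m h \<Omega> \<mu> u G f \<and> (\<integral>\<^sup>+ y. A (kA * f y) \<partial>lborel) \<le> 1 \<and> boundary_excess \<Omega> u 2 = 0 \<longrightarrow>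
      emeasure lborel {x \<in> \<Omega>. C < norm (u x)} = 0"
  shows "\<exists>C>0. \<forall>\<alpha> c m (\<Omega> :: (real ^ 'n) set) \<mu>. admissible \<alpha> c V m h \<Omega> \<mu> \<longrightarrow>
          (\<forall>u \<in> E1 \<Omega> (orlicz_space (lebesgue_on \<Omega>) A) \<inter> Cb (closure \<Omega>).
             linfty_norm (lebesgue_on \<Omega>) u \<le>
               ennreal C * (luxemburg_norm (lebesgue_on \<Omega>) A (sym_grad \<Omega> u)
                            + linfty_norm (boundary_measure \<Omega>) u))"
proof -
  obtain C where C: "C > 0" and est: "\<And>\<alpha> c m \<Omega> \<mu> (u :: real ^ 'n \<Rightarrow> real ^ 'n) G f.
      sobolev_data \<alpha> c V m h \<Omega> \<mu> u G f \<and> (\<integral>\<^sup>+ y. A (kA * f y) \<partial>lborel) \<le> 1 \<and> boundary_excess \<Omega> u 2 = 0 \<Longrightarrow>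
      emeasure lborel {x \<in> \<Omega>. C < norm (u x)} = 0"
    using mod by (elim exE conjE) (rule that, assumption, (drule spec)+, drule (1) mp, assumption)
  define C' where "C' = C * kA"
  have C': "C' > 0" using C k by (simp add: C'_def)
  have main: "linfty_norm (lebesgue_on \<Omega>) u \<le> ennreal C' * (luxemburg_norm (lebesgue_on \<Omega>) A (sym_grad \<Omega> u) + linfty_norm (boundary_measure \<Omega>) u)"
    if adm: "admissible \<alpha> c V m h \<Omega> \<mu>" and u: "u \<in> E1 \<Omega> (orlicz_space (lebesgue_on \<Omega>) A)" "u \<in> Cb (closure \<Omega>)"
    for \<alpha> c m \<Omega> \<mu> and u :: "real ^ 'n \<Rightarrow> real ^ 'n"
  proof -
    let ?G = "sym_grad \<Omega> u" and ?N = "linfty_norm (boundary_measure \<Omega>) u"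
    have \<Omega>: "open \<Omega>" using adm by (simp add: admissible_def)
    have G: "has_sym_grad \<Omega> u ?G" using u(1) by (rule has_sym_grad_sym_grad)
    have meas: "(\<lambda>x. norm (?G x)) \<in> borel_measurable (lebesgue_on \<Omega>)"
      using u(1) by (simp add: E1_def orlicz_space_def)
    have um: "u \<in> borel_measurable (restrict_space borel \<Omega>)" "u \<in> borel_measurable (lebesgue_on \<Omega>)"
    proof -
      have cont: "continuous_on \<Omega> u" using u(2) closure_subset by (auto simp: Cb_def intro: continuous_on_subset)
      show "u \<in> borel_measurable (restrict_space borel \<Omega>)" by (rule borel_measurable_continuous_on_restrict[OF cont])
      show "u \<in> borel_measurable (lebesgue_on \<Omega>)" using cont \<Omega> by (intro continuous_imp_measurable_on_sets_lebesgue) auto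
    qed
    have step: "linfty_norm (lebesgue_on \<Omega>) u \<le> ennreal (C' * (r + s))"
      if r: "r \<in> {l. 0 < l \<and> (\<integral>\<^sup>+ x. A (norm (?G x) / l) \<partial>lebesgue_on \<Omega>) \<le> 1}" and s: "s \<in> {s. 0 < s \<and> ?N \<le> ennreal s}" for r s
    proof -
      have rs: "r > 0" "s > 0" using r s by auto
      define l where "l = kA * (r + s)"
      have l: "l > 0" using rs k by (auto simp: l_def intro!: mult_pos_pos)
      obtain f where data: "sobolev_data \<alpha> c V m h \<Omega> \<mu> (\<lambda>x. (1 / l) *\<^sub>R u x) (\<lambda>x. (1 / l) *\<^sub>R ?G x) f"
        using sobolev_data_exists[OF adm u(2) G meas, of "1 / l"] l by auto
      have "kA * r \<le> l" using k rs by (simp add: l_def)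
      then have q: "kA * (1 / l) \<le> 1 / r" using l rs by (simp add: field_simps)
      have mA: "(\<integral>\<^sup>+ y. A (kA * f y) \<partial>lborel) \<le> 1"
        by (rule nn_integral_young_gradient_le[OF A data _ rs(1) _ q]) (use l k r in auto)
      have "s \<le> l"
      proof -
        have "1 * s \<le> kA * (r + s)" using k rs by (intro mult_mono) auto
        then show ?thesis by (simp add: l_def)
      qed
      \<comment> \<open>Since l \<ge> s, the normalised boundary values are at most 1 almost
        everywhere and hence below the level 2.\<close>
      have bz: "boundary_excess \<Omega> (\<lambda>x. (1 / l) *\<^sub>R u x) 2 = 0"
      proof -
        have "AE p in boundary_measure \<Omega>. ennreal (norm (u p)) \<le> ?N"
          unfolding linfty_norm_def by (rule esssup_AE)
        then have "AE p in hausdorff_measure (real CARD('n) - 1). p \<in> frontier \<Omega> \<longrightarrow> ennreal (norm (u p)) \<le> ?N"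
          by (subst (asm) AE_restrict_space_iff) (auto simp: frontier_closed)
        then have "AE p in hausdorff_measure (real CARD('n) - 1).
            indicator {p \<in> frontier \<Omega>. 2 < norm ((1 / l) *\<^sub>R u p)} p * ennreal (norm ((1 / l) *\<^sub>R u p)) = 0"
        proof eventually_elim
          fix p assume p: "p \<in> frontier \<Omega> \<longrightarrow> ennreal (norm (u p)) \<le> ?N"
          have "\<not> 2 < norm ((1 / l) *\<^sub>R u p)" if "p \<in> frontier \<Omega>"
          proof -
            have "ennreal (norm (u p)) \<le> ennreal s" using p that s order_trans by blast
            then have "norm (u p) \<le> l" using rs \<open>s \<le> l\<close> by (simp add: ennreal_le_iff)
            then show ?thesis using l by (simp add: field_simps)
          qed
          then show "indicator {p \<in> frontier \<Omega>. 2 < norm ((1 / l) *\<^sub>R u p)} p * ennreal (norm ((1 / l) *\<^sub>R u p)) = 0"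
            by (auto simp: indicator_def)
        qed
        then have "boundary_excess \<Omega> (\<lambda>x. (1 / l) *\<^sub>R u x) 2 = (\<integral>\<^sup>+ p. 0 \<partial>(hausdorff_measure (real CARD('n) - 1) :: (real ^ 'n) measure))"
          unfolding boundary_excess_def by (rule nn_integral_cong_AE)
        then show ?thesis by simp
      qed
      have null: "emeasure lborel {x \<in> \<Omega>. C < norm ((1 / l) *\<^sub>R u x)} = 0"
        using est data mA bz by blast
      have eqs: "{x \<in> \<Omega>. C < norm ((1 / l) *\<^sub>R u x)} = {x \<in> \<Omega>. C' * (r + s) < norm (u x)}"
        using l by (auto simp: C'_def l_def field_simps)
      have "{x \<in> \<Omega>. C' * (r + s) < norm (u x)} \<in> sets borel"
      proof -
        have "{x \<in> space (restrict_space borel \<Omega>). C' * (r + s) < norm (u x)} \<in> sets (restrict_space borel \<Omega>)"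
          using um(1) by measurable
        then show ?thesis using \<Omega> by (auto simp: space_restrict_space sets_restrict_space_iff)
      qed
      then have "{x \<in> \<Omega>. C' * (r + s) < norm (u x)} \<in> null_sets lborel"
        using null unfolding eqs by (simp add: null_sets_def)
      then have "AE x in lborel. x \<notin> {x \<in> \<Omega>. C' * (r + s) < norm (u x)}" by (rule AE_not_in)
      then have "AE x in lebesgue. x \<in> \<Omega> \<longrightarrow> norm (u x) \<le> C' * (r + s)"
        by (intro AE_completion) (auto elim!: eventually_mono)
      then have "AE x in lebesgue_on \<Omega>. norm (u x) \<le> C' * (r + s)"
        using \<Omega> by (subst AE_restrict_space_iff) auto
      then have "AE x in lebesgue_on \<Omega>. ennreal (norm (u x)) \<le> ennreal (C' * (r + s))"
        by eventually_elim (rule ennreal_leI)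
      then show ?thesis unfolding linfty_norm_def using um(2) by (intro esssup_I) auto
    qed
    have "linfty_norm (lebesgue_on \<Omega>) u \<le> ennreal C' * ((INF r\<in>{l. 0 < l \<and> (\<integral>\<^sup>+ x. A (norm (?G x) / l) \<partial>lebesgue_on \<Omega>) \<le> 1}. ennreal r)
        + (INF s\<in>{s. 0 < s \<and> ?N \<le> ennreal s}. ennreal s))"
      by (rule ennreal_le_mult_add_INF[OF C' step]) auto
    also have "(INF s\<in>{s. 0 < s \<and> ?N \<le> ennreal s}. ennreal s) \<le> ?N"
    proof (rule ennreal_le_epsilon)
      fix e :: real assume "?N < top" "e > 0"
      then have "?N + ennreal e = ennreal (enn2real ?N + e)" by (simp add: ennreal_plus)
      moreover have "(INF s\<in>{s. 0 < s \<and> ?N \<le> ennreal s}. ennreal s) \<le> ennreal (enn2real ?N + e)"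
      proof (rule INF_lower)
        have "0 < enn2real ?N + e" using \<open>e > 0\<close> by (simp add: add_nonneg_pos)
        moreover have "?N \<le> ennreal (enn2real ?N + e)"
          unfolding \<open>?N + ennreal e = _\<close>[symmetric] by simp
        ultimately show "enn2real ?N + e \<in> {s. 0 < s \<and> ?N \<le> ennreal s}" by simp
      qed
      ultimately show "(INF s\<in>{s. 0 < s \<and> ?N \<le> ennreal s}. ennreal s) \<le> ?N + ennreal e" by simp
    qed
    finally show ?thesis
      unfolding luxemburg_norm_def by (simp add: add_left_mono mult_left_mono)
  qed
  show ?thesis by (intro exI[of _ C'] conjI C') (use main in blast)
qed

section \<open>Powers with logarithmic factors\<close>

text \<open>On t > 0 this family is closed under real powers and under multiplication by t, and
  differentiation lowers p by one up to a factor that tends to p. All weights W and the subcritical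
  Y are expressed in it.\<close>

definition power_log :: "real \<Rightarrow> real \<Rightarrow> real \<Rightarrow> real" where
  "power_log p s t = t powr p * ln (1 + t) powr s"

lemma power_log_measurable [measurable]: "power_log p s \<in> borel_measurable borel"
  unfolding power_log_def[abs_def] by measurable

lemma power_log_pos: "t > 0 \<Longrightarrow> power_log p s t > 0"
  by (simp add: power_log_def)

lemma power_log_powr:
  assumes "t > 0"
  shows "power_log p s t powr r = power_log (p * r) (s * r) t"
  using assms by (simp add: power_log_def powr_mult powr_powr)

lemma power_log_add:
  assumes "t > 0"
  shows "t * power_log p s t = power_log (p + 1) s t"
  using assms by (simp add: power_log_def powr_add)

lemma power_log_deriv:
  assumes "t > 0"
  shows "(power_log p s has_real_derivative power_log (p - 1) s t * (p + s * (t / ((1 + t) * ln (1 + t))))) (at t)"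
proof -
  have l: "ln (1 + t) > 0" using assms by simp
  have "((\<lambda>t. t powr p * ln (1 + t) powr s) has_real_derivative
     (p * t powr (p - 1)) * ln (1 + t) powr s + (s * ln (1 + t) powr (s - 1) * (1 / (1 + t))) * t powr p) (at t)"
    using assms l by (auto intro!: derivative_eq_intros has_real_derivative_powr simp: powr_diff field_simps)
  moreover have "(p * t powr (p - 1)) * ln (1 + t) powr s + (s * ln (1 + t) powr (s - 1) * (1 / (1 + t))) * t powr p =
     power_log (p - 1) s t * (p + s * (t / ((1 + t) * ln (1 + t))))"
    using assms l by (simp add: power_log_def powr_diff field_simps)
  ultimately show ?thesis unfolding power_log_def[abs_def] by simp
qed

lemma log_ratio_scale: "\<kappa> > 0 \<Longrightarrow> ((\<lambda>l::real. ln (1 + \<kappa> * l) / ln (1 + l)) \<longlongrightarrow> 1) at_top"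
  by real_asymp

lemma log_ratio_power:
  fixes a \<eta> s :: real
  assumes "a > 0" "\<eta> > 0"
  shows "((\<lambda>l. ln (1 + \<eta> * power_log a s l) / ln (1 + l)) \<longlongrightarrow> a) at_top"
  unfolding power_log_def using assms by real_asymp

lemma log_weight_small: "((\<lambda>t::real. t / ((1 + t) * ln (1 + t))) \<longlongrightarrow> 0) at_top"
  by real_asymp

lemma power_log_ratio:
  assumes "\<kappa> > 0"
  shows "((\<lambda>l. power_log p s (\<kappa> * l) / power_log p s l) \<longlongrightarrow> \<kappa> powr p) at_top"
proof -
  have "((\<lambda>l. \<kappa> powr p * (ln (1 + \<kappa> * l) / ln (1 + l)) powr s) \<longlongrightarrow> \<kappa> powr p * 1 powr s) at_top"
    by (intro tendsto_intros log_ratio_scale assms) auto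
  then have "((\<lambda>l. \<kappa> powr p * (ln (1 + \<kappa> * l) / ln (1 + l)) powr s) \<longlongrightarrow> \<kappa> powr p) at_top" by simp
  then show ?thesis
    by (rule Lim_transform_eventually, use eventually_gt_at_top[of 0] in eventually_elim)
       (use assms in \<open>simp add: power_log_def powr_mult powr_divide\<close>)
qed

lemma power_log_scale_ge:
  assumes "\<kappa> > 0" "c < \<kappa> powr p"
  shows "\<forall>\<^sub>F l in at_top. c * power_log p s l \<le> power_log p s (\<kappa> * l)"
proof -
  have "\<forall>\<^sub>F l in at_top. c < power_log p s (\<kappa> * l) / power_log p s l"
    using power_log_ratio[OF assms(1)] assms(2) by (rule order_tendstoD(1))
  then show ?thesis using eventually_gt_at_top[of 0]
    by eventually_elim (simp add: power_log_pos field_simps less_imp_le)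
qed

lemma power_log_scale_le:
  assumes "\<kappa> > 0" "\<kappa> powr p < c"
  shows "\<forall>\<^sub>F l in at_top. power_log p s (\<kappa> * l) \<le> c * power_log p s l"
proof -
  have "\<forall>\<^sub>F l in at_top. power_log p s (\<kappa> * l) / power_log p s l < c"
    using power_log_ratio[OF assms(1)] assms(2) by (rule order_tendstoD(2))
  then show ?thesis using eventually_gt_at_top[of 0]
    by eventually_elim (simp add: power_log_pos field_simps less_imp_le)
qed

text \<open>The derivative has the sign of p + s t / ((1 + t) ln (1 + t)), which tends to p > 0 for
  every real s.\<close>

lemma power_log_eventually_mono:
  assumes "p > 0"
  shows "\<forall>\<^sub>F l in at_top. \<forall>t\<ge>l. power_log p s l \<le> power_log p s t"
proof -
  have "((\<lambda>t. p + s * (t / ((1 + t) * ln (1 + t)))) \<longlongrightarrow> p + s * 0) at_top"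
    by (intro tendsto_intros log_weight_small)
  then have "\<forall>\<^sub>F t in at_top. 0 < p + s * (t / ((1 + t) * ln (1 + t)))"
    using assms by (intro order_tendstoD(1)[of _ "p + s * 0"]) auto
  then have "\<forall>\<^sub>F t in at_top. 0 < p + s * (t / ((1 + t) * ln (1 + t))) \<and> t > 0"
    using eventually_gt_at_top[of 0] by eventually_elim blast
  then obtain N where N: "\<And>t. t \<ge> N \<Longrightarrow> 0 < p + s * (t / ((1 + t) * ln (1 + t))) \<and> t > 0"
    unfolding eventually_at_top_linorder by blast
  have "power_log p s l \<le> power_log p s t" if "l \<ge> N" "t \<ge> l" for l t
  proof (rule DERIV_nonneg_imp_nondecreasing[OF that(2)])
    fix x assume "l \<le> x" "x \<le> t"
    then have x: "0 < p + s * (x / ((1 + x) * ln (1 + x)))" "x > 0" using N[of x] that by auto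
    show "\<exists>y. (power_log p s has_real_derivative y) (at x) \<and> 0 \<le> y"
      using power_log_deriv[OF x(2), of p s] mult_pos_pos[OF power_log_pos[OF x(2)] x(1), of "p - 1" s] by (meson less_imp_le)
  qed
  then show ?thesis unfolding eventually_at_top_linorder by blast
qed

section \<open>Weights and truncation levels in the different ranges of the exponents\<close>

lemma log_powr_deriv:
  assumes "t > 0" "s \<noteq> 1"
  shows "((\<lambda>t. 2 / (1 - s) * ln (1 + t) powr (1 - s)) has_real_derivative 2 / (1 + t) * ln (1 + t) powr (- s)) (at t)"
proof -
  have l: "ln (1 + t) > 0" using assms by simp
  have d: "((\<lambda>t. ln (1 + t)) has_real_derivative 1 / (1 + t)) (at t)"
    using assms by (auto intro!: derivative_eq_intros)
  have "((\<lambda>t. 2 / (1 - s) * ln (1 + t) powr (1 - s)) has_real_derivative 2 / (1 - s) * ((1 - s) * ln (1 + t) powr (1 - s - 1) * (1 / (1 + t)))) (at t)"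
    by (rule DERIV_cmult[OF DERIV_chain2[OF has_real_derivative_powr[OF l] d]])
  moreover have "2 / (1 - s) * ((1 - s) * ln (1 + t) powr (1 - s - 1) * (1 / (1 + t))) = 2 / (1 + t) * ln (1 + t) powr (- s)"
  proof -
    have e1: "2 / (1 - s) * ((1 - s) * x * (1 / y)) = (2 / (1 - s) * (1 - s)) * (x * (1 / y))" for x y :: real
      by (simp only: mult.assoc)
    have e2: "2 / (1 - s) * (1 - s) = 2" using nonzero_eq_divide_eq[of "1 - s" "2 / (1 - s)" 2] assms by simp
    show ?thesis unfolding e1 e2 by simp
  qed
  ultimately show ?thesis by (simp only:)
qed

text \<open>For p = n the power of t in W^(-1/(n-1)) is exactly 1/t. Replacing it by 2/(1 + t) for t
  \<ge> 1 turns the bound into an exact derivative, that of a power of ln (1 + t) or of its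
  logarithm.\<close>

lemma critical_weight_le:
  assumes "n > 1" "t \<ge> 1"
  shows "power_log (n - 1) \<sigma> t powr (- 1 / (n - 1)) \<le> 2 / (1 + t) * ln (1 + t) powr (- (\<sigma> / (n - 1)))"
proof -
  have "power_log (n - 1) \<sigma> t powr (- 1 / (n - 1)) = 1 / t * ln (1 + t) powr (- (\<sigma> / (n - 1)))"
    using assms by (subst power_log_powr) (auto simp: power_log_def powr_minus divide_inverse)
  also have "\<dots> \<le> 2 / (1 + t) * ln (1 + t) powr (- (\<sigma> / (n - 1)))"
    using assms by (intro mult_right_mono) (auto simp: field_simps)
  finally show ?thesis .
qed

text \<open>p > n leaves a spare negative power of t, with exponent -(p - n)/(n - 1), that outweighs
  every power of the logarithm. The exponent -2 is one choice below -1; it brings p > n into the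
  form of the case p = n with \<sigma> > n - 1.\<close>

lemma supercritical_weight_le:
  assumes n: "n > 1" and p: "p > n"
  shows "\<forall>\<^sub>F t in at_top. power_log (p - 1) \<sigma> t powr (- 1 / (n - 1)) \<le> 2 / (1 + t) * ln (1 + t) powr (- 2)"
proof -
  define d where "d = (p - n) / (n - 1)"
  have d: "d > 0" using n p by (simp add: d_def)
  have "((\<lambda>t. t powr (- d) * ln (1 + t) powr (2 - \<sigma> / (n - 1))) \<longlongrightarrow> 0) at_top"
    using d by real_asymp
  then have "\<forall>\<^sub>F t in at_top. t powr (- d) * ln (1 + t) powr (2 - \<sigma> / (n - 1)) < 1"
    by (rule order_tendstoD(2)) simp
  then show ?thesis using eventually_ge_at_top[of 1]
  proof eventually_elim
    fix t :: real assume t: "t powr (- d) * ln (1 + t) powr (2 - \<sigma> / (n - 1)) < 1" "1 \<le> t"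
    have e: "(p - 1) * (- 1 / (n - 1)) = - 1 + - d" using n by (simp add: d_def field_simps)
    have "power_log (p - 1) \<sigma> t powr (- 1 / (n - 1)) = t powr (- 1 + - d) * ln (1 + t) powr (- (\<sigma> / (n - 1)))"
    proof -
      have "\<sigma> * (- 1 / (n - 1)) = - (\<sigma> / (n - 1))" by simp
      moreover have "t > 0" using t by simp
      ultimately show ?thesis unfolding power_log_powr[OF \<open>t > 0\<close>] by (simp only: power_log_def e)
    qed
    also have "\<dots> = 1 / t * ln (1 + t) powr (- 2) * (t powr (- d) * ln (1 + t) powr (2 - \<sigma> / (n - 1)))"
    proof -
      define L where "L = ln (1 + t)"
      have "L > 0" using t by (simp add: L_def)
      then show ?thesis
        unfolding L_def[symmetric] powr_add using t by (simp add: powr_minus powr_diff divide_inverse power2_eq_square) (simp add: field_simps)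
    qed
    also have "\<dots> \<le> 1 / t * ln (1 + t) powr (- 2) * 1"
      using t by (intro mult_left_mono) auto
    also have "\<dots> \<le> 2 / (1 + t) * ln (1 + t) powr (- 2)"
      using t by (simp only: mult_1_right) (intro mult_right_mono, auto simp: field_simps)
    finally show "power_log (p - 1) \<sigma> t powr (- 1 / (n - 1)) \<le> 2 / (1 + t) * ln (1 + t) powr (- 2)" .
  qed
qed

lemma power_log_at_top:
  assumes "p > 0"
  shows "filterlim (power_log p s) at_top at_top"
  unfolding power_log_def[abs_def] using assms by real_asymp

text \<open>At T = e^(4j) - 1 the logarithm ln (1 + T) is exactly 4j, and T^(n-1) \<ge> T since n -
  1 \<ge> 1. The gap between e^(4j) and e^(2j) absorbs the factor (4j)^\<sigma>, also for negative
  \<sigma>.\<close>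

lemma critical_weight_exp:
  assumes "n \<ge> 2"
  shows "\<forall>\<^sub>F j in sequentially. exp (2 * real j) \<le> power_log (n - 1) \<sigma> (exp (4 * real j) - 1)"
proof -
  have "\<forall>\<^sub>F x in at_top. exp (2 * x) \<le> (exp (4 * x) - 1) * (4 * x) powr \<sigma>" by real_asymp
  then have "\<forall>\<^sub>F j in sequentially. exp (2 * real j) \<le> (exp (4 * real j) - 1) * (4 * real j) powr \<sigma>"
    by (rule eventually_compose_filterlim[OF _ filterlim_real_sequentially])
  then show ?thesis using eventually_ge_at_top[of 1]
  proof eventually_elim
    fix j :: nat assume j: "exp (2 * real j) \<le> (exp (4 * real j) - 1) * (4 * real j) powr \<sigma>" "1 \<le> j"
    have "1 + 4 * real j \<le> exp (4 * real j)" by (rule exp_ge_add_one_self)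
    then have e: "exp (4 * real j) - 1 \<ge> 1" using j(2) by linarith
    then have "(exp (4 * real j) - 1) powr 1 \<le> (exp (4 * real j) - 1) powr (n - 1)"
      using assms by (intro powr_mono) auto
    then have "(exp (4 * real j) - 1) * (4 * real j) powr \<sigma> \<le> power_log (n - 1) \<sigma> (exp (4 * real j) - 1)"
      using e by (simp add: power_log_def mult_right_mono)
    then show "exp (2 * real j) \<le> power_log (n - 1) \<sigma> (exp (4 * real j) - 1)" using j by linarith
  qed
qed

lemma exp_dominates:
  assumes "L > 0"
  shows "\<forall>\<^sub>F j in sequentially. exp (2 * real j) \<le> (exp (4 * real j) - 1) / (L * real j powr a)"
proof -
  have "\<forall>\<^sub>F x in at_top. exp (2 * x) \<le> (exp (4 * x) - 1) / (L * x powr a)"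
    using assms by real_asymp
  then show ?thesis by (rule eventually_compose_filterlim[OF _ filterlim_real_sequentially])
qed

lemma exp_square_dominates:
  assumes "L > 0"
  shows "\<forall>\<^sub>F j in sequentially. exp (2 * real j) \<le> (exp ((real j)\<^sup>2) - exp 1) / (L * ln (real j) powr a)"
proof -
  have "\<forall>\<^sub>F x in at_top. exp (2 * x) \<le> (exp (x\<^sup>2) - exp 1) / (L * ln x powr a)"
    using assms by real_asymp
  then show ?thesis by (rule eventually_compose_filterlim[OF _ filterlim_real_sequentially])
qed

text \<open>Y(T)^((n-1)/n) is of order T^((n-p)/n) log^(-\<sigma>/n), and T1 is its inverse function
  up to constants: l^a log^(\<sigma>/(n-p)) with a = n/(n-p). Inserted into W this gives l^q
  log^\<tau>, the weight that belongs to the boundary space, so interior and boundary need the same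
  growth. The constants give each of the three terms 1, Y and T2, multiplied by C, a third of
  l.\<close>

lemma power_choice:
  assumes p: "1 < p" "p < n" and C: "C > 0" and K: "K > 0"
  shows "\<exists>\<epsilon>>0. \<exists>T1 T2. filterlim T1 at_top at_top \<and> filterlim T2 at_top at_top \<and> (\<forall>\<^sub>F l in at_top.
     C * (1 + (K * power_log ((n - p) / (n - 1)) (- \<sigma> / (n - 1)) (T1 l)) powr ((n - 1) / n) + T2 l) \<le> l \<and>
     \<epsilon> * power_log (p * (n - 1) / (n - p) - 1) (\<sigma> * (n - 1) / (n - p)) l \<le> power_log (p - 1) \<sigma> (T1 l) \<and>
     \<epsilon> * power_log (p * (n - 1) / (n - p) - 1) (\<sigma> * (n - 1) / (n - p)) l \<le>
       power_log (p * (n - 1) / (n - p) - 1) (\<sigma> * (n - 1) / (n - p)) (T2 l))"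
proof -
  define q where "q = p * (n - 1) / (n - p) - 1"
  define \<tau> where "\<tau> = \<sigma> * (n - 1) / (n - p)"
  define a where "a = n / (n - p)"
  have a: "a > 0" using p by (simp add: a_def)
  have q: "q = n * (p - 1) / (n - p)" using p by (simp add: q_def field_simps)
  have q0: "q > 0" using p by (simp add: q)
  \<comment> \<open>The logarithms of l and of T1 l differ asymptotically by the factor a; M exceeds
    the limit of the resulting quotient raised to \<sigma>/n.\<close>
  define M where "M = (1 / a) powr (\<sigma> / n) + 1"
  have M: "M > 0" by (simp add: M_def add_nonneg_pos)
  define B where "B = C * K powr ((n - 1) / n) * M"
  have B: "B > 0" using C K M by (simp add: B_def)
  \<comment> \<open>Since a is the reciprocal of (n-p)/n, the power \<eta>^((n-p)/n) is 1/(3B), and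
    B collects every other constant in front of l.\<close>
  define \<eta> where "\<eta> = (1 / (3 * B)) powr a"
  have \<eta>: "\<eta> > 0" using B by (simp add: \<eta>_def)
  define T1 where "T1 l = \<eta> * power_log a (\<sigma> / (n - p)) l" for l
  define T2 where "T2 l = 1 / (3 * C) * l" for l
  have T1lim: "filterlim T1 at_top at_top"
    unfolding T1_def[abs_def] by (rule filterlim_tendsto_pos_mult_at_top[OF tendsto_const \<eta> power_log_at_top[OF a]])
  have T2lim: "filterlim T2 at_top at_top"
    unfolding T2_def[abs_def] using C by (intro filterlim_tendsto_pos_mult_at_top[OF tendsto_const _ filterlim_ident]) auto
  have ratio: "((\<lambda>l. ln (1 + T1 l) / ln (1 + l)) \<longlongrightarrow> a) at_top"
    unfolding T1_def by (rule log_ratio_power[OF a \<eta>])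
  have r1: "\<forall>\<^sub>F l in at_top. (ln (1 + l) / ln (1 + T1 l)) powr (\<sigma> / n) < M"
  proof -
    have "((\<lambda>l. (1 / (ln (1 + T1 l) / ln (1 + l))) powr (\<sigma> / n)) \<longlongrightarrow> (1 / a) powr (\<sigma> / n)) at_top"
      using a by (intro tendsto_intros ratio) auto
    then have "\<forall>\<^sub>F l in at_top. (1 / (ln (1 + T1 l) / ln (1 + l))) powr (\<sigma> / n) < M"
      by (rule order_tendstoD(2)) (simp add: M_def)
    then show ?thesis by simp
  qed
  have r2: "\<forall>\<^sub>F l in at_top. (ln (1 + T1 l) / ln (1 + l)) powr \<sigma> > a powr \<sigma> / 2"
  proof -
    have "((\<lambda>l. (ln (1 + T1 l) / ln (1 + l)) powr \<sigma>) \<longlongrightarrow> a powr \<sigma>) at_top"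
      using a by (intro tendsto_intros ratio) auto
    then show ?thesis by (rule order_tendstoD(1)) (use a in simp)
  qed
  \<comment> \<open>Each entry is half of a limiting quotient with denominator
    \<open>power_log q \<tau> l\<close>: the numerator is the gradient weight at T1 l in the first
    and the boundary weight at T2 l in the second.\<close>
  define \<epsilon> where "\<epsilon> = min (\<eta> powr (p - 1) * (a powr \<sigma> / 2)) ((1 / (3 * C)) powr q / 2)"
  have \<epsilon>: "\<epsilon> > 0" using \<eta> a C by (simp add: \<epsilon>_def)
  have r3: "\<forall>\<^sub>F l in at_top. (1 / (3 * C)) powr q / 2 * power_log q \<tau> l \<le> power_log q \<tau> (1 / (3 * C) * l)"
    using C by (intro power_log_scale_ge) auto
  have ev: "\<forall>\<^sub>F l in at_top. T1 l > 0"
    using T1lim eventually_gt_at_top[of 0] by (rule eventually_compose_filterlim[rotated])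
  have "\<forall>\<^sub>F l in at_top.
     C * (1 + (K * power_log ((n - p) / (n - 1)) (- \<sigma> / (n - 1)) (T1 l)) powr ((n - 1) / n) + T2 l) \<le> l \<and>
     \<epsilon> * power_log q \<tau> l \<le> power_log (p - 1) \<sigma> (T1 l) \<and> \<epsilon> * power_log q \<tau> l \<le> power_log q \<tau> (T2 l)"
    using r1 r2 r3 ev eventually_ge_at_top[of "max 1 (3 * C)"]
  proof eventually_elim
    fix l assume r1: "(ln (1 + l) / ln (1 + T1 l)) powr (\<sigma> / n) < M" and r2: "a powr \<sigma> / 2 < (ln (1 + T1 l) / ln (1 + l)) powr \<sigma>"
      and r3: "(1 / (3 * C)) powr q / 2 * power_log q \<tau> l \<le> power_log q \<tau> (1 / (3 * C) * l)" and T1p: "0 < T1 l" and l: "max 1 (3 * C) \<le> l"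
    have l1: "l \<ge> 1" "l \<ge> 3 * C" using l by auto
    have ln1: "ln (1 + l) > 0" "ln (1 + T1 l) > 0" using l1 T1p by simp_all
    have T1_powr: "T1 l powr x = \<eta> powr x * (l powr (a * x) * ln (1 + l) powr (\<sigma> / (n - p) * x))" for x
      unfolding T1_def power_log_def using \<eta> by (simp only: powr_mult powr_powr)
    have "(K * power_log ((n - p) / (n - 1)) (- \<sigma> / (n - 1)) (T1 l)) powr ((n - 1) / n) =
       K powr ((n - 1) / n) * power_log ((n - p) / n) (- \<sigma> / n) (T1 l)"
      using K T1p p by (simp add: powr_mult less_imp_le[OF power_log_pos] power_log_powr)
    also have "power_log ((n - p) / n) (- \<sigma> / n) (T1 l) = (1 / (3 * B)) * l * (ln (1 + l) / ln (1 + T1 l)) powr (\<sigma> / n)"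
    proof -
      have "T1 l powr ((n - p) / n) = (1 / (3 * B)) * l * ln (1 + l) powr (\<sigma> / n)"
      proof -
        have e: "a * ((n - p) / n) = 1" "\<sigma> / (n - p) * ((n - p) / n) = \<sigma> / n"
          using p by (simp_all add: a_def)
        have "\<eta> powr ((n - p) / n) = 1 / (3 * B)" unfolding \<eta>_def powr_powr e(1) using B by simp
        then show ?thesis unfolding T1_powr e using l1 by simp
      qed
      moreover have "ln (1 + T1 l) powr (- \<sigma> / n) = inverse (ln (1 + T1 l) powr (\<sigma> / n))"
        using powr_minus[of "ln (1 + T1 l)" "\<sigma> / n"] by simp
      moreover have "(ln (1 + l) / ln (1 + T1 l)) powr (\<sigma> / n) = ln (1 + l) powr (\<sigma> / n) / ln (1 + T1 l) powr (\<sigma> / n)"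
        by (rule powr_divide)
      ultimately show ?thesis by (simp only: power_log_def divide_inverse mult.assoc)
    qed
    also have "K powr ((n - 1) / n) * (1 / (3 * B) * l * (ln (1 + l) / ln (1 + T1 l)) powr (\<sigma> / n))
       \<le> K powr ((n - 1) / n) * (1 / (3 * B) * l * M)"
      using K B l1 r1 by (intro mult_left_mono) auto
    finally have "C * (K * power_log ((n - p) / (n - 1)) (- \<sigma> / (n - 1)) (T1 l)) powr ((n - 1) / n) \<le> C * (K powr ((n - 1) / n) * (1 / (3 * B) * l * M))"
      using C by (intro mult_left_mono) auto
    also have "\<dots> = B / (3 * B) * l" by (simp add: B_def)
    also have "\<dots> = l / 3" using B by simp
    finally have c1: "C * (K * power_log ((n - p) / (n - 1)) (- \<sigma> / (n - 1)) (T1 l)) powr ((n - 1) / n) \<le> l / 3" .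
    have c2: "C * T2 l = l / 3" using C by (simp add: T2_def)
    have 1: "C * (1 + (K * power_log ((n - p) / (n - 1)) (- \<sigma> / (n - 1)) (T1 l)) powr ((n - 1) / n) + T2 l) \<le> l"
      using c1 c2 l1(2) by (simp add: distrib_left)
    have pl: "power_log q \<tau> l > 0" using l1 by (intro power_log_pos) simp
    have "power_log (p - 1) \<sigma> (T1 l) = \<eta> powr (p - 1) * (ln (1 + T1 l) / ln (1 + l)) powr \<sigma> * power_log q \<tau> l"
    proof -
      have e: "\<sigma> * (n - 1) / (n - p) = \<sigma> * (p - 1) / (n - p) + \<sigma>" using p by (simp add: field_simps)
      have "T1 l powr (p - 1) = \<eta> powr (p - 1) * (l powr q * ln (1 + l) powr (\<sigma> * (p - 1) / (n - p)))"
      proof -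
        have e: "a * (p - 1) = q" "\<sigma> / (n - p) * (p - 1) = \<sigma> * (p - 1) / (n - p)"
          by (simp_all add: a_def q)
        show ?thesis unfolding T1_powr e ..
      qed
      moreover have "ln (1 + l) powr \<tau> = ln (1 + l) powr (\<sigma> * (p - 1) / (n - p)) * ln (1 + l) powr \<sigma>"
        unfolding \<tau>_def e powr_add ..
      ultimately show ?thesis using ln1 by (simp add: power_log_def powr_divide)
    qed
    moreover have "\<eta> powr (p - 1) * (a powr \<sigma> / 2) * power_log q \<tau> l \<le>
       \<eta> powr (p - 1) * (ln (1 + T1 l) / ln (1 + l)) powr \<sigma> * power_log q \<tau> l"
      using r2 pl \<eta> by (intro mult_right_mono mult_left_mono) auto
    moreover have "\<epsilon> * power_log q \<tau> l \<le> \<eta> powr (p - 1) * (a powr \<sigma> / 2) * power_log q \<tau> l"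
      using pl by (intro mult_right_mono) (auto simp: \<epsilon>_def)
    ultimately have 2: "\<epsilon> * power_log q \<tau> l \<le> power_log (p - 1) \<sigma> (T1 l)"
      by linarith
    have "\<epsilon> * power_log q \<tau> l \<le> (1 / (3 * C)) powr q / 2 * power_log q \<tau> l"
      using pl by (intro mult_right_mono) (auto simp: \<epsilon>_def)
    then have 3: "\<epsilon> * power_log q \<tau> l \<le> power_log q \<tau> (T2 l)"
      using r3 unfolding T2_def by linarith
    show "C * (1 + (K * power_log ((n - p) / (n - 1)) (- \<sigma> / (n - 1)) (T1 l)) powr ((n - 1) / n) + T2 l) \<le> l \<and>
     \<epsilon> * power_log q \<tau> l \<le> power_log (p - 1) \<sigma> (T1 l) \<and> \<epsilon> * power_log q \<tau> l \<le> power_log q \<tau> (T2 l)"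
      using 1 2 3 by blast
  qed
  then show ?thesis using \<epsilon> T1lim T2lim unfolding q_def \<tau>_def by blast
qed

section \<open>The four regimes\<close>

lemma zygmund_superlinear:
  assumes "zygmund_young p \<sigma> A"
  shows "\<exists>k\<ge>1. \<forall>\<^sub>F t0 in at_top. superlinear t0 (power_log (p - 1) \<sigma>) (\<lambda>t. A (k * t))"
proof (rule superlinear_of_equivalent)
  show "young_function A" using assms by (simp add: zygmund_young_def)
  show "equivalent_near_infinity A (\<lambda>t. ennreal (power_log p \<sigma> t))"
    using assms by (simp add: zygmund_young_def power_log_def)
  show "\<forall>\<^sub>F t in at_top. power_log p \<sigma> t = t * power_log (p - 1) \<sigma> t \<and> power_log (p - 1) \<sigma> t > 0"
    using eventually_gt_at_top[of 0] by eventually_elim (simp add: power_log_add power_log_pos)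
qed

lemma subcritical_estimate:
  fixes n :: real and c :: real and V m h :: ennreal
  assumes n2: "CARD('n::finite) \<ge> 2" and n: "n = real CARD('n)"
    and fin: "c > 0" "V < \<infinity>" "m < \<infinity>" "h < \<infinity>"
    and p: "1 < p" "p < n" and \<alpha>: "n - 1 < \<alpha>"
    and A: "zygmund_young p \<sigma> A"
    and B: "zygmund_young (p * \<alpha> / (n - p)) (\<sigma> * \<alpha> / (n - p)) B"
    and D: "zygmund_young (p * (n - 1) / (n - p)) (\<sigma> * (n - 1) / (n - p)) D"
  shows "\<exists>C>0. \<forall>(\<Omega> :: (real ^ 'n) set) \<mu>. admissible \<alpha> c V m h \<Omega> \<mu> \<longrightarrow>
          (\<forall>u \<in> E1 \<Omega> (orlicz_space (lebesgue_on \<Omega>) A) \<inter> Cb (closure \<Omega>).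
             luxemburg_norm \<mu> B u \<le>
               ennreal C * (luxemburg_norm (lebesgue_on \<Omega>) A (sym_grad \<Omega> u)
                            + luxemburg_norm (boundary_measure \<Omega>) D u))"
proof -
  have n1: "n > 1" using p by simp
  define q where "q = p * (n - 1) / (n - p)"
  define \<tau> where "\<tau> = \<sigma> * (n - 1) / (n - p)"
  define W where "W = power_log (p - 1) \<sigma>"
  define g where "g = power_log (q - 1) \<tau>"
  define b where "b = power_log (p * \<alpha> / (n - p)) (\<sigma> * \<alpha> / (n - p))"
  have q1: "q > 1"
  proof -
    have "n - p < p * (n - 1)" using mult_strict_left_mono[of 1 p n] p n1 by (simp add: algebra_simps)
    then show ?thesis using p by (simp add: q_def)
  qed
  obtain kA where kA: "kA \<ge> 1" "\<forall>\<^sub>F t0 in at_top. superlinear t0 W (\<lambda>t. A (kA * t))"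
    using zygmund_superlinear[OF A] unfolding W_def by blast
  obtain kD where kD: "kD \<ge> 1" "\<forall>\<^sub>F t0 in at_top. superlinear t0 g (\<lambda>t. D (kD * t))"
    using zygmund_superlinear[OF D] unfolding g_def q_def \<tau>_def by blast
  obtain kB where kB: "kB \<ge> 1" "\<forall>\<^sub>F t in at_top. B (t / kB) \<le> ennreal (b t)"
    using B upper_of_equivalent unfolding zygmund_young_def b_def power_log_def by blast
  obtain s0 where s0: "superlinear s0 g (\<lambda>t. D (kD * t))"
    using eventually_happens[OF kD(2)] by auto
  \<comment> \<open>W^(-1/(n-1)) has the power \<theta> - 1, so Y has the power \<theta>.
    Differentiating \<open>power_log\<close> produces a factor tending to \<theta>, eventually at
    least \<theta>/2; the constant K = 2/\<theta> makes up for it.\<close>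
  define \<theta> where "\<theta> = (n - p) / (n - 1)"
  have \<theta>: "\<theta> > 0" using p n1 by (simp add: \<theta>_def)
  define K where "K = 2 / \<theta>"
  have K: "K > 0" using \<theta> by (simp add: K_def)
  define Y where "Y t = K * power_log \<theta> (- \<sigma> / (n - 1)) t" for t
  define y' where "y' t = K * (power_log (\<theta> - 1) (- \<sigma> / (n - 1)) t * (\<theta> + - \<sigma> / (n - 1) * (t / ((1 + t) * ln (1 + t)))))" for t
  have "((\<lambda>t. \<theta> + - \<sigma> / (n - 1) * (t / ((1 + t) * ln (1 + t)))) \<longlongrightarrow> \<theta> + - \<sigma> / (n - 1) * 0) at_top"
    by (intro tendsto_intros log_weight_small)
  then have "\<forall>\<^sub>F t in at_top. \<theta> / 2 < \<theta> + - \<sigma> / (n - 1) * (t / ((1 + t) * ln (1 + t)))"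
    by (rule order_tendstoD(1)) (use \<theta> in simp)
  then have "\<forall>\<^sub>F t in at_top. superlinear t W (\<lambda>t. A (kA * t)) \<and> \<theta> / 2 < \<theta> + - \<sigma> / (n - 1) * (t / ((1 + t) * ln (1 + t)))"
    using kA(2) by eventually_elim blast
  then obtain t0 where t0: "\<And>t. t \<ge> t0 \<Longrightarrow> superlinear t W (\<lambda>t. A (kA * t)) \<and> \<theta> / 2 < \<theta> + - \<sigma> / (n - 1) * (t / ((1 + t) * ln (1 + t)))"
    unfolding eventually_at_top_linorder by blast
  have tpos: "t > 0" if "t \<ge> t0" for t using t0[OF that] by (simp add: superlinear_def)
  have Yprops: "\<forall>t\<ge>t0. DERIV Y t :> y' t \<and> W t powr (- 1 / (n - 1)) \<le> y' t \<and> Y t > 0"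
  proof (intro allI impI)
    fix t assume t: "t \<ge> t0"
    have "DERIV Y t :> y' t"
      unfolding Y_def[abs_def] y'_def by (rule DERIV_cmult[OF power_log_deriv[OF tpos[OF t]]])
    moreover have "W t powr (- 1 / (n - 1)) = power_log (\<theta> - 1) (- \<sigma> / (n - 1)) t"
    proof -
      have "(p - 1) * (- 1 / (n - 1)) = \<theta> - 1" "\<sigma> * (- 1 / (n - 1)) = - \<sigma> / (n - 1)"
        using n1 by (simp_all add: \<theta>_def field_simps)
      then show ?thesis unfolding W_def by (simp only: power_log_powr[OF tpos[OF t]])
    qed
    moreover have "power_log (\<theta> - 1) (- \<sigma> / (n - 1)) t \<le> y' t"
    proof -
      have "power_log (\<theta> - 1) (- \<sigma> / (n - 1)) t * (\<theta> / 2) \<le> power_log (\<theta> - 1) (- \<sigma> / (n - 1)) t * (\<theta> + - \<sigma> / (n - 1) * (t / ((1 + t) * ln (1 + t))))"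
        using t0[OF t] power_log_pos[OF tpos[OF t]] by (intro mult_left_mono) (auto intro: less_imp_le)
      then have "K * (power_log (\<theta> - 1) (- \<sigma> / (n - 1)) t * (\<theta> / 2)) \<le> y' t"
        unfolding y'_def by (rule mult_left_mono) (use K in simp)
      then show ?thesis using \<theta> by (simp add: K_def)
    qed
    ultimately show "DERIV Y t :> y' t \<and> W t powr (- 1 / (n - 1)) \<le> y' t \<and> Y t > 0"
      using K power_log_pos[OF tpos[OF t]] by (simp add: Y_def)
  qed
  have y'm: "y' \<in> borel_measurable borel" unfolding y'_def[abs_def] by measurable
  have sl: "superlinear t0 W (\<lambda>t. A (kA * t))" using t0[of t0] by simp
  have Wm: "W \<in> borel_measurable borel" unfolding W_def by measurable
  have "\<exists>l0>0. \<exists>Q\<ge>0. \<forall>\<Omega> \<mu> (u :: real ^ 'n \<Rightarrow> real ^ 'n) G f.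
    sobolev_data \<alpha> c V m h \<Omega> \<mu> u G f \<and> (\<integral>\<^sup>+ y. A (kA * f y) \<partial>lborel) \<le> 1 \<and> boundary_modular \<Omega> (\<lambda>t. D (kD * t)) u \<le> 1 \<longrightarrow>
    (\<integral>\<^sup>+ x. indicator {x \<in> \<Omega>. l0 < norm (u x)} x * ennreal (b (norm (u x))) \<partial>\<mu>) \<le> ennreal Q"
  proof (rule power_modular_estimate[OF n2 _ fin(1-4) Wm sl y'm Yprops[unfolded n] s0])
    show "real CARD('n) - 1 < \<alpha>" using \<alpha> n by simp
    show "\<exists>\<epsilon>>0. \<exists>T1 T2. \<forall>\<^sub>F l in at_top. t0 \<le> T1 l \<and> s0 \<le> T2 l \<and>
       C * (1 + Y (T1 l) powr ((real CARD('n) - 1) / real CARD('n)) + T2 l) \<le> l \<and>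
       \<epsilon> * g l \<le> W (T1 l) \<and> \<epsilon> * g l \<le> g (T2 l)" if C: "C > 0" for C
    proof -
      obtain \<epsilon> T1 T2 where ch: "\<epsilon> > 0" "filterlim T1 at_top at_top" "filterlim T2 at_top at_top"
        "\<forall>\<^sub>F l in at_top. C * (1 + Y (T1 l) powr ((n - 1) / n) + T2 l) \<le> l \<and>
          \<epsilon> * g l \<le> W (T1 l) \<and> \<epsilon> * g l \<le> g (T2 l)"
        using power_choice[OF p C K, of \<sigma>] unfolding Y_def \<theta>_def g_def q_def \<tau>_def W_def by blast
      have "\<forall>\<^sub>F l in at_top. t0 \<le> T1 l" "\<forall>\<^sub>F l in at_top. s0 \<le> T2 l"
        using ch(2,3) unfolding filterlim_at_top by blast+
      with ch(4) have "\<forall>\<^sub>F l in at_top. t0 \<le> T1 l \<and> s0 \<le> T2 l \<and>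
         C * (1 + Y (T1 l) powr ((n - 1) / n) + T2 l) \<le> l \<and> \<epsilon> * g l \<le> W (T1 l) \<and> \<epsilon> * g l \<le> g (T2 l)"
        by eventually_elim blast
      then show ?thesis using ch(1) unfolding n by blast
    qed
    \<comment> \<open>g (2 l)/g l tends to 2^(q-1) > 1; the midpoint between 1 and this limit is a
      growth ratio that g eventually attains.\<close>
    have two: "2 powr (q - 1) > 1" using q1 by simp
    then show "(1 + 2 powr (q - 1)) / 2 > 1" by simp
    have "\<forall>\<^sub>F l in at_top. (1 + 2 powr (q - 1)) / 2 * g l \<le> g (2 * l)"
      unfolding g_def by (rule power_log_scale_ge) (use two in auto)
    then show "\<forall>\<^sub>F l in at_top. g l > 0 \<and> (1 + 2 powr (q - 1)) / 2 * g l \<le> g (2 * l)"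
      using eventually_gt_at_top[of 0] by eventually_elim (simp add: g_def power_log_pos)
    show "2 powr (p * \<alpha> / (n - p)) + 1 > (0::real)" by (simp add: add_nonneg_pos)
    have "\<forall>\<^sub>F l in at_top. b (2 * l) \<le> (2 powr (p * \<alpha> / (n - p)) + 1) * b l"
      unfolding b_def by (rule power_log_scale_le) auto
    then show "\<forall>\<^sub>F l in at_top. b (2 * l) \<le> (2 powr (p * \<alpha> / (n - p)) + 1) * (l * g l) powr (\<alpha> / (real CARD('n) - 1))"
      using eventually_gt_at_top[of 0]
    proof eventually_elim
      fix l :: real assume l: "b (2 * l) \<le> (2 powr (p * \<alpha> / (n - p)) + 1) * b l" "0 < l"
      \<comment> \<open>Raising l g l, the boundary Young function, to the power \<alpha>/(n-1)
        gives exactly the Young function of the target space.\<close>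
      have e: "q * (\<alpha> / (n - 1)) = p * \<alpha> / (n - p)" "\<tau> * (\<alpha> / (n - 1)) = \<sigma> * \<alpha> / (n - p)"
        using n1 by (simp_all add: q_def \<tau>_def)
      have "l * g l = power_log q \<tau> l" using power_log_add[OF l(2), of "q - 1" \<tau>] by (simp add: g_def)
      then have "(l * g l) powr (\<alpha> / (n - 1)) = b l"
        unfolding b_def e[symmetric] by (simp only: power_log_powr[OF l(2)])
      then show "b (2 * l) \<le> (2 powr (p * \<alpha> / (n - p)) + 1) * (l * g l) powr (\<alpha> / (real CARD('n) - 1))"
        using l(1) n by simp
    qed
    show "\<forall>\<^sub>F l in at_top. \<forall>s\<ge>l. b l \<le> b s"
      unfolding b_def by (rule power_log_eventually_mono) (use p \<alpha> n1 in simp)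
  qed
  then have mod: "\<exists>C>0. \<exists>l0>0. \<exists>Q\<ge>0. \<forall>\<Omega> \<mu> (u :: real ^ 'n \<Rightarrow> real ^ 'n) G f.
    sobolev_data \<alpha> c V m h \<Omega> \<mu> u G f \<and> (\<integral>\<^sup>+ y. A (kA * f y) \<partial>lborel) \<le> 1 \<and> boundary_modular \<Omega> (\<lambda>t. D (kD * t)) u \<le> 1 \<longrightarrow>
    (\<integral>\<^sup>+ x. indicator {x \<in> \<Omega>. l0 < norm (u x)} x * ennreal (b (norm (u x) / C)) \<partial>\<mu>) \<le> ennreal Q"
    by (intro exI[of _ 1]) simp
  have bm: "b \<in> borel_measurable borel" unfolding b_def by measurable
  show ?thesis
    by (rule luxemburg_of_modular[OF _ _ _ fin(3) kA(1) kD(1) kB bm mod])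
       (use A B D in \<open>simp_all add: zygmund_young_def\<close>)
qed

section \<open>Exponential and double exponential target spaces\<close>

lemma exp_superlinear:
  assumes "young_function D" "equivalent_near_infinity D (\<lambda>t. ennreal (a t))" "\<And>t. t > 0 \<Longrightarrow> a t > 0"
  shows "\<exists>k\<ge>1. \<forall>\<^sub>F t0 in at_top. superlinear t0 (\<lambda>t. a t / t) (\<lambda>t. D (k * t))"
proof (rule superlinear_of_equivalent[OF assms(1,2)])
  show "\<forall>\<^sub>F t in at_top. a t = t * (a t / t) \<and> a t / t > 0"
    using eventually_gt_at_top[of 0] by eventually_elim (use assms(3) in simp)
qed

text \<open>Common frame of the two critical cases, in which \<open>a\<close> is the growth of both
  B and D. The truncation level of the gradient is e^(4j) - 1 in both; they differ in
  \<open>Y\<close> and in the levels \<open>\<psi>\<close>, at which \<open>a\<close> is at most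
  e^j.\<close>

lemma exponential_case:
  fixes n :: real and c :: real and V m h :: ennreal and a :: "real \<Rightarrow> real" and \<psi> :: "nat \<Rightarrow> real"
  assumes n2: "CARD('n::finite) \<ge> 2" and n: "n = real CARD('n)"
    and fin: "c > 0" "V < \<infinity>" "m < \<infinity>" "h < \<infinity>" and \<alpha>: "n - 1 < \<alpha>"
    and A: "zygmund_young n \<sigma> A"
    and B: "young_function B" "equivalent_near_infinity B (\<lambda>t. ennreal (a t))"
    and D: "young_function D" "equivalent_near_infinity D (\<lambda>t. ennreal (a t))"
    and a: "\<And>t. t > 0 \<Longrightarrow> a t > 0" "\<And>s t. 0 \<le> s \<Longrightarrow> s \<le> t \<Longrightarrow> a s \<le> a t" "a \<in> borel_measurable borel"
    and Y: "y' \<in> borel_measurable borel"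
      "\<forall>\<^sub>F t in at_top. DERIV Y t :> y' t \<and> power_log (n - 1) \<sigma> t powr (- 1 / (n - 1)) \<le> y' t \<and> Y t > 0"
    and \<psi>: "filterlim \<psi> at_top sequentially"
    and K: "K \<ge> 0" "\<forall>\<^sub>F j in sequentially. Y (exp (4 * real j) - 1) powr ((n - 1) / n) \<le> K * \<psi> j"
    and L0: "\<And>L. L \<ge> L0 \<Longrightarrow> \<forall>\<^sub>F j in sequentially. exp (2 * real j) \<le> a (L * \<psi> j) / (L * \<psi> j)"
    and a\<psi>: "\<forall>\<^sub>F j in sequentially. a (\<psi> j) \<le> exp (real j)"
  shows "\<exists>C>0. \<forall>(\<Omega> :: (real ^ 'n) set) \<mu>. admissible \<alpha> c V m h \<Omega> \<mu> \<longrightarrow>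
          (\<forall>u \<in> E1 \<Omega> (orlicz_space (lebesgue_on \<Omega>) A) \<inter> Cb (closure \<Omega>).
             luxemburg_norm \<mu> B u \<le>
               ennreal C * (luxemburg_norm (lebesgue_on \<Omega>) A (sym_grad \<Omega> u)
                            + luxemburg_norm (boundary_measure \<Omega>) D u))"
proof -
  define W where "W = power_log (n - 1) \<sigma>"
  have Wm: "W \<in> borel_measurable borel" unfolding W_def by measurable
  obtain kA where kA: "kA \<ge> 1" "\<forall>\<^sub>F t0 in at_top. superlinear t0 W (\<lambda>t. A (kA * t))"
    using zygmund_superlinear[OF A] unfolding W_def by blast
  obtain kD where kD: "kD \<ge> 1" "\<forall>\<^sub>F t0 in at_top. superlinear t0 (\<lambda>t. a t / t) (\<lambda>t. D (kD * t))"
    using exp_superlinear[OF D a(1)] by blast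
  obtain kB where kB: "kB \<ge> 1" "\<forall>\<^sub>F t in at_top. B (t / kB) \<le> ennreal (a t)"
    using upper_of_equivalent[OF B(2)] by blast
  obtain s0 where s0: "superlinear s0 (\<lambda>t. a t / t) (\<lambda>t. D (kD * t))"
    using eventually_happens[OF kD(2)] by auto
  have "\<forall>\<^sub>F t in at_top. superlinear t W (\<lambda>t. A (kA * t)) \<and> (DERIV Y t :> y' t \<and> W t powr (- 1 / (n - 1)) \<le> y' t \<and> Y t > 0)"
    using kA(2) Y(2) unfolding W_def by eventually_elim blast
  then obtain t0 where t0: "\<And>t. t \<ge> t0 \<Longrightarrow> superlinear t W (\<lambda>t. A (kA * t)) \<and> (DERIV Y t :> y' t \<and> W t powr (- 1 / (n - 1)) \<le> y' t \<and> Y t > 0)"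
    unfolding eventually_at_top_linorder by blast
  have sl: "superlinear t0 W (\<lambda>t. A (kA * t))" using t0[of t0] by simp
  have Yprops: "\<forall>t\<ge>t0. DERIV Y t :> y' t \<and> W t powr (- 1 / (n - 1)) \<le> y' t \<and> Y t > 0" using t0 by blast
  have mod: "\<exists>C>0. \<exists>l0>0. \<exists>Q\<ge>0. \<forall>\<Omega> \<mu> (u :: real ^ 'n \<Rightarrow> real ^ 'n) G f.
    sobolev_data \<alpha> c V m h \<Omega> \<mu> u G f \<and> (\<integral>\<^sup>+ y. A (kA * f y) \<partial>lborel) \<le> 1 \<and> boundary_modular \<Omega> (\<lambda>t. D (kD * t)) u \<le> 1 \<longrightarrow>
    (\<integral>\<^sup>+ x. indicator {x \<in> \<Omega>. l0 < norm (u x)} x * ennreal (a (norm (u x) / C)) \<partial>\<mu>) \<le> ennreal Q"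
  proof (rule exp_modular_estimate[OF n2 _ fin Wm sl Y(1) Yprops[unfolded n] s0 \<psi> K(1) _ L0 a\<psi>])
    show "real CARD('n) - 1 < \<alpha>" using \<alpha> n by simp
    have n_ge_2: "2 \<le> n" using n2 n by simp
    have "filterlim (\<lambda>x::real. exp (4 * x) - 1) at_top at_top" by real_asymp
    then have "\<forall>\<^sub>F x::real in at_top. t0 \<le> exp (4 * x) - 1" unfolding filterlim_at_top by blast
    then have "\<forall>\<^sub>F j in sequentially. t0 \<le> exp (4 * real j) - 1"
      by (rule eventually_compose_filterlim[OF _ filterlim_real_sequentially])
    then have "\<forall>\<^sub>F j in sequentially. t0 \<le> exp (4 * real j) - 1 \<and> Y (exp (4 * real j) - 1) powr ((n - 1) / n) \<le> K * \<psi> j \<and>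
        exp (2 * real j) \<le> W (exp (4 * real j) - 1)"
      using K(2) critical_weight_exp[of n \<sigma>, folded W_def, OF n_ge_2] by eventually_elim simp
    then show "\<forall>\<^sub>F j in sequentially. t0 \<le> exp (4 * real j) - 1 \<and>
        Y (exp (4 * real j) - 1) powr ((real CARD('n) - 1) / real CARD('n)) \<le> K * \<psi> j \<and> exp (2 * real j) \<le> W (exp (4 * real j) - 1)"
      by (simp add: n)
    show "\<forall>\<^sub>F l in at_top. \<forall>s\<ge>l. a l \<le> a s"
      using eventually_ge_at_top[of 0] by eventually_elim (use a(2) in blast)
  qed
  show ?thesis
    by (rule luxemburg_of_modular[OF _ B(1) D(1) fin(3) kA(1) kD(1) kB a(3) mod])
       (use A in \<open>simp add: zygmund_young_def\<close>)
qed

text \<open>With s = \<sigma>/(n-1) < 1, the function Y is a multiple of ln^(1-s)(1 + t), so at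
  e^(4j) - 1 it is a multiple of j^(1-s). The identity \<open>es\<close> then makes Y^((n-1)/n) a
  multiple of j^(1/\<gamma>); this is where the exponent \<gamma> of the target space comes
  from.\<close>

lemma critical_exp_estimate:
  fixes n :: real and c :: real and V m h :: ennreal
  assumes n2: "CARD('n::finite) \<ge> 2" and n: "n = real CARD('n)"
    and fin: "c > 0" "V < \<infinity>" "m < \<infinity>" "h < \<infinity>" and \<alpha>: "n - 1 < \<alpha>" and \<sigma>: "\<sigma> < n - 1"
    and A: "zygmund_young n \<sigma> A"
    and B: "exp_young (n / (n - 1 - \<sigma>)) B" and D: "exp_young (n / (n - 1 - \<sigma>)) D"
  shows "\<exists>C>0. \<forall>(\<Omega> :: (real ^ 'n) set) \<mu>. admissible \<alpha> c V m h \<Omega> \<mu> \<longrightarrow>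
          (\<forall>u \<in> E1 \<Omega> (orlicz_space (lebesgue_on \<Omega>) A) \<inter> Cb (closure \<Omega>).
             luxemburg_norm \<mu> B u \<le>
               ennreal C * (luxemburg_norm (lebesgue_on \<Omega>) A (sym_grad \<Omega> u)
                            + luxemburg_norm (boundary_measure \<Omega>) D u))"
proof -
  have n1: "n > 1" using n2 n by simp
  define \<gamma> where "\<gamma> = n / (n - 1 - \<sigma>)"
  have \<gamma>: "\<gamma> > 0" using \<sigma> n1 by (simp add: \<gamma>_def)
  define s where "s = \<sigma> / (n - 1)"
  have s: "s < 1" using \<sigma> n1 by (simp add: s_def)
  have es: "(1 - s) * ((n - 1) / n) = 1 / \<gamma>" using n1 \<sigma> by (simp add: s_def \<gamma>_def field_simps)
  define Y where "Y t = 2 / (1 - s) * ln (1 + t) powr (1 - s)" for t :: real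
  define y' where "y' t = 2 / (1 + t) * ln (1 + t) powr (- s)" for t :: real
  \<comment> \<open>Solves \<psi>^\<gamma> = j. For L \<ge> 4^(1/\<gamma>) the level L \<psi> j has
    \<gamma>-th power at least 4j, which leaves e^(4j) against e^(2j) and the denominator L \<psi>
    j.\<close>
  define \<psi> where "\<psi> j = real j powr (1 / \<gamma>)" for j
  define K where "K = (2 / (1 - s) * 4 powr (1 - s)) powr ((n - 1) / n)"
  show ?thesis
  proof (rule exponential_case[OF n2 n fin \<alpha> A, where a = "\<lambda>t. exp (t powr \<gamma>) - 1" and Y = Y and y' = y' and \<psi> = \<psi> and K = K and ?L0.0 = "4 powr (1 / \<gamma>)"])
    show "\<forall>\<^sub>F t in at_top. DERIV Y t :> y' t \<and> power_log (n - 1) \<sigma> t powr (- 1 / (n - 1)) \<le> y' t \<and> Y t > 0"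
      using eventually_ge_at_top[of 1]
    proof eventually_elim
      fix t :: real assume t: "1 \<le> t"
      have "DERIV Y t :> y' t" unfolding Y_def[abs_def] y'_def using t s by (intro log_powr_deriv) auto
      moreover have "power_log (n - 1) \<sigma> t powr (- 1 / (n - 1)) \<le> y' t"
        unfolding y'_def s_def by (rule critical_weight_le[OF n1 t])
      moreover have "Y t > 0" using t s by (simp add: Y_def)
      ultimately show "DERIV Y t :> y' t \<and> power_log (n - 1) \<sigma> t powr (- 1 / (n - 1)) \<le> y' t \<and> Y t > 0" by blast
    qed
    have "filterlim (\<lambda>x::real. x powr (1 / \<gamma>)) at_top at_top" using \<gamma> by real_asymp
    then show "filterlim \<psi> at_top sequentially"
      unfolding \<psi>_def by (rule filterlim_compose[OF _ filterlim_real_sequentially])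
    show "\<forall>\<^sub>F j in sequentially. Y (exp (4 * real j) - 1) powr ((n - 1) / n) \<le> K * \<psi> j"
    proof (rule always_eventually, rule allI)
      fix j
      have "Y (exp (4 * real j) - 1) = 2 / (1 - s) * 4 powr (1 - s) * real j powr (1 - s)"
        by (simp add: Y_def powr_mult)
      then show "Y (exp (4 * real j) - 1) powr ((n - 1) / n) \<le> K * \<psi> j"
        by (simp only: powr_mult powr_powr es K_def \<psi>_def order_refl)
    qed
    fix L :: real assume L: "L \<ge> 4 powr (1 / \<gamma>)"
    have L0: "L > 0" using L by (rule less_le_trans[rotated]) simp
    have "(4 powr (1 / \<gamma>)) powr \<gamma> \<le> L powr \<gamma>" using L \<gamma> by (intro powr_mono2) auto
    then have L4: "L powr \<gamma> \<ge> 4" using \<gamma> by (simp add: powr_powr)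
    show "\<forall>\<^sub>F j in sequentially. exp (2 * real j) \<le> (exp ((L * \<psi> j) powr \<gamma>) - 1) / (L * \<psi> j)"
      using exp_dominates[OF L0, of "1 / \<gamma>"]
    proof eventually_elim
      fix j assume j: "exp (2 * real j) \<le> (exp (4 * real j) - 1) / (L * real j powr (1 / \<gamma>))"
      have "(L * \<psi> j) powr \<gamma> = L powr \<gamma> * real j" using \<gamma> by (simp add: \<psi>_def powr_mult powr_powr)
      then have "4 * real j \<le> (L * \<psi> j) powr \<gamma>" using L4 by (simp add: mult_right_mono)
      then have "(exp (4 * real j) - 1) / (L * \<psi> j) \<le> (exp ((L * \<psi> j) powr \<gamma>) - 1) / (L * \<psi> j)"
        using L0 by (intro divide_right_mono) (auto simp: \<psi>_def)
      then show "exp (2 * real j) \<le> (exp ((L * \<psi> j) powr \<gamma>) - 1) / (L * \<psi> j)" using j by (simp add: \<psi>_def)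
    qed
  next
    show "\<forall>\<^sub>F j in sequentially. exp (\<psi> j powr \<gamma>) - 1 \<le> exp (real j)"
      using \<gamma> by (intro always_eventually allI) (simp add: \<psi>_def powr_powr)
    show "(\<lambda>t. exp (t powr \<gamma>) - 1) \<in> borel_measurable borel" by measurable
    show "y' \<in> borel_measurable borel" unfolding y'_def[abs_def] by measurable
    show "exp (s powr \<gamma>) - 1 \<le> exp (t powr \<gamma>) - 1" if "0 \<le> s" "s \<le> t" for s t :: real
      using that \<gamma> by (simp add: powr_mono2)
    show "K \<ge> 0" by (simp add: K_def)
  qed (use B D in \<open>simp_all add: exp_young_def \<gamma>_def\<close>)
qed

text \<open>At \<sigma> = n - 1 the dominating function is 2/((1 + t) ln (1 + t)), whose primitive
  is an iterated logarithm, so at e^(4j) - 1 the function Y is 2 ln (4j), which is at most 4 ln j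
  for j \<ge> 4.\<close>

lemma critical_exp_exp_estimate:
  fixes n :: real and c :: real and V m h :: ennreal
  assumes n2: "CARD('n::finite) \<ge> 2" and n: "n = real CARD('n)"
    and fin: "c > 0" "V < \<infinity>" "m < \<infinity>" "h < \<infinity>" and \<alpha>: "n - 1 < \<alpha>"
    and A: "zygmund_young n (n - 1) A"
    and B: "exp_exp_young (n / (n - 1)) B" and D: "exp_exp_young (n / (n - 1)) D"
  shows "\<exists>C>0. \<forall>(\<Omega> :: (real ^ 'n) set) \<mu>. admissible \<alpha> c V m h \<Omega> \<mu> \<longrightarrow>
          (\<forall>u \<in> E1 \<Omega> (orlicz_space (lebesgue_on \<Omega>) A) \<inter> Cb (closure \<Omega>).
             luxemburg_norm \<mu> B u \<le>
               ennreal C * (luxemburg_norm (lebesgue_on \<Omega>) A (sym_grad \<Omega> u)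
                            + luxemburg_norm (boundary_measure \<Omega>) D u))"
proof -
  have n1: "n > 1" using n2 n by simp
  define \<gamma> where "\<gamma> = n / (n - 1)"
  have \<gamma>: "\<gamma> > 0" "(n - 1) / n = 1 / \<gamma>" using n1 by (simp_all add: \<gamma>_def)
  define Y where "Y t = 2 * ln (ln (1 + t))" for t :: real
  define y' where "y' t = 2 / (1 + t) * ln (1 + t) powr (- 1)" for t :: real
  \<comment> \<open>Solves exp(\<psi>^\<gamma>) = j for j \<ge> 1. For L \<ge> 2^(1/\<gamma>) the
    inner exponential at L \<psi> j is at least j^2, and exp(j^2) outweighs e^(2j) times the
    level.\<close>
  define \<psi> where "\<psi> j = ln (real j) powr (1 / \<gamma>)" for j
  define K where "K = 4 powr (1 / \<gamma>)"
  show ?thesis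
  proof (rule exponential_case[OF n2 n fin \<alpha> A, where a = "\<lambda>t. exp (exp (t powr \<gamma>)) - exp 1" and Y = Y and y' = y' and \<psi> = \<psi> and K = K and ?L0.0 = "2 powr (1 / \<gamma>)"])
    have "\<forall>\<^sub>F t::real in at_top. ln (1 + t) > 1" by real_asymp
    then show "\<forall>\<^sub>F t in at_top. DERIV Y t :> y' t \<and> power_log (n - 1) (n - 1) t powr (- 1 / (n - 1)) \<le> y' t \<and> Y t > 0"
      using eventually_ge_at_top[of 1]
    proof eventually_elim
      fix t :: real assume l: "1 < ln (1 + t)" and t: "1 \<le> t"
      have "DERIV Y t :> 2 * (1 / ln (1 + t) * (1 / (1 + t)))"
        unfolding Y_def[abs_def] using t l by (auto intro!: derivative_eq_intros)
      then have "DERIV Y t :> y' t" using l by (simp add: y'_def powr_minus divide_inverse mult_ac)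
      moreover have "power_log (n - 1) (n - 1) t powr (- 1 / (n - 1)) \<le> y' t"
        using critical_weight_le[OF n1 t, of "n - 1"] n1 by (simp add: y'_def)
      moreover have "Y t > 0" using l by (simp add: Y_def)
      ultimately show "DERIV Y t :> y' t \<and> power_log (n - 1) (n - 1) t powr (- 1 / (n - 1)) \<le> y' t \<and> Y t > 0" by blast
    qed
    have "filterlim (\<lambda>x::real. ln x powr (1 / \<gamma>)) at_top at_top" using \<gamma>(1) by real_asymp
    then show "filterlim \<psi> at_top sequentially"
      unfolding \<psi>_def by (rule filterlim_compose[OF _ filterlim_real_sequentially])
    show "\<forall>\<^sub>F j in sequentially. Y (exp (4 * real j) - 1) powr ((n - 1) / n) \<le> K * \<psi> j"
      using eventually_ge_at_top[of 4]
    proof eventually_elim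
      fix j :: nat assume j: "4 \<le> j"
      have "ln (4 * real j) \<le> ln (real j * real j)" using j by (subst ln_le_cancel_iff) auto
      also have "\<dots> = 2 * ln (real j)" using j by (simp add: ln_mult)
      finally have "Y (exp (4 * real j) - 1) \<le> 4 * ln (real j)" by (simp add: Y_def)
      moreover have "Y (exp (4 * real j) - 1) \<ge> 0" using j by (simp add: Y_def)
      ultimately have "Y (exp (4 * real j) - 1) powr (1 / \<gamma>) \<le> (4 * ln (real j)) powr (1 / \<gamma>)"
        using \<gamma>(1) by (intro powr_mono2) auto
      then show "Y (exp (4 * real j) - 1) powr ((n - 1) / n) \<le> K * \<psi> j"
        unfolding \<gamma>(2) by (simp only: powr_mult K_def \<psi>_def)
    qed
    fix L :: real assume L: "L \<ge> 2 powr (1 / \<gamma>)"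
    have L0: "L > 0" using L by (rule less_le_trans[rotated]) simp
    have "(2 powr (1 / \<gamma>)) powr \<gamma> \<le> L powr \<gamma>" using L \<gamma>(1) by (intro powr_mono2) auto
    then have L2: "L powr \<gamma> \<ge> 2" using \<gamma>(1) by (simp add: powr_powr)
    show "\<forall>\<^sub>F j in sequentially. exp (2 * real j) \<le> (exp (exp ((L * \<psi> j) powr \<gamma>)) - exp 1) / (L * \<psi> j)"
      using exp_square_dominates[OF L0, of "1 / \<gamma>"] eventually_ge_at_top[of 2]
    proof eventually_elim
      fix j :: nat assume j: "exp (2 * real j) \<le> (exp ((real j)\<^sup>2) - exp 1) / (L * ln (real j) powr (1 / \<gamma>))" "2 \<le> j"
      have "(L * \<psi> j) powr \<gamma> = L powr \<gamma> * ln (real j)" using \<gamma>(1) j(2) by (simp add: \<psi>_def powr_mult powr_powr)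
      also have "\<dots> \<ge> 2 * ln (real j)" using L2 j(2) by (intro mult_right_mono) auto
      finally have "exp (2 * ln (real j)) \<le> exp ((L * \<psi> j) powr \<gamma>)" by simp
      moreover have "exp (2 * ln (real j)) = (real j)\<^sup>2" using j(2) by (simp add: exp_double)
      ultimately have "(exp ((real j)\<^sup>2) - exp 1) / (L * \<psi> j) \<le> (exp (exp ((L * \<psi> j) powr \<gamma>)) - exp 1) / (L * \<psi> j)"
        using L0 by (intro divide_right_mono) (auto simp: \<psi>_def)
      then show "exp (2 * real j) \<le> (exp (exp ((L * \<psi> j) powr \<gamma>)) - exp 1) / (L * \<psi> j)" using j(1) by (simp add: \<psi>_def)
    qed
  next
    show "\<forall>\<^sub>F j in sequentially. exp (exp (\<psi> j powr \<gamma>)) - exp 1 \<le> exp (real j)"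
      using eventually_ge_at_top[of 1] by eventually_elim (use \<gamma>(1) in \<open>simp add: \<psi>_def powr_powr\<close>)
    show "(\<lambda>t. exp (exp (t powr \<gamma>)) - exp 1) \<in> borel_measurable borel" by measurable
    show "y' \<in> borel_measurable borel" unfolding y'_def[abs_def] by measurable
    show "exp (exp (s powr \<gamma>)) - exp 1 \<le> exp (exp (t powr \<gamma>)) - exp 1" if "0 \<le> s" "s \<le> t" for s t :: real
      using that \<gamma>(1) by (simp add: powr_mono2)
    show "K \<ge> 0" by (simp add: K_def)
  qed (use B D in \<open>simp_all add: exp_exp_young_def \<gamma>_def\<close>)
qed

text \<open>In both cases W^(-1/(n-1)) is eventually at most 2/(1 + t) ln^(-s)(1 + t) with some s >
  1, namely s = 2 for p > n and s = \<sigma>/(n-1) for p = n. This is integrable at infinity, which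
  is why Y stays bounded.\<close>

lemma supercritical_estimate:
  fixes n :: real and V h :: ennreal
  assumes n2: "CARD('n::finite) \<ge> 2" and n: "n = real CARD('n)" and fin: "V < \<infinity>" "h < \<infinity>"
    and p: "p = n \<and> n - 1 < \<sigma> \<or> n < p" and A: "zygmund_young p \<sigma> A"
  shows "\<exists>C>0. \<forall>\<alpha> c m (\<Omega> :: (real ^ 'n) set) \<mu>. admissible \<alpha> c V m h \<Omega> \<mu> \<longrightarrow>
          (\<forall>u \<in> E1 \<Omega> (orlicz_space (lebesgue_on \<Omega>) A) \<inter> Cb (closure \<Omega>).
             linfty_norm (lebesgue_on \<Omega>) u \<le>
               ennreal C * (luxemburg_norm (lebesgue_on \<Omega>) A (sym_grad \<Omega> u)
                            + linfty_norm (boundary_measure \<Omega>) u))"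
proof -
  have n1: "n > 1" using n2 n by simp
  define W where "W = power_log (p - 1) \<sigma>"
  have Wm: "W \<in> borel_measurable borel" unfolding W_def by measurable
  have Wlim: "filterlim W at_top at_top" unfolding W_def using p n1 by (intro power_log_at_top) auto
  obtain kA where kA: "kA \<ge> 1" "\<forall>\<^sub>F t0 in at_top. superlinear t0 W (\<lambda>t. A (kA * t))"
    using zygmund_superlinear[OF A] unfolding W_def by blast
  obtain s where s: "s > 1" "\<forall>\<^sub>F t in at_top. W t powr (- 1 / (n - 1)) \<le> 2 / (1 + t) * ln (1 + t) powr (- s)"
  proof (cases "n < p")
    case True
    then show ?thesis using supercritical_weight_le[OF n1 True, of \<sigma>] by (intro that[of 2]) (auto simp: W_def)
  next
    case False
    then have pn: "p = n" "n - 1 < \<sigma>" using p by auto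
    have "\<forall>\<^sub>F t in at_top. W t powr (- 1 / (n - 1)) \<le> 2 / (1 + t) * ln (1 + t) powr (- (\<sigma> / (n - 1)))"
      using eventually_ge_at_top[of 1] unfolding W_def pn(1) by eventually_elim (rule critical_weight_le[OF n1])
    then show ?thesis using pn n1 by (intro that[of "\<sigma> / (n - 1)"]) auto
  qed
  define Z where "Z t = 2 / (1 - s) * ln (1 + t) powr (1 - s)" for t :: real
  define y' where "y' t = 2 / (1 + t) * ln (1 + t) powr (- s)" for t :: real
  have y'm: "y' \<in> borel_measurable borel" unfolding y'_def[abs_def] by measurable
  have "(Z \<longlongrightarrow> 0) at_top" unfolding Z_def using s(1) by real_asymp
  then have "\<forall>\<^sub>F t in at_top. Z t > - 1" by (rule order_tendstoD(1)) simp
  then have "\<forall>\<^sub>F t in at_top. superlinear t W (\<lambda>t. A (kA * t)) \<and> Z t > - 1 \<and> W t powr (- 1 / (n - 1)) \<le> y' t \<and> t \<ge> 1"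
    using kA(2) s(2) eventually_ge_at_top[of 1] unfolding y'_def by eventually_elim blast
  then obtain t0 where t0: "\<And>t. t \<ge> t0 \<Longrightarrow> superlinear t W (\<lambda>t. A (kA * t)) \<and> Z t > - 1 \<and> W t powr (- 1 / (n - 1)) \<le> y' t \<and> t \<ge> 1"
    unfolding eventually_at_top_linorder by blast
  \<comment> \<open>The primitive \<open>Z\<close> is negative for t > 0 and tends to 0; past a
    \<open>t0\<close> where it exceeds -1 the shift makes it positive and at most 1.\<close>
  define Y where "Y t = Z t + 1" for t
  have Yprops: "\<forall>t\<ge>t0. DERIV Y t :> y' t \<and> W t powr (- 1 / (n - 1)) \<le> y' t \<and> Y t > 0 \<and> Y t \<le> 1"
  proof (intro allI impI)
    fix t assume "t \<ge> t0"
    then have t: "Z t > - 1" "W t powr (- 1 / (n - 1)) \<le> y' t" "t \<ge> 1" using t0 by auto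
    have "DERIV Z t :> y' t" unfolding Z_def[abs_def] y'_def using t s by (intro log_powr_deriv) auto
    then have "DERIV Y t :> y' t" unfolding Y_def[abs_def] by (auto intro!: derivative_eq_intros)
    moreover have "Z t \<le> 0" using s(1) by (simp add: Z_def divide_nonneg_neg mult_nonpos_nonneg)
    ultimately show "DERIV Y t :> y' t \<and> W t powr (- 1 / (n - 1)) \<le> y' t \<and> Y t > 0 \<and> Y t \<le> 1"
      using t by (simp add: Y_def)
  qed
  have sl: "superlinear t0 W (\<lambda>t. A (kA * t))" using t0[of t0] by simp
  show ?thesis
    by (rule linfty_of_modular[OF _ kA(1) sup_estimate[OF n2 fin Wm sl Wlim y'm Yprops[unfolded n]]])
       (use A in \<open>simp add: zygmund_young_def\<close>)
qed

theorem theorem4p7: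
  fixes n :: real and c :: real and V m h :: ennreal
  assumes "CARD('n::finite) \<ge> 2" and "n = real CARD('n)"
    and "c > 0" and "V < \<infinity>" and "m < \<infinity>" and "h < \<infinity>"
  shows
    "(\<forall>p \<sigma> \<alpha> A B D.
        1 < p \<and> p < n \<and> n - 1 < \<alpha> \<and> \<alpha> \<le> n \<and>
        zygmund_young p \<sigma> A \<and>
        zygmund_young (p * \<alpha> / (n - p)) (\<sigma> * \<alpha> / (n - p)) B \<and>
        zygmund_young (p * (n - 1) / (n - p)) (\<sigma> * (n - 1) / (n - p)) D \<longrightarrow>
        (\<exists>C>0. \<forall>(\<Omega> :: (real ^ 'n) set) \<mu>. admissible \<alpha> c V m h \<Omega> \<mu> \<longrightarrow>
          (\<forall>u \<in> E1 \<Omega> (orlicz_space (lebesgue_on \<Omega>) A) \<inter> Cb (closure \<Omega>).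
             luxemburg_norm \<mu> B u \<le>
               ennreal C * (luxemburg_norm (lebesgue_on \<Omega>) A (sym_grad \<Omega> u)
                            + luxemburg_norm (boundary_measure \<Omega>) D u))))
   \<and> (\<forall>\<sigma> \<alpha> A B D.
        \<sigma> < n - 1 \<and> n - 1 < \<alpha> \<and> \<alpha> \<le> n \<and>
        zygmund_young n \<sigma> A \<and>
        exp_young (n / (n - 1 - \<sigma>)) B \<and>
        exp_young (n / (n - 1 - \<sigma>)) D \<longrightarrow>
        (\<exists>C>0. \<forall>(\<Omega> :: (real ^ 'n) set) \<mu>. admissible \<alpha> c V m h \<Omega> \<mu> \<longrightarrow>
          (\<forall>u \<in> E1 \<Omega> (orlicz_space (lebesgue_on \<Omega>) A) \<inter> Cb (closure \<Omega>).
             luxemburg_norm \<mu> B u \<le>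
               ennreal C * (luxemburg_norm (lebesgue_on \<Omega>) A (sym_grad \<Omega> u)
                            + luxemburg_norm (boundary_measure \<Omega>) D u))))
   \<and> (\<forall>\<alpha> A B D.
        n - 1 < \<alpha> \<and> \<alpha> \<le> n \<and>
        zygmund_young n (n - 1) A \<and>
        exp_exp_young (n / (n - 1)) B \<and>
        exp_exp_young (n / (n - 1)) D \<longrightarrow>
        (\<exists>C>0. \<forall>(\<Omega> :: (real ^ 'n) set) \<mu>. admissible \<alpha> c V m h \<Omega> \<mu> \<longrightarrow>
          (\<forall>u \<in> E1 \<Omega> (orlicz_space (lebesgue_on \<Omega>) A) \<inter> Cb (closure \<Omega>).
             luxemburg_norm \<mu> B u \<le>
               ennreal C * (luxemburg_norm (lebesgue_on \<Omega>) A (sym_grad \<Omega> u)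
                            + luxemburg_norm (boundary_measure \<Omega>) D u))))
   \<and> (\<forall>p \<sigma> A.
        (p = n \<and> n - 1 < \<sigma> \<or> n < p) \<and>
        zygmund_young p \<sigma> A \<longrightarrow>
        (\<exists>C>0. \<forall>\<alpha> (\<Omega> :: (real ^ 'n) set) \<mu>.
          n - 1 < \<alpha> \<and> \<alpha> \<le> n \<and> admissible \<alpha> c V m h \<Omega> \<mu> \<longrightarrow>
          (\<forall>u \<in> E1 \<Omega> (orlicz_space (lebesgue_on \<Omega>) A) \<inter> Cb (closure \<Omega>).
             linfty_norm (lebesgue_on \<Omega>) u \<le>
               ennreal C * (luxemburg_norm (lebesgue_on \<Omega>) A (sym_grad \<Omega> u)
                            + linfty_norm (boundary_measure \<Omega>) u))))"
proof (intro conjI allI impI; elim conjE)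
  fix p \<sigma> \<alpha> A B D
  assume "1 < p" "p < n" "n - 1 < \<alpha>" "zygmund_young p \<sigma> A"
    "zygmund_young (p * \<alpha> / (n - p)) (\<sigma> * \<alpha> / (n - p)) B"
    "zygmund_young (p * (n - 1) / (n - p)) (\<sigma> * (n - 1) / (n - p)) D"
  then show "\<exists>C>0. \<forall>(\<Omega> :: (real ^ 'n) set) \<mu>. admissible \<alpha> c V m h \<Omega> \<mu> \<longrightarrow>
          (\<forall>u \<in> E1 \<Omega> (orlicz_space (lebesgue_on \<Omega>) A) \<inter> Cb (closure \<Omega>).
             luxemburg_norm \<mu> B u \<le>
               ennreal C * (luxemburg_norm (lebesgue_on \<Omega>) A (sym_grad \<Omega> u)
                            + luxemburg_norm (boundary_measure \<Omega>) D u))"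
    by (rule subcritical_estimate[OF assms])
next
  fix \<sigma> \<alpha> A B D
  assume "\<sigma> < n - 1" "n - 1 < \<alpha>" "zygmund_young n \<sigma> A"
    "exp_young (n / (n - 1 - \<sigma>)) B" "exp_young (n / (n - 1 - \<sigma>)) D"
  then show "\<exists>C>0. \<forall>(\<Omega> :: (real ^ 'n) set) \<mu>. admissible \<alpha> c V m h \<Omega> \<mu> \<longrightarrow>
          (\<forall>u \<in> E1 \<Omega> (orlicz_space (lebesgue_on \<Omega>) A) \<inter> Cb (closure \<Omega>).
             luxemburg_norm \<mu> B u \<le>
               ennreal C * (luxemburg_norm (lebesgue_on \<Omega>) A (sym_grad \<Omega> u)
                            + luxemburg_norm (boundary_measure \<Omega>) D u))"
    by (intro critical_exp_estimate[OF assms])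
next
  fix \<alpha> A B D
  assume "n - 1 < \<alpha>" "zygmund_young n (n - 1) A"
    "exp_exp_young (n / (n - 1)) B" "exp_exp_young (n / (n - 1)) D"
  then show "\<exists>C>0. \<forall>(\<Omega> :: (real ^ 'n) set) \<mu>. admissible \<alpha> c V m h \<Omega> \<mu> \<longrightarrow>
          (\<forall>u \<in> E1 \<Omega> (orlicz_space (lebesgue_on \<Omega>) A) \<inter> Cb (closure \<Omega>).
             luxemburg_norm \<mu> B u \<le>
               ennreal C * (luxemburg_norm (lebesgue_on \<Omega>) A (sym_grad \<Omega> u)
                            + luxemburg_norm (boundary_measure \<Omega>) D u))"
    by (rule critical_exp_exp_estimate[OF assms])
next
  fix p \<sigma> A
  assume "p = n \<and> n - 1 < \<sigma> \<or> n < p" "zygmund_young p \<sigma> A"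
  from supercritical_estimate[OF assms(1,2,4,6) this]
  show "\<exists>C>0. \<forall>\<alpha> (\<Omega> :: (real ^ 'n) set) \<mu>.
          n - 1 < \<alpha> \<and> \<alpha> \<le> n \<and> admissible \<alpha> c V m h \<Omega> \<mu> \<longrightarrow>
          (\<forall>u \<in> E1 \<Omega> (orlicz_space (lebesgue_on \<Omega>) A) \<inter> Cb (closure \<Omega>).
             linfty_norm (lebesgue_on \<Omega>) u \<le>
               ennreal C * (luxemburg_norm (lebesgue_on \<Omega>) A (sym_grad \<Omega> u)
                            + linfty_norm (boundary_measure \<Omega>) u))"
    by (elim exE conjE) (rule exI, intro conjI allI impI, assumption, blast)
qed

end
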